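(* Consider the linear bandit problem with growing arm set and the Sublinear Time Elimination algorithm described in the context. Given any $T$ that does not scale with $K$, one can choose $\eta(T)=\frac1{\sqrt T}$. Then, for any $\delta\in(0,1)$, with probability at least $1-\delta$ the regret is bounded by $R(T)=\widetilde O(d\sqrt T)$, while the per-step time complexity is $K^{1-\Theta\left(\frac{1}{T^2\log^2T}\right)}$ for sufficiently large $K$ (in particular it is sublinear in $K$).
   Context: Linear bandit setting. $\mathcal{A}$ is the set of arms; arm $a$ has feature vector $x_a\in\mathbb{R}^d$. At each time step $t\in\{1,\dots,T\}$ a set $\mathcal{A}_{new}$ of at most $C_{change}$ new arms ($C_{change}$ a constant) is added to $\mathcal{A}$, and no arm is deleted. $K$ is the maximum size of $\mathcal{A}$. The learner plays $a_t\in\mathcal{A}$ and observes reward $r_t$. Assumptions: (i) there is $\theta^*\in\mathbb{R}^d$ with $r_t=\langle\theta^*,x_{a_t}\rangle+\eta_t$, $\eta_t$ a mean-zero noise; (ii) $\mathbb{E}[\exp(\alpha\eta_t)\mid\mathcal{F}_{t-1}]\le\exp(\alpha^2/2)$ for all $\alpha\in\mathbb{R}$, $t\in[T]$, where $\mathcal{F}_{t-1}=\sigma(a_1,r_1,\dots,a_{t-1},r_{t-1},a_t)$; (iii) $\|\theta^*\|_2\le1$ and $\|x_a\|_2\le1$ for all $a$. The regret is $R(T)=\sum_{t=1}^T(x_{a_t^*}^\top\theta^*-x_{a_t}^\top\theta^* )$, where $a_t^*=\arg\max_{a\in\mathcal{A}}x_a^\top\theta^*$ is the optimal arm at step $t$.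 Notation: $\|x\|_M=\sqrt{x^\top Mx}$; $\widetilde O$ hides logarithmic factors. $d=K^{o(1)}$. Per-step time complexity means the time for selecting an arm at a step; it excludes the overhead of initializing and maintaining the data structures $\Psi_s$, which is counted in total over all steps and equals $K^{1+o(1)}$. Adaptive MIPS solver. The $(c,r,\epsilon)$-MIPS problem for a finite set $P$ in the unit ball of $\mathbb{R}^n$ and a query $q$ with $\|q\|_2\le1$: find $p\in P$ with $\langle q,p\rangle\ge cr-\epsilon$ if there is $p^*\in P$ with $\langle q,p^*\rangle\ge r+\epsilon$. A single-query solver $\mathcal{S}(c,r,0)$ for $|P|=K$ (adapted from Andoni et al. 2017) solves $(c,r,0)$-MIPS for any given query with probability at least $0.9$, with preprocessing time $K^{1+o(1)}$, time $K^{o(1)}$ to add a point, query time $K^{\rho_q+o(\log^{-0.45}K)}$, $\rho_q=\frac{4c'^2}{(1+c'^2)^2}$, $c'=\sqrt{\frac{3-cr}{3-r}}$. The adaptive solver $\mathcal{M}(c,r,\epsilon,\delta')$ keeps $\kappa=n\log(Kn/(\epsilon\delta'))$ independent copies of $\mathcal{S}(c,r,0)$; adding a point adds it to all copies; a query $q$ is rounded to the nearest point $\widehat q$ with all coordinates multiples of $\epsilon/n$, all copies are queried with $\widehat q$, and any point returned by any copy is returned (null if none). Heap augmented arm set $\Psi_s$, with parameters $(s,d,\beta,\eta,\delta_\Psi)$. Initialize: an adaptive MIPS solver $\mathcal{M}_s$ with parameters $\left(\frac14,\frac{2^{-2s-2}(1-\eta^2)}{d^2\beta^2},\frac{2^{-2s-2}\eta^2}{d^2\beta^2},\delta_\Psi\right)$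 and an empty min-heap $\mathcal{H}_s$. Add(arm $a$, current estimate $\widehat\theta$): add the point $\mathrm{vec}(x_ax_a^\top/d)$ to $\mathcal{M}_s$ and push $a$ to $\mathcal{H}_s$ with key $x_a^\top\widehat\theta+2^{-s}$. Eliminate($\underline r$): while the top key of $\mathcal{H}_s$ is smaller than $\underline r$, pop it and delete the corresponding arm from $\mathcal{M}_s$. Query($V$): query $\mathcal{M}_s$ with $\mathrm{vec}(V/d)$ and return the resulting arm, or null. Sublinear Time Elimination algorithm. Input: $\mathcal{A}$, $T$, $\delta$, $\eta(T)\in(0,1)$. Write $\beta=\beta(\delta/2)=1+\sqrt{2\log\frac2\delta+d\log(1+\frac Td)}$, $s_{max}=\lceil\log\frac{1}{8\eta(T)}\rceil$; logarithms defining stage indices are base 2. Set $V_1=I$, $\widehat\theta_1=0$, $\underline r=-\infty$; use sets $\Psi_s$ with parameters $(s,d,\beta,\eta(T),\frac{\delta}{2s_{max}})$ for each index $s\le s_{max}$ that occurs; add all initial arms to $\Psi_0$. For $t=1,\dots,T$: 1. Add each $a\in\mathcal{A}_{new}$ to $\Psi_s$ with $s=\min(\lfloor-\log(\beta\|x_a\|_{V_t^{-1}})\rfloor,s_{max})$. Let $\underline r'=\max_{a\in\mathcal{A}_{new}}(x_a^\top\widehat\theta_t-\beta\|x_a\|_{V_t^{-1}})$; if $\underline r'>\underline r$, set $\underline r=\underline r'$ and run Eliminate($\underline r$) on every $\Psi_s$. 2. Let $s_t$ be the smallest $s$ with $\Psi_s\neq\emptyset$. If $s_t=s_{max}$, let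 $a_t$ be a random arm in $\Psi_{s_t}$. Otherwise let $a_t$ be the result of Query($V_t^{-1}$) on $\Psi_{s_t}$, and while $a_t$ is null: put $\underline r'=\max_{a\in\Psi_{s_t}}(x_a^\top\widehat\theta_t-\beta\|x_a\|_{V_t^{-1}})$; move every $a\in\Psi_{s_t}$ to $\Psi_{s'}$ with $s'=\min(\lfloor-\log(\beta\|x_a\|_{V_t^{-1}})\rfloor,s_{max})$; if $\underline r'>\underline r$, set $\underline r=\underline r'$ and run Eliminate($\underline r$) on every $\Psi_s$; recompute $s_t$ as the smallest $s$ with $\Psi_s\ne\emptyset$ and let $a_t$ be the result of Query($V_t^{-1}$) on $\Psi_{s_t}$ (a random arm of $\Psi_{s_t}$ if $s_t=s_{max}$). 3. Play $a_t$, observe $r_t$, set $V_{t+1}=V_t+x_{a_t}x_{a_t}^\top$ and $\widehat\theta_{t+1}=(X_{1:t}^\top X_{1:t}+I)^{-1}X_{1:t}^\top Y_{1:t}$, where $X_{1:t}$ has rows $x_{a_1}^\top,\dots,x_{a_t}^\top$ and $Y_{1:t}=(r_1,\dots,r_t)$.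
   Formalization: Eliminate is run even if r' does not exceed r; a point returned by the single-query solver always meets the threshold cr; d is fixed as K grows (hidden constants depend on d, δ); δ_Ψ uses max(1, s_max); queries are rounded within the unit ball; T ≥ 2. *)

theory Defs
  imports
    "HOL-Probability.Probability"
    "HOL-Library.While_Combinator"
    "HOL-Library.Landau_Symbols"
    "Jordan_Normal_Form.Gauss_Jordan_Elimination"
begin

unbundle no vec_syntax
hide_const (open) Finite_Cartesian_Product.vec Finite_Cartesian_Product.mat
  Determinants.det Finite_Cartesian_Product.row Finite_Cartesian_Product.column

section \<open>Vectors and matrices\<close>

definition norm2 :: "real vec \<Rightarrow> real" where
  "norm2 v = sqrt (scalar_prod v v)"

definition mat_norm :: "real mat \<Rightarrow> real vec \<Rightarrow> real" where
  "mat_norm M v = sqrt (scalar_prod v (M *\<^sub>v v))"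

definition inv_mat :: "real mat \<Rightarrow> real mat" where
  "inv_mat A = the (mat_inverse A)"

definition outer :: "real vec \<Rightarrow> real mat" where
  "outer v = mat (dim_vec v) (dim_vec v) (\<lambda>(i, j). v $ i * v $ j)"

definition vectorize :: "real mat \<Rightarrow> real vec" where
  "vectorize M = vec (dim_row M * dim_col M) (\<lambda>k. M $$ (k div dim_col M, k mod dim_col M))"

definition unit_ball :: "nat \<Rightarrow> real vec set" where
  "unit_ball n = {v \<in> carrier_vec n. norm2 v \<le> 1}"

section \<open>Maximum inner product search\<close>

text \<open>The searched points are labelled (several arms may have the same point), so a point set is a
  finite map from labels to vectors, and an answer is a label or null.\<close>

definition mips_solved ::
    "real \<Rightarrow> real \<Rightarrow> real \<Rightarrow> (nat \<rightharpoonup> real vec) \<Rightarrow> real vec \<Rightarrow> nat option \<Rightarrow> bool" where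
  "mips_solved c r \<epsilon> P q out \<longleftrightarrow>
     ((\<exists>p\<in>ran P. scalar_prod q p \<ge> r + \<epsilon>) \<longrightarrow>
      (\<exists>a p. out = Some a \<and> P a = Some p \<and> scalar_prod q p \<ge> c * r - \<epsilon>))"

definition mips_sound ::
    "real \<Rightarrow> real \<Rightarrow> real \<Rightarrow> (nat \<rightharpoonup> real vec) \<Rightarrow> real vec \<Rightarrow> nat option \<Rightarrow> bool" where
  "mips_sound c r \<epsilon> P q out \<longleftrightarrow>
     (\<forall>a. out = Some a \<longrightarrow> (\<exists>p. P a = Some p \<and> scalar_prod q p \<ge> c * r - \<epsilon>))"

datatype update = Insert nat "real vec" | Delete nat

fun apply_update :: "update \<Rightarrow> (nat \<rightharpoonup> real vec) \<Rightarrow> (nat \<rightharpoonup> real vec)" where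
  "apply_update (Insert a p) P = P(a \<mapsto> p)"
| "apply_update (Delete a) P = P(a := None)"

definition content :: "update list \<Rightarrow> (nat \<rightharpoonup> real vec)" where
  "content us = fold apply_update us Map.empty"

definition admissible :: "nat \<Rightarrow> nat \<Rightarrow> update list \<Rightarrow> bool" where
  "admissible n K us \<longleftrightarrow>
     (\<forall>a p. Insert a p \<in> set us \<longrightarrow> p \<in> unit_ball n) \<and>
     (\<forall>i\<le>length us. card (dom (content (take i us))) \<le> K)"

text \<open>A data structure whose whole randomness is a seed drawn when it is initialised.  Its state is
  determined by the seed and the sequence of updates so far, so answers and running times (numbers
  of elementary operations) are functions of these.\<close>

record 's solver =
  seed_dist :: "'s measure"
  answer :: "'s \<Rightarrow> update list \<Rightarrow> real vec \<Rightarrow> nat option"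
  prep_time :: "'s \<Rightarrow> nat"
  insert_time :: "'s \<Rightarrow> update list \<Rightarrow> nat \<Rightarrow> real vec \<Rightarrow> nat"
  query_time :: "'s \<Rightarrow> update list \<Rightarrow> real vec \<Rightarrow> nat"

text \<open>The success probability is required for each fixed update sequence and each fixed query
  separately.  Failures are one-sided: a returned point always meets the threshold
  \<open>c * r\<close>.\<close>

definition solves_mips :: "nat \<Rightarrow> real \<Rightarrow> real \<Rightarrow> nat \<Rightarrow> 's solver \<Rightarrow> bool" where
  "solves_mips n c r K S \<longleftrightarrow>
     prob_space (seed_dist S) \<and>
     (\<forall>us q. (\<lambda>z. answer S z us q) \<in> measurable (seed_dist S) (count_space UNIV)) \<and>
     (\<forall>us q. admissible n K us \<longrightarrow> q \<in> unit_ball n \<longrightarrow>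
        (\<forall>z\<in>space (seed_dist S). mips_sound c r 0 (content us) q (answer S z us q)) \<and>
        measure (seed_dist S)
          {z \<in> space (seed_dist S). mips_solved c r 0 (content us) q (answer S z us q)} \<ge> 0.9)"

definition rho_query :: "real \<Rightarrow> real \<Rightarrow> real" where
  "rho_query c r = (let c' = sqrt ((3 - c * r) / (3 - r)) in 4 * c'\<^sup>2 / (1 + c'\<^sup>2)\<^sup>2)"

text \<open>\<open>S n c r K\<close> is the single-query solver for at most \<open>K\<close> points in dimension \<open>n\<close>.  The
  error terms in the exponents are asymptotic in \<open>K\<close> for fixed \<open>n\<close>, \<open>c\<close>, \<open>r\<close>.\<close>

definition solver_family :: "(nat \<Rightarrow> real \<Rightarrow> real \<Rightarrow> nat \<Rightarrow> 's solver) \<Rightarrow> bool" where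
  "solver_family S \<longleftrightarrow>
     (\<forall>n\<ge>1. \<forall>c\<in>{0<..<1}. \<forall>r\<in>{0<..1}.
        (\<forall>K\<ge>1. solves_mips n c r K (S n c r K)) \<and>
        (\<exists>h\<^sub>1\<in>o(\<lambda>_. 1). \<exists>h\<^sub>2\<in>o(\<lambda>_. 1). \<exists>h\<^sub>3\<in>o(\<lambda>K. ln (real K) powr (-0.45)). \<exists>K\<^sub>1.
           \<forall>K\<ge>K\<^sub>1. \<forall>z\<in>space (seed_dist (S n c r K)).
             real (prep_time (S n c r K) z) \<le> real K powr (1 + h\<^sub>1 K) \<and>
             (\<forall>us a p. admissible n K (us @ [Insert a p]) \<longrightarrow>
                real (insert_time (S n c r K) z us a p) \<le> real K powr (h\<^sub>2 K)) \<and>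
             (\<forall>us q. admissible n K us \<longrightarrow> q \<in> unit_ball n \<longrightarrow>
                real (query_time (S n c r K) z us q) \<le> real K powr (rho_query c r + h\<^sub>3 K))))"

text \<open>Number of copies held by the adaptive solver.\<close>

definition num_copies :: "nat \<Rightarrow> real \<Rightarrow> real \<Rightarrow> nat \<Rightarrow> nat" where
  "num_copies n \<epsilon> \<delta>' K = nat \<lceil>real n * ln (real K * real n / (\<epsilon> * \<delta>'))\<rceil>"

text \<open>The rounded query must again be a legal query, so the nearest grid point is taken within the
  unit ball (this matters only for queries within rounding distance of the sphere).\<close>

definition grid :: "nat \<Rightarrow> real \<Rightarrow> real vec set" where
  "grid n \<epsilon> = {v \<in> unit_ball n. \<forall>i<n. \<exists>m::int. v $ i = of_int m * (\<epsilon> / real n)}"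

definition round_query :: "nat \<Rightarrow> real \<Rightarrow> real vec \<Rightarrow> real vec" where
  "round_query n \<epsilon> q = arg_min_on (\<lambda>v. norm2 (q - v)) (grid n \<epsilon>)"

definition adaptive_answer ::
    "'s solver \<Rightarrow> nat \<Rightarrow> real \<Rightarrow> nat \<Rightarrow> (nat \<Rightarrow> 's) \<Rightarrow> update list \<Rightarrow> real vec \<Rightarrow> nat option" where
  "adaptive_answer S n \<epsilon> \<kappa> z us q =
     (let out = (\<lambda>i. answer S (z i) us (round_query n \<epsilon> q))
      in if \<exists>i<\<kappa>. out i \<noteq> None then out (LEAST i. i < \<kappa> \<and> out i \<noteq> None) else None)"

text \<open>\<open>n\<close> operations for rounding, then one query and one inspection of the answer per copy.\<close>

definition adaptive_query_time ::
    "'s solver \<Rightarrow> nat \<Rightarrow> real \<Rightarrow> nat \<Rightarrow> (nat \<Rightarrow> 's) \<Rightarrow> update list \<Rightarrow> real vec \<Rightarrow> nat" where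
  "adaptive_query_time S n \<epsilon> \<kappa> z us q =
     n + (\<Sum>i<\<kappa>. query_time S (z i) us (round_query n \<epsilon> q) + 1)"

section \<open>The linear bandit with growing arm set\<close>

text \<open>\<open>noise as e\<close> is the noise of round \<open>length as\<close> when the arms played in rounds
  \<open>1, \<dots>, length as\<close> are \<open>as\<close> and the environment's randomness is \<open>e\<close>; thus the noise may
  depend on the actions, but not otherwise on the learner's internal randomness.\<close>

record 'e bandit =
  init_arms :: "nat set"
  new_arms :: "nat \<Rightarrow> nat set"
  feature :: "nat \<Rightarrow> real vec"
  theta :: "real vec"
  env :: "'e measure"
  noise :: "nat list \<Rightarrow> 'e \<Rightarrow> real"

definition arms_at :: "('e, 'z) bandit_scheme \<Rightarrow> nat \<Rightarrow> nat set" where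
  "arms_at B t = init_arms B \<union> (\<Union>i\<in>{1..t}. new_arms B i)"

definition valid_bandit :: "nat \<Rightarrow> nat \<Rightarrow> nat \<Rightarrow> nat \<Rightarrow> ('e, 'z) bandit_scheme \<Rightarrow> bool" where
  "valid_bandit d T C\<^sub>c\<^sub>h\<^sub>a\<^sub>n\<^sub>g\<^sub>e K B \<longleftrightarrow>
     finite (init_arms B) \<and>
     (\<forall>t\<in>{1..T}. finite (new_arms B t) \<and> card (new_arms B t) \<le> C\<^sub>c\<^sub>h\<^sub>a\<^sub>n\<^sub>g\<^sub>e \<and>
                 new_arms B t \<inter> arms_at B (t - 1) = {}) \<and>
     card (arms_at B T) = K \<and>
     (\<forall>a\<in>arms_at B T. feature B a \<in> unit_ball d) \<and>
     theta B \<in> unit_ball d \<and>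
     prob_space (env B) \<and>
     (\<forall>as. noise B as \<in> borel_measurable (env B))"

definition optimal_arm :: "('e, 'z) bandit_scheme \<Rightarrow> nat \<Rightarrow> nat" where
  "optimal_arm B t = arg_max_on (\<lambda>a. scalar_prod (feature B a) (theta B)) (arms_at B t)"

section \<open>Parameters of the algorithm\<close>

text \<open>\<open>max_arms\<close> is the maximum size \<open>K\<close> of the arm set.\<close>

record params =
  dim :: nat
  horizon :: nat
  conf :: real
  eta :: real
  max_arms :: nat

definition beta :: "params \<Rightarrow> real" where
  "beta p = 1 + sqrt (2 * ln (2 / conf p)
                      + real (dim p) * ln (1 + real (horizon p) / real (dim p)))"

definition s_max :: "params \<Rightarrow> int" where
  "s_max p = \<lceil>log 2 (1 / (8 * eta p))\<rceil>"

text \<open>The maximum with 1 only makes this meaningful for short horizons, where \<open>s_max p \<le> 0\<close>.\<close>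

definition delta_psi :: "params \<Rightarrow> real" where
  "delta_psi p = conf p / (2 * real_of_int (max 1 (s_max p)))"

definition mips_r :: "params \<Rightarrow> int \<Rightarrow> real" where
  "mips_r p s = 2 powr (- 2 * of_int s - 2) * (1 - (eta p)\<^sup>2) / ((real (dim p))\<^sup>2 * (beta p)\<^sup>2)"

definition mips_eps :: "params \<Rightarrow> int \<Rightarrow> real" where
  "mips_eps p s = 2 powr (- 2 * of_int s - 2) * (eta p)\<^sup>2 / ((real (dim p))\<^sup>2 * (beta p)\<^sup>2)"

definition point_dim :: "params \<Rightarrow> nat" where
  "point_dim p = dim p * dim p"

definition copies :: "params \<Rightarrow> int \<Rightarrow> nat" where
  "copies p s = num_copies (point_dim p) (mips_eps p s) (delta_psi p) (max_arms p)"

definition level_solver ::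
    "params \<Rightarrow> (nat \<Rightarrow> real \<Rightarrow> real \<Rightarrow> nat \<Rightarrow> 's solver) \<Rightarrow> int \<Rightarrow> 's solver" where
  "level_solver p S s = S (point_dim p) (1/4) (mips_r p s) (max_arms p)"

text \<open>All indices that can occur: as \<open>V\<^sub>t \<ge> I\<close>, widths are at most 1, so the index of an arm
  is at least \<open>\<lfloor>- log 2 (beta p)\<rfloor>\<close>; the initial arms have index 0.\<close>

definition levels :: "params \<Rightarrow> int set" where
  "levels p = {\<lfloor>- log 2 (beta p)\<rfloor> .. max 0 (s_max p)}"

text \<open>A width of 0 corresponds to \<open>- log 0 = \<infinity>\<close>.\<close>

definition level_of :: "params \<Rightarrow> real \<Rightarrow> int" where
  "level_of p w = (if w = 0 then s_max p else min \<lfloor>- log 2 (beta p * w)\<rfloor> (s_max p))"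

section \<open>Heap augmented arm sets\<close>

text \<open>\<open>heap\<close> maps each stored arm to its key; \<open>updates\<close> is the update sequence of the MIPS
  solver.\<close>

record arm_set =
  heap :: "nat \<rightharpoonup> real"
  updates :: "update list"

definition arms_of :: "arm_set \<Rightarrow> nat set" where
  "arms_of \<Psi> = dom (heap \<Psi>)"

definition psi_add :: "real vec \<Rightarrow> nat \<Rightarrow> real vec \<Rightarrow> int \<Rightarrow> arm_set \<Rightarrow> arm_set" where
  "psi_add x a \<theta> s \<Psi> =
     \<lparr>heap = (heap \<Psi>)(a \<mapsto> scalar_prod x \<theta> + 2 powr (- of_int s)),
      updates = updates \<Psi> @ [Insert a (vectorize ((1 / real (dim_vec x)) \<cdot>\<^sub>m outer x))]\<rparr>"

definition psi_remove :: "nat \<Rightarrow> arm_set \<Rightarrow> arm_set" where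
  "psi_remove a \<Psi> = \<lparr>heap = (heap \<Psi>)(a := None), updates = updates \<Psi> @ [Delete a]\<rparr>"

text \<open>Arms are popped in increasing order of their keys.\<close>

definition psi_eliminate :: "ereal \<Rightarrow> arm_set \<Rightarrow> arm_set" where
  "psi_eliminate r \<Psi> =
     fold psi_remove
       (sort_key (\<lambda>a. the (heap \<Psi> a))
          (sorted_list_of_set {a \<in> arms_of \<Psi>. ereal (the (heap \<Psi> a)) < r})) \<Psi>"

section \<open>Sublinear Time Elimination\<close>

record state =
  psi :: "int \<Rightarrow> arm_set"
  lower :: ereal

definition gram :: "params \<Rightarrow> ('e, 'z) bandit_scheme \<Rightarrow> (nat \<times> real) list \<Rightarrow> real mat" where
  "gram p B h = fold (\<lambda>(a, r) V. V + outer (feature B a)) h (1\<^sub>m (dim p))"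

text \<open>For the empty history this is the zero vector.\<close>

definition theta_hat :: "params \<Rightarrow> ('e, 'z) bandit_scheme \<Rightarrow> (nat \<times> real) list \<Rightarrow> real vec" where
  "theta_hat p B h =
     (let X = mat_of_rows (dim p) (map (\<lambda>(a, r). feature B a) h);
          Y = vec_of_list (map snd h)
      in inv_mat (transpose_mat X * X + 1\<^sub>m (dim p)) *\<^sub>v (transpose_mat X *\<^sub>v Y))"

definition width :: "params \<Rightarrow> ('e, 'z) bandit_scheme \<Rightarrow> (nat \<times> real) list \<Rightarrow> nat \<Rightarrow> real" where
  "width p B h a = mat_norm (inv_mat (gram p B h)) (feature B a)"

definition put_arm ::
    "params \<Rightarrow> ('e, 'z) bandit_scheme \<Rightarrow> (nat \<times> real) list \<Rightarrow> nat
      \<Rightarrow> (int \<Rightarrow> arm_set) \<Rightarrow> (int \<Rightarrow> arm_set)" where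
  "put_arm p B h a \<Psi> =
     (let s = level_of p (width p B h a)
      in \<Psi>(s := psi_add (feature B a) a (theta_hat p B h) s (\<Psi> s)))"

text \<open>Set \<open>r\<close> to the largest lower confidence bound of \<open>A\<close> if that is an improvement, and run
  Eliminate on all sets.  Eliminate is run in either case, so that newly inserted arms whose keys
  are already below \<open>r\<close> are removed.\<close>

definition update_lower ::
    "params \<Rightarrow> ('e, 'z) bandit_scheme \<Rightarrow> (nat \<times> real) list \<Rightarrow> nat set \<Rightarrow> ereal \<Rightarrow> ereal" where
  "update_lower p B h A r =
     Max (insert r ((\<lambda>a. ereal (scalar_prod (feature B a) (theta_hat p B h)
                                - beta p * width p B h a)) ` A))"

definition raise_and_eliminate ::
    "params \<Rightarrow> ('e, 'z) bandit_scheme \<Rightarrow> (nat \<times> real) list \<Rightarrow> nat set \<Rightarrow> state \<Rightarrow> state" where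
  "raise_and_eliminate p B h A st =
     (let r = update_lower p B h A (lower st)
      in \<lparr>psi = (\<lambda>s. psi_eliminate r (psi st s)), lower = r\<rparr>)"

definition initial_state :: "params \<Rightarrow> ('e, 'z) bandit_scheme \<Rightarrow> state" where
  "initial_state p B =
     \<lparr>psi = (\<lambda>s. \<lparr>heap = Map.empty, updates = []\<rparr>)
        (0 := fold (\<lambda>a. psi_add (feature B a) a (0\<^sub>v (dim p)) 0)
                (sorted_list_of_set (init_arms B)) \<lparr>heap = Map.empty, updates = []\<rparr>),
      lower = - \<infinity>\<rparr>"

definition add_new_arms ::
    "params \<Rightarrow> ('e, 'z) bandit_scheme \<Rightarrow> (nat \<times> real) list \<Rightarrow> nat set \<Rightarrow> state \<Rightarrow> state" where
  "add_new_arms p B h A st =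
     raise_and_eliminate p B h A
       (st\<lparr>psi := fold (put_arm p B h) (sorted_list_of_set A) (psi st)\<rparr>)"

definition current_level :: "state \<Rightarrow> int" where
  "current_level st = Min {s. arms_of (psi st s) \<noteq> {}}"

definition move_arms ::
    "params \<Rightarrow> ('e, 'z) bandit_scheme \<Rightarrow> (nat \<times> real) list \<Rightarrow> state \<Rightarrow> state" where
  "move_arms p B h st =
     (let s = current_level st; A = arms_of (psi st s)
      in raise_and_eliminate p B h A
           (st\<lparr>psi := fold (\<lambda>a \<Psi>. put_arm p B h a (\<Psi>(s := psi_remove a (\<Psi> s))))
                        (sorted_list_of_set A) (psi st)\<rparr>))"

text \<open>One attempt to select an arm, with its time: looking up \<open>s\<^sub>t\<close>, then either a uniformly random
  choice (through \<open>u\<close>, uniform on \<open>[0,1)\<close>) or forming the query and querying the solver.  If all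
  sets are empty, no arm is ever selected.\<close>

definition attempt ::
    "params \<Rightarrow> (nat \<Rightarrow> real \<Rightarrow> real \<Rightarrow> nat \<Rightarrow> 's solver) \<Rightarrow> ('e, 'z) bandit_scheme
      \<Rightarrow> (int \<times> nat \<Rightarrow> 's) \<Rightarrow> real \<Rightarrow> (nat \<times> real) list \<Rightarrow> state \<Rightarrow> nat option \<times> nat" where
  "attempt p S B z u h st =
     (let s = current_level st; \<Psi> = psi st s; A = arms_of \<Psi>;
          q = vectorize ((1 / real (dim p)) \<cdot>\<^sub>m inv_mat (gram p B h)) in
      if \<forall>s. arms_of (psi st s) = {} then (None, card (levels p))
      else if s = s_max p then
        (Some (sorted_list_of_set A ! nat \<lfloor>u * real (card A)\<rfloor>), card (levels p) + 1)
      else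
        (adaptive_answer (level_solver p S s) (point_dim p) (mips_eps p s) (copies p s)
           (\<lambda>i. z (s, i)) (updates \<Psi>) q,
         card (levels p) + point_dim p
         + adaptive_query_time (level_solver p S s) (point_dim p) (mips_eps p s) (copies p s)
             (\<lambda>i. z (s, i)) (updates \<Psi>) q))"

text \<open>The result is \<open>None\<close> if the loop does not terminate.  The last component is the time for
  selecting the arm; moving and eliminating arms is maintenance of the data structures.\<close>

definition select_arm ::
    "params \<Rightarrow> (nat \<Rightarrow> real \<Rightarrow> real \<Rightarrow> nat \<Rightarrow> 's solver) \<Rightarrow> ('e, 'z) bandit_scheme
      \<Rightarrow> (int \<times> nat \<Rightarrow> 's) \<Rightarrow> real \<Rightarrow> (nat \<times> real) list \<Rightarrow> state
      \<Rightarrow> (state \<times> nat option \<times> nat) option" where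
  "select_arm p S B z u h st =
     while_option (\<lambda>(st, a, c). a = None)
       (\<lambda>(st, a, c). let st' = move_arms p B h st; (a', c') = attempt p S B z u h st'
                     in (st', a', c + c'))
       (st, attempt p S B z u h st)"

text \<open>\<open>\<omega> = (z, u, e)\<close>: seeds of the solver copies, random numbers for the random choices, and the
  randomness of the environment.  The result after \<open>t\<close> rounds consists of the state, the history of
  played arms and rewards, and the selection times; it is \<open>None\<close> once some round does not
  terminate.\<close>

type_synonym ('s, 'e) outcome = "(int \<times> nat \<Rightarrow> 's) \<times> (nat \<Rightarrow> real) \<times> 'e"

primrec run ::
    "params \<Rightarrow> (nat \<Rightarrow> real \<Rightarrow> real \<Rightarrow> nat \<Rightarrow> 's solver) \<Rightarrow> ('e, 'z) bandit_scheme
      \<Rightarrow> ('s, 'e) outcome \<Rightarrow> nat \<Rightarrow> (state \<times> (nat \<times> real) list \<times> nat list) option" where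
  "run p S B \<omega> 0 = Some (initial_state p B, [], [])"
| "run p S B \<omega> (Suc t) =
     (case run p S B \<omega> t of
        None \<Rightarrow> None
      | Some (st, h, cs) \<Rightarrow>
          (let (z, u, e) = \<omega> in
           case select_arm p S B z (u (Suc t)) h
                  (add_new_arms p B h (new_arms B (Suc t)) st) of
             None \<Rightarrow> None
           | Some (st', a, c) \<Rightarrow>
               (let r = scalar_prod (theta B) (feature B (the a))
                        + noise B (map fst h @ [the a]) e
                in Some (st', h @ [(the a, r)], cs @ [c]))))"

definition outcome_space ::
    "params \<Rightarrow> (nat \<Rightarrow> real \<Rightarrow> real \<Rightarrow> nat \<Rightarrow> 's solver) \<Rightarrow> ('e, 'z) bandit_scheme
      \<Rightarrow> ('s, 'e) outcome measure" where
  "outcome_space p S B =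
     (\<Pi>\<^sub>M (s, i) \<in> (SIGMA s : levels p. {..<copies p s}). seed_dist (level_solver p S s)) \<Otimes>\<^sub>M
     (\<Pi>\<^sub>M t \<in> {1..horizon p}. uniform_measure lborel {0..<1}) \<Otimes>\<^sub>M
     env B"

definition played ::
    "params \<Rightarrow> (nat \<Rightarrow> real \<Rightarrow> real \<Rightarrow> nat \<Rightarrow> 's solver) \<Rightarrow> ('e, 'z) bandit_scheme
      \<Rightarrow> nat \<Rightarrow> ('s, 'e) outcome \<Rightarrow> nat option" where
  "played p S B t \<omega> = map_option (\<lambda>(st, h, cs). fst (h ! (t - 1))) (run p S B \<omega> t)"

definition step_time ::
    "params \<Rightarrow> (nat \<Rightarrow> real \<Rightarrow> real \<Rightarrow> nat \<Rightarrow> 's solver) \<Rightarrow> ('e, 'z) bandit_scheme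
      \<Rightarrow> nat \<Rightarrow> ('s, 'e) outcome \<Rightarrow> nat option" where
  "step_time p S B t \<omega> = map_option (\<lambda>(st, h, cs). cs ! (t - 1)) (run p S B \<omega> t)"

definition reward_at ::
    "params \<Rightarrow> (nat \<Rightarrow> real \<Rightarrow> real \<Rightarrow> nat \<Rightarrow> 's solver) \<Rightarrow> ('e, 'z) bandit_scheme
      \<Rightarrow> nat \<Rightarrow> ('s, 'e) outcome \<Rightarrow> real" where
  "reward_at p S B t \<omega> = (case run p S B \<omega> t of None \<Rightarrow> 0 | Some (st, h, cs) \<Rightarrow> snd (h ! (t - 1)))"

definition noise_at ::
    "params \<Rightarrow> (nat \<Rightarrow> real \<Rightarrow> real \<Rightarrow> nat \<Rightarrow> 's solver) \<Rightarrow> ('e, 'z) bandit_scheme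
      \<Rightarrow> nat \<Rightarrow> ('s, 'e) outcome \<Rightarrow> real" where
  "noise_at p S B t \<omega> =
     (case run p S B \<omega> t of
        None \<Rightarrow> 0
      | Some (st, h, cs) \<Rightarrow> noise B (map fst h) (snd (snd \<omega>)))"

text \<open>The sigma-algebra generated by \<open>a\<^sub>1, r\<^sub>1, \<dots>, a\<^bsub>t-1\<^esub>, r\<^bsub>t-1\<^esub>, a\<^sub>t\<close>.\<close>

definition history_algebra ::
    "params \<Rightarrow> (nat \<Rightarrow> real \<Rightarrow> real \<Rightarrow> nat \<Rightarrow> 's solver) \<Rightarrow> ('e, 'z) bandit_scheme
      \<Rightarrow> nat \<Rightarrow> ('s, 'e) outcome measure" where
  "history_algebra p S B t =
     (let \<Omega> = space (outcome_space p S B)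
      in sigma \<Omega> ({played p S B i -` A \<inter> \<Omega> | i A. i \<in> {1..t}} \<union>
                  {reward_at p S B i -` A \<inter> \<Omega> | i A. i \<in> {1..<t} \<and> A \<in> sets borel}))"

definition subgaussian_noise ::
    "params \<Rightarrow> (nat \<Rightarrow> real \<Rightarrow> real \<Rightarrow> nat \<Rightarrow> 's solver) \<Rightarrow> ('e, 'z) bandit_scheme \<Rightarrow> bool" where
  "subgaussian_noise p S B \<longleftrightarrow>
     (\<forall>t\<in>{1..horizon p}.
        integrable (outcome_space p S B) (noise_at p S B t) \<and>
        (\<integral>\<omega>. noise_at p S B t \<omega> \<partial>outcome_space p S B) = 0 \<and>
        (\<forall>\<alpha>::real.
           integrable (outcome_space p S B) (\<lambda>\<omega>. exp (\<alpha> * noise_at p S B t \<omega>)) \<and>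
           (AE \<omega> in outcome_space p S B.
              real_cond_exp (outcome_space p S B) (history_algebra p S B t)
                (\<lambda>\<omega>. exp (\<alpha> * noise_at p S B t \<omega>)) \<omega> \<le> exp (\<alpha>\<^sup>2 / 2))))"

text \<open>Rounds that are not completed contribute nothing.\<close>

definition regret ::
    "params \<Rightarrow> (nat \<Rightarrow> real \<Rightarrow> real \<Rightarrow> nat \<Rightarrow> 's solver) \<Rightarrow> ('e, 'z) bandit_scheme
      \<Rightarrow> ('s, 'e) outcome \<Rightarrow> real" where
  "regret p S B \<omega> =
     (\<Sum>t = 1..horizon p.
        case played p S B t \<omega> of
          None \<Rightarrow> 0
        | Some a \<Rightarrow> scalar_prod (feature B (optimal_arm B t)) (theta B)
                     - scalar_prod (feature B a) (theta B))"

end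

(*
  The regret bound rests on a confidence set.  With S_n the sum of noise times feature, the "wealth"
  exp (|S_n|^2_{V_n^-1} / 2) / sqrt (det V_n) is the Gaussian mixture of the supermartingales
  exp (<alpha, S_n> - |alpha|^2_{V_n - I} / 2); its factor in round n is a one-dimensional Gaussian integral
  over the direction x_n.  By Ville's inequality the wealth stays below 2 / delta with probability at least
  1 - delta / 2, and then |theta_hat - theta|_V <= beta in all rounds.  On this event the best arm
  is never eliminated, an arm stored at level s loses at most a multiple of 2^-s against it, and an
  arm returned by the solver at level s has width at least a multiple of 2^-s / beta; the elliptical
  potential lemma sums the widths.

  For the running time, an unsuccessful query means that all arms of the level have small width, unless
  all copies of the solver fail, so the arms move up and there are boundedly many attempts per
  round.  The copies are queried adaptively.  To use their independence nevertheless, note that the answers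
  so far are determined by the indices of the copies that gave them, so that for each of the
  polylogarithmically many index sequences the remaining copies are independent of the next query and fail
  together with probability at most 10^-(copies - rounds), which is polynomially small in K.
  Finally 1 - rho_query (1/4) r >= r^2 / 64 and r is at least a multiple of 1 / (T log T).
*)
theory Submission
  imports
Defs
    "Jordan_Normal_Form.Determinant"
begin

section \<open>Linear algebra of the Gram matrices I + sum of x x^T\<close>

section \<open>Regularised design matrices\<close>

text \<open>Both probabilistic arguments require a measurable run, although the state holds real
  keys and vectors and the retry loop may diverge. This is why attempts are followed instead of
  rounds: the list of answers lies in a countable type and exists for every outcome. Once it is
  fixed, the arms, Gram matrices and widths are constants, and only estimates, keys and the lower
  bound vary with the environment; eliminations see these through finitely many comparisons. For the
  same reason the supermartingale is set up on the whole space, before any property of the run is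
  known.

  The count of attempts is circular: it is valid while no fresh group of copies has failed, but the
  failure event must be formed for a number of attempts fixed in advance. An induction with a
  potential closes the circle, since the bound under proof keeps the attempt number in the covered
  range.

  The gain 2 g in the exponent of one query is spent in portions: g/4 for the error term of the
  solver, 3/4 g for logarithmic factors, and g remains.\<close>

definition design :: "nat \<Rightarrow> real vec list \<Rightarrow> real mat" where
  "design d xs = fold (\<lambda>x V. V + outer x) xs (1\<^sub>m d)"

text \<open>The Loewner order V >= I for symmetric V. Invertibility, the Cauchy-Schwarz inequality
  for V^-1 and the bound V^-1 <= I follow from it, and it survives rank-one additions.\<close>

definition ge_one :: "nat \<Rightarrow> real mat \<Rightarrow> bool" where
  "ge_one d V \<longleftrightarrow> V \<in> carrier_mat d d \<and> transpose_mat V = V \<and>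
     (\<forall>v\<in>carrier_vec d. scalar_prod v v \<le> scalar_prod v (V *\<^sub>v v))"

lemma outer_carrier [simp]: "x \<in> carrier_vec d \<Longrightarrow> outer x \<in> carrier_mat d d"
  by (auto simp: outer_def)

lemma outer_mult_vec:
  assumes "x \<in> carrier_vec d" "v \<in> carrier_vec d"
  shows "outer x *\<^sub>v v = scalar_prod x v \<cdot>\<^sub>v x"
  using assms
  by (intro eq_vecI) (auto simp: outer_def scalar_prod_def sum_distrib_left sum_distrib_right
      algebra_simps intro!: sum.cong)

lemma scalar_prod_self_nonneg: "scalar_prod v v \<ge> (0::real)"
  by (auto simp: scalar_prod_def intro!: sum_nonneg)

lemma ge_one_one: "ge_one d (1\<^sub>m d)"
  by (auto simp: ge_one_def)

lemma ge_one_add_outer: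
  assumes V: "ge_one d V" and x: "x \<in> carrier_vec d"
  shows "ge_one d (V + outer x)"
  unfolding ge_one_def
proof (intro conjI ballI)
  have Vc: "V \<in> carrier_mat d d" using V by (auto simp: ge_one_def)
  show "V + outer x \<in> carrier_mat d d" using Vc x by auto
  have "transpose_mat (outer x) = outer x"
    using x by (intro eq_matI) (auto simp: outer_def)
  then show "transpose_mat (V + outer x) = V + outer x"
    using Vc x V by (subst transpose_add[of _ d d]) (auto simp: ge_one_def)
  fix v :: "real vec" assume v: "v \<in> carrier_vec d"
  have "scalar_prod v ((V + outer x) *\<^sub>v v) = scalar_prod v (V *\<^sub>v v) + (scalar_prod x v)\<^sup>2"
    using Vc x v
    by (auto simp: add_mult_distrib_mat_vec[of _ d d] outer_mult_vec scalar_prod_add_distrib[of _ d]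
        comm_scalar_prod[of v d x] power2_eq_square)
  then show "scalar_prod v v \<le> scalar_prod v ((V + outer x) *\<^sub>v v)"
    using V v by (auto simp: ge_one_def intro: add_increasing2)
qed

lemma ge_one_design:
  assumes "set xs \<subseteq> carrier_vec d"
  shows "ge_one d (design d xs)"
  using assms
proof (induction xs rule: rev_induct)
  case Nil then show ?case by (simp add: design_def ge_one_one)
next
  case (snoc x xs)
  then show ?case by (simp add: design_def ge_one_add_outer)
qed

lemma design_snoc: "design d (xs @ [x]) = design d xs + outer x"
  by (simp add: design_def)

lemma design_index:
  assumes "set xs \<subseteq> carrier_vec d" "i < d" "j < d"
  shows "design d xs $$ (i, j) = (if i = j then 1 else 0) + (\<Sum>k<length xs. xs ! k $ i * xs ! k $ j)"
  using assms
proof (induction xs rule: rev_induct)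
  case Nil then show ?case by (simp add: design_def)
next
  case (snoc x xs)
  then show ?case
    by (auto simp: design_snoc outer_def nth_append)
qed

text \<open>For c > 0 evaluate at the vertex -b/c; for c < 0 a large argument makes the quadratic
  negative, and for c = 0 a nonzero slope does. Applied to the square of x + t y it yields
  Cauchy-Schwarz both for the Euclidean form and for the form of V^-1.\<close>

lemma quadratic_nonneg_discriminant:
  fixes a b c :: real
  assumes "\<And>t. a + 2 * b * t + c * t\<^sup>2 \<ge> 0"
  shows "b\<^sup>2 \<le> a * c"
proof (cases "c = 0")
  case True
  have "b = 0"
  proof (rule ccontr)
    assume "b \<noteq> 0"
    then have "2 * b * (- (\<bar>a\<bar> + 1) / (2 * b)) = - (\<bar>a\<bar> + 1)" by simp
    then have "a + 2 * b * (- (\<bar>a\<bar> + 1) / (2 * b)) < 0" by linarith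
    then show False using assms[of "- (\<bar>a\<bar> + 1) / (2 * b)"] True by simp
  qed
  then show ?thesis using True by simp
next
  case False
  have "c > 0"
  proof (rule ccontr)
    assume "\<not> c > 0"
    with False have c: "c < 0" by simp
    \<comment> \<open>Chosen so that -c (t - 1) = |a| + 2 |b|; as t >= 1, the quadratic is then at
      most t c < 0.\<close>
    define t where "t = 1 + (\<bar>a\<bar> + 2 * \<bar>b\<bar>) / - c"
    have t: "t \<ge> 1" using c by (simp add: t_def field_simps)
    have 1: "- c * (t - 1) = \<bar>a\<bar> + 2 * \<bar>b\<bar>" using c by (simp add: t_def)
    have "\<bar>a\<bar> \<le> \<bar>a\<bar> * t" "2 * b * t \<le> 2 * \<bar>b\<bar> * t" using t
      by (auto simp: mult_left_mono intro!: mult_right_mono mult_left_le)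
         (metis abs_ge_zero mult_left_mono mult.right_neutral)
    then have "a + 2 * b * t + c * t\<^sup>2 \<le> t * (\<bar>a\<bar> + 2 * \<bar>b\<bar> + c * t)"
      by (simp add: power2_eq_square algebra_simps)
    also have "\<dots> = t * c" unfolding 1[symmetric] by (simp add: algebra_simps)
    also have "\<dots> < 0" using t c by (simp add: mult_pos_neg)
    finally show False using assms[of t] by simp
  qed
  moreover have "a + 2 * b * (- b / c) + c * (- b / c)\<^sup>2 \<ge> 0" by (rule assms)
  ultimately show ?thesis by (simp add: field_simps power2_eq_square)
qed

text \<open>A kernel vector v satisfies v.v <= v.Vv = 0, so V is injective and its determinant is
  nonzero.\<close>

lemma ge_one_inverse:
  assumes V: "ge_one d V"
  shows "inv_mat V \<in> carrier_mat d d" "V * inv_mat V = 1\<^sub>m d" "inv_mat V * V = 1\<^sub>m d"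
    "transpose_mat (inv_mat V) = inv_mat V" "det V \<noteq> 0"
proof -
  have Vc: "V \<in> carrier_mat d d" using V by (auto simp: ge_one_def)
  show dV: "det V \<noteq> 0"
  proof
    assume "det V = 0"
    then obtain v where v: "v \<in> carrier_vec d" "v \<noteq> 0\<^sub>v d" "V *\<^sub>v v = 0\<^sub>v d"
      using det_0_iff_vec_prod_zero_field[OF Vc] by auto
    have "scalar_prod v v \<le> 0" using V v by (auto simp: ge_one_def)
    then have "(\<Sum>i<d. v $ i * v $ i) = 0"
      using v(1) scalar_prod_self_nonneg[of v] by (simp add: scalar_prod_def atLeast0LessThan)
    then have "\<forall>i<d. v $ i = 0" by (subst (asm) sum_nonneg_eq_0_iff) auto
    with v show False by auto
  qed
  have "V \<in> Units (ring_mat TYPE(real) d ())"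
    by (rule det_non_zero_imp_unit[OF Vc dV])
  then have "mat_inverse V \<noteq> None" using mat_inverse(1)[OF Vc, of "()"] by blast
  then show *: "inv_mat V \<in> carrier_mat d d" "V * inv_mat V = 1\<^sub>m d" "inv_mat V * V = 1\<^sub>m d"
    unfolding inv_mat_def using mat_inverse(2)[OF Vc] by auto
  have tV: "transpose_mat V = V" using V by (auto simp: ge_one_def)
  \<comment> \<open>The transposed inverse is a left inverse of the symmetric V, and a left inverse
    equals the right inverse.\<close>
  have "transpose_mat (inv_mat V) * V = 1\<^sub>m d"
    using transpose_mult[OF Vc *(1)] *(2) tV by simp
  then have "transpose_mat (inv_mat V) * (V * inv_mat V) = inv_mat V"
    using Vc *(1) by (subst assoc_mult_mat[symmetric, of _ d d _ d _ d]) auto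
  then show "transpose_mat (inv_mat V) = inv_mat V" using * by simp
qed

lemma inv_mat_mult_vec:
  assumes V: "ge_one d V" and x: "x \<in> carrier_vec d"
  shows "inv_mat V *\<^sub>v x \<in> carrier_vec d" "V *\<^sub>v (inv_mat V *\<^sub>v x) = x" "inv_mat V *\<^sub>v (V *\<^sub>v x) = x"
proof -
  have Vc: "V \<in> carrier_mat d d" using V by (auto simp: ge_one_def)
  note W = ge_one_inverse[OF V]
  show "inv_mat V *\<^sub>v x \<in> carrier_vec d" using W(1) x by auto
  show "V *\<^sub>v (inv_mat V *\<^sub>v x) = x"
    using W(2) x assoc_mult_mat_vec[OF Vc W(1) x] by simp
  show "inv_mat V *\<^sub>v (V *\<^sub>v x) = x"
    using W(3) x assoc_mult_mat_vec[OF W(1) Vc x] by simp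
qed

lemma inv_mat_symmetric:
  assumes V: "ge_one d V" and x: "x \<in> carrier_vec d" and y: "y \<in> carrier_vec d"
  shows "scalar_prod x (inv_mat V *\<^sub>v y) = scalar_prod (inv_mat V *\<^sub>v x) y"
  using transpose_vec_mult_scalar[OF ge_one_inverse(1)[OF V] y x] ge_one_inverse(4)[OF V] by simp

lemma scalar_prod_square_le:
  assumes x: "x \<in> carrier_vec d" and y: "y \<in> carrier_vec d"
  shows "(scalar_prod x y)\<^sup>2 \<le> scalar_prod x x * scalar_prod y (y::real vec)"
proof (rule quadratic_nonneg_discriminant)
  fix t :: real
  have "0 \<le> scalar_prod (x + t \<cdot>\<^sub>v y) (x + t \<cdot>\<^sub>v y)" by (rule scalar_prod_self_nonneg)
  also have "\<dots> = scalar_prod x x + 2 * scalar_prod x y * t + scalar_prod y y * t\<^sup>2"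
    using x y by (simp add: scalar_prod_add_distrib[of _ d] add_scalar_prod_distrib[of _ d]
        comm_scalar_prod[of y d x] power2_eq_square algebra_simps)
  finally show "0 \<le> scalar_prod x x + 2 * scalar_prod x y * t + scalar_prod y y * t\<^sup>2" .
qed

text \<open>With y = V^-1 x one has |y|^2 <= y.Vy = x.y, and Cauchy-Schwarz gives (x.y)^2 <= |x|^2
  |y|^2 <= |x|^2 (x.y). In particular features in the unit ball have width at most 1.\<close>

lemma inv_mat_form_bounds:
  assumes V: "ge_one d V" and x: "x \<in> carrier_vec d"
  defines "y \<equiv> inv_mat V *\<^sub>v x"
  shows "scalar_prod y y \<le> scalar_prod x y" "scalar_prod x y \<le> scalar_prod x x" "scalar_prod x y \<ge> 0"
proof -
  have y: "y \<in> carrier_vec d" "V *\<^sub>v y = x" unfolding y_def using inv_mat_mult_vec[OF V x] by auto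
  show 1: "scalar_prod y y \<le> scalar_prod x y"
    using V y comm_scalar_prod[OF y(1) x] by (auto simp: ge_one_def)
  show 0: "scalar_prod x y \<ge> 0" using 1 scalar_prod_self_nonneg[of y] by linarith
  have "scalar_prod x y * scalar_prod x y \<le> scalar_prod x x * scalar_prod y y"
    using scalar_prod_square_le[OF x y(1)] by (simp add: power2_eq_square)
  also have "\<dots> \<le> scalar_prod x x * scalar_prod x y"
    by (intro mult_left_mono 1 scalar_prod_self_nonneg)
  finally show "scalar_prod x y \<le> scalar_prod x x"
    using 0 scalar_prod_self_nonneg[of x] by (cases "scalar_prod x y = 0") auto
qed

text \<open>The nonnegative quadratic is the V^-1 form of x + t y. The inequality will bound an
  estimation error by a width times the norm of the noise sum.\<close>

lemma inv_mat_cauchy_schwarz: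
  assumes V: "ge_one d V" and x: "x \<in> carrier_vec d" and y: "y \<in> carrier_vec d"
  shows "\<bar>scalar_prod x (inv_mat V *\<^sub>v y)\<bar> \<le> mat_norm (inv_mat V) x * mat_norm (inv_mat V) y"
proof -
  let ?W = "inv_mat V"
  note W = ge_one_inverse(1)[OF V]
  have "(scalar_prod x (?W *\<^sub>v y))\<^sup>2 \<le> scalar_prod x (?W *\<^sub>v x) * scalar_prod y (?W *\<^sub>v y)"
  proof (rule quadratic_nonneg_discriminant)
    fix t :: real
    have "0 \<le> scalar_prod (x + t \<cdot>\<^sub>v y) (?W *\<^sub>v (x + t \<cdot>\<^sub>v y))"
      using inv_mat_form_bounds(3)[OF V, of "x + t \<cdot>\<^sub>v y"] x y by auto
    also have "\<dots> = scalar_prod x (?W *\<^sub>v x) + 2 * scalar_prod x (?W *\<^sub>v y) * t + scalar_prod y (?W *\<^sub>v y) * t\<^sup>2"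
      using x y W inv_mat_mult_vec(1)[OF V x] inv_mat_mult_vec(1)[OF V y]
        inv_mat_symmetric[OF V y x] comm_scalar_prod[of "?W *\<^sub>v y" d x]
      by (simp add: scalar_prod_add_distrib[of _ d] add_scalar_prod_distrib[of _ d]
          mult_add_distrib_mat_vec[of _ d d] mult_mat_vec[of _ d d] power2_eq_square algebra_simps)
    finally show "0 \<le> scalar_prod x (?W *\<^sub>v x) + 2 * scalar_prod x (?W *\<^sub>v y) * t + scalar_prod y (?W *\<^sub>v y) * t\<^sup>2" .
  qed
  then have "\<bar>scalar_prod x (?W *\<^sub>v y)\<bar> \<le> sqrt (scalar_prod x (?W *\<^sub>v x) * scalar_prod y (?W *\<^sub>v y))"
    by (metis real_sqrt_abs real_sqrt_le_iff)
  then show ?thesis by (simp add: mat_norm_def real_sqrt_mult)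
qed

text \<open>The Sherman--Morrison formula, at the level of quadratic forms.\<close>

lemma inv_mat_form_update:
  fixes e :: real
  assumes V: "ge_one d V" and x: "x \<in> carrier_vec d" and S: "S \<in> carrier_vec d"
  defines "w2 \<equiv> scalar_prod x (inv_mat V *\<^sub>v x)" and "b \<equiv> scalar_prod x (inv_mat V *\<^sub>v S)"
  shows "scalar_prod (S + e \<cdot>\<^sub>v x) (inv_mat (V + outer x) *\<^sub>v (S + e \<cdot>\<^sub>v x))
    = scalar_prod S (inv_mat V *\<^sub>v S) + (2 * b * e + e\<^sup>2 * w2 - b\<^sup>2) / (1 + w2)"
proof -
  let ?W = "inv_mat V" and ?V' = "V + outer x"
  define y where "y = ?W *\<^sub>v x"
  have Vc: "V \<in> carrier_mat d d" using V by (auto simp: ge_one_def)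
  note W = ge_one_inverse(1)[OF V]
  have y: "y \<in> carrier_vec d" "V *\<^sub>v y = x" unfolding y_def using inv_mat_mult_vec[OF V x] by auto
  have w2: "w2 = scalar_prod x y" "w2 \<ge> 0"
    using inv_mat_form_bounds(3)[OF V x] by (auto simp: w2_def y_def)
  have V': "ge_one d ?V'" by (rule ge_one_add_outer[OF V x])
  \<comment> \<open>A candidate for the image of z under the inverse of V + x x^T; multiplying it by
    V + x x^T gives back z, which identifies it.\<close>
  have inv': "inv_mat ?V' *\<^sub>v z = ?W *\<^sub>v z - (scalar_prod y z / (1 + w2)) \<cdot>\<^sub>v y"
    if z: "z \<in> carrier_vec d" for z
  proof -
    define c where "c = scalar_prod y z / (1 + w2)"
    define u where "u = ?W *\<^sub>v z - c \<cdot>\<^sub>v y"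
    have u: "u \<in> carrier_vec d" unfolding u_def using W y z by auto
    have "scalar_prod x (?W *\<^sub>v z) = scalar_prod y z"
      unfolding y_def by (rule inv_mat_symmetric[OF V x z])
    then have xu: "scalar_prod x u = scalar_prod y z - c * w2"
      unfolding u_def using W x y z w2 by (simp add: scalar_prod_minus_distrib[of _ d])
    have "c * (1 + w2) = scalar_prod y z" unfolding c_def using w2(2) by simp
    then have c: "scalar_prod y z = c + c * w2" by (simp add: algebra_simps)
    have "?V' *\<^sub>v u = V *\<^sub>v u + scalar_prod x u \<cdot>\<^sub>v x"
      using Vc x u by (simp add: add_mult_distrib_mat_vec[of _ d d] outer_mult_vec[of _ d])
    also have "V *\<^sub>v u = z - c \<cdot>\<^sub>v x"
      unfolding u_def using Vc W y z inv_mat_mult_vec(2)[OF V z]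
      by (simp add: mult_minus_distrib_mat_vec[of _ d d] mult_mat_vec[of _ d d])
    also have "z - c \<cdot>\<^sub>v x + scalar_prod x u \<cdot>\<^sub>v x = z"
      using x z xu c by (intro eq_vecI) (auto simp: algebra_simps)
    finally have "inv_mat ?V' *\<^sub>v z = inv_mat ?V' *\<^sub>v (?V' *\<^sub>v u)" by simp
    also have "\<dots> = u" by (rule inv_mat_mult_vec(3)[OF V' u])
    finally show ?thesis by (simp add: u_def c_def)
  qed
  let ?z = "S + e \<cdot>\<^sub>v x"
  have z: "?z \<in> carrier_vec d" using S x by auto
  have yz: "scalar_prod y ?z = b + e * w2"
    using y S x w2 inv_mat_symmetric[OF V x S]
    by (simp add: scalar_prod_add_distrib[of _ d] b_def y_def comm_scalar_prod[of "?W *\<^sub>v x" d x])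
  have zWz: "scalar_prod ?z (?W *\<^sub>v ?z) = scalar_prod S (?W *\<^sub>v S) + 2 * e * b + e\<^sup>2 * w2"
    using x S W inv_mat_mult_vec(1)[OF V x] inv_mat_mult_vec(1)[OF V S]
      inv_mat_symmetric[OF V S x] comm_scalar_prod[of "?W *\<^sub>v S" d x]
    by (simp add: scalar_prod_add_distrib[of _ d] add_scalar_prod_distrib[of _ d]
        mult_add_distrib_mat_vec[of _ d d] mult_mat_vec[of _ d d] power2_eq_square algebra_simps b_def w2_def)
  have "scalar_prod ?z (inv_mat ?V' *\<^sub>v ?z)
      = scalar_prod ?z (?W *\<^sub>v ?z) - (b + e * w2)\<^sup>2 / (1 + w2)"
    unfolding inv'[OF z] yz using z W y yz comm_scalar_prod[of ?z d y]
    by (simp add: scalar_prod_minus_distrib[of _ d] power2_eq_square)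
  also have "\<dots> = scalar_prod S (?W *\<^sub>v S) + (2 * b * e + e\<^sup>2 * w2 - b\<^sup>2) / (1 + w2)"
  proof -
    have "2 * e * b + e\<^sup>2 * w2 - (b + e * w2)\<^sup>2 / (1 + w2) = (2 * b * e + e\<^sup>2 * w2 - b\<^sup>2) / (1 + w2)"
      using w2(2) by (simp add: divide_simps) (simp add: power2_eq_square algebra_simps)
    then show ?thesis using zWz by linarith
  qed
  finally show ?thesis .
qed

section \<open>Determinants of design matrices\<close>

text \<open>Right multiplication by the unitriangular block matrix with corner -A^-1 B clears the
  upper right block and keeps the determinant.\<close>

lemma det_schur_complement_left:
  fixes A :: "'a::field mat"
  assumes A: "A \<in> carrier_mat n n" and B: "B \<in> carrier_mat n m" and C: "C \<in> carrier_mat m n"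
    and D: "D \<in> carrier_mat m m" and Ai: "Ai \<in> carrier_mat n n" "A * Ai = 1\<^sub>m n"
  shows "det (four_block_mat A B C D) = det A * det (D - C * (Ai * B))"
proof -
  let ?E = "four_block_mat (1\<^sub>m n) (- (Ai * B)) (0\<^sub>m m n) (1\<^sub>m m)"
  have AB: "Ai * B \<in> carrier_mat n m" using Ai B by auto
  have "A * (- (Ai * B)) = - (A * (Ai * B))" using A AB by (intro eq_matI) auto
  also have "A * (Ai * B) = B"
    using A Ai B by (subst assoc_mult_mat[symmetric, of _ n n _ n _ m]) auto
  finally have *: "A * (- (Ai * B)) = - B" .
  have "four_block_mat A B C D * ?E
      = four_block_mat (A * 1\<^sub>m n + B * 0\<^sub>m m n) (A * (- (Ai * B)) + B * 1\<^sub>m m)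
          (C * 1\<^sub>m n + D * 0\<^sub>m m n) (C * (- (Ai * B)) + D * 1\<^sub>m m)"
    using AB by (intro mult_four_block_mat[OF A B C D one_carrier_mat _ zero_carrier_mat one_carrier_mat]) (rule uminus_carrier_mat)
  also have "\<dots> = four_block_mat A (0\<^sub>m n m) C (D - C * (Ai * B))"
  proof -
    have "A * 1\<^sub>m n + B * 0\<^sub>m m n = A" "C * 1\<^sub>m n + D * 0\<^sub>m m n = C" using A B C D by auto
    moreover have "- B + B * 1\<^sub>m m = 0\<^sub>m n m" using B by (intro eq_matI) auto
    moreover have "C * (- (Ai * B)) = - (C * (Ai * B))" using C AB by (intro eq_matI) auto
    moreover have "- (C * (Ai * B)) + D * 1\<^sub>m m = D - C * (Ai * B)"
      using C D AB by (intro eq_matI) auto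
    ultimately show ?thesis unfolding * by simp
  qed
  finally have "det (four_block_mat A B C D) * det ?E = det A * det (D - C * (Ai * B))"
    using A B C D AB
    by (subst det_mult[symmetric, of _ "n + m"])
       (auto intro!: det_four_block_mat_upper_right_zero[OF _ refl, of _ n _ m] minus_carrier_mat)
  moreover have "det ?E = 1"
    using AB by (subst det_four_block_mat_lower_left_zero[of _ n _ m]) auto
  ultimately show ?thesis by simp
qed

text \<open>The same elimination with the invertible block at the lower right. Comparing both
  evaluations of one block matrix yields the rank-one determinant formula.\<close>

lemma det_schur_complement_right:
  fixes A :: "'a::field mat"
  assumes A: "A \<in> carrier_mat n n" and B: "B \<in> carrier_mat n m" and C: "C \<in> carrier_mat m n"
    and D: "D \<in> carrier_mat m m" and Di: "Di \<in> carrier_mat m m" "D * Di = 1\<^sub>m m"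
  shows "det (four_block_mat A B C D) = det (A - B * (Di * C)) * det D"
proof -
  let ?E = "four_block_mat (1\<^sub>m n) (0\<^sub>m n m) (- (Di * C)) (1\<^sub>m m)"
  have DC: "Di * C \<in> carrier_mat m n" using Di C by auto
  have "D * (- (Di * C)) = - (D * (Di * C))" using D DC by (intro eq_matI) auto
  also have "D * (Di * C) = C"
    using D Di C by (subst assoc_mult_mat[symmetric, of _ m m _ m _ n]) auto
  finally have *: "D * (- (Di * C)) = - C" .
  have "four_block_mat A B C D * ?E
      = four_block_mat (A * 1\<^sub>m n + B * (- (Di * C))) (A * 0\<^sub>m n m + B * 1\<^sub>m m)
          (C * 1\<^sub>m n + D * (- (Di * C))) (C * 0\<^sub>m n m + D * 1\<^sub>m m)"
    using DC by (intro mult_four_block_mat[OF A B C D one_carrier_mat zero_carrier_mat _ one_carrier_mat]) (rule uminus_carrier_mat)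
  also have "\<dots> = four_block_mat (A - B * (Di * C)) B (0\<^sub>m m n) D"
  proof -
    have "A * 0\<^sub>m n m + B * 1\<^sub>m m = B" "C * 0\<^sub>m n m + D * 1\<^sub>m m = D" using A B C D by auto
    moreover have "C * 1\<^sub>m n + - C = 0\<^sub>m m n" using C by (intro eq_matI) auto
    moreover have "B * (- (Di * C)) = - (B * (Di * C))" using B DC by (intro eq_matI) auto
    moreover have "A * 1\<^sub>m n + - (B * (Di * C)) = A - B * (Di * C)"
      using A B DC by (intro eq_matI) auto
    ultimately show ?thesis unfolding * by simp
  qed
  finally have "det (four_block_mat A B C D) * det ?E = det (A - B * (Di * C)) * det D"
    using A B C D DC
    by (subst det_mult[symmetric, of _ "n + m"])
       (auto intro!: det_four_block_mat_lower_left_zero[of _ n _ m] minus_carrier_mat)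
  moreover have "det ?E = 1"
    using DC by (subst det_four_block_mat_upper_right_zero[OF _ refl, of _ n _ m]) auto
  ultimately show ?thesis by simp
qed

lemma det_one_by_one: "A \<in> carrier_mat 1 1 \<Longrightarrow> det A = A $$ (0, 0)"
  by (rule det_single) 

text \<open>The block matrix with rows (V, x) and (-x^T, 1) has the Schur complements V + x x^T and
  1 + x^T V^-1 x; its determinant is computed from either.\<close>

lemma det_add_outer:
  assumes V: "ge_one d V" and x: "x \<in> carrier_vec d"
  shows "det (V + outer x) = det V * (1 + scalar_prod x (inv_mat V *\<^sub>v x))"
proof -
  have Vc: "V \<in> carrier_mat d d" using V by (auto simp: ge_one_def)
  note W = ge_one_inverse[OF V]
  let ?B = "mat d 1 (\<lambda>(i, j). x $ i)" and ?C = "mat 1 d (\<lambda>(i, j). - x $ j)"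
  have 1: "V - ?B * (1\<^sub>m 1 * ?C) = V + outer x"
    using Vc x by (intro eq_matI) (auto simp: outer_def scalar_prod_def)
  have 2: "(1\<^sub>m 1 - ?C * (inv_mat V * ?B)) $$ (0, 0) = 1 + scalar_prod x (inv_mat V *\<^sub>v x)"
    using W(1) x by (auto simp: scalar_prod_def sum_negf sum_distrib_left intro!: sum.cong)
  have "det (V + outer x) = det (four_block_mat V ?B ?C (1\<^sub>m 1))"
    using det_schur_complement_right[of V d ?B 1 ?C "1\<^sub>m 1" "1\<^sub>m 1"] Vc 1 by simp
  also have "\<dots> = det V * det (1\<^sub>m 1 - ?C * (inv_mat V * ?B))"
    using Vc W by (intro det_schur_complement_left) auto
  also have "det (1\<^sub>m 1 - ?C * (inv_mat V * ?B)) = 1 + scalar_prod x (inv_mat V *\<^sub>v x)"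
    using W(1) 2 by (subst det_one_by_one) (auto intro!: minus_carrier_mat)
  finally show ?thesis .
qed

text \<open>Induction on the dimension: splitting off the corner entry a leaves the Schur complement
  S, which is again positive definite and whose diagonal entries are those of V minus b_i^2 /
  a.\<close>

lemma hadamard_inequality:
  fixes V :: "real mat"
  assumes "V \<in> carrier_mat n n" "\<And>i j. i < n \<Longrightarrow> j < n \<Longrightarrow> V $$ (i, j) = V $$ (j, i)"
    and "\<And>v. (\<exists>i<n. v i \<noteq> 0) \<Longrightarrow> 0 < (\<Sum>i<n. \<Sum>j<n. v i * V $$ (i, j) * v j)"
  shows "0 < det V \<and> det V \<le> (\<Prod>i<n. V $$ (i, i))"
  using assms
proof (induction n arbitrary: V)
  case 0
  then show ?case by (simp add: det_dim_zero)
next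
  case (Suc n)
  note V = Suc.prems(1) and sym = Suc.prems(2) and pd = Suc.prems(3)
  define a where "a = V $$ (0, 0)"
  define b where "b j = V $$ (0, Suc j)" for j
  define S where "S = mat n n (\<lambda>(i, j). V $$ (Suc i, Suc j) - b i * b j / a)"
  have "0 < (\<Sum>i<Suc n. \<Sum>j<Suc n. (if i = 0 then 1 else 0) * V $$ (i, j) * (if j = 0 then 1 else 0))"
    by (rule pd) auto
  then have a: "a > 0" by (simp add: sum.lessThan_Suc_shift a_def del: sum.lessThan_Suc)
  have b': "V $$ (Suc i, 0) = b i" if "i < n" for i using sym[of "Suc i" 0] that by (simp add: b_def)
  have S: "S \<in> carrier_mat n n" by (simp add: S_def)
  have pd_S: "0 < (\<Sum>i<n. \<Sum>j<n. v i * S $$ (i, j) * v j)" if "\<exists>i<n. v i \<noteq> 0" for v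
  proof -
    from that obtain i0 where i0: "i0 < n" "v i0 \<noteq> 0" by auto
    define s where "s = (\<Sum>j<n. b j * v j)"
    \<comment> \<open>The head -s/a minimises the form over the first coordinate, and the minimum is
      the form of \<open>S\<close> at \<open>v\<close>.\<close>
    define u where "u = case_nat (- s / a) v"
    have "u (Suc i0) \<noteq> 0" using i0 by (simp add: u_def)
    then have "0 < (\<Sum>i<Suc n. \<Sum>j<Suc n. u i * V $$ (i, j) * u j)"
      using i0 by (intro pd) auto
    also have "\<dots> = (- s / a) * a * (- s / a) + (\<Sum>j<n. (- s / a) * (b j * v j))
        + ((\<Sum>i<n. (- s / a) * (b i * v i)) + (\<Sum>i<n. \<Sum>j<n. v i * V $$ (Suc i, Suc j) * v j))"
      unfolding sum.lessThan_Suc_shift sum.distrib[symmetric]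
      by (intro arg_cong2[of _ _ _ _ "(+)"] sum.cong refl)
         (simp_all add: u_def a_def[symmetric] b_def[symmetric] b' algebra_simps)
    also have "\<dots> = a * (- s / a)\<^sup>2 + 2 * (- s / a) * s + (\<Sum>i<n. \<Sum>j<n. v i * V $$ (Suc i, Suc j) * v j)"
      by (simp only: sum_distrib_left[symmetric] s_def[symmetric]) (simp add: power2_eq_square)
    also have "\<dots> = (\<Sum>i<n. \<Sum>j<n. v i * V $$ (Suc i, Suc j) * v j) - s * s / a"
      using a by (simp add: power2_eq_square field_simps)
    also have "s * s / a = (\<Sum>i<n. \<Sum>j<n. v i * (b i * b j / a) * v j)"
      unfolding s_def sum_product sum_divide_distrib by (intro sum.cong refl) (simp add: algebra_simps)
    finally show "0 < (\<Sum>i<n. \<Sum>j<n. v i * S $$ (i, j) * v j)"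
      by (simp add: S_def sum_subtractf algebra_simps)
  qed
  have IH: "0 < det S \<and> det S \<le> (\<Prod>i<n. S $$ (i, i))"
    by (rule Suc.IH[OF S _ pd_S]) (use sym in \<open>simp_all add: S_def mult.commute\<close>)
  have S_diag: "0 < S $$ (i, i)" if "i < n" for i
  proof -
    have "0 < (\<Sum>k<n. \<Sum>j<n. (if k = i then 1 else 0) * S $$ (k, j) * (if j = i then 1 else 0))"
      using that by (intro pd_S) auto
    also have "\<dots> = (\<Sum>k<n. \<Sum>j<n. if j = i then (if k = i then S $$ (i, i) else 0) else 0)"
      by (intro sum.cong refl) auto
    also have "\<dots> = S $$ (i, i)" using that by simp
    finally show ?thesis .
  qed
  let ?A = "mat 1 1 (\<lambda>_. a)" and ?B = "mat 1 n (\<lambda>(_, j). b j)" and ?C = "mat n 1 (\<lambda>(i, _). b i)"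
    and ?D = "mat n n (\<lambda>(i, j). V $$ (Suc i, Suc j))" and ?Ai = "mat 1 1 (\<lambda>_. 1 / a)"
  have "V = four_block_mat ?A ?B ?C ?D"
  proof (rule eq_matI)
    fix i j assume "i < dim_row (four_block_mat ?A ?B ?C ?D)" "j < dim_col (four_block_mat ?A ?B ?C ?D)"
    then show "V $$ (i, j) = four_block_mat ?A ?B ?C ?D $$ (i, j)"
      using b' by (cases i; cases j) (auto simp: a_def b_def)
  qed (use V in auto)
  then have "det V = det (four_block_mat ?A ?B ?C ?D)" by (rule arg_cong)
  also have "\<dots> = det ?A * det (?D - ?C * (?Ai * ?B))"
    using a by (intro det_schur_complement_left) (auto intro!: eq_matI simp: scalar_prod_def)
  also have "?D - ?C * (?Ai * ?B) = S"
    using a by (intro eq_matI) (auto simp: S_def scalar_prod_def)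
  also have "det ?A = a" by (subst det_one_by_one) auto
  finally have d: "det V = a * det S" .
  have "a * det S \<le> a * (\<Prod>i<n. V $$ (Suc i, Suc i))"
    using IH a by (intro mult_left_mono order_trans[OF conjunct2[OF IH]] prod_mono conjI)
      (use S_diag in \<open>auto simp: S_def less_imp_le\<close>)
  then show ?case using IH a d by (simp add: prod.lessThan_Suc_shift a_def del: prod.lessThan_Suc)
qed
text \<open>Hadamard's inequality reduces the determinant to the diagonal, whose sum is d plus the
  squared lengths of the vectors. The inequality of arithmetic and geometric means then appears as
  ln z <= z - 1.\<close>

lemma det_design_le:
  assumes xs: "set xs \<subseteq> unit_ball d" and d: "d \<ge> 1"
  shows "0 < det (design d xs)"
    "ln (det (design d xs)) \<le> real d * ln (1 + real (length xs) / real d)"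
proof -
  let ?V = "design d xs"
  have xs': "set xs \<subseteq> carrier_vec d" using xs by (auto simp: unit_ball_def)
  have ge: "ge_one d ?V" by (rule ge_one_design[OF xs'])
  then have Vc: "?V \<in> carrier_mat d d" by (auto simp: ge_one_def)
  note idx = design_index[OF xs']
  have had: "0 < det ?V \<and> det ?V \<le> (\<Prod>i<d. ?V $$ (i, i))"
  proof (rule hadamard_inequality[OF Vc])
    show "?V $$ (i, j) = ?V $$ (j, i)" if "i < d" "j < d" for i j
      using that by (simp add: idx mult.commute)
    fix v :: "nat \<Rightarrow> real" assume v: "\<exists>i<d. v i \<noteq> 0"
    have "0 < (\<Sum>i<d. v i * v i)"
      using v by (auto intro!: sum_pos2 simp: zero_less_mult_iff)
    also have "\<dots> = scalar_prod (vec d v) (vec d v)" by (simp add: scalar_prod_def atLeast0LessThan)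
    also have "\<dots> \<le> scalar_prod (vec d v) (?V *\<^sub>v vec d v)" using ge by (auto simp: ge_one_def)
    also have "\<dots> = (\<Sum>i<d. \<Sum>j<d. v i * ?V $$ (i, j) * v j)"
      using Vc by (auto simp: scalar_prod_def atLeast0LessThan sum_distrib_left mult.assoc intro!: sum.cong)
    finally show "0 < (\<Sum>i<d. \<Sum>j<d. v i * ?V $$ (i, j) * v j)" .
  qed
  show det: "0 < det ?V" using had by simp
  have diag: "?V $$ (i, i) \<ge> 1" if "i < d" for i
    using that by (simp add: idx sum_nonneg)
  have "(\<Sum>i<d. ?V $$ (i, i)) = real d + (\<Sum>k<length xs. \<Sum>i<d. xs ! k $ i * xs ! k $ i)"
    by (simp add: idx sum.distrib sum.swap[of _ "{..<d}"])
  also have "(\<Sum>k<length xs. \<Sum>i<d. xs ! k $ i * xs ! k $ i) \<le> (\<Sum>k<length xs. 1)"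
  proof (rule sum_mono)
    fix k assume "k \<in> {..<length xs}"
    then have "xs ! k \<in> unit_ball d" using xs by auto
    then show "(\<Sum>i<d. xs ! k $ i * xs ! k $ i) \<le> 1"
      by (auto simp: unit_ball_def norm2_def scalar_prod_def atLeast0LessThan)
  qed
  finally have tr: "(\<Sum>i<d. ?V $$ (i, i)) \<le> real d + real (length xs)" by simp
  \<comment> \<open>A bound for the mean of the diagonal entries, with which each entry is
    compared.\<close>
  define m where "m = 1 + real (length xs) / real d"
  have m: "m > 0" "real d * m = real d + real (length xs)" using d by (auto simp: m_def field_simps add_pos_nonneg)
  have "ln (det ?V) \<le> ln (\<Prod>i<d. ?V $$ (i, i))" using had by simp
  also have "\<dots> = (\<Sum>i<d. ln (?V $$ (i, i)))" using diag by (intro ln_prod) force+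
  also have "\<dots> \<le> (\<Sum>i<d. ln m + ?V $$ (i, i) / m - 1)"
  proof (rule sum_mono)
    fix i assume "i \<in> {..<d}"
    then have p: "?V $$ (i, i) > 0" using diag[of i] by auto
    have "ln (?V $$ (i, i) / m) \<le> ?V $$ (i, i) / m - 1" using p m by (intro ln_le_minus_one) auto
    then show "ln (?V $$ (i, i)) \<le> ln m + ?V $$ (i, i) / m - 1" using p m by (simp add: ln_div)
  qed
  also have "\<dots> = real d * ln m + (\<Sum>i<d. ?V $$ (i, i)) / m - real d"
    by (simp add: sum.distrib sum_subtractf sum_divide_distrib)
  also have "(\<Sum>i<d. ?V $$ (i, i)) / m \<le> real d" using tr m by (simp add: divide_le_eq)
  finally show "ln (det ?V) \<le> real d * ln (1 + real (length xs) / real d)" by (simp add: m_def)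
qed

section \<open>Vectorised matrices\<close>

lemma scalar_prod_vectorize:
  assumes A: "A \<in> carrier_mat d d" and B: "B \<in> carrier_mat d d"
  shows "scalar_prod (vectorize A) (vectorize B) = (\<Sum>i<d. \<Sum>j<d. A $$ (i, j) * (B $$ (i, j) :: real))"
proof (cases "d = 0")
  case True then show ?thesis using A B by (simp add: vectorize_def scalar_prod_def)
next
  case False
  have "scalar_prod (vectorize A) (vectorize B)
      = (\<Sum>k<d * d. A $$ (k div d, k mod d) * B $$ (k div d, k mod d))"
    using A B by (simp add: vectorize_def scalar_prod_def atLeast0LessThan)
  also have "\<dots> = (\<Sum>i<d. \<Sum>k\<in>{i * d..<i * d + d}. A $$ (k div d, k mod d) * B $$ (k div d, k mod d))"
    by (rule sum.nat_group[symmetric])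
  also have "\<dots> = (\<Sum>i<d. \<Sum>j<d. A $$ (i, j) * B $$ (i, j))"
  proof (rule sum.cong[OF refl])
    fix i assume "i \<in> {..<d}"
    show "(\<Sum>k\<in>{i * d..<i * d + d}. A $$ (k div d, k mod d) * B $$ (k div d, k mod d))
        = (\<Sum>j<d. A $$ (i, j) * B $$ (i, j))"
    proof (rule sum.reindex_bij_witness[of _ "\<lambda>j. i * d + j" "\<lambda>k. k - i * d"])
      fix k assume k: "k \<in> {i * d..<i * d + d}"
      define j where "j = k - i * d"
      have "k = j + i * d" "j < d" using k by (auto simp: j_def)
      then have "k div d = i" "k mod d = j" by auto
      then show "A $$ (i, k - i * d) * B $$ (i, k - i * d) = A $$ (k div d, k mod d) * B $$ (k div d, k mod d)"
        by (simp add: j_def)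
    qed auto
  qed
  finally show ?thesis .
qed

lemma vectorize_carrier: "A \<in> carrier_mat d d \<Longrightarrow> vectorize A \<in> carrier_vec (d * d)"
  by (auto simp: vectorize_def)

text \<open>The Frobenius inner product of M and x x^T is x^T M x. With M = V^-1 a wide arm becomes
  a point of large inner product, which is why inner product search applies.\<close>

lemma scalar_prod_vectorize_outer:
  fixes M :: "real mat"
  assumes "M \<in> carrier_mat d d" "x \<in> carrier_vec d"
  shows "scalar_prod (vectorize (c \<cdot>\<^sub>m M)) (vectorize (c \<cdot>\<^sub>m outer x)) = c\<^sup>2 * scalar_prod x (M *\<^sub>v x)"
  using assms
  by (subst scalar_prod_vectorize[of _ d])
     (auto simp: scalar_prod_def outer_def atLeast0LessThan sum_distrib_left power2_eq_square
       algebra_simps intro!: sum.cong)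

lemma vectorize_outer_unit_ball:
  assumes x: "x \<in> unit_ball d" and d: "d \<ge> 1"
  shows "vectorize ((1 / real d) \<cdot>\<^sub>m outer x) \<in> unit_ball (d * d)"
proof -
  have xc: "x \<in> carrier_vec d" and x1: "scalar_prod x x \<le> 1"
    using x by (auto simp: unit_ball_def norm2_def)
  have "scalar_prod (vectorize ((1 / real d) \<cdot>\<^sub>m outer x)) (vectorize ((1 / real d) \<cdot>\<^sub>m outer x))
      = (1 / real d)\<^sup>2 * scalar_prod x (outer x *\<^sub>v x)"
    using xc by (intro scalar_prod_vectorize_outer) auto
  also have "\<dots> = (1 / real d)\<^sup>2 * (scalar_prod x x)\<^sup>2"
    using xc by (simp add: outer_mult_vec[of _ d] power2_eq_square)
  also have "\<dots> \<le> 1 * 1"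
    using d x1 scalar_prod_self_nonneg[of x] by (intro mult_mono power_le_one) auto
  finally show ?thesis using xc
    by (auto simp: unit_ball_def norm2_def intro!: vectorize_carrier)
qed

text \<open>Each column V^-1 e_j has length at most 1, so the Frobenius norm of V^-1 is at most sqrt
  d; dividing by d leaves a legal query.\<close>

lemma vectorize_inv_mat_unit_ball:
  assumes V: "ge_one d V" and d: "d \<ge> 1"
  shows "vectorize ((1 / real d) \<cdot>\<^sub>m inv_mat V) \<in> unit_ball (d * d)"
proof -
  let ?W = "inv_mat V" and ?M = "(1 / real d) \<cdot>\<^sub>m inv_mat V"
  have W: "?W \<in> carrier_mat d d" by (rule ge_one_inverse(1)[OF V])
  have "scalar_prod (vectorize ?M) (vectorize ?M) = (\<Sum>i<d. \<Sum>j<d. (?W $$ (i, j) / real d)\<^sup>2)"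
    using W by (subst scalar_prod_vectorize[of _ d]) (auto simp: power2_eq_square intro!: sum.cong)
  also have "\<dots> = (\<Sum>j<d. (\<Sum>i<d. ?W $$ (i, j) * ?W $$ (i, j))) / (real d)\<^sup>2"
    by (subst sum.swap) (simp add: sum_divide_distrib power_divide power2_eq_square)
  also have "\<dots> \<le> (\<Sum>j<d. 1) / (real d)\<^sup>2"
  proof (intro divide_right_mono sum_mono)
    fix j assume j: "j \<in> {..<d}"
    let ?e = "unit_vec d j :: real vec"
    have e: "?e \<in> carrier_vec d" by simp
    have "?W *\<^sub>v ?e = vec d (\<lambda>i. ?W $$ (i, j))"
      using W j by (intro eq_vecI) auto
    then have "(\<Sum>i<d. ?W $$ (i, j) * ?W $$ (i, j)) = scalar_prod (?W *\<^sub>v ?e) (?W *\<^sub>v ?e)"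
      by (simp add: scalar_prod_def atLeast0LessThan)
    also have "\<dots> \<le> scalar_prod ?e ?e"
      using inv_mat_form_bounds[OF V e] by linarith
    also have "\<dots> = 1" using j by simp
    finally show "(\<Sum>i<d. ?W $$ (i, j) * ?W $$ (i, j)) \<le> 1" .
  qed simp
  also have "\<dots> \<le> 1" using d by (simp add: power2_eq_square)
  finally show ?thesis using W
    by (auto simp: unit_ball_def norm2_def intro!: vectorize_carrier)
qed

section \<open>Error of the ridge estimator\<close>

definition weighted_sum :: "nat \<Rightarrow> real vec list \<Rightarrow> real list \<Rightarrow> real vec" where
  "weighted_sum d xs es = vec d (\<lambda>i. \<Sum>k<length xs. es ! k * xs ! k $ i)"

lemma weighted_sum_carrier [simp]: "weighted_sum d xs es \<in> carrier_vec d"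
  by (simp add: weighted_sum_def)

lemma weighted_sum_Nil [simp]: "weighted_sum d [] [] = 0\<^sub>v d"
  by (auto simp: weighted_sum_def)

lemma weighted_sum_snoc:
  assumes "length es = length xs" "x \<in> carrier_vec d"
  shows "weighted_sum d (xs @ [x]) (es @ [e]) = weighted_sum d xs es + e \<cdot>\<^sub>v x"
  using assms by (intro eq_vecI) (auto simp: weighted_sum_def nth_append)

lemma transpose_mult_of_rows:
  assumes "set xs \<subseteq> carrier_vec d"
  shows "transpose_mat (mat_of_rows d xs) * mat_of_rows d xs + 1\<^sub>m d = design d xs"
proof (rule eq_matI)
  have Vc: "design d xs \<in> carrier_mat d d" using ge_one_design[OF assms] by (auto simp: ge_one_def)
  fix i j assume "i < dim_row (design d xs)" "j < dim_col (design d xs)"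
  then show "(transpose_mat (mat_of_rows d xs) * mat_of_rows d xs + 1\<^sub>m d) $$ (i, j) = design d xs $$ (i, j)"
    using Vc by (simp add: design_index[OF assms] scalar_prod_def mat_of_rows_def atLeast0LessThan)
qed (use ge_one_design[OF assms] in \<open>auto simp: ge_one_def\<close>)

text \<open>X^T Y = (V - I) theta + S with S the weighted noise sum, so theta' - theta = V^-1 S -
  V^-1 theta. Cauchy-Schwarz for V^-1 bounds both terms; the summand 1 is the regularisation bias,
  as the V^-1 norm of theta is at most its length.\<close>

lemma ridge_error:
  assumes xs: "set xs \<subseteq> carrier_vec d" and th: "\<theta> \<in> unit_ball d"
    and len: "length es = length xs" and x: "x \<in> carrier_vec d"
  defines "V \<equiv> design d xs"
  defines "Y \<equiv> vec_of_list (map2 (\<lambda>x e. scalar_prod \<theta> x + e) xs es)"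
  defines "\<theta>' \<equiv> inv_mat (transpose_mat (mat_of_rows d xs) * mat_of_rows d xs + 1\<^sub>m d)
     *\<^sub>v (transpose_mat (mat_of_rows d xs) *\<^sub>v Y)"
  shows "\<bar>scalar_prod x \<theta>' - scalar_prod x \<theta>\<bar>
    \<le> mat_norm (inv_mat V) x * (1 + mat_norm (inv_mat V) (weighted_sum d xs es))"
proof -
  have V: "ge_one d V" unfolding V_def by (rule ge_one_design[OF xs])
  then have Vc: "V \<in> carrier_mat d d" by (auto simp: ge_one_def)
  note W = ge_one_inverse(1)[OF V]
  have thc: "\<theta> \<in> carrier_vec d" and th1: "scalar_prod \<theta> \<theta> \<le> 1"
    using th by (auto simp: unit_ball_def norm2_def)
  have dimY: "dim_vec Y = length xs" using len by (simp add: Y_def)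
  have Yk: "Y $ k = scalar_prod \<theta> (xs ! k) + es ! k" if "k < length xs" for k
    unfolding Y_def vec_of_list_index using that len by simp
  let ?S = "weighted_sum d xs es"
  have Vth: "(V *\<^sub>v \<theta>) $ i = \<theta> $ i + (\<Sum>k<length xs. scalar_prod \<theta> (xs ! k) * xs ! k $ i)" if i: "i < d" for i
  proof -
    have "(V *\<^sub>v \<theta>) $ i = (\<Sum>j<d. V $$ (i, j) * \<theta> $ j)"
      using i Vc thc by (simp add: scalar_prod_def atLeast0LessThan)
    also have "\<dots> = (\<Sum>j<d. (if i = j then \<theta> $ j else 0) + (\<Sum>k<length xs. xs ! k $ i * xs ! k $ j * \<theta> $ j))"
      using i by (intro sum.cong refl) (simp add: V_def design_index[OF xs] algebra_simps sum_distrib_left)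
    also have "\<dots> = \<theta> $ i + (\<Sum>k<length xs. \<Sum>j<d. xs ! k $ i * xs ! k $ j * \<theta> $ j)"
      using i by (simp add: sum.distrib sum.swap[of _ "{..<d}"])
    also have "(\<Sum>k<length xs. \<Sum>j<d. xs ! k $ i * xs ! k $ j * \<theta> $ j)
        = (\<Sum>k<length xs. scalar_prod \<theta> (xs ! k) * xs ! k $ i)"
    proof (rule sum.cong[OF refl])
      fix k assume "k \<in> {..<length xs}"
      then have "dim_vec (xs ! k) = d" using xs by (auto dest!: subsetD[OF _ nth_mem])
      then show "(\<Sum>j<d. xs ! k $ i * xs ! k $ j * \<theta> $ j) = scalar_prod \<theta> (xs ! k) * xs ! k $ i"
        by (simp add: scalar_prod_def atLeast0LessThan sum_distrib_left sum_distrib_right algebra_simps)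
    qed
    finally show ?thesis .
  qed
  have XY: "transpose_mat (mat_of_rows d xs) *\<^sub>v Y = (V *\<^sub>v \<theta> - \<theta>) + ?S"
  proof (rule eq_vecI)
    fix i assume "i < dim_vec ((V *\<^sub>v \<theta> - \<theta>) + ?S)"
    then have i: "i < d" by (simp add: weighted_sum_def)
    have "(transpose_mat (mat_of_rows d xs) *\<^sub>v Y) $ i
        = (\<Sum>k<length xs. xs ! k $ i * (scalar_prod \<theta> (xs ! k) + es ! k))"
      using i Yk by (simp add: scalar_prod_def[of _ Y] mat_of_rows_def atLeast0LessThan dimY)
    then show "(transpose_mat (mat_of_rows d xs) *\<^sub>v Y) $ i = ((V *\<^sub>v \<theta> - \<theta>) + ?S) $ i"
      using i Vc thc Vth[OF i] by (simp add: weighted_sum_def sum.distrib algebra_simps)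
  qed (use thc in \<open>auto simp: weighted_sum_def\<close>)
  have "\<theta>' = inv_mat V *\<^sub>v ((V *\<^sub>v \<theta> - \<theta>) + ?S)"
    unfolding \<theta>'_def transpose_mult_of_rows[OF xs] XY V_def by simp
  also have "\<dots> = inv_mat V *\<^sub>v (V *\<^sub>v \<theta>) - inv_mat V *\<^sub>v \<theta> + inv_mat V *\<^sub>v ?S"
    using Vc W thc by (simp add: mult_add_distrib_mat_vec[of _ d d] mult_minus_distrib_mat_vec[of _ d d])
  also have "inv_mat V *\<^sub>v (V *\<^sub>v \<theta>) = \<theta>" by (rule inv_mat_mult_vec(3)[OF V thc])
  finally have "\<theta>' = \<theta> - inv_mat V *\<^sub>v \<theta> + inv_mat V *\<^sub>v ?S" .
  then have "scalar_prod x \<theta>' - scalar_prod x \<theta> = scalar_prod x (inv_mat V *\<^sub>v ?S) - scalar_prod x (inv_mat V *\<^sub>v \<theta>)"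
    using x W thc inv_mat_mult_vec(1)[OF V thc] inv_mat_mult_vec(1)[OF V weighted_sum_carrier[of d xs es]]
    by (simp add: scalar_prod_add_distrib[of _ d] scalar_prod_minus_distrib[of _ d] minus_carrier_vec)
  then have "\<bar>scalar_prod x \<theta>' - scalar_prod x \<theta>\<bar>
      \<le> mat_norm (inv_mat V) x * mat_norm (inv_mat V) ?S + mat_norm (inv_mat V) x * mat_norm (inv_mat V) \<theta>"
    using inv_mat_cauchy_schwarz[OF V x weighted_sum_carrier[of d xs es]] inv_mat_cauchy_schwarz[OF V x thc]
    by linarith
  also have "\<dots> \<le> mat_norm (inv_mat V) x * mat_norm (inv_mat V) ?S + mat_norm (inv_mat V) x * 1"
    using inv_mat_form_bounds[OF V thc] inv_mat_form_bounds(3)[OF V x] th1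
    by (intro add_mono order_refl mult_left_mono) (auto simp: mat_norm_def)
  finally show ?thesis by (simp add: algebra_simps)
qed

section \<open>Gaussian mixtures, conditional expectations and Ville's inequality\<close>

section \<open>Mixtures of exponential supermartingales\<close>

text \<open>\<open>mix_ratio b v e\<close> is the integral of \<open>exp (\<alpha> e - \<alpha>\<^sup>2/2)\<close> over \<open>\<alpha>\<close> distributed normally with mean \<open>b\<close> and
  variance \<open>v\<close>.\<close>

definition mix_ratio :: "real \<Rightarrow> real \<Rightarrow> real \<Rightarrow> real" where
  "mix_ratio b v e = exp ((2 * b * e + e\<^sup>2 * v - b\<^sup>2) / (2 * (1 + v))) / sqrt (1 + v)"

lemma mix_ratio_nonneg: "v \<ge> 0 \<Longrightarrow> mix_ratio b v e \<ge> 0"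
  by (simp add: mix_ratio_def)

lemma nn_integral_normal_density:
  assumes "s > 0"
  shows "(\<integral>\<^sup>+\<alpha>. ennreal (normal_density m s \<alpha>) \<partial>lborel) = 1"
proof -
  interpret prob_space "density lborel (normal_density m s)" by (rule prob_space_normal_density[OF assms])
  show ?thesis using emeasure_space_1 by (simp add: emeasure_density)
qed

text \<open>Completing the square in \<open>\<alpha>\<close>: the normal prior times exp
  (\<open>\<alpha>\<close> e - \<open>\<alpha>\<close>^2 / 2) is \<open>mix_ratio b v e\<close>
  times the posterior density, which has mean \<open>m\<close> and standard deviation
  \<open>s\<close> and integrates to 1.\<close>

lemma nn_integral_normal_mixture:
  assumes v: "v > 0"
  shows "(\<integral>\<^sup>+\<alpha>. ennreal (normal_density b (sqrt v) \<alpha> * exp (\<alpha> * e - \<alpha>\<^sup>2 / 2)) \<partial>lborel) = ennreal (mix_ratio b v e)"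
proof -
  define s where "s = sqrt (v / (1 + v))"
  define m where "m = (b + e * v) / (1 + v)"
  have s: "s > 0" "s\<^sup>2 = v / (1 + v)" using v by (auto simp: s_def)
  have eq: "normal_density b (sqrt v) \<alpha> * exp (\<alpha> * e - \<alpha>\<^sup>2 / 2) = mix_ratio b v e * normal_density m s \<alpha>" for \<alpha>
  proof -
    have 1: "- (\<alpha> - b)\<^sup>2 / (2 * v) + (\<alpha> * e - \<alpha>\<^sup>2 / 2)
      = (2 * b * e + e\<^sup>2 * v - b\<^sup>2) / (2 * (1 + v)) + - (\<alpha> - m)\<^sup>2 / (2 * (v / (1 + v)))"
    proof -
      have "1 + v \<noteq> 0" "v \<noteq> 0" using v by auto
      then show ?thesis unfolding m_def
        by (simp add: divide_simps) (simp add: power2_eq_square algebra_simps)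
    qed
    have "sqrt (2 * pi * v) = sqrt (2 * pi * (v / (1 + v))) * sqrt (1 + v)"
      using v by (simp add: real_sqrt_mult[symmetric])
    then have 2: "1 / sqrt (2 * pi * v) = 1 / sqrt (1 + v) * (1 / sqrt (2 * pi * (v / (1 + v))))" by simp
    have "normal_density b (sqrt v) \<alpha> * exp (\<alpha> * e - \<alpha>\<^sup>2 / 2)
        = 1 / sqrt (2 * pi * v) * exp (- (\<alpha> - b)\<^sup>2 / (2 * v) + (\<alpha> * e - \<alpha>\<^sup>2 / 2))"
      unfolding exp_add using v by (simp add: normal_density_def)
    also have "\<dots> = mix_ratio b v e * normal_density m s \<alpha>"
      unfolding 1 2 exp_add mix_ratio_def normal_density_def s(2) by (simp add: field_simps)
    finally show ?thesis .
  qed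
  have "(\<integral>\<^sup>+\<alpha>. ennreal (normal_density b (sqrt v) \<alpha> * exp (\<alpha> * e - \<alpha>\<^sup>2 / 2)) \<partial>lborel)
      = (\<integral>\<^sup>+\<alpha>. ennreal (mix_ratio b v e) * ennreal (normal_density m s \<alpha>) \<partial>lborel)"
    unfolding eq using v by (simp add: ennreal_mult' mix_ratio_nonneg)
  also have "\<dots> = ennreal (mix_ratio b v e) * (\<integral>\<^sup>+\<alpha>. ennreal (normal_density m s \<alpha>) \<partial>lborel)"
    by (rule nn_integral_cmult) simp
  also have "(\<integral>\<^sup>+\<alpha>. ennreal (normal_density m s \<alpha>) \<partial>lborel) = 1"
    by (rule nn_integral_normal_density[OF s(1)])
  finally show ?thesis by simp
qed

text \<open>The weight \<open>G\<close> may fail to be integrable, so the bound is carried over to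
  \<open>nn_cond_exp\<close>, where an \<open>F\<close>-measurable factor can be pulled out without
  integrability.\<close>

lemma (in prob_space) nn_integral_le_of_real_cond_exp_le:
  assumes F: "subalgebra M F" and G: "G \<in> borel_measurable F"
    and f: "integrable M f" "\<And>x. f x \<ge> 0" and c: "c \<ge> 0" and le: "AE x in M. real_cond_exp M F f x \<le> c"
  shows "(\<integral>\<^sup>+x. G x * ennreal (f x) \<partial>M) \<le> ennreal c * (\<integral>\<^sup>+x. G x \<partial>M)"
proof -
  interpret finite_measure_subalgebra M F by (unfold_locales) (rule F)
  have fm [measurable]: "f \<in> borel_measurable M" using f(1) by auto
  have "(\<integral>\<^sup>+x. 1 * nn_cond_exp M F (\<lambda>x. ennreal (f x)) x \<partial>M) = (\<integral>\<^sup>+x. 1 * ennreal (f x) \<partial>M)"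
    by (rule nn_cond_exp_intg) auto
  also have "\<dots> < \<infinity>" using f by (simp add: nn_integral_eq_integral)
  \<comment> \<open>\<open>enn2real\<close> sends infinity to 0, so a bound on
    \<open>real_cond_exp\<close> says something about \<open>nn_cond_exp\<close> only where the
    latter is finite.\<close>
  finally have fin: "AE x in M. nn_cond_exp M F (\<lambda>x. ennreal (f x)) x \<noteq> \<infinity>"
    by (intro nn_integral_PInf_AE) (auto intro: measurable_from_subalg[OF F])
  have z: "(\<lambda>x. ennreal (- f x)) = (\<lambda>_. 0)" using f(2) by (auto simp: ennreal_neg)
  have "AE x in M. (0::ennreal) = nn_cond_exp M F (\<lambda>x. ennreal (- f x)) x"
    unfolding z by (rule nn_cond_exp_F_meas) auto
  then have "AE x in M. nn_cond_exp M F (\<lambda>x. ennreal (f x)) x \<le> ennreal c"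
    using fin le
  proof eventually_elim
    case (elim x)
    then have "enn2real (nn_cond_exp M F (\<lambda>x. ennreal (f x)) x) \<le> c" by (simp add: real_cond_exp_def flip: elim(1))
    then show ?case using elim c
      by (cases "nn_cond_exp M F (\<lambda>x. ennreal (f x)) x") (auto simp: ennreal_leI)
  qed
  then have "(\<integral>\<^sup>+x. G x * nn_cond_exp M F (\<lambda>x. ennreal (f x)) x \<partial>M) \<le> (\<integral>\<^sup>+x. G x * ennreal c \<partial>M)"
    by (intro nn_integral_mono_AE) (auto elim!: eventually_mono intro: mult_left_mono)
  also have "\<dots> = ennreal c * (\<integral>\<^sup>+x. G x \<partial>M)"
    using measurable_from_subalg[OF F G] by (simp add: nn_integral_cmult mult.commute)
  finally show ?thesis using nn_cond_exp_intg[OF G, of "\<lambda>x. ennreal (f x)"] by simp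
qed

text \<open>For each fixed \<open>\<alpha>\<close> the prior density at \<open>\<alpha>\<close> is
  an \<open>F\<close>-measurable weight, so the subgaussian bound for this deterministic
  \<open>\<alpha>\<close> applies; Tonelli's theorem then averages over
  \<open>\<alpha>\<close>.\<close>

lemma (in prob_space) nn_integral_mix_ratio_le:
  fixes \<xi> :: "'a \<Rightarrow> real"
  assumes F: "subalgebra M F" and W: "W \<in> borel_measurable F"
    and b: "b \<in> borel_measurable F" and v: "v \<in> borel_measurable F"
    and v0: "\<And>x. v x \<ge> 0" and bv: "\<And>x. v x = 0 \<Longrightarrow> b x = 0"
    and \<xi>: "\<xi> \<in> borel_measurable M" and int: "\<And>\<alpha>. integrable M (\<lambda>x. exp (\<alpha> * \<xi> x))"
    and le: "\<And>\<alpha>. AE x in M. real_cond_exp M F (\<lambda>x. exp (\<alpha> * \<xi> x)) x \<le> exp (\<alpha>\<^sup>2 / 2)"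
  shows "(\<integral>\<^sup>+x. W x * ennreal (mix_ratio (b x) (v x) (\<xi> x)) \<partial>M) \<le> (\<integral>\<^sup>+x. W x \<partial>M)"
proof -
  note sub = measurable_from_subalg[OF F]
  have Wm [measurable]: "W \<in> borel_measurable M" and bm [measurable]: "b \<in> borel_measurable M"
    and vm [measurable]: "v \<in> borel_measurable M"
    using sub W b v by auto
  note \<xi>[measurable]
  interpret P: pair_sigma_finite M lborel by unfold_locales
  define G where "G \<alpha> x = (if v x > 0 then W x * ennreal (normal_density (b x) (sqrt (v x)) \<alpha>) else 0)" for \<alpha> x
  define W0 where "W0 x = (if v x > 0 then W x else 0)" for x
  have GF: "G \<alpha> \<in> borel_measurable F" for \<alpha>
    unfolding G_def normal_density_def using W b v by measurable
  have G1: "(\<integral>\<^sup>+\<alpha>. G \<alpha> x \<partial>lborel) = W0 x" for x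
  proof (cases "v x > 0")
    case True
    then show ?thesis by (simp add: G_def W0_def nn_integral_cmult nn_integral_normal_density)
  qed (simp add: G_def W0_def)
  have step: "(\<integral>\<^sup>+x. G \<alpha> x * ennreal (exp (\<alpha> * \<xi> x - \<alpha>\<^sup>2 / 2)) \<partial>M) \<le> (\<integral>\<^sup>+x. G \<alpha> x \<partial>M)" for \<alpha>
  proof -
    have [measurable]: "G \<alpha> \<in> borel_measurable M" by (rule sub[OF GF])
    have "(\<integral>\<^sup>+x. G \<alpha> x * ennreal (exp (\<alpha> * \<xi> x - \<alpha>\<^sup>2 / 2)) \<partial>M)
        = (\<integral>\<^sup>+x. ennreal (exp (- \<alpha>\<^sup>2 / 2)) * (G \<alpha> x * ennreal (exp (\<alpha> * \<xi> x))) \<partial>M)"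
    proof (intro nn_integral_cong)
      fix x
      have "exp (\<alpha> * \<xi> x - \<alpha>\<^sup>2 / 2) = exp (- \<alpha>\<^sup>2 / 2) * exp (\<alpha> * \<xi> x)"
        by (simp add: exp_add[symmetric])
      then show "G \<alpha> x * ennreal (exp (\<alpha> * \<xi> x - \<alpha>\<^sup>2 / 2))
          = ennreal (exp (- \<alpha>\<^sup>2 / 2)) * (G \<alpha> x * ennreal (exp (\<alpha> * \<xi> x)))"
        by (simp only: ennreal_mult' exp_ge_zero mult.left_commute)
    qed
    also have "\<dots> = ennreal (exp (- \<alpha>\<^sup>2 / 2)) * (\<integral>\<^sup>+x. G \<alpha> x * ennreal (exp (\<alpha> * \<xi> x)) \<partial>M)"
      by (rule nn_integral_cmult) measurable
    also have "\<dots> \<le> ennreal (exp (- \<alpha>\<^sup>2 / 2)) * (ennreal (exp (\<alpha>\<^sup>2 / 2)) * (\<integral>\<^sup>+x. G \<alpha> x \<partial>M))"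
      by (intro mult_left_mono nn_integral_le_of_real_cond_exp_le[OF F GF int _ _ le]) auto
    also have "\<dots> = (\<integral>\<^sup>+x. G \<alpha> x \<partial>M)"
      by (simp add: mult.assoc[symmetric] exp_minus flip: ennreal_mult')
    finally show ?thesis .
  qed
  have "(\<integral>\<^sup>+x. W0 x * ennreal (mix_ratio (b x) (v x) (\<xi> x)) \<partial>M)
      = (\<integral>\<^sup>+x. \<integral>\<^sup>+\<alpha>. G \<alpha> x * ennreal (exp (\<alpha> * \<xi> x - \<alpha>\<^sup>2 / 2)) \<partial>lborel \<partial>M)"
  proof (intro nn_integral_cong)
    fix x
    show "W0 x * ennreal (mix_ratio (b x) (v x) (\<xi> x))
        = (\<integral>\<^sup>+\<alpha>. G \<alpha> x * ennreal (exp (\<alpha> * \<xi> x - \<alpha>\<^sup>2 / 2)) \<partial>lborel)"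
    proof (cases "v x > 0")
      case True
      then show ?thesis
        by (simp add: W0_def G_def nn_integral_normal_mixture[symmetric] nn_integral_cmult[symmetric]
            ennreal_mult' mult.assoc)
    qed (simp add: W0_def G_def)
  qed
  also have "\<dots> = (\<integral>\<^sup>+\<alpha>. \<integral>\<^sup>+x. G \<alpha> x * ennreal (exp (\<alpha> * \<xi> x - \<alpha>\<^sup>2 / 2)) \<partial>M \<partial>lborel)"
    unfolding G_def normal_density_def by (rule P.Fubini'[symmetric]) measurable
  also have "\<dots> \<le> (\<integral>\<^sup>+\<alpha>. \<integral>\<^sup>+x. G \<alpha> x \<partial>M \<partial>lborel)"
    by (intro nn_integral_mono step)
  also have "\<dots> = (\<integral>\<^sup>+x. \<integral>\<^sup>+\<alpha>. G \<alpha> x \<partial>lborel \<partial>M)"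
    unfolding G_def normal_density_def by (rule P.Fubini') measurable
  finally have *: "(\<integral>\<^sup>+x. W0 x * ennreal (mix_ratio (b x) (v x) (\<xi> x)) \<partial>M) \<le> (\<integral>\<^sup>+x. W0 x \<partial>M)"
    by (simp add: G1)
  \<comment> \<open>Where v = 0 the prior degenerates to a point mass at 0 and the factor is 1; this
    part of the space is split off.\<close>
  define W1 where "W1 x = (if v x > 0 then 0 else W x)" for x
  have [measurable]: "W0 \<in> borel_measurable M" "W1 \<in> borel_measurable M"
    unfolding W0_def W1_def by measurable
  have mm [measurable]: "(\<lambda>x. mix_ratio (b x) (v x) (\<xi> x)) \<in> borel_measurable M"
    unfolding mix_ratio_def by measurable
  have "(\<integral>\<^sup>+x. W x * ennreal (mix_ratio (b x) (v x) (\<xi> x)) \<partial>M)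
      = (\<integral>\<^sup>+x. W0 x * ennreal (mix_ratio (b x) (v x) (\<xi> x)) + W1 x \<partial>M)"
  proof (intro nn_integral_cong)
    fix x show "W x * ennreal (mix_ratio (b x) (v x) (\<xi> x)) = W0 x * ennreal (mix_ratio (b x) (v x) (\<xi> x)) + W1 x"
      using v0[of x] bv[of x] by (cases "v x = 0") (auto simp: W0_def W1_def mix_ratio_def)
  qed
  also have "\<dots> = (\<integral>\<^sup>+x. W0 x * ennreal (mix_ratio (b x) (v x) (\<xi> x)) \<partial>M) + (\<integral>\<^sup>+x. W1 x \<partial>M)"
    by (rule nn_integral_add) measurable
  also have "\<dots> \<le> (\<integral>\<^sup>+x. W0 x \<partial>M) + (\<integral>\<^sup>+x. W1 x \<partial>M)" by (intro add_mono * order_refl)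
  also have "\<dots> = (\<integral>\<^sup>+x. W0 x + W1 x \<partial>M)" by (rule nn_integral_add[symmetric]) measurable
  also have "\<dots> = (\<integral>\<^sup>+x. W x \<partial>M)" by (intro nn_integral_cong) (auto simp: W0_def W1_def)
  finally show ?thesis .
qed

lemma sets_Collect_all_less:
  "(\<And>s. s < n \<Longrightarrow> {x \<in> space M. P s x} \<in> sets M) \<Longrightarrow> {x \<in> space M. \<forall>s<(n::nat). P s x} \<in> sets M"
proof (induction n)
  case (Suc n)
  have "{x \<in> space M. \<forall>s<Suc n. P s x} = {x \<in> space M. \<forall>s<n. P s x} \<inter> {x \<in> space M. P n x}"
    by (auto simp: less_Suc_eq)
  then show ?case using Suc by (simp add: sets.Int)
qed simp

text \<open>The stopping is made explicit: \<open>N n\<close> is the event that the level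
  \<open>l\<close> was not reached before time n, and E[W n; N n] + l P(not N n), the stopped
  process with \<open>l\<close> in place of its value after the crossing, never increases.\<close>

lemma (in prob_space) supermartingale_maximal:
  fixes W :: "nat \<Rightarrow> 'a \<Rightarrow> real"
  assumes W0: "\<And>x. W 0 x = 1" and Wm: "\<And>t. t \<le> T \<Longrightarrow> W t \<in> borel_measurable M"
    and F: "\<And>t. t < T \<Longrightarrow> subalgebra M (F t)"
    and adapted: "\<And>s t. s \<le> t \<Longrightarrow> t < T \<Longrightarrow> W s \<in> borel_measurable (F t)"
    and step: "\<And>t A. t < T \<Longrightarrow> A \<in> sets (F t) \<Longrightarrow>
      (\<integral>\<^sup>+x. ennreal (W (Suc t) x) * indicator A x \<partial>M) \<le> (\<integral>\<^sup>+x. ennreal (W t x) * indicator A x \<partial>M)"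
    and l: "l > 0"
  shows "prob {x \<in> space M. \<exists>t\<le>T. W t x \<ge> l} \<le> 1 / l"
proof -
  define N where "N n = {x \<in> space M. \<forall>s<n. W s x < l}" for n
  have Nm: "N n \<in> sets M" if "n \<le> Suc T" for n
    unfolding N_def using Wm that by (intro sets_Collect_all_less borel_measurable_less) auto
  have "(\<integral>\<^sup>+x. ennreal (W n x) * indicator (N n) x \<partial>M) + ennreal l * emeasure M (space M - N n) \<le> 1"
    if "n \<le> T" for n
    using that
  proof (induction n)
    case 0
    then show ?case by (simp add: W0 N_def emeasure_space_1 nn_integral_indicator
          cong: nn_integral_cong)
  next
    case (Suc n)
    then have n: "n < T" by simp
    have [measurable]: "W n \<in> borel_measurable M" "N n \<in> sets M" "N (Suc n) \<in> sets M"
      using Wm Nm Suc.prems by auto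
    have "space (F n) = space M" using F[OF n] by (simp add: subalgebra_def)
    then have "N (Suc n) = {x \<in> space (F n). \<forall>s<Suc n. W s x < l}" by (simp add: N_def)
    also have "\<dots> \<in> sets (F n)"
      using adapted n by (intro sets_Collect_all_less borel_measurable_less) auto
    finally have NF: "N (Suc n) \<in> sets (F n)" .
    have "(\<integral>\<^sup>+x. ennreal (W (Suc n) x) * indicator (N (Suc n)) x \<partial>M) + ennreal l * emeasure M (space M - N (Suc n))
        \<le> (\<integral>\<^sup>+x. ennreal (W n x) * indicator (N (Suc n)) x \<partial>M)
          + (\<integral>\<^sup>+x. ennreal l * indicator (space M - N (Suc n)) x \<partial>M)"
      by (intro add_mono step n NF) (simp add: nn_integral_cmult_indicator)
    also have "\<dots> = (\<integral>\<^sup>+x. ennreal (W n x) * indicator (N (Suc n)) x + ennreal l * indicator (space M - N (Suc n)) x \<partial>M)"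
      by (rule nn_integral_add[symmetric]) measurable
    also have "\<dots> \<le> (\<integral>\<^sup>+x. ennreal (W n x) * indicator (N n) x + ennreal l * indicator (space M - N n) x \<partial>M)"
    proof (intro nn_integral_mono)
      fix x assume x: "x \<in> space M"
      have "x \<in> N (Suc n) \<longleftrightarrow> x \<in> N n \<and> W n x < l" using x by (auto simp: N_def less_Suc_eq)
      then show "ennreal (W n x) * indicator (N (Suc n)) x + ennreal l * indicator (space M - N (Suc n)) x
          \<le> ennreal (W n x) * indicator (N n) x + ennreal l * indicator (space M - N n) x"
        using x by (cases "x \<in> N n"; cases "W n x < l") (auto intro!: ennreal_leI)
    qed
    also have "\<dots> = (\<integral>\<^sup>+x. ennreal (W n x) * indicator (N n) x \<partial>M) + ennreal l * emeasure M (space M - N n)"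
      by (subst nn_integral_add) (simp_all add: nn_integral_cmult_indicator)
    also have "\<dots> \<le> 1" using Suc by simp
    finally show ?case .
  qed
  note claim = this[of T, OF order_refl]
  define E where "E = {x \<in> space M. \<exists>t\<le>T. W t x \<ge> l}"
  have [measurable]: "W T \<in> borel_measurable M" "N T \<in> sets M" using Wm Nm by auto
  have "E = space M - N (Suc T)" by (auto simp: E_def N_def not_less less_Suc_eq_le)
  then have Em: "E \<in> sets M" using Nm by simp
  have "ennreal l * emeasure M E = (\<integral>\<^sup>+x. ennreal l * indicator E x \<partial>M)"
    using Em by (simp add: nn_integral_cmult_indicator)
  also have "\<dots> \<le> (\<integral>\<^sup>+x. ennreal (W T x) * indicator (N T) x + ennreal l * indicator (space M - N T) x \<partial>M)"
  proof (intro nn_integral_mono)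
    fix x assume x: "x \<in> space M"
    have "x \<in> E \<longleftrightarrow> x \<notin> N T \<or> W T x \<ge> l"
    proof -
      have "(\<exists>t\<le>T. W t x \<ge> l) \<longleftrightarrow> (\<exists>t<T. W t x \<ge> l) \<or> W T x \<ge> l"
        by (metis le_eq_less_or_eq)
      then show ?thesis using x by (simp add: E_def N_def not_less)
    qed
    then show "ennreal l * indicator E x
        \<le> ennreal (W T x) * indicator (N T) x + ennreal l * indicator (space M - N T) x"
      using x by (cases "x \<in> N T"; cases "W T x \<ge> l") (simp_all add: ennreal_leI)
  qed
  also have "\<dots> = (\<integral>\<^sup>+x. ennreal (W T x) * indicator (N T) x \<partial>M) + ennreal l * emeasure M (space M - N T)"
    by (subst nn_integral_add) (simp_all add: nn_integral_cmult_indicator)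
  also have "\<dots> \<le> 1" by (rule claim)
  finally have "ennreal (l * prob E) \<le> 1"
    using l by (simp add: emeasure_eq_measure ennreal_mult')
  then have "l * prob E \<le> 1" using ennreal_le_1 by blast
  then show ?thesis using l unfolding E_def[symmetric] by (simp add: field_simps)
qed

section \<open>Independence of coordinates that have not influenced a decision\<close>

section \<open>Adaptively chosen copies\<close>

text \<open>An event that ignores coordinate \<open>c\<close> is independent of it: split the
  product measure at \<open>c\<close> and integrate over that coordinate in the inner
  integral.\<close>

lemma emeasure_fresh_coordinate:
  assumes J: "finite J" "c \<in> J" and M: "\<And>i. i \<in> J \<Longrightarrow> prob_space (M i)"
    and A: "A \<in> sets (PiM J M)" and inv: "\<And>z y. z \<in> space (PiM J M) \<Longrightarrow> y \<in> space (M c) \<Longrightarrow> z(c := y) \<in> A \<longleftrightarrow> z \<in> A"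
    and B: "B \<in> sets (M c)"
  shows "emeasure (PiM J M) {z \<in> A. z c \<in> B} = emeasure (PiM J M) A * emeasure (M c) B"
proof -
  \<comment> \<open>\<open>product_prob_space\<close> asks for a probability measure at every index,
    so indices outside \<open>J\<close> get a point mass; the product over \<open>J\<close> stays
    the same.\<close>
  define M' where "M' i = (if i \<in> J then M i else return (count_space UNIV) undefined)" for i
  interpret M': product_prob_space M'
    by (rule product_prob_spaceI) (auto simp: M'_def intro!: M prob_space_return)
  have eqM: "PiM J M = PiM J M'" by (intro PiM_cong) (auto simp: M'_def)
  define I where "I = J - {c}"
  have I: "finite I" "c \<notin> I" "insert c I = J" using J by (auto simp: I_def)
  have Mc: "M' c = M c" using J by (simp add: M'_def)
  have A': "A \<in> sets (PiM (insert c I) M')" using A eqM I by simp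
  interpret c: prob_space "M c" using M J by auto
  have key: "emeasure (PiM J M) {z \<in> A. z c \<in> B'} = (\<integral>\<^sup>+x. (\<integral>\<^sup>+y. indicator A (x(c := y)) * indicator B' y \<partial>M c) \<partial>PiM I M')"
    if B': "B' \<in> sets (M c)" for B'
  proof -
    have "{z \<in> A. z c \<in> B'} = A \<inter> ((\<lambda>z. z c) -` B' \<inter> space (PiM (insert c I) M'))"
      using sets.sets_into_space[OF A'] by auto
    also have "\<dots> \<in> sets (PiM (insert c I) M')"
      using B' Mc by (intro sets.Int A' measurable_sets[of _ _ "M' c"] measurable_component_singleton) auto
    finally have m: "{z \<in> A. z c \<in> B'} \<in> sets (PiM (insert c I) M')" .
    have "emeasure (PiM J M) {z \<in> A. z c \<in> B'} = (\<integral>\<^sup>+z. indicator {z \<in> A. z c \<in> B'} z \<partial>PiM (insert c I) M')"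
      using m I eqM by simp
    also have "\<dots> = (\<integral>\<^sup>+x. (\<integral>\<^sup>+y. indicator {z \<in> A. z c \<in> B'} (x(c := y)) \<partial>M' c) \<partial>PiM I M')"
      using m I by (intro M'.product_nn_integral_insert) auto
    also have "\<dots> = (\<integral>\<^sup>+x. (\<integral>\<^sup>+y. indicator A (x(c := y)) * indicator B' y \<partial>M c) \<partial>PiM I M')"
      unfolding Mc by (intro nn_integral_cong) (auto simp: indicator_def)
    finally show ?thesis .
  qed
  \<comment> \<open>By invariance, membership in \<open>A\<close> can be tested with coordinate
    \<open>c\<close> frozen at any one value.\<close>
  obtain y0 where y0: "y0 \<in> space (M c)" using c.not_empty by auto
  have const: "(\<integral>\<^sup>+y. indicator A (x(c := y)) * indicator B' y \<partial>M c) = indicator A (x(c := y0)) * emeasure (M c) B'"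
    if x: "x \<in> space (PiM I M')" and B': "B' \<in> sets (M c)" for x B'
  proof -
    have "x(c := y0) \<in> space (PiM J M)"
      using x y0 Mc I(3) unfolding eqM by (auto simp: space_PiM PiE_def extensional_def Pi_def)
    from inv[OF this] have "x(c := y) \<in> A \<longleftrightarrow> x(c := y0) \<in> A" if "y \<in> space (M c)" for y using that by simp
    then have "(\<integral>\<^sup>+y. indicator A (x(c := y)) * indicator B' y \<partial>M c)
        = (\<integral>\<^sup>+y. indicator A (x(c := y0)) * indicator B' y \<partial>M c)"
      by (intro nn_integral_cong) (auto simp: indicator_def)
    also have "\<dots> = indicator A (x(c := y0)) * emeasure (M c) B'"
      using B' by (simp add: nn_integral_cmult_indicator)
    finally show ?thesis .
  qed
  have "{z \<in> A. z c \<in> space (M c)} = A"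
    using sets.sets_into_space[OF A] J by (auto simp: space_PiM)
  then have A_eq: "emeasure (PiM J M) A = (\<integral>\<^sup>+x. indicator A (x(c := y0)) \<partial>PiM I M')"
    using key[OF sets.top] const[OF _ sets.top]
    by (simp add: c.emeasure_space_1 cong: nn_integral_cong)
  have meas: "(\<lambda>x. indicator A (x(c := y0)) :: ennreal) \<in> borel_measurable (PiM I M')"
    using A' y0 Mc
    by (intro measurable_compose[OF _ borel_measurable_indicator[OF A']] measurable_fun_upd[where J = I]) auto
  show ?thesis
    using key[OF B] const[OF _ B] A_eq meas by (simp add: nn_integral_multc cong: nn_integral_cong)
qed

lemma emeasure_fresh_coordinates:
  assumes J: "finite J" "J' \<subseteq> J" and M: "\<And>i. i \<in> J \<Longrightarrow> prob_space (M i)"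
    and A: "A \<in> sets (PiM J M)"
    and inv: "\<And>z y c. c \<in> J' \<Longrightarrow> z \<in> space (PiM J M) \<Longrightarrow> y \<in> space (M c) \<Longrightarrow> z(c := y) \<in> A \<longleftrightarrow> z \<in> A"
    and B: "\<And>c. c \<in> J' \<Longrightarrow> B c \<in> sets (M c)" "\<And>c. c \<in> J' \<Longrightarrow> emeasure (M c) (B c) \<le> \<epsilon>"
  shows "{z \<in> A. \<forall>c\<in>J'. z c \<in> B c} \<in> sets (PiM J M)"
    "emeasure (PiM J M) {z \<in> A. \<forall>c\<in>J'. z c \<in> B c} \<le> emeasure (PiM J M) A * \<epsilon> ^ card J'"
proof -
  have fin: "finite J'" using J finite_subset by auto
  have "{z \<in> A. \<forall>c\<in>J'. z c \<in> B c} \<in> sets (PiM J M) \<and>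
    emeasure (PiM J M) {z \<in> A. \<forall>c\<in>J'. z c \<in> B c} \<le> emeasure (PiM J M) A * \<epsilon> ^ card J'"
    using fin J(2) inv B
  proof (induction J' rule: finite_induct)
    case empty then show ?case using A by simp
  next
    case (insert c J')
    let ?A = "{z \<in> A. \<forall>c\<in>J'. z c \<in> B c}"
    have IH: "?A \<in> sets (PiM J M)" "emeasure (PiM J M) ?A \<le> emeasure (PiM J M) A * \<epsilon> ^ card J'"
      using insert by auto
    have c: "c \<in> J" using insert by auto
    have eq: "{z \<in> A. \<forall>c\<in>insert c J'. z c \<in> B c} = {z \<in> ?A. z c \<in> B c}" by auto
    have "{z \<in> ?A. z c \<in> B c} = ?A \<inter> ((\<lambda>z. z c) -` B c \<inter> space (PiM J M))"
      using sets.sets_into_space[OF A] by auto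
    also have "\<dots> \<in> sets (PiM J M)"
      using insert.prems(3)[of c] c by (intro sets.Int IH measurable_sets[of _ _ "M c"] measurable_component_singleton) auto
    finally have 1: "{z \<in> ?A. z c \<in> B c} \<in> sets (PiM J M)" .
    have "emeasure (PiM J M) {z \<in> ?A. z c \<in> B c} = emeasure (PiM J M) ?A * emeasure (M c) (B c)"
    proof (rule emeasure_fresh_coordinate[OF J(1) c M IH(1)])
      fix z y assume "z \<in> space (PiM J M)" "y \<in> space (M c)"
      then have "z(c := y) \<in> A \<longleftrightarrow> z \<in> A" by (rule insert.prems(2)[OF insertI1])
      moreover have "(z(c := y)) c' = z c'" if "c' \<in> J'" for c' using insert.hyps(2) that by auto
      ultimately show "(z(c := y) \<in> ?A) = (z \<in> ?A)" unfolding mem_Collect_eq by metis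
    qed (use insert.prems in auto)
    also have "\<dots> \<le> (emeasure (PiM J M) A * \<epsilon> ^ card J') * \<epsilon>"
      using insert.prems(4)[of c] by (intro mult_mono IH) auto
    finally show ?case using 1 insert.hyps unfolding eq by (simp add: mult_ac)
  qed
  then show "{z \<in> A. \<forall>c\<in>J'. z c \<in> B c} \<in> sets (PiM J M)"
    "emeasure (PiM J M) {z \<in> A. \<forall>c\<in>J'. z c \<in> B c} \<le> emeasure (PiM J M) A * \<epsilon> ^ card J'" by auto
qed

text \<open>\<open>D\<close> is the decision taken so far, and \<open>J' v\<close> are coordinates
  without influence on whether the decision is \<open>v\<close>. On the event D = v they still have
  their original law, so failure has probability at most \<open>\<epsilon> ^ m\<close> times that of
  D = v; summing over the countably many decisions gives the bound.\<close>

lemma emeasure_adaptive_failure_le: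
  fixes D :: "('i \<Rightarrow> 's) \<Rightarrow> 'd"
  assumes J: "finite J" and M: "\<And>i. i \<in> J \<Longrightarrow> prob_space (M i)"
    and D: "D \<in> measurable (PiM J M) (count_space UNIV)" "countable (D ` space (PiM J M))"
    and Jv: "\<And>v. J' v \<subseteq> J" "\<And>z. z \<in> space (PiM J M) \<Longrightarrow> card (J' (D z)) \<ge> m"
    and inv: "\<And>z y c v. c \<in> J' v \<Longrightarrow> z \<in> space (PiM J M) \<Longrightarrow> y \<in> space (M c) \<Longrightarrow> D (z(c := y)) = v \<longleftrightarrow> D z = v"
    and B: "\<And>c v. c \<in> J' v \<Longrightarrow> B v c \<in> sets (M c)" "\<And>c v. c \<in> J' v \<Longrightarrow> emeasure (M c) (B v c) \<le> \<epsilon>"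
    and \<epsilon>: "\<epsilon> \<le> 1"
  shows "{z \<in> space (PiM J M). \<forall>c\<in>J' (D z). z c \<in> B (D z) c} \<in> sets (PiM J M)"
    "emeasure (PiM J M) {z \<in> space (PiM J M). \<forall>c\<in>J' (D z). z c \<in> B (D z) c} \<le> \<epsilon> ^ m"
proof -
  let ?P = "PiM J M" and ?V = "D ` space (PiM J M)"
  let ?A = "\<lambda>v. D -` {v} \<inter> space ?P"
  interpret P: prob_space ?P using M by (rule prob_space_PiM)
  have A: "?A v \<in> sets ?P" for v using measurable_sets[OF D(1)] by auto
  have inv': "z(c := y) \<in> ?A v \<longleftrightarrow> z \<in> ?A v" if "c \<in> J' v" "z \<in> space ?P" "y \<in> space (M c)" for z c y v
  proof -
    have "c \<in> J" using that Jv(1) by auto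
    then have "z(c := y) \<in> space ?P" using that by (auto simp: space_PiM PiE_def extensional_def Pi_def)
    then show ?thesis using inv[OF that(1,2,3)] that by auto
  qed
  let ?F = "\<lambda>v. {z \<in> ?A v. \<forall>c\<in>J' v. z c \<in> B v c}"
  have F1: "?F v \<in> sets ?P" for v
    by (rule emeasure_fresh_coordinates(1)[OF J Jv(1) M A inv' B]) assumption+
  have F2: "emeasure ?P (?F v) \<le> emeasure ?P (?A v) * \<epsilon> ^ card (J' v)" for v
    by (rule emeasure_fresh_coordinates(2)[OF J Jv(1) M A inv' B]) assumption+
  have eq: "{z \<in> space ?P. \<forall>c\<in>J' (D z). z c \<in> B (D z) c} = (\<Union>v\<in>?V. ?F v)" by auto
  show "{z \<in> space ?P. \<forall>c\<in>J' (D z). z c \<in> B (D z) c} \<in> sets ?P"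
    unfolding eq using D(2) F1 by (intro sets.countable_UN'') auto
  have "emeasure ?P (\<Union>v\<in>?V. ?F v) = (\<integral>\<^sup>+v. emeasure ?P (?F v) \<partial>count_space ?V)"
    using D(2) F1 by (intro emeasure_UN_countable) (auto simp: disjoint_family_on_def)
  also have "\<dots> \<le> (\<integral>\<^sup>+v. emeasure ?P (?A v) * \<epsilon> ^ m \<partial>count_space ?V)"
  proof (intro nn_integral_mono)
    fix v assume "v \<in> space (count_space ?V)"
    then have "m \<le> card (J' v)" using Jv(2) by auto
    then have "\<epsilon> ^ card (J' v) \<le> \<epsilon> ^ m" using \<epsilon> by (intro power_decreasing) auto
    then show "emeasure ?P (?F v) \<le> emeasure ?P (?A v) * \<epsilon> ^ m"
      using F2[of v] by (meson mult_left_mono order_trans zero_le)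
  qed
  also have "\<dots> = (\<integral>\<^sup>+v. emeasure ?P (?A v) \<partial>count_space ?V) * \<epsilon> ^ m"
    by (rule nn_integral_multc) simp
  also have "(\<integral>\<^sup>+v. emeasure ?P (?A v) \<partial>count_space ?V) = emeasure ?P (\<Union>v\<in>?V. ?A v)"
    using D(2) A by (intro emeasure_UN_countable[symmetric]) (auto simp: disjoint_family_on_def)
  also have "(\<Union>v\<in>?V. ?A v) = space ?P" by auto
  finally show "emeasure ?P {z \<in> space ?P. \<forall>c\<in>J' (D z). z c \<in> B (D z) c} \<le> \<epsilon> ^ m"
    unfolding eq by (simp add: P.emeasure_space_1)
qed

section \<open>Random arm sets and states, described by countable codes and real keys\<close>

section \<open>Measurability of the data structures\<close>

text \<open>\<open>H\<close> is constant on the level sets of \<open>D\<close>, so every preimage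
  under \<open>H\<close> is a countable union of such sets. The target may carry the full power set
  even if its type is uncountable.\<close>

lemma measurable_discrete_factor:
  fixes D :: "'a \<Rightarrow> 'd::countable"
  assumes D: "D \<in> measurable M (count_space UNIV)"
    and eq: "\<And>x y. x \<in> space M \<Longrightarrow> y \<in> space M \<Longrightarrow> D x = D y \<Longrightarrow> H x = H y"
  shows "H \<in> measurable M (count_space UNIV)"
proof -
  have "H -` Y \<inter> space M = (\<Union>v\<in>{v. \<exists>x\<in>space M. D x = v \<and> H x \<in> Y}. D -` {v} \<inter> space M)" for Y
  proof (intro equalityI subsetI)
    fix z assume "z \<in> (\<Union>v\<in>{v. \<exists>x\<in>space M. D x = v \<and> H x \<in> Y}. D -` {v} \<inter> space M)"
    then obtain x where x: "x \<in> space M" "D x = D z" "H x \<in> Y" and z: "z \<in> space M" by auto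
    show "z \<in> H -` Y \<inter> space M" using eq[OF x(1) z x(2)] x z by simp
  qed blast
  moreover have "(\<Union>v\<in>{v. \<exists>x\<in>space M. D x = v \<and> H x \<in> Y}. D -` {v} \<inter> space M) \<in> sets M" for Y
    using measurable_sets[OF D] by (intro sets.countable_UN'') auto
  ultimately show ?thesis by (auto simp: measurable_def)
qed

lemma measurable_split_discrete:
  fixes D :: "'a \<Rightarrow> 'd::countable"
  assumes D: "D \<in> measurable M (count_space UNIV)"
    and g: "\<And>v. v \<in> D ` space M \<Longrightarrow> g v \<in> measurable M N"
    and F: "\<And>x. x \<in> space M \<Longrightarrow> F x = g (D x) x"
  shows "F \<in> measurable M N"
proof (cases "space M = {}")
  case True
  then show ?thesis by (simp add: measurable_def)
next
  case False
  then obtain x0 where x0: "x0 \<in> space M" by auto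
  define g' where "g' v = (if v \<in> D ` space M then g v else g (D x0))" for v
  have "g' v \<in> measurable M N" for v using g x0 by (auto simp: g'_def)
  then have "(\<lambda>x. g' (D x) x) \<in> measurable M N"
    by (rule measurable_compose_countable[OF _ D])
  then show ?thesis using F by (subst measurable_cong[of _ _ "\<lambda>x. g' (D x) x"]) (auto simp: g'_def)
qed

lemma measurable_map_discrete:
  fixes f :: "'b \<Rightarrow> 'a \<Rightarrow> 'c::countable"
  assumes "\<And>s. s \<in> set ls \<Longrightarrow> f s \<in> measurable M (count_space UNIV)"
  shows "(\<lambda>x. map (\<lambda>s. f s x) ls) \<in> measurable M (count_space UNIV)"
  using assms
proof (induction ls)
  case (Cons s ls)
  then have "(\<lambda>x. (f s x, map (\<lambda>s. f s x) ls)) \<in> measurable M (count_space UNIV \<Otimes>\<^sub>M count_space UNIV)"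
    by (intro measurable_Pair) auto
  then have "(\<lambda>x. (f s x, map (\<lambda>s. f s x) ls)) \<in> measurable M (count_space UNIV)"
    by (subst (asm) pair_measure_countable) auto
  then show ?case by (rule measurable_discrete_factor) auto
qed auto

lemma measurable_Pair_discrete:
  fixes f :: "'a \<Rightarrow> 'c::countable" and g :: "'a \<Rightarrow> 'd::countable"
  assumes "f \<in> measurable M (count_space UNIV)" "g \<in> measurable M (count_space UNIV)"
  shows "(\<lambda>x. (f x, g x)) \<in> measurable M (count_space UNIV)"
proof -
  have "(\<lambda>x. (f x, g x)) \<in> measurable M (count_space UNIV \<Otimes>\<^sub>M count_space UNIV)"
    by (intro measurable_Pair assms)
  then show ?thesis by (subst (asm) pair_measure_countable) auto
qed

text \<open>Dropping the vector makes updates countable. Nothing is lost, because the vector of an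
  inserted arm is determined by its label (\<open>good_set\<close>).\<close>

fun update_code :: "update \<Rightarrow> nat + nat" where
  "update_code (Insert a p) = Inl a"
| "update_code (Delete a) = Inr a"

definition codes :: "arm_set \<Rightarrow> (nat + nat) list" where
  "codes \<Psi> = map update_code (updates \<Psi>)"

text \<open>Absent arms get key 0, so that the key of each arm is a total real function and
  measurability can be stated arm by arm.\<close>

definition key_of :: "arm_set \<Rightarrow> nat \<Rightarrow> real" where
  "key_of \<Psi> a = (case heap \<Psi> a of None \<Rightarrow> 0 | Some k \<Rightarrow> k)"

text \<open>Heap and MIPS structure hold the same arms, and every stored vector is the one belonging
  to its label. Hence \<open>codes\<close> recovers both the updates and the stored arms.\<close>

definition good_set :: "(nat \<Rightarrow> real vec) \<Rightarrow> nat set \<Rightarrow> arm_set \<Rightarrow> bool" where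
  "good_set pt A \<Psi> \<longleftrightarrow> (\<forall>u\<in>set (updates \<Psi>). \<exists>a\<in>A. u = Insert a (pt a) \<or> u = Delete a) \<and>
     content (updates \<Psi>) = (\<lambda>a. if a \<in> arms_of \<Psi> then Some (pt a) else None) \<and> arms_of \<Psi> \<subseteq> A"

lemma good_set_codes_eq:
  assumes "good_set pt A \<Psi>" "good_set pt A \<Psi>'" "codes \<Psi> = codes \<Psi>'"
  shows "updates \<Psi> = updates \<Psi>'" "arms_of \<Psi> = arms_of \<Psi>'"
proof -
  have "us = us'"
    if "map update_code us = map update_code us'"
      "\<forall>u\<in>set us. \<exists>a\<in>A. u = Insert a (pt a) \<or> u = Delete a"
      "\<forall>u\<in>set us'. \<exists>a\<in>A. u = Insert a (pt a) \<or> u = Delete a" for us us'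
    using that
  proof (induction us arbitrary: us')
    case (Cons u us)
    then obtain v vs where us': "us' = v # vs" "update_code v = update_code u" "map update_code us = map update_code vs"
      by (cases us') auto
    obtain a where a: "a \<in> A" "u = Insert a (pt a) \<or> u = Delete a" using Cons.prems(2) by auto
    obtain b where b: "b \<in> A" "v = Insert b (pt b) \<or> v = Delete b" using Cons.prems(3) us' by auto
    have "u = v" using a b us'(2) by (elim disjE) simp_all
    moreover have "us = vs" using Cons.prems us' by (intro Cons.IH) simp_all
    ultimately show ?case using us' by simp
  qed simp
  then show *: "updates \<Psi> = updates \<Psi>'" using assms unfolding good_set_def codes_def by blast
  have "arms_of \<Psi> = dom (content (updates \<Psi>))" if "good_set pt A \<Psi>" for \<Psi>
    using that by (auto simp: good_set_def split: if_splits)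
  then show "arms_of \<Psi> = arms_of \<Psi>'" using * assms by simp
qed

lemma content_snoc: "content (us @ [u]) = apply_update u (content us)"
  by (simp add: content_def)

lemma good_set_empty: "good_set pt A \<lparr>heap = Map.empty, updates = []\<rparr>"
  by (auto simp: good_set_def arms_of_def content_def)

lemma good_set_add:
  assumes "good_set pt A \<Psi>" "a \<in> A" "pt a = vectorize ((1 / real (dim_vec x)) \<cdot>\<^sub>m outer x)"
  shows "good_set pt A (psi_add x a \<theta> s \<Psi>)"
  using assms by (auto simp: good_set_def psi_add_def arms_of_def content_snoc fun_eq_iff)

lemma good_set_remove:
  assumes "good_set pt A \<Psi>" "a \<in> A"
  shows "good_set pt A (psi_remove a \<Psi>)"
  using assms by (auto simp: good_set_def psi_remove_def arms_of_def content_snoc fun_eq_iff)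

lemma fold_psi_remove:
  "heap (fold psi_remove xs \<Psi>) = (\<lambda>a. if a \<in> set xs then None else heap \<Psi> a)"
  "updates (fold psi_remove xs \<Psi>) = updates \<Psi> @ map Delete xs"
  by (induction xs arbitrary: \<Psi>) (auto simp: psi_remove_def fun_eq_iff)

lemma psi_eliminate_heap:
  assumes "finite (arms_of \<Psi>)"
  shows "heap (psi_eliminate r \<Psi>) = (\<lambda>a. case heap \<Psi> a of None \<Rightarrow> None
     | Some k \<Rightarrow> if ereal k < r then None else Some k)"
  using assms
  by (auto simp: psi_eliminate_def fold_psi_remove arms_of_def fun_eq_iff dom_def split: option.splits)

text \<open>Measurability of a random arm set, split into its discrete part and its real keys;
  \<open>arm_set\<close> itself is given no sigma-algebra.\<close>

definition mset_fun :: "'e measure \<Rightarrow> (nat \<Rightarrow> real vec) \<Rightarrow> nat set \<Rightarrow> ('e \<Rightarrow> arm_set) \<Rightarrow> bool" where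
  "mset_fun M pt A F \<longleftrightarrow> (\<forall>x\<in>space M. good_set pt A (F x)) \<and>
     (\<lambda>x. codes (F x)) \<in> measurable M (count_space UNIV) \<and>
     (\<forall>a. (\<lambda>x. key_of (F x) a) \<in> borel_measurable M)"

lemma mset_fun_split:
  fixes D :: "'e \<Rightarrow> 'd::countable"
  assumes D: "D \<in> measurable M (count_space UNIV)"
    and g: "\<And>v. v \<in> D ` space M \<Longrightarrow> mset_fun M pt A (g v)"
    and F: "\<And>x. x \<in> space M \<Longrightarrow> F x = g (D x) x"
  shows "mset_fun M pt A F"
  unfolding mset_fun_def
proof (intro conjI ballI allI)
  show "good_set pt A (F x)" if "x \<in> space M" for x
    using that g F by (auto simp: mset_fun_def)
  show "(\<lambda>x. codes (F x)) \<in> measurable M (count_space UNIV)"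
    by (rule measurable_split_discrete[OF D, of "\<lambda>v x. codes (g v x)"])
       (use g F in \<open>auto simp: mset_fun_def\<close>)
  show "(\<lambda>x. key_of (F x) a) \<in> borel_measurable M" for a
    by (rule measurable_split_discrete[OF D, of "\<lambda>v x. key_of (g v x) a"])
       (use g F in \<open>auto simp: mset_fun_def\<close>)
qed

lemma codes_add: "codes (psi_add x a \<theta> s \<Psi>) = codes \<Psi> @ [Inl a]"
  by (simp add: codes_def psi_add_def)

lemma codes_fold_remove: "codes (fold psi_remove xs \<Psi>) = codes \<Psi> @ map Inr xs"
  by (simp add: codes_def fold_psi_remove)

lemma mset_fun_const: "good_set pt A \<Psi> \<Longrightarrow> mset_fun M pt A (\<lambda>_. \<Psi>)"
  by (simp add: mset_fun_def)

lemma mset_fun_add: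
  assumes F: "mset_fun M pt A F" and a: "a \<in> A" "pt a = vectorize ((1 / real (dim_vec x)) \<cdot>\<^sub>m outer x)"
    and \<theta>: "(\<lambda>e. scalar_prod x (\<theta> e)) \<in> borel_measurable M"
  shows "mset_fun M pt A (\<lambda>e. psi_add x a (\<theta> e) s (F e))"
  unfolding mset_fun_def
proof (intro conjI ballI allI)
  show "good_set pt A (psi_add x a (\<theta> e) s (F e))" if "e \<in> space M" for e
    using F a that by (intro good_set_add) (simp_all add: mset_fun_def)
  show "(\<lambda>e. codes (psi_add x a (\<theta> e) s (F e))) \<in> measurable M (count_space UNIV)"
    by (rule measurable_discrete_factor[of "\<lambda>e. codes (F e)"])
       (use F in \<open>simp_all only: mset_fun_def codes_add\<close>)
  fix b
  have "(\<lambda>e. key_of (psi_add x a (\<theta> e) s (F e)) b)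
      = (\<lambda>e. if b = a then scalar_prod x (\<theta> e) + 2 powr (- of_int s) else key_of (F e) b)"
    by (rule ext) (simp add: key_of_def psi_add_def)
  also have "\<dots> \<in> borel_measurable M" using F \<theta> by (cases "b = a") (simp_all add: mset_fun_def)
  finally show "(\<lambda>e. key_of (psi_add x a (\<theta> e) s (F e)) b) \<in> borel_measurable M" .
qed

lemma mset_fun_fold_remove:
  assumes F: "mset_fun M pt A F" and xs: "set xs \<subseteq> A"
  shows "mset_fun M pt A (\<lambda>e. fold psi_remove xs (F e))"
  unfolding mset_fun_def
proof (intro conjI ballI allI)
  have "good_set pt A (fold psi_remove xs \<Psi>)" if "good_set pt A \<Psi>" for \<Psi>
    using that xs by (induction xs arbitrary: \<Psi>) (auto simp: good_set_remove)
  then show "good_set pt A (fold psi_remove xs (F e))" if "e \<in> space M" for e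
    using F that by (auto simp: mset_fun_def)
  show "(\<lambda>e. codes (fold psi_remove xs (F e))) \<in> measurable M (count_space UNIV)"
    by (rule measurable_discrete_factor[of "\<lambda>e. codes (F e)"])
       (use F in \<open>simp_all only: mset_fun_def codes_fold_remove\<close>)
  fix b
  have "(\<lambda>e. key_of (fold psi_remove xs (F e)) b) = (\<lambda>e. if b \<in> set xs then 0 else key_of (F e) b)"
    by (rule ext) (simp add: key_of_def fold_psi_remove)
  also have "\<dots> \<in> borel_measurable M" using F by (cases "b \<in> set xs") (simp_all add: mset_fun_def)
  finally show "(\<lambda>e. key_of (fold psi_remove xs (F e)) b) \<in> borel_measurable M" .
qed

lemma mset_fun_remove:
  assumes F: "mset_fun M pt A F" and a: "a \<in> A"
  shows "mset_fun M pt A (\<lambda>e. psi_remove a (F e))"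
  using mset_fun_fold_remove[OF F, of "[a]"] a by simp

text \<open>Sorting looks only at comparisons of keys, so the order in which a heap is emptied is a
  discrete quantity although its keys are real.\<close>

lemma sort_key_cong_order:
  assumes "\<And>a b. a \<in> set xs \<Longrightarrow> b \<in> set xs \<Longrightarrow> (f a \<le> f b) = (g a \<le> (g b :: real))"
  shows "sort_key f xs = sort_key (g :: _ \<Rightarrow> real) xs"
proof -
  have ins: "insort_key f x ys = insort_key g x ys"
    if "\<And>b. b \<in> set ys \<Longrightarrow> (f x \<le> f b) = (g x \<le> g b)" for x ys
    using that by (induction ys) auto
  show ?thesis using assms
  proof (induction xs)
    case (Cons x xs)
    then have "sort_key f xs = sort_key g xs" by simp
    moreover have "insort_key f x (sort_key g xs) = insort_key g x (sort_key g xs)"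
      using Cons.prems by (intro ins) auto
    ultimately show ?case by (simp add: sort_key_def)
  qed simp
qed

lemma measurable_discrete_pred:
  "{x \<in> space M. P x} \<in> sets M \<Longrightarrow> P \<in> measurable M (count_space UNIV)"
  by (simp add: pred_def)

text \<open>The list of popped arms is determined by the codes and by finitely many comparisons, of
  keys with the bound and with each other. On each value of this list, elimination is a fixed
  sequence of removals.\<close>

lemma mset_fun_eliminate:
  assumes F: "mset_fun M pt A F" and A: "finite A" and r: "r \<in> borel_measurable M"
  shows "mset_fun M pt A (\<lambda>e. psi_eliminate (r e) (F e))"
proof -
  define As where "As = sorted_list_of_set A"
  have As: "set As = A" using A by (simp add: As_def)
  have key [measurable]: "(\<lambda>e. key_of (F e) a) \<in> borel_measurable M" for a
    using F by (simp add: mset_fun_def)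
  note r [measurable]
  define D1 where "D1 e = map (\<lambda>a. ereal (key_of (F e) a) < r e) As" for e
  define D2 where "D2 e = map (\<lambda>(a, b). key_of (F e) a \<le> key_of (F e) b) (List.product As As)" for e
  define D where "D e = (codes (F e), D1 e, D2 e)" for e
  have "D1 \<in> measurable M (count_space UNIV)" unfolding D1_def
    by (intro measurable_map_discrete measurable_discrete_pred) measurable
  moreover have "D2 \<in> measurable M (count_space UNIV)" unfolding D2_def case_prod_beta
    by (intro measurable_map_discrete measurable_discrete_pred) measurable
  ultimately have D: "D \<in> measurable M (count_space UNIV)"
    unfolding D_def using F by (intro measurable_Pair_discrete) (auto simp: mset_fun_def)
  define l where "l e = sort_key (\<lambda>a. the (heap (F e) a))
      (sorted_list_of_set {a \<in> arms_of (F e). ereal (the (heap (F e) a)) < r e})" for e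
  have good: "good_set pt A (F e)" if "e \<in> space M" for e using F that by (auto simp: mset_fun_def)
  have fin: "finite (arms_of (F e))" if "e \<in> space M" for e
    using good[OF that] A finite_subset by (auto simp: good_set_def)
  have keyeq: "the (heap (F e) a) = key_of (F e) a" if "a \<in> arms_of (F e)" for e a
    using that by (auto simp: key_of_def arms_of_def)
  have l_eq: "l e = sort_key (key_of (F e)) (sorted_list_of_set {a \<in> arms_of (F e). ereal (key_of (F e) a) < r e})"
    if "e \<in> space M" for e
  proof -
    have "{a \<in> arms_of (F e). ereal (the (heap (F e) a)) < r e}
        = {a \<in> arms_of (F e). ereal (key_of (F e) a) < r e}" using keyeq by auto
    then show ?thesis unfolding l_def using keyeq fin[OF that] by (auto intro!: sort_key_cong_order)
  qed
  have lD: "l \<in> measurable M (count_space UNIV)"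
  proof (rule measurable_discrete_factor[OF D])
    fix x y assume x: "x \<in> space M" and y: "y \<in> space M" and eq: "D x = D y"
    have arms: "arms_of (F x) = arms_of (F y)"
      using good_set_codes_eq(2)[OF good[OF x] good[OF y]] eq by (simp add: D_def)
    have lt: "(ereal (key_of (F x) a) < r x) = (ereal (key_of (F y) a) < r y)" if "a \<in> A" for a
      using eq that As by (auto simp: D_def D1_def)
    have le: "(key_of (F x) a \<le> key_of (F x) b) = (key_of (F y) a \<le> key_of (F y) b)" if "a \<in> A" "b \<in> A" for a b
      using eq that As by (auto simp: D_def D2_def)
    have sub: "arms_of (F y) \<subseteq> A" using good[OF y] by (auto simp: good_set_def)
    have "{a \<in> arms_of (F x). ereal (key_of (F x) a) < r x} = {a \<in> arms_of (F y). ereal (key_of (F y) a) < r y}"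
      using arms lt sub by auto
    then have "l x = sort_key (key_of (F x)) (sorted_list_of_set {a \<in> arms_of (F y). ereal (key_of (F y) a) < r y})"
      unfolding l_eq[OF x] by simp
    also have "\<dots> = l y" unfolding l_eq[OF y]
      by (rule sort_key_cong_order, rule le) (use sub fin[OF y] in auto)
    finally show "l x = l y" .
  qed
  show ?thesis
  proof (rule mset_fun_split[OF lD, of _ _ "\<lambda>v e. fold psi_remove v (F e)"])
    fix v assume "v \<in> l ` space M"
    then obtain x where x: "x \<in> space M" "v = l x" by auto
    have "set v \<subseteq> arms_of (F x)" unfolding x(2) l_def using fin[OF x(1)] by auto
    then show "mset_fun M pt A (\<lambda>e. fold psi_remove v (F e))"
      using good[OF x(1)] by (intro mset_fun_fold_remove[OF F]) (auto simp: good_set_def)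
  next
    show "psi_eliminate (r x) (F x) = fold psi_remove (l x) (F x)" for x
      by (simp only: psi_eliminate_def l_def)
  qed
qed

text \<open>The list of levels is common to all outcomes, so that finitely many codes describe where
  arms are stored.\<close>

definition mstate :: "'e measure \<Rightarrow> (nat \<Rightarrow> real vec) \<Rightarrow> nat set \<Rightarrow> ('e \<Rightarrow> state) \<Rightarrow> bool" where
  "mstate M pt A f \<longleftrightarrow> (\<forall>s. mset_fun M pt A (\<lambda>x. psi (f x) s)) \<and>
     (\<exists>ls. \<forall>x\<in>space M. \<forall>s. s \<notin> set ls \<longrightarrow> arms_of (psi (f x) s) = {}) \<and>
     (\<lambda>x. lower (f x)) \<in> borel_measurable M"

definition arm_view :: "int list \<Rightarrow> state \<Rightarrow> (nat + nat) list list" where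
  "arm_view ls st = map (\<lambda>s. codes (psi st s)) ls"

lemma mstate_arm_view:
  assumes "mstate M pt A f"
  shows "(\<lambda>x. arm_view ls (f x)) \<in> measurable M (count_space UNIV)"
  unfolding arm_view_def using assms
  by (intro measurable_map_discrete) (auto simp: mstate_def mset_fun_def)

lemma arm_view_eqD:
  assumes f: "mstate M pt A f" and ls: "\<And>x s. x \<in> space M \<Longrightarrow> s \<notin> set ls \<Longrightarrow> arms_of (psi (f x) s) = {}"
    and xy: "x \<in> space M" "y \<in> space M" and eq: "arm_view ls (f x) = arm_view ls (f y)"
  shows "arms_of (psi (f x) s) = arms_of (psi (f y) s)"
    "s \<in> set ls \<Longrightarrow> updates (psi (f x) s) = updates (psi (f y) s)"
    "current_level (f x) = current_level (f y)"
proof -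
  have good: "good_set pt A (psi (f x) s)" if "x \<in> space M" for x s
    using f that by (auto simp: mstate_def mset_fun_def)
  have c: "codes (psi (f x) s) = codes (psi (f y) s)" if "s \<in> set ls" for s
    using eq that by (auto simp: arm_view_def)
  have *: "arms_of (psi (f x) s) = arms_of (psi (f y) s)" for s
    using ls[OF xy(1), of s] ls[OF xy(2), of s] c[of s] good_set_codes_eq(2)[OF good[OF xy(1)] good[OF xy(2)]]
    by (cases "s \<in> set ls") auto
  then show "arms_of (psi (f x) s) = arms_of (psi (f y) s)" by simp
  show "current_level (f x) = current_level (f y)" using * by (simp add: current_level_def)
  show "s \<in> set ls \<Longrightarrow> updates (psi (f x) s) = updates (psi (f y) s)"
    using c good_set_codes_eq(1)[OF good[OF xy(1)] good[OF xy(2)]] by auto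
qed

lemma measurable_Max_insert:
  fixes f :: "'a \<Rightarrow> 'e \<Rightarrow> ereal"
  assumes "finite X" "r \<in> borel_measurable M" "\<And>a. a \<in> X \<Longrightarrow> f a \<in> borel_measurable M"
  shows "(\<lambda>e. Max (insert (r e) ((\<lambda>a. f a e) ` X))) \<in> borel_measurable M"
  using assms
proof (induction X rule: finite_induct)
  case (insert a X)
  have *: "Max (insert (r e) ((\<lambda>a. f a e) ` insert a X)) = max (f a e) (Max (insert (r e) ((\<lambda>a. f a e) ` X)))" for e
  proof -
    have eq: "insert (r e) ((\<lambda>a. f a e) ` insert a X) = insert (f a e) (insert (r e) ((\<lambda>a. f a e) ` X))"
      unfolding image_insert by (rule insert_commute)
    show ?thesis unfolding eq by (rule Max_insert) (simp_all add: insert.hyps(1))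
  qed
  have "(\<lambda>e. Max (insert (r e) ((\<lambda>a. f a e) ` X))) \<in> borel_measurable M"
    using insert.prems by (intro insert.IH) auto
  then show ?case unfolding * using insert.prems by (intro borel_measurable_max) auto
qed simp

section \<open>The run as a function of answers, coins and environment\<close>

section \<open>The algorithm as a function of the answers\<close>

definition point_of :: "('e, 'z) bandit_scheme \<Rightarrow> nat \<Rightarrow> real vec" where
  "point_of B a = vectorize ((1 / real (dim_vec (feature B a))) \<cdot>\<^sub>m outer (feature B a))"

text \<open>The rewards are recomputed from the arms and the environment, so for fixed arms the
  history is a function of the environment alone.\<close>

definition hist :: "('e, 'z) bandit_scheme \<Rightarrow> 'e \<Rightarrow> nat list \<Rightarrow> (nat \<times> real) list" where
  "hist B e as = map (\<lambda>i. (as ! i, scalar_prod (theta B) (feature B (as ! i)) + noise B (take (Suc i) as) e)) [0..<length as]"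

lemma state_update_select: "psi (st\<lparr>psi := P\<rparr>) = P" "lower (st\<lparr>psi := P\<rparr>) = lower st"
  by (cases st, simp)+

lemma hist_Nil [simp]: "hist B e [] = []"
  by (simp add: hist_def)

lemma hist_snoc:
  "hist B e (as @ [a]) = hist B e as @ [(a, scalar_prod (theta B) (feature B a) + noise B (as @ [a]) e)]"
  by (auto simp: hist_def nth_append intro!: nth_equalityI)

lemma length_hist [simp]: "length (hist B e as) = length as"
  by (simp add: hist_def)

lemma map_fst_hist [simp]: "map fst (hist B e as) = as"
  by (auto simp: hist_def intro!: nth_equalityI)

lemma gram_eq_fold_arms: "gram p B h = fold (\<lambda>a V. V + outer (feature B a)) (map fst h) (1\<^sub>m (dim p))"
  unfolding gram_def fold_map by (rule arg_cong2[where f = "\<lambda>f. fold f h"]) (auto simp: fun_eq_iff)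

lemma gram_hist: "gram p B (hist B e as) = gram p B (hist B e' as)"
  by (simp add: gram_eq_fold_arms)

text \<open>Gram matrices and widths see the arms but not the rewards. For a fixed sequence of arms
  every level index is therefore a constant, and only the estimates are random.\<close>

lemma width_hist: "width p B (hist B e as) a = width p B (hist B e' as) a"
  by (simp add: width_def gram_hist[of p B e as e'])

text \<open>For fixed arms the estimator is linear in the rewards.\<close>

lemma measurable_theta_hat:
  assumes noise: "\<And>as. noise B as \<in> borel_measurable M"
  shows "(\<lambda>e. scalar_prod x (theta_hat p B (hist B e as))) \<in> borel_measurable M"
proof -
  define X where "X = mat_of_rows (dim p) (map (feature B) as)"
  define W where "W = inv_mat (transpose_mat X * X + 1\<^sub>m (dim p))"
  have X: "mat_of_rows (dim p) (map (\<lambda>(a, r). feature B a) (hist B e as)) = X" for e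
  proof -
    have "map (\<lambda>(a, r). feature B a) (hist B e as) = map (feature B) (map fst (hist B e as))"
      unfolding map_map by (rule map_cong) auto
    then show ?thesis by (simp add: X_def)
  qed
  have "scalar_prod x (theta_hat p B (hist B e as))
      = (\<Sum>i<dim_row W. x $ i * (\<Sum>k<dim_row (transpose_mat X). row W i $ k *
          (\<Sum>l<length as. row (transpose_mat X) k $ l * snd (hist B e as ! l))))" for e
    unfolding theta_hat_def Let_def X W_def[symmetric]
    by (simp add: scalar_prod_def atLeast0LessThan vec_of_list_index del: vec_of_list_map)
  moreover have "(\<lambda>e. snd (hist B e as ! l)) \<in> borel_measurable M" if "l < length as" for l
    using that noise by (simp add: hist_def)
  ultimately show ?thesis by (simp only:) (intro borel_measurable_sum borel_measurable_times, auto)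
qed

definition level_list :: "params \<Rightarrow> ('e, 'z) bandit_scheme \<Rightarrow> (nat \<times> real) list \<Rightarrow> nat set \<Rightarrow> int list" where
  "level_list p B h A = map (\<lambda>a. level_of p (width p B h a)) (sorted_list_of_set A)"

lemma level_list_hist: "level_list p B (hist B e as) A = level_list p B (hist B e' as) A"
  by (simp add: level_list_def width_hist[of p B e as _ e'])

definition stored_in :: "int set \<Rightarrow> (int \<Rightarrow> arm_set) \<Rightarrow> bool" where
  "stored_in L \<Psi> \<longleftrightarrow> (\<forall>s. s \<notin> L \<longrightarrow> arms_of (\<Psi> s) = {})"

lemma stored_in_mono: "stored_in L \<Psi> \<Longrightarrow> L \<subseteq> L' \<Longrightarrow> stored_in L' \<Psi>"
  by (auto simp: stored_in_def)

lemma set_level_list: "finite A \<Longrightarrow> set (level_list p B h A) = (\<lambda>a. level_of p (width p B h a)) ` A"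
  by (simp add: level_list_def)

lemma arms_of_put_arm:
  "arms_of (put_arm p B h a \<Psi> s) = (if s = level_of p (width p B h a) then insert a (arms_of (\<Psi> s)) else arms_of (\<Psi> s))"
  by (auto simp: put_arm_def Let_def psi_add_def arms_of_def)

lemma arms_of_psi_remove: "arms_of (psi_remove a \<Psi>) = arms_of \<Psi> - {a}"
  by (auto simp: psi_remove_def arms_of_def)

lemma arms_of_psi_eliminate_subset: "arms_of (psi_eliminate r \<Psi>) \<subseteq> arms_of \<Psi>"
  by (auto simp: psi_eliminate_def arms_of_def fold_psi_remove split: if_splits)

lemma stored_in_fold_put:
  "stored_in L \<Psi> \<Longrightarrow> stored_in (L \<union> (\<lambda>a. level_of p (width p B h a)) ` set xs) (fold (put_arm p B h) xs \<Psi>)"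
proof (induction xs arbitrary: \<Psi> L)
  case (Cons a xs)
  have "stored_in (insert (level_of p (width p B h a)) L) (put_arm p B h a \<Psi>)"
    using Cons.prems by (auto simp: stored_in_def arms_of_put_arm)
  from Cons.IH[OF this] show ?case
    by (simp only: fold_Cons comp_apply list.set image_insert Un_insert_left Un_insert_right)
qed simp

lemma stored_in_fold_move:
  "stored_in L \<Psi> \<Longrightarrow> stored_in (L \<union> (\<lambda>a. level_of p (width p B h a)) ` set xs)
     (fold (\<lambda>a \<Psi>. put_arm p B h a (\<Psi>(s := psi_remove a (\<Psi> s)))) xs \<Psi>)"
proof (induction xs arbitrary: \<Psi> L)
  case (Cons a xs)
  have "stored_in (insert (level_of p (width p B h a)) L) (put_arm p B h a (\<Psi>(s := psi_remove a (\<Psi> s))))"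
    using Cons.prems by (auto simp: stored_in_def arms_of_put_arm arms_of_psi_remove)
  from Cons.IH[OF this] show ?case
    by (simp only: fold_Cons comp_apply list.set image_insert Un_insert_left Un_insert_right)
qed simp

lemma stored_in_raise: "stored_in L (psi st) \<Longrightarrow> stored_in L (psi (raise_and_eliminate p B h A st))"
  using arms_of_psi_eliminate_subset by (fastforce simp: stored_in_def raise_and_eliminate_def Let_def)

text \<open>The finite pool \<open>A\<close> contains every arm that can ever be stored, so each
  elimination involves finitely many keys.\<close>

locale measurable_bandit =
  fixes p :: params and B :: "('e, 'z) bandit_scheme" and M :: "'e measure" and A :: "nat set"
  assumes noise_measurable: "\<And>as. noise B as \<in> borel_measurable M" and finite_A: "finite A"
    and init_subset: "init_arms B \<subseteq> A" and new_subset: "\<And>t. t \<in> {1..horizon p} \<Longrightarrow> new_arms B t \<subseteq> A"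
begin

abbreviation "msets \<equiv> mset_fun M (point_of B) A"

lemma msets_put_arm:
  assumes F: "\<And>s. msets (\<lambda>e. \<Psi> e s)" and a: "a \<in> A"
  shows "msets (\<lambda>e. put_arm p B (hist B e as) a (\<Psi> e) s)"
proof -
  define l where "l = level_of p (width p B (hist B undefined as) a)"
  have l: "level_of p (width p B (hist B e as) a) = l" for e
    by (simp add: l_def width_hist[of p B e as a undefined])
  have "msets (\<lambda>e. psi_add (feature B a) a (theta_hat p B (hist B e as)) l (\<Psi> e l))"
    by (intro mset_fun_add F a measurable_theta_hat noise_measurable) (simp add: point_of_def)
  then show ?thesis using F[of s] by (cases "s = l") (simp_all add: put_arm_def Let_def l)
qed

lemma msets_fold_put:
  assumes "\<And>s. msets (\<lambda>e. \<Psi> e s)" "set xs \<subseteq> A"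
  shows "msets (\<lambda>e. fold (put_arm p B (hist B e as)) xs (\<Psi> e) s)"
  using assms
proof (induction xs arbitrary: \<Psi>)
  case (Cons a xs)
  have "msets (\<lambda>e. put_arm p B (hist B e as) a (\<Psi> e) s)" for s
    using Cons.prems by (intro msets_put_arm) auto
  from Cons.IH[of "\<lambda>e. put_arm p B (hist B e as) a (\<Psi> e)", OF this] Cons.prems show ?case by simp
qed simp

lemma msets_fold_move:
  assumes "\<And>s. msets (\<lambda>e. \<Psi> e s)" "set xs \<subseteq> A"
  shows "msets (\<lambda>e. fold (\<lambda>a \<Psi>. put_arm p B (hist B e as) a (\<Psi>(l := psi_remove a (\<Psi> l)))) xs (\<Psi> e) s)"
  using assms
proof (induction xs arbitrary: \<Psi>)
  case (Cons a xs)
  have "msets (\<lambda>e. psi_remove a (\<Psi> e l))"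
    using Cons.prems by (intro mset_fun_remove) auto
  then have "msets (\<lambda>e. ((\<Psi> e)(l := psi_remove a (\<Psi> e l))) s)" for s
    using Cons.prems(1)[of s] by (cases "s = l") simp_all
  then have "msets (\<lambda>e. put_arm p B (hist B e as) a ((\<Psi> e)(l := psi_remove a (\<Psi> e l))) s)" for s
    using Cons.prems by (intro msets_put_arm) auto
  from Cons.IH[of "\<lambda>e. put_arm p B (hist B e as) a ((\<Psi> e)(l := psi_remove a (\<Psi> e l)))", OF this] Cons.prems(2)
  show ?case unfolding fold_Cons comp_apply by (meson set_subset_Cons subset_trans)
qed simp

lemma measurable_update_lower:
  assumes r: "r \<in> borel_measurable M" and X: "finite X"
  shows "(\<lambda>e. update_lower p B (hist B e as) X (r e)) \<in> borel_measurable M"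
  unfolding update_lower_def
proof (rule measurable_Max_insert[OF X r])
  fix a
  have "(\<lambda>e. ereal (scalar_prod (feature B a) (theta_hat p B (hist B e as)) - beta p * width p B (hist B e as) a))
    = (\<lambda>e. ereal (scalar_prod (feature B a) (theta_hat p B (hist B e as)) - beta p * width p B (hist B undefined as) a))"
    by (rule ext) (subst width_hist[of p B _ as a undefined], rule refl)
  also have "\<dots> \<in> borel_measurable M"
    by (intro borel_measurable_ereal borel_measurable_diff measurable_theta_hat noise_measurable) simp
  finally show "(\<lambda>e. ereal (scalar_prod (feature B a) (theta_hat p B (hist B e as)) - beta p * width p B (hist B e as) a))
    \<in> borel_measurable M" .
qed

abbreviation "mst \<equiv> mstate M (point_of B) A"

lemma mst_raise:
  assumes \<Psi>: "\<And>s. msets (\<lambda>e. \<Psi> e s)" and r: "(\<lambda>e. lower (f e)) \<in> borel_measurable M" and X: "finite X"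
    and st: "\<And>e. e \<in> space M \<Longrightarrow> stored_in (set ls) (\<Psi> e)"
  shows "mst (\<lambda>e. raise_and_eliminate p B (hist B e as) X ((f e)\<lparr>psi := \<Psi> e\<rparr>))"
  unfolding mstate_def
proof (intro conjI allI exI[of _ ls] ballI)
  let ?r = "\<lambda>e. update_lower p B (hist B e as) X (lower (f e))"
  have m: "?r \<in> borel_measurable M" by (rule measurable_update_lower[OF r X])
  show "msets (\<lambda>x. psi (raise_and_eliminate p B (hist B x as) X ((f x)\<lparr>psi := \<Psi> x\<rparr>)) s)" for s
    unfolding raise_and_eliminate_def Let_def state.simps state_update_select by (rule mset_fun_eliminate[OF \<Psi> finite_A m])
  show "(\<lambda>x. lower (raise_and_eliminate p B (hist B x as) X ((f x)\<lparr>psi := \<Psi> x\<rparr>))) \<in> borel_measurable M"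
    unfolding raise_and_eliminate_def Let_def state.simps state_update_select by (rule m)
  show "s \<notin> set ls \<longrightarrow> arms_of (psi (raise_and_eliminate p B (hist B x as) X ((f x)\<lparr>psi := \<Psi> x\<rparr>)) s) = {}"
    if "x \<in> space M" for x s
  proof -
    have "stored_in (set ls) (psi ((f x)\<lparr>psi := \<Psi> x\<rparr>))" unfolding state_update_select by (rule st[OF that])
    from stored_in_raise[OF this] show ?thesis unfolding stored_in_def by blast
  qed
qed

lemma mst_add_new_arms:
  assumes f: "mst f" and N: "N \<subseteq> A"
  shows "mst (\<lambda>e. add_new_arms p B (hist B e as) N (f e))"
proof -
  have finN: "finite N" using N finite_A finite_subset by auto
  obtain ls where ls': "\<forall>e\<in>space M. \<forall>s. s \<notin> set ls \<longrightarrow> arms_of (psi (f e) s) = {}"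
    using f unfolding mstate_def by blast
  then have ls: "\<And>e s. e \<in> space M \<Longrightarrow> s \<notin> set ls \<Longrightarrow> arms_of (psi (f e) s) = {}" by blast
  show ?thesis unfolding add_new_arms_def
  proof (rule mst_raise[where ls = "ls @ level_list p B (hist B undefined as) N"])
    show "msets (\<lambda>e. fold (put_arm p B (hist B e as)) (sorted_list_of_set N) (psi (f e)) s)" for s
      using f N finN by (intro msets_fold_put) (auto simp: mstate_def)
    show "(\<lambda>e. lower (f e)) \<in> borel_measurable M" using f by (simp add: mstate_def)
    fix e assume "e \<in> space M"
    then have "stored_in (set ls) (psi (f e))" using ls by (auto simp: stored_in_def)
    from stored_in_fold_put[OF this, of p B "hist B e as" "sorted_list_of_set N"]
    show "stored_in (set (ls @ level_list p B (hist B undefined as) N))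
        (fold (put_arm p B (hist B e as)) (sorted_list_of_set N) (psi (f e)))"
      by (rule stored_in_mono)
         (use finN in \<open>auto simp: level_list_hist[of p B undefined as N e] set_level_list\<close>)
  qed (rule finN)
qed

text \<open>Which arms move is random, but it is determined by the countable view of the state; on
  each value of the view the move is a fixed sequence of operations.\<close>

lemma mst_move_arms:
  assumes f: "mst f"
  shows "mst (\<lambda>e. move_arms p B (hist B e as) (f e))"
proof -
  obtain ls where ls': "\<forall>e\<in>space M. \<forall>s. s \<notin> set ls \<longrightarrow> arms_of (psi (f e) s) = {}"
    using f unfolding mstate_def by blast
  then have ls: "\<And>e s. e \<in> space M \<Longrightarrow> s \<notin> set ls \<Longrightarrow> arms_of (psi (f e) s) = {}" by blast
  define ls' where "ls' = ls @ level_list p B (hist B undefined as) A"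
  define D where "D e = arm_view ls (f e)" for e
  \<comment> \<open>A representative outcome for each view: reading the current level and its arms
    at \<open>w v\<close> turns them into constants.\<close>
  define w where "w v = (SOME e. e \<in> space M \<and> D e = v)" for v
  define g where "g v e = (let s = current_level (f (w v)); X = arms_of (psi (f (w v)) s)
      in raise_and_eliminate p B (hist B e as) X
           ((f e)\<lparr>psi := fold (\<lambda>a \<Psi>. put_arm p B (hist B e as) a (\<Psi>(s := psi_remove a (\<Psi> s))))
                        (sorted_list_of_set X) (psi (f e))\<rparr>))" for v e
  have D: "D \<in> measurable M (count_space UNIV)" unfolding D_def by (rule mstate_arm_view[OF f])
  have w: "w (D e) \<in> space M" "D (w (D e)) = D e" if "e \<in> space M" for e
    using someI[of "\<lambda>e'. e' \<in> space M \<and> D e' = D e" e] that by (auto simp: w_def)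
  have good: "arms_of (psi (f e) s) \<subseteq> A" if "e \<in> space M" for e s
    using f that by (auto simp: mstate_def mset_fun_def good_set_def)
  have g: "mst (g v)" if v: "v \<in> D ` space M" for v
  proof -
    have wv: "w v \<in> space M" using v w by auto
    define s where "s = current_level (f (w v))"
    define X where "X = arms_of (psi (f (w v)) s)"
    have X: "X \<subseteq> A" "finite X" using good[OF wv] finite_subset[OF _ finite_A] unfolding X_def by blast+
    show ?thesis unfolding g_def Let_def s_def[symmetric] X_def[symmetric]
    proof (rule mst_raise[where ls = ls'])
      show "msets (\<lambda>e. fold (\<lambda>a \<Psi>. put_arm p B (hist B e as) a (\<Psi>(s := psi_remove a (\<Psi> s))))
            (sorted_list_of_set X) (psi (f e)) s')" for s'
        using f X by (intro msets_fold_move) (auto simp: mstate_def)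
      show "(\<lambda>e. lower (f e)) \<in> borel_measurable M" using f by (simp add: mstate_def)
      fix e assume "e \<in> space M"
      then have "stored_in (set ls) (psi (f e))" using ls by (auto simp: stored_in_def)
      from stored_in_fold_move[OF this, of p B "hist B e as" "sorted_list_of_set X" s]
      show "stored_in (set ls') (fold (\<lambda>a \<Psi>. put_arm p B (hist B e as) a (\<Psi>(s := psi_remove a (\<Psi> s))))
            (sorted_list_of_set X) (psi (f e)))"
        by (rule stored_in_mono)
           (use X finite_A in \<open>auto simp: ls'_def level_list_hist[of p B undefined as A e] set_level_list\<close>)
    qed (rule X)
  qed
  have eq: "move_arms p B (hist B e as) (f e) = g (D e) e" if e: "e \<in> space M" for e
  proof -
    have c: "current_level (f (w (D e))) = current_level (f e)"
      "arms_of (psi (f (w (D e))) s) = arms_of (psi (f e) s)" for s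
      using arm_view_eqD[OF f ls w(1)[OF e] e] w(2)[OF e] unfolding D_def by auto
    show ?thesis unfolding move_arms_def g_def Let_def c ..
  qed
  show ?thesis unfolding mstate_def
  proof (intro conjI allI exI[of _ ls'] ballI)
    show "msets (\<lambda>x. psi (move_arms p B (hist B x as) (f x)) s)" for s
      by (rule mset_fun_split[OF D, of _ _ "\<lambda>v e. psi (g v e) s"]) (use g eq in \<open>auto simp: mstate_def\<close>)
    show "(\<lambda>x. lower (move_arms p B (hist B x as) (f x))) \<in> borel_measurable M"
      by (rule measurable_split_discrete[OF D, of "\<lambda>v e. lower (g v e)"]) (use g eq in \<open>auto simp: mstate_def\<close>)
    fix e s assume e: "e \<in> space M"
    let ?s = "current_level (f e)" and ?X = "arms_of (psi (f e) (current_level (f e)))"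
    have X: "?X \<subseteq> A" "finite ?X" using good[OF e] finite_subset[OF _ finite_A] by blast+
    have "stored_in (set ls) (psi (f e))" using e ls by (auto simp: stored_in_def)
    note * = stored_in_fold_move[OF this, of p B "hist B e as" "sorted_list_of_set ?X" ?s]
    have "stored_in (set ls \<union> (\<lambda>a. level_of p (width p B (hist B e as) a)) ` set (sorted_list_of_set ?X))
        (psi (move_arms p B (hist B e as) (f e)))"
      unfolding move_arms_def Let_def by (rule stored_in_raise) (use * in \<open>simp only: state_update_select\<close>)
    then have "stored_in (set ls') (psi (move_arms p B (hist B e as) (f e)))"
      by (rule stored_in_mono)
         (use X finite_A in \<open>auto simp: ls'_def level_list_hist[of p B undefined as A e] set_level_list\<close>)
    then show "s \<notin> set ls' \<longrightarrow> arms_of (psi (move_arms p B (hist B e as) (f e)) s) = {}"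
      by (simp add: stored_in_def)
  qed
qed

lemma mst_initial: "mst (\<lambda>_. initial_state p B)"
  unfolding mstate_def
proof (intro conjI allI exI[of _ "[0]"] ballI)
  have "good_set (point_of B) A (fold (\<lambda>a. psi_add (feature B a) a \<theta> 0) xs \<Psi>)"
    if "good_set (point_of B) A \<Psi>" "set xs \<subseteq> A" for xs \<Psi> \<theta>
    using that
  proof (induction xs arbitrary: \<Psi>)
    case (Cons a xs)
    have "good_set (point_of B) A (psi_add (feature B a) a \<theta> 0 \<Psi>)"
      using Cons.prems by (intro good_set_add) (simp_all add: point_of_def[of B a])
    then show ?case using Cons.IH Cons.prems by simp
  qed simp
  moreover have "set (sorted_list_of_set (init_arms B)) \<subseteq> A"
    using init_subset finite_subset[OF init_subset finite_A] by simp
  ultimately show "msets (\<lambda>_. psi (initial_state p B) s)" for s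
    by (intro mset_fun_const) (auto simp: initial_state_def good_set_empty)
  show "s \<notin> set [0] \<longrightarrow> arms_of (psi (initial_state p B) s) = {}" for s
    by (simp add: initial_state_def arms_of_def)
qed (simp add: initial_state_def)

end

section \<open>Runs driven by an oracle\<close>

text \<open>The answer of \<open>attempt\<close> with the solver replaced by an oracle. The actual
  run, guided runs and failure events are instances with different oracles, and measurability is
  shown once for all of them.\<close>

definition pick :: "params \<Rightarrow> ('e, 'z) bandit_scheme \<Rightarrow> (int \<Rightarrow> update list \<Rightarrow> real vec \<Rightarrow> nat option)
    \<Rightarrow> real \<Rightarrow> (nat \<times> real) list \<Rightarrow> state \<Rightarrow> nat option" where
  "pick p B Q u h st =
     (let s = current_level st; X = arms_of (psi st s) in
      if \<forall>s. arms_of (psi st s) = {} then None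
      else if s = s_max p then Some (sorted_list_of_set X ! nat \<lfloor>u * real (card X)\<rfloor>)
      else Q s (updates (psi st s)) (vectorize ((1 / real (dim p)) \<cdot>\<^sub>m inv_mat (gram p B h))))"

definition solver_oracle :: "params \<Rightarrow> (nat \<Rightarrow> real \<Rightarrow> real \<Rightarrow> nat \<Rightarrow> 's solver) \<Rightarrow> (int \<times> nat \<Rightarrow> 's)
    \<Rightarrow> int \<Rightarrow> update list \<Rightarrow> real vec \<Rightarrow> nat option" where
  "solver_oracle p S z s us q = adaptive_answer (level_solver p S s) (point_dim p) (mips_eps p s) (copies p s)
     (\<lambda>i. z (s, i)) us q"

lemma fst_attempt: "fst (attempt p S B z u h st) = pick p B (solver_oracle p S z) u h st"
  by (simp add: attempt_def pick_def solver_oracle_def Let_def)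

text \<open>One step is an attempt, not a round. A played arm ends the round and lets in the arms of
  the next one immediately, so before the horizon every configuration is one in which a query is
  due. After the last round nothing changes.\<close>

definition advance :: "params \<Rightarrow> ('e, 'z) bandit_scheme \<Rightarrow> 'e \<Rightarrow> nat option \<Rightarrow> state \<times> nat list \<Rightarrow> state \<times> nat list" where
  "advance p B e ans c =
     (let (st, as) = c in
      if length as \<ge> horizon p then c
      else case ans of
          None \<Rightarrow> (move_arms p B (hist B e as) st, as)
        | Some a \<Rightarrow>
            (let as' = as @ [a] in
             (if length as' < horizon p
              then add_new_arms p B (hist B e as') (new_arms B (Suc (length as'))) st else st, as')))"

text \<open>The answers are an argument: with \<open>L\<close> fixed the played arms are fixed too,
  and the configuration is treated as a function of \<open>e\<close>, separately for each of the
  countably many \<open>L\<close>.\<close>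

definition config :: "params \<Rightarrow> ('e, 'z) bandit_scheme \<Rightarrow> 'e \<Rightarrow> nat option list \<Rightarrow> state \<times> nat list" where
  "config p B e L = fold (advance p B e) L (add_new_arms p B [] (new_arms B 1) (initial_state p B), [])"

lemma config_Nil: "config p B e [] = (add_new_arms p B [] (new_arms B 1) (initial_state p B), [])"
  by (simp add: config_def)

lemma config_snoc: "config p B e (L @ [ans]) = advance p B e ans (config p B e L)"
  by (simp add: config_def)

definition played_arms :: "params \<Rightarrow> nat option list \<Rightarrow> nat list" where
  "played_arms p L = take (horizon p) (List.map_filter id L)"

lemma played_arms_snoc:
  "played_arms p (L @ [ans]) = (if length (played_arms p L) \<ge> horizon p then played_arms p L
     else case ans of None \<Rightarrow> played_arms p L | Some a \<Rightarrow> played_arms p L @ [a])"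
  by (auto simp: played_arms_def List.map_filter_def split: option.splits)

lemma snd_config: "snd (config p B e L) = played_arms p L"
proof (induction L rule: rev_induct)
  case Nil then show ?case by (simp add: config_Nil played_arms_def List.map_filter_def)
next
  case (snoc ans L)
  then show ?case
    by (auto simp: config_snoc advance_def Let_def played_arms_snoc split: prod.splits option.splits)
qed

lemma length_played_arms: "length (played_arms p L) \<le> horizon p"
  by (simp add: played_arms_def)

text \<open>The oracle is indexed by the attempt, which lets a guided run consult a different copy
  each time.\<close>

primrec answers :: "params \<Rightarrow> ('e, 'z) bandit_scheme \<Rightarrow> (nat \<Rightarrow> int \<Rightarrow> update list \<Rightarrow> real vec \<Rightarrow> nat option)
    \<Rightarrow> (nat \<Rightarrow> real) \<Rightarrow> 'e \<Rightarrow> nat \<Rightarrow> nat option list" where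
  "answers p B Q u e 0 = []"
| "answers p B Q u e (Suc j) =
     (let L = answers p B Q u e j; (st, as) = config p B e L
      in L @ [if length as \<ge> horizon p then None else pick p B (Q j) (u (Suc (length as))) (hist B e as) st])"

lemma answers_Suc: "answers p B Q u e (Suc j) = (let L = answers p B Q u e j; as = played_arms p L in
    L @ [if length as \<ge> horizon p then None else pick p B (Q j) (u (Suc (length as))) (hist B e as) (fst (config p B e L))])"
  by (simp add: Let_def case_prod_beta snd_config)

lemma length_answers [simp]: "length (answers p B Q u e j) = j"
  by (induction j) (auto simp: Let_def case_prod_beta)

lemma (in measurable_bandit) mst_config:
  assumes "horizon p \<ge> 1"
  shows "mst (\<lambda>e. fst (config p B e L))"
proof (induction L rule: rev_induct)
  case Nil
  have "mst (\<lambda>e. add_new_arms p B (hist B e []) (new_arms B 1) (initial_state p B))"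
    using assms by (intro mst_add_new_arms mst_initial new_subset) auto
  then show ?case by (simp add: config_Nil)
next
  case (snoc ans L)
  let ?as = "played_arms p L"
  have c: "config p B e L = (fst (config p B e L), ?as)" for e
    by (rule prod_eqI) (simp_all add: snd_config)
  show ?case
  proof (cases "length ?as \<ge> horizon p")
    case True
    then show ?thesis using snoc.IH unfolding config_snoc by (subst c) (simp add: advance_def)
  next
    case F: False
    show ?thesis
    proof (cases ans)
      case None
      have "fst (config p B e (L @ [ans])) = move_arms p B (hist B e ?as) (fst (config p B e L))" for e
        unfolding config_snoc by (subst c) (use F None in \<open>simp add: advance_def\<close>)
      then show ?thesis using mst_move_arms[OF snoc.IH] by simp
    next
      case (Some a)
      show ?thesis
      proof (cases "length (?as @ [a]) < horizon p")
        case True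
        have "fst (config p B e (L @ [ans]))
            = add_new_arms p B (hist B e (?as @ [a])) (new_arms B (Suc (length (?as @ [a])))) (fst (config p B e L))" for e
          unfolding config_snoc by (subst c) (use F Some True in \<open>simp add: advance_def Let_def\<close>)
        then show ?thesis using mst_add_new_arms[OF snoc.IH new_subset] True by simp
      next
        case False
        have "fst (config p B e (L @ [ans])) = fst (config p B e L)" for e
          unfolding config_snoc by (subst c) (use F Some False in \<open>simp add: advance_def Let_def\<close>)
        then show ?thesis using snoc.IH by simp
      qed
    qed
  qed
qed

lemma (in measurable_bandit) measurable_query:
  assumes T: "horizon p \<ge> 1" and E: "E \<in> measurable N M"
  shows "\<exists>ls. (\<forall>\<omega>\<in>space N. \<forall>s. s \<notin> set ls \<longrightarrow> arms_of (psi (fst (config p B (E \<omega>) L)) s) = {}) \<and>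
    (\<lambda>\<omega>. arm_view ls (fst (config p B (E \<omega>) L))) \<in> measurable N (count_space UNIV) \<and>
    (\<forall>\<omega>\<in>space N. \<forall>\<omega>'\<in>space N. \<forall>s.
      arm_view ls (fst (config p B (E \<omega>) L)) = arm_view ls (fst (config p B (E \<omega>') L)) \<longrightarrow>
      arms_of (psi (fst (config p B (E \<omega>) L)) s) = arms_of (psi (fst (config p B (E \<omega>') L)) s) \<and>
      (s \<in> set ls \<longrightarrow> updates (psi (fst (config p B (E \<omega>) L)) s) = updates (psi (fst (config p B (E \<omega>') L)) s)) \<and>
      current_level (fst (config p B (E \<omega>) L)) = current_level (fst (config p B (E \<omega>') L)))"
proof -
  note m = mst_config[OF T, of L]
  obtain ls where ls': "\<forall>e\<in>space M. \<forall>s. s \<notin> set ls \<longrightarrow> arms_of (psi (fst (config p B e L)) s) = {}"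
    using m unfolding mstate_def by blast
  then have ls: "\<And>e s. e \<in> space M \<Longrightarrow> s \<notin> set ls \<Longrightarrow> arms_of (psi (fst (config p B e L)) s) = {}" by blast
  note Esp = measurable_space[OF E]
  show ?thesis
  proof (intro exI[of _ ls] conjI ballI allI)
    show "(\<lambda>\<omega>. arm_view ls (fst (config p B (E \<omega>) L))) \<in> measurable N (count_space UNIV)"
      by (rule measurable_compose[OF E mstate_arm_view[OF m]])
    show "s \<notin> set ls \<longrightarrow> arms_of (psi (fst (config p B (E \<omega>) L)) s) = {}" if "\<omega> \<in> space N" for \<omega> s
      using ls[OF Esp[OF that]] by blast
    fix \<omega> \<omega>' s
    assume \<omega>: "\<omega> \<in> space N" "\<omega>' \<in> space N"
    show "arm_view ls (fst (config p B (E \<omega>) L)) = arm_view ls (fst (config p B (E \<omega>') L)) \<longrightarrow>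
      arms_of (psi (fst (config p B (E \<omega>) L)) s) = arms_of (psi (fst (config p B (E \<omega>') L)) s) \<and>
      (s \<in> set ls \<longrightarrow> updates (psi (fst (config p B (E \<omega>) L)) s) = updates (psi (fst (config p B (E \<omega>') L)) s)) \<and>
      current_level (fst (config p B (E \<omega>) L)) = current_level (fst (config p B (E \<omega>') L))"
    proof
      assume eq: "arm_view ls (fst (config p B (E \<omega>) L)) = arm_view ls (fst (config p B (E \<omega>') L))"
      note e = arm_view_eqD[OF m ls Esp[OF \<omega>(1)] Esp[OF \<omega>(2)] eq]
      show "arms_of (psi (fst (config p B (E \<omega>) L)) s) = arms_of (psi (fst (config p B (E \<omega>') L)) s) \<and>
        (s \<in> set ls \<longrightarrow> updates (psi (fst (config p B (E \<omega>) L)) s) = updates (psi (fst (config p B (E \<omega>') L)) s)) \<and>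
        current_level (fst (config p B (E \<omega>) L)) = current_level (fst (config p B (E \<omega>') L))"
        by (intro conjI impI e)
    qed
  qed
qed

lemma current_level_in:
  assumes "arms_of (psi st s0) \<noteq> {}" and "\<And>s. s \<notin> set ls \<Longrightarrow> arms_of (psi st s) = {}"
  shows "arms_of (psi st (current_level st)) \<noteq> {}" "current_level st \<in> set ls" "current_level st \<le> s0"
proof -
  let ?X = "{s. arms_of (psi st s) \<noteq> {}}"
  have "?X \<subseteq> set ls" using assms(2) by auto
  then have X: "finite ?X" "?X \<noteq> {}" using assms(1) finite_subset by auto
  have "Min ?X \<in> ?X" by (rule Min_in[OF X])
  then show "arms_of (psi st (current_level st)) \<noteq> {}" "current_level st \<in> set ls"
    using assms(2) unfolding current_level_def by auto
  show "current_level st \<le> s0" unfolding current_level_def using X(1) assms(1) by (intro Min_le) auto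
qed

text \<open>Given the view of the state, the level, the arm set, the updates and the query vector
  are constants; what remains random is the oracle and the coin \<open>U\<close>.\<close>

lemma (in measurable_bandit) measurable_pick:
  assumes T: "horizon p \<ge> 1" and E: "E \<in> measurable N M" and U: "U \<in> borel_measurable N"
    and Q: "\<And>s us q. (\<lambda>\<omega>. Q \<omega> s us q) \<in> measurable N (count_space UNIV)"
  shows "(\<lambda>\<omega>. pick p B (Q \<omega>) (U \<omega>) (hist B (E \<omega>) as) (fst (config p B (E \<omega>) L))) \<in> measurable N (count_space UNIV)"
proof -
  let ?st = "\<lambda>\<omega>. fst (config p B (E \<omega>) L)"
  obtain ls where ls: "\<And>\<omega> s. \<omega> \<in> space N \<Longrightarrow> s \<notin> set ls \<Longrightarrow> arms_of (psi (?st \<omega>) s) = {}"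
    and D: "(\<lambda>\<omega>. arm_view ls (?st \<omega>)) \<in> measurable N (count_space UNIV)"
    and eq: "\<And>\<omega> \<omega>' s. \<omega> \<in> space N \<Longrightarrow> \<omega>' \<in> space N \<Longrightarrow> arm_view ls (?st \<omega>) = arm_view ls (?st \<omega>') \<Longrightarrow>
      arms_of (psi (?st \<omega>) s) = arms_of (psi (?st \<omega>') s) \<and>
      (s \<in> set ls \<longrightarrow> updates (psi (?st \<omega>) s) = updates (psi (?st \<omega>') s)) \<and>
      current_level (?st \<omega>) = current_level (?st \<omega>')"
    using measurable_query[OF T E, of L] by blast
  define w where "w v = (SOME \<omega>. \<omega> \<in> space N \<and> arm_view ls (?st \<omega>) = v)" for v
  define g where "g v \<omega> = pick p B (Q \<omega>) (U \<omega>) (hist B undefined as) (?st (w v))" for v \<omega>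
  have w: "w (arm_view ls (?st \<omega>)) \<in> space N" "arm_view ls (?st (w (arm_view ls (?st \<omega>)))) = arm_view ls (?st \<omega>)"
    if "\<omega> \<in> space N" for \<omega>
    using someI[of "\<lambda>\<omega>'. \<omega>' \<in> space N \<and> arm_view ls (?st \<omega>') = arm_view ls (?st \<omega>)" \<omega>] that by (auto simp: w_def)
  show ?thesis
  proof (rule measurable_split_discrete[OF D, of g])
    fix v
    have "(\<lambda>\<omega>. nat \<lfloor>U \<omega> * c\<rfloor>) \<in> measurable N (count_space UNIV)" for c
      using U by measurable
    then have "(\<lambda>\<omega>. Some (sorted_list_of_set X ! nat \<lfloor>U \<omega> * c\<rfloor>)) \<in> measurable N (count_space UNIV)" for X :: "nat set" and c
      by (rule measurable_compose) simp
    then show "g v \<in> measurable N (count_space UNIV)"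
      unfolding g_def pick_def Let_def using Q by simp
  next
    fix \<omega> assume \<omega>: "\<omega> \<in> space N"
    let ?w = "w (arm_view ls (?st \<omega>))"
    note e = eq[OF w(1)[OF \<omega>] \<omega> w(2)[OF \<omega>]]
    have arms: "arms_of (psi (?st ?w) s) = arms_of (psi (?st \<omega>) s)" for s using e by blast
    have cl: "current_level (?st ?w) = current_level (?st \<omega>)" using e by blast
    have gr: "gram p B (hist B (E \<omega>) as) = gram p B (hist B undefined as)" by (rule gram_hist)
    show "pick p B (Q \<omega>) (U \<omega>) (hist B (E \<omega>) as) (?st \<omega>) = g (arm_view ls (?st \<omega>)) \<omega>"
    proof (cases "\<forall>s. arms_of (psi (?st \<omega>) s) = {}")
      case True
      then show ?thesis unfolding g_def pick_def Let_def arms by simp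
    next
      case False
      then have "current_level (?st \<omega>) \<in> set ls" using current_level_in(2)[of "?st \<omega>"] ls[OF \<omega>] by blast
      then have "updates (psi (?st ?w) (current_level (?st \<omega>))) = updates (psi (?st \<omega>) (current_level (?st \<omega>)))"
        using e by blast
      then show ?thesis unfolding g_def pick_def Let_def arms cl gr by simp
    qed
  qed
qed

text \<open>Induction on the number of attempts. Each step splits over the countably many lists of
  earlier answers and applies \<open>measurable_pick\<close> to each of them.\<close>

lemma (in measurable_bandit) measurable_answers:
  assumes T: "horizon p \<ge> 1" and E: "E \<in> measurable N M"
    and U: "\<And>t. t \<in> {1..horizon p} \<Longrightarrow> (\<lambda>\<omega>. U \<omega> t) \<in> borel_measurable N"
    and Q: "\<And>j s us q. (\<lambda>\<omega>. Q \<omega> j s us q) \<in> measurable N (count_space UNIV)"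
  shows "(\<lambda>\<omega>. answers p B (Q \<omega>) (U \<omega>) (E \<omega>) j) \<in> measurable N (count_space UNIV)"
proof (induction j)
  case (Suc j)
  define g where "g L \<omega> = L @ [if length (played_arms p L) \<ge> horizon p then None
      else pick p B (Q \<omega> j) (U \<omega> (Suc (length (played_arms p L)))) (hist B (E \<omega>) (played_arms p L))
        (fst (config p B (E \<omega>) L))]" for L \<omega>
  show ?case
  proof (rule measurable_split_discrete[OF Suc, of g])
    fix L
    show "g L \<in> measurable N (count_space UNIV)"
    proof (cases "length (played_arms p L) \<ge> horizon p")
      case False
      have "(\<lambda>\<omega>. pick p B (Q \<omega> j) (U \<omega> (Suc (length (played_arms p L)))) (hist B (E \<omega>) (played_arms p L))
        (fst (config p B (E \<omega>) L))) \<in> measurable N (count_space UNIV)"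
        using False by (intro measurable_pick[OF T E U Q]) auto
      then have "(\<lambda>\<omega>. L @ [pick p B (Q \<omega> j) (U \<omega> (Suc (length (played_arms p L)))) (hist B (E \<omega>) (played_arms p L))
        (fst (config p B (E \<omega>) L))]) \<in> measurable N (count_space UNIV)"
        by (rule measurable_compose) simp
      then show ?thesis using False by (simp add: g_def[abs_def])
    qed (simp add: g_def[abs_def])
  next
    fix \<omega>
    show "answers p B (Q \<omega>) (U \<omega>) (E \<omega>) (Suc j) = g (answers p B (Q \<omega>) (U \<omega>) (E \<omega>) j) \<omega>"
      unfolding answers_Suc g_def Let_def ..
  qed
qed simp

section \<open>Rounds and retry loops expressed by attempts\<close>

section \<open>Runs as sequences of attempts\<close>

lemma while_option_NoneD: "while_option b c s = None \<Longrightarrow> b ((c ^^ k) s)"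
  by (auto simp: while_option_def split: if_splits)

lemma while_option_SomeD:
  assumes "while_option b c s = Some t"
  shows "\<exists>k. (\<forall>i<k. b ((c ^^ i) s)) \<and> \<not> b ((c ^^ k) s) \<and> t = (c ^^ k) s"
proof -
  let ?P = "\<lambda>k. \<not> b ((c ^^ k) s)"
  have ex: "\<exists>k. ?P k" and t: "t = (c ^^ (LEAST k. ?P k)) s"
    using assms unfolding while_option_def by (auto split: if_splits)
  show ?thesis
    by (intro exI[of _ "LEAST k. ?P k"] conjI allI impI)
       (use t LeastI_ex[OF ex] not_less_Least[of _ ?P] in auto)
qed

locale run_trace =
  fixes p :: params and S :: "nat \<Rightarrow> real \<Rightarrow> real \<Rightarrow> nat \<Rightarrow> 's solver" and B :: "('e, 'z) bandit_scheme"
    and \<omega> :: "('s, 'e) outcome"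
begin

definition trace :: "nat \<Rightarrow> nat option list" where
  "trace j = answers p B (\<lambda>_. solver_oracle p S (fst \<omega>)) (fst (snd \<omega>)) (snd (snd \<omega>)) j"

definition arms :: "nat \<Rightarrow> nat list" where
  "arms j = played_arms p (trace j)"

definition past :: "nat \<Rightarrow> (nat \<times> real) list" where
  "past j = hist B (snd (snd \<omega>)) (arms j)"

definition st :: "nat \<Rightarrow> state" where
  "st j = fst (config p B (snd (snd \<omega>)) (trace j))"

definition att :: "nat \<Rightarrow> nat option \<times> nat" where
  "att j = attempt p S B (fst \<omega>) (fst (snd \<omega>) (Suc (length (arms j)))) (past j) (st j)"

lemma config_trace: "config p B (snd (snd \<omega>)) (trace j) = (st j, arms j)"
  by (rule prod_eqI) (simp_all add: st_def arms_def snd_config)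

lemma trace_Suc: "trace (Suc j) = trace j @ [if length (arms j) \<ge> horizon p then None else fst (att j)]"
proof -
  have "trace (Suc j) = trace j @ [if length (arms j) \<ge> horizon p then None
      else pick p B (solver_oracle p S (fst \<omega>)) (fst (snd \<omega>) (Suc (length (arms j)))) (past j) (st j)]"
    unfolding trace_def answers_Suc Let_def arms_def past_def st_def ..
  then show ?thesis by (simp only: fst_attempt att_def)
qed

lemma conf_Suc: "(st (Suc j), arms (Suc j))
    = advance p B (snd (snd \<omega>)) (if length (arms j) \<ge> horizon p then None else fst (att j)) (st j, arms j)"
  unfolding config_trace[symmetric] trace_Suc config_snoc ..

lemma done_Suc: "length (arms j) \<ge> horizon p \<Longrightarrow> arms (Suc j) = arms j"
  using conf_Suc[of j] by (simp add: advance_def)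

lemma None_Suc:
  "length (arms j) < horizon p \<Longrightarrow> fst (att j) = None \<Longrightarrow>
    arms (Suc j) = arms j \<and> st (Suc j) = move_arms p B (past j) (st j)"
  using conf_Suc[of j] by (simp add: advance_def past_def)

lemma Some_Suc:
  "length (arms j) < horizon p \<Longrightarrow> fst (att j) = Some a \<Longrightarrow>
    arms (Suc j) = arms j @ [a] \<and>
    (Suc (length (arms j)) < horizon p \<longrightarrow>
      st (Suc j) = add_new_arms p B (past (Suc j)) (new_arms B (Suc (Suc (length (arms j))))) (st j))"
  using conf_Suc[of j] by (auto simp: advance_def past_def Let_def)

lemma arms_0: "arms 0 = []"
  by (simp add: arms_def trace_def played_arms_def List.map_filter_def)

lemma st_0: "st 0 = add_new_arms p B [] (new_arms B 1) (initial_state p B)"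
  by (simp add: st_def trace_def config_Nil)

lemma length_arms: "length (arms j) \<le> horizon p"
  by (simp add: arms_def length_played_arms)

lemma arms_Suc: "arms (Suc j) = arms j \<or> (\<exists>a. arms (Suc j) = arms j @ [a])"
proof (cases "length (arms j) \<ge> horizon p")
  case True then show ?thesis using done_Suc by simp
next
  case False
  then show ?thesis using None_Suc[of j] Some_Suc[of j] by (cases "fst (att j)") auto
qed

lemma arms_mono: "j \<le> j' \<Longrightarrow> \<exists>ys. arms j' = arms j @ ys"
proof (induction rule: dec_induct)
  case (step n)
  then obtain ys where "arms n = arms j @ ys" by auto
  then show ?case using arms_Suc[of n] by auto
qed simp

lemma arms_nth_eq:
  assumes "i < length (arms j)" "i < length (arms j')"
  shows "arms j ! i = arms j' ! i"
proof -
  have "arms j ! i = arms j' ! i" if "j \<le> j'" "i < length (arms j)" for j j'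
    using arms_mono[OF that(1)] that(2) by (auto simp: nth_append)
  then show ?thesis using assms by (metis nle_le)
qed

text \<open>The body of the loop in \<open>select_arm\<close>, named so that its iterates can be
  compared with attempts.\<close>

definition retry :: "(nat \<times> real) list \<Rightarrow> real \<Rightarrow> state \<times> nat option \<times> nat \<Rightarrow> state \<times> nat option \<times> nat" where
  "retry h v = (\<lambda>(st, a, c). let st' = move_arms p B h st; (a', c') = attempt p S B (fst \<omega>) v h st'
                     in (st', a', c + c'))"

text \<open>While answers are null no arm is played, so history and coin stay the same and the k-th
  iterate of the loop is attempt j + k.\<close>

lemma retry_iterate:
  assumes j: "length (arms j) < horizon p" and none: "\<And>i. i < k \<Longrightarrow> fst (att (j + i)) = None"
  shows "arms (j + k) = arms j"
    "(retry (past j) (fst (snd \<omega>) (Suc (length (arms j)))) ^^ k) (st j, att j)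
      = (st (j + k), fst (att (j + k)), \<Sum>i\<le>k. snd (att (j + i)))"
proof -
  let ?f = "retry (past j) (fst (snd \<omega>) (Suc (length (arms j))))"
  have "arms (j + k) = arms j \<and> (?f ^^ k) (st j, att j) = (st (j + k), fst (att (j + k)), \<Sum>i\<le>k. snd (att (j + i)))"
    using none
  proof (induction k)
    case (Suc k)
    then have IH: "arms (j + k) = arms j"
      "(?f ^^ k) (st j, att j) = (st (j + k), fst (att (j + k)), \<Sum>i\<le>k. snd (att (j + i)))" by auto
    have n: "arms (Suc (j + k)) = arms (j + k)" "st (Suc (j + k)) = move_arms p B (past (j + k)) (st (j + k))"
      using None_Suc[of "j + k"] IH(1) j Suc.prems by auto
    have pa: "past (j + k) = past j" "past (Suc (j + k)) = past j" using n(1) IH(1) by (simp_all add: past_def)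
    have "(?f ^^ Suc k) (st j, att j) = ?f (st (j + k), fst (att (j + k)), \<Sum>i\<le>k. snd (att (j + i)))"
      using IH(2) by simp
    also have "\<dots> = (st (Suc (j + k)), fst (att (Suc (j + k))), (\<Sum>i\<le>k. snd (att (j + i))) + snd (att (Suc (j + k))))"
      unfolding retry_def att_def[of "Suc (j + k)"] pa n(1) IH(1) n(2)
      by (simp add: Let_def case_prod_beta)
    finally show ?case using n(1) IH(1) by simp
  qed simp
  then show "arms (j + k) = arms j"
    "(?f ^^ k) (st j, att j) = (st (j + k), fst (att (j + k)), \<Sum>i\<le>k. snd (att (j + i)))" by auto
qed

lemma select_arm_eq: "select_arm p S B (fst \<omega>) v h s = while_option (\<lambda>(st, a, c). a = None) (retry h v) (s, attempt p S B (fst \<omega>) v h s)"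
  unfolding select_arm_def retry_def ..

lemma select_arm_cases:
  assumes j: "length (arms j) < horizon p"
  defines "r \<equiv> select_arm p S B (fst \<omega>) (fst (snd \<omega>) (Suc (length (arms j)))) (past j) (st j)"
  shows "r = None \<Longrightarrow> fst (att (j + k)) = None"
    "r = Some (st', a, c) \<Longrightarrow> \<exists>k. (\<forall>i<k. fst (att (j + i)) = None) \<and> fst (att (j + k)) = a \<and> a \<noteq> None \<and>
       st' = st (j + k) \<and> c = (\<Sum>i\<le>k. snd (att (j + i)))"
proof -
  let ?f = "retry (past j) (fst (snd \<omega>) (Suc (length (arms j))))"
  define b where "b = (\<lambda>(s::state, a::nat option, c::nat). a = None)"
  have r: "r = while_option b ?f (st j, att j)"
    unfolding r_def select_arm_eq b_def att_def[of j, symmetric] ..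
  have iter: "(?f ^^ k) (st j, att j) = (st (j + k), fst (att (j + k)), \<Sum>i\<le>k. snd (att (j + i)))"
    if "\<And>i. i < k \<Longrightarrow> fst (att (j + i)) = None" for k
    by (rule retry_iterate(2)[OF j that])
  have none: "fst (att (j + i)) = None" if "\<And>i. i < k \<Longrightarrow> b ((?f ^^ i) (st j, att j))" "i < k" for i k
    using that(2)
  proof (induction i rule: less_induct)
    case (less i)
    have eq: "(?f ^^ i) (st j, att j) = (st (j + i), fst (att (j + i)), \<Sum>i'\<le>i. snd (att (j + i')))"
      by (rule iter, rule less.IH) (use less.prems in auto)
    show ?case using that(1)[OF less.prems] unfolding eq by (simp add: b_def)
  qed
  show "fst (att (j + k)) = None" if "r = None"
  proof (rule none[where k = "Suc k"])
    have "while_option b ?f (st j, att j) = None" using that r by simp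
    then show "b ((?f ^^ i) (st j, att j))" for i by (rule while_option_NoneD)
  qed simp
  assume some: "r = Some (st', a, c)"
  then have "while_option b ?f (st j, att j) = Some (st', a, c)" using r by simp
  from while_option_SomeD[OF this] obtain k
    where k1: "\<forall>i<k. b ((?f ^^ i) (st j, att j))" and k2: "\<not> b ((?f ^^ k) (st j, att j))"
      and k3: "(st', a, c) = (?f ^^ k) (st j, att j)"
    by (elim exE conjE)
  note k = k1[rule_format] k2 k3
  have eq: "(?f ^^ k) (st j, att j) = (st (j + k), fst (att (j + k)), \<Sum>i\<le>k. snd (att (j + i)))"
    by (rule iter, rule none[OF k(1)])
  show "\<exists>k. (\<forall>i<k. fst (att (j + i)) = None) \<and> fst (att (j + k)) = a \<and> a \<noteq> None \<and>
       st' = st (j + k) \<and> c = (\<Sum>i\<le>k. snd (att (j + i)))"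
    using none[OF k(1)] k(2,3) unfolding eq by (intro exI[of _ k]) (simp add: b_def)
qed

text \<open>The index \<open>j\<close> counts the attempts made up to the end of round
  \<open>t\<close>. Each selection time is bounded by the cost of all attempts so far, which is
  crude but enough, since their number will be bounded independently of the number of arms.\<close>

lemma run_SomeD:
  assumes "horizon p \<ge> 1" "t \<le> horizon p" "run p S B \<omega> t = Some (s, h, cs)"
  shows "\<exists>j. h = past j \<and> length (arms j) = t \<and> length cs = t \<and>
     (t < horizon p \<longrightarrow> st j = add_new_arms p B h (new_arms B (Suc t)) s) \<and>
     (\<forall>c\<in>set cs. c \<le> (\<Sum>i<j. snd (att i))) \<and> (\<forall>i<j. length (arms i) < t)"
  using assms(2,3)
proof (induction t arbitrary: s h cs)
  case 0
  then show ?case by (intro exI[of _ 0]) (auto simp: past_def arms_0 st_0)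
next
  case (Suc t)
  obtain s0 h0 cs0 where r0: "run p S B \<omega> t = Some (s0, h0, cs0)"
    using Suc.prems by (cases "run p S B \<omega> t") auto
  obtain j where j: "h0 = past j" "length (arms j) = t" "length cs0 = t"
    "st j = add_new_arms p B h0 (new_arms B (Suc t)) s0" "\<forall>c\<in>set cs0. c \<le> (\<Sum>i<j. snd (att i))"
    using Suc.IH[OF _ r0] Suc.prems by auto
  have jT: "length (arms j) < horizon p" using j Suc.prems by simp
  let ?r = "select_arm p S B (fst \<omega>) (fst (snd \<omega>) (Suc (length (arms j)))) (past j) (st j)"
  obtain s' a c where r: "?r = Some (s', a, c)"
    using Suc.prems r0 j by (cases ?r) (auto simp: case_prod_beta Let_def)
  from select_arm_cases(2)[OF jT r] obtain k where k: "\<And>i. i < k \<Longrightarrow> fst (att (j + i)) = None"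
    "fst (att (j + k)) = a" "a \<noteq> None" "s' = st (j + k)" "c = (\<Sum>i\<le>k. snd (att (j + i)))" by auto
  obtain b where b: "a = Some b" using k(3) by auto
  have ak: "arms (j + k) = arms j" by (rule retry_iterate(1)[OF jT k(1)])
  have S: "arms (Suc (j + k)) = arms j @ [b]" "Suc t < horizon p \<Longrightarrow>
      st (Suc (j + k)) = add_new_arms p B (past (Suc (j + k))) (new_arms B (Suc (Suc t))) s'"
    using Some_Suc[of "j + k" b] ak jT k b j(2) by auto
  have eqs: "s = s'" "h = past j @ [(b, scalar_prod (theta B) (feature B b) + noise B (arms j @ [b]) (snd (snd \<omega>)))]"
    "cs = cs0 @ [c]"
    using Suc.prems(2) r0 r j b unfolding run.simps by (auto simp: case_prod_beta Let_def past_def)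
  have hp: "h = past (Suc (j + k))" unfolding eqs(2) past_def S(1) hist_snoc ..
  have "c \<le> (\<Sum>i<Suc (j + k). snd (att i))"
  proof -
    have "c = (\<Sum>i\<in>{j..j + k}. snd (att i))" unfolding k(5)
      by (rule sum.reindex_bij_witness[of _ "\<lambda>i. i - j" "\<lambda>i. j + i"]) auto
    also have "\<dots> \<le> (\<Sum>i<Suc (j + k). snd (att i))" by (rule sum_mono2) auto
    finally show ?thesis .
  qed
  moreover have "(\<Sum>i<j. snd (att i)) \<le> (\<Sum>i<Suc (j + k). snd (att i))" by (rule sum_mono2) auto
  ultimately have cs: "\<forall>c\<in>set cs. c \<le> (\<Sum>i<Suc (j + k). snd (att i))"
    using j(5) eqs(3) by (auto intro: order_trans)
  show ?case
  proof (intro exI[of _ "Suc (j + k)"] conjI allI impI)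
    show "length (arms (Suc (j + k))) = Suc t" "length cs = Suc t" using S(1) j eqs(3) by simp_all
    show "st (Suc (j + k)) = add_new_arms p B h (new_arms B (Suc (Suc t))) s" if "Suc t < horizon p"
      unfolding hp eqs(1) by (rule S(2)[OF that])
    show "length (arms i) < Suc t" if i: "i < Suc (j + k)" for i
    proof -
      obtain ys where "arms (j + k) = arms i @ ys" using arms_mono[of i "j + k"] i by auto
      then show ?thesis using ak j(2) by simp
    qed
  qed (rule hp, rule cs)
qed

text \<open>If the loop diverges in some round, all later attempts are null, so the list of arms
  stops growing before it has length \<open>t\<close>.\<close>

lemma run_NoneD:
  assumes "horizon p \<ge> 1" "t \<le> horizon p" "run p S B \<omega> t = None"
  shows "length (arms j) < t"
  using assms(2,3)
proof (induction t)
  case (Suc t)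
  show ?case
  proof (cases "run p S B \<omega> t")
    case None
    then show ?thesis using Suc by simp
  next
    case (Some r)
    obtain s0 h0 cs0 where r0: "run p S B \<omega> t = Some (s0, h0, cs0)" using Some by (cases r) auto
    obtain i where i: "h0 = past i" "length (arms i) = t" "st i = add_new_arms p B h0 (new_arms B (Suc t)) s0"
      using run_SomeD[OF assms(1) _ r0] Suc.prems by auto
    have iT: "length (arms i) < horizon p" using i Suc.prems by simp
    let ?r = "select_arm p S B (fst \<omega>) (fst (snd \<omega>) (Suc (length (arms i)))) (past i) (st i)"
    have "?r = None"
      using Suc.prems(2) r0 i by (cases ?r) (auto simp: case_prod_beta Let_def)
    then have "fst (att (i + k)) = None" for k by (rule select_arm_cases(1)[OF iT])
    then have *: "arms (i + k) = arms i" for k using retry_iterate(1)[OF iT] by simp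
    show ?thesis
    proof (cases "i \<le> j")
      case True then show ?thesis using *[of "j - i"] i by simp
    next
      case False
      then obtain ys where "arms i = arms j @ ys" using arms_mono[of j i] by auto
      then show ?thesis using i by simp
    qed
  qed
qed simp

text \<open>Describes \<open>played\<close> through countably many attempts, which makes it
  measurable even though some rounds may diverge.\<close>

lemma played_eq:
  assumes T: "horizon p \<ge> 1" and t: "t \<in> {1..horizon p}"
  shows "played p S B t \<omega> = Some a \<longleftrightarrow> (\<exists>j. t \<le> length (arms j) \<and> arms j ! (t - 1) = a)"
proof (cases "run p S B \<omega> t")
  case None
  then have "length (arms j) < t" for j using run_NoneD[OF T _ None] t by simp
  then show ?thesis using None by (simp add: played_def not_le[symmetric])
next
  case (Some r)
  obtain s h cs where r: "run p S B \<omega> t = Some (s, h, cs)" using Some by (cases r) auto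
  obtain j where j: "h = past j" "length (arms j) = t" using run_SomeD[OF T _ r] t by auto
  have "fst (past j ! (t - 1)) = arms j ! (t - 1)" using j(2) t by (simp add: past_def hist_def)
  then have *: "played p S B t \<omega> = Some (arms j ! (t - 1))" using r j by (simp add: played_def)
  show ?thesis
  proof
    assume "played p S B t \<omega> = Some a"
    then show "\<exists>j. t \<le> length (arms j) \<and> arms j ! (t - 1) = a"
      using * j(2) by (intro exI[of _ j]) simp
  next
    assume "\<exists>j. t \<le> length (arms j) \<and> arms j ! (t - 1) = a"
    then obtain i where i: "t \<le> length (arms i)" "arms i ! (t - 1) = a" by auto
    have "arms i ! (t - 1) = arms j ! (t - 1)" using i j t by (intro arms_nth_eq) auto
    then show "played p S B t \<omega> = Some a" using * i by simp
  qed
qed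

lemma played_arms_nth:
  assumes "horizon p \<ge> 1" "i < length (arms j)"
  shows "played p S B (Suc i) \<omega> = Some (arms j ! i)"
  using assms length_arms[of j] by (subst played_eq) (auto intro!: exI[of _ j])

lemma run_Some_past:
  assumes "horizon p \<ge> 1" "t \<le> length (arms j)"
  shows "\<exists>s cs. run p S B \<omega> t = Some (s, hist B (snd (snd \<omega>)) (take t (arms j)), cs)"
proof -
  have tT: "t \<le> horizon p" using assms length_arms[of j] by simp
  obtain r where "run p S B \<omega> t = Some r"
    using run_NoneD[OF assms(1) tT, of j] assms by (cases "run p S B \<omega> t") auto
  then obtain s h cs where r: "run p S B \<omega> t = Some (s, h, cs)" by (cases r) auto
  obtain i where i: "h = past i" "length (arms i) = t" using run_SomeD[OF assms(1) tT r] by auto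
  have "arms i = take t (arms j)"
    using i assms by (intro nth_equalityI) (auto intro!: arms_nth_eq)
  then show ?thesis using r i by (auto simp: past_def)
qed

text \<open>Reward and noise become functions of the played arms and the environment, so they can be
  handled by splitting over countably many arm sequences.\<close>

lemma reward_noise_at:
  assumes T: "horizon p \<ge> 1" and t: "t \<in> {1..horizon p}"
  shows "reward_at p S B t \<omega> = (if \<exists>i\<in>{1..t}. played p S B i \<omega> = None then 0
      else scalar_prod (theta B) (feature B (the (played p S B t \<omega>)))
        + noise B (map (\<lambda>i. the (played p S B i \<omega>)) [1..<Suc t]) (snd (snd \<omega>)))"
    "noise_at p S B t \<omega> = (if \<exists>i\<in>{1..t}. played p S B i \<omega> = None then 0
      else noise B (map (\<lambda>i. the (played p S B i \<omega>)) [1..<Suc t]) (snd (snd \<omega>)))"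
proof -
  have "(reward_at p S B t \<omega> = (if \<exists>i\<in>{1..t}. played p S B i \<omega> = None then 0
      else scalar_prod (theta B) (feature B (the (played p S B t \<omega>)))
        + noise B (map (\<lambda>i. the (played p S B i \<omega>)) [1..<Suc t]) (snd (snd \<omega>)))) \<and>
    (noise_at p S B t \<omega> = (if \<exists>i\<in>{1..t}. played p S B i \<omega> = None then 0
      else noise B (map (\<lambda>i. the (played p S B i \<omega>)) [1..<Suc t]) (snd (snd \<omega>))))"
  proof (cases "run p S B \<omega> t")
    case None
    then have "played p S B t \<omega> = None" by (simp add: played_def)
    then have "\<exists>i\<in>{1..t}. played p S B i \<omega> = None" using t by (intro bexI[of _ t]) auto
    then show ?thesis using None by (simp add: reward_at_def noise_at_def)
  next
    case (Some r)
    obtain s h cs where r: "run p S B \<omega> t = Some (s, h, cs)" using Some by (cases r) auto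
    obtain j where j: "h = past j" "length (arms j) = t" using run_SomeD[OF T _ r] t by auto
    have pl: "played p S B (Suc i) \<omega> = Some (arms j ! i)" if "i < t" for i
      using played_arms_nth[OF T] that j by simp
    have pl': "played p S B i \<omega> = Some (arms j ! (i - 1))" if "i \<in> {1..t}" for i
      using pl[of "i - 1"] that by (cases i) auto
    have all: "\<not> (\<exists>i\<in>{1..t}. played p S B i \<omega> = None)"
      by (simp add: pl')
    have as: "map (\<lambda>i. the (played p S B i \<omega>)) [1..<Suc t] = arms j"
      using pl j by (intro nth_equalityI) (auto simp del: upt_Suc)
    have 1: "snd (h ! (t - 1)) = scalar_prod (theta B) (feature B (arms j ! (t - 1))) + noise B (arms j) (snd (snd \<omega>))"
      using j t by (simp add: past_def hist_def)
    have 2: "map fst h = arms j" using j(1) by (simp add: past_def)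
    have rew: "reward_at p S B t \<omega> = snd (h ! (t - 1))" "noise_at p S B t \<omega> = noise B (arms j) (snd (snd \<omega>))"
      using r 2 by (simp_all add: reward_at_def noise_at_def)
    have the: "the (played p S B t \<omega>) = arms j ! (t - 1)" using pl'[of t] t by simp
    show ?thesis by (simp only: rew 1 the as all if_False)
  qed
  then show "reward_at p S B t \<omega> = (if \<exists>i\<in>{1..t}. played p S B i \<omega> = None then 0
      else scalar_prod (theta B) (feature B (the (played p S B t \<omega>)))
        + noise B (map (\<lambda>i. the (played p S B i \<omega>)) [1..<Suc t]) (snd (snd \<omega>)))"
    "noise_at p S B t \<omega> = (if \<exists>i\<in>{1..t}. played p S B i \<omega> = None then 0
      else noise B (map (\<lambda>i. the (played p S B i \<omega>)) [1..<Suc t]) (snd (snd \<omega>)))" by blast+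
qed

end

section \<open>Measurability of the run\<close>

text \<open>The answers of all copies form a list of countable type, and the passed-on answer is a
  function of this list.\<close>

lemma measurable_adaptive_answer:
  assumes "\<And>i us q. i < \<kappa> \<Longrightarrow> (\<lambda>\<omega>. answer S (z \<omega> i) us q) \<in> measurable N (count_space UNIV)"
  shows "(\<lambda>\<omega>. adaptive_answer S n \<epsilon> \<kappa> (z \<omega>) us q) \<in> measurable N (count_space UNIV)"
proof (rule measurable_discrete_factor)
  show "(\<lambda>\<omega>. map (\<lambda>i. answer S (z \<omega> i) us (round_query n \<epsilon> q)) [0..<\<kappa>]) \<in> measurable N (count_space UNIV)"
    using assms by (intro measurable_map_discrete) auto
  fix x y
  assume "map (\<lambda>i. answer S (z x i) us (round_query n \<epsilon> q)) [0..<\<kappa>]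
    = map (\<lambda>i. answer S (z y i) us (round_query n \<epsilon> q)) [0..<\<kappa>]"
  then have e: "\<And>i. i < \<kappa> \<Longrightarrow> answer S (z x i) us (round_query n \<epsilon> q) = answer S (z y i) us (round_query n \<epsilon> q)" by simp
  let ?P = "\<lambda>z i. i < \<kappa> \<and> answer S (z i) us (round_query n \<epsilon> q) \<noteq> None"
  have P: "?P (z x) = ?P (z y)" using e by auto
  show "adaptive_answer S n \<epsilon> \<kappa> (z x) us q = adaptive_answer S n \<epsilon> \<kappa> (z y) us q"
  proof (cases "\<exists>i. ?P (z x) i")
    case True
    then have "?P (z x) (LEAST i. ?P (z x) i)" by (rule LeastI_ex)
    then have "answer S (z x (LEAST i. ?P (z x) i)) us (round_query n \<epsilon> q) = answer S (z y (LEAST i. ?P (z x) i)) us (round_query n \<epsilon> q)"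
      using e by blast
    moreover have "\<exists>i<\<kappa>. answer S (z x i) us (round_query n \<epsilon> q) \<noteq> None" using True by blast
    moreover have "\<exists>i<\<kappa>. answer S (z y i) us (round_query n \<epsilon> q) \<noteq> None" using True e by auto
    ultimately show ?thesis unfolding adaptive_answer_def Let_def P[symmetric] by simp
  next
    case False
    then show ?thesis using e unfolding adaptive_answer_def Let_def by auto
  qed
qed

locale bandit_setup =
  fixes p :: params and S :: "nat \<Rightarrow> real \<Rightarrow> real \<Rightarrow> nat \<Rightarrow> 's solver" and B :: "'e bandit"
    and C :: nat
  assumes T: "horizon p \<ge> 1" and d: "dim p \<ge> 1"
    and valid: "valid_bandit (dim p) (horizon p) C (max_arms p) B"
    and solver: "\<And>s. s \<in> levels p \<Longrightarrow> solves_mips (point_dim p) (1/4) (mips_r p s) (max_arms p) (level_solver p S s)"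
begin

abbreviation "A \<equiv> arms_at B (horizon p)"
abbreviation "M \<equiv> outcome_space p S B"

lemma finite_A: "finite A"
  using valid by (auto simp: valid_bandit_def arms_at_def)

lemma feature_ball: "a \<in> A \<Longrightarrow> feature B a \<in> unit_ball (dim p)"
  and theta_ball: "theta B \<in> unit_ball (dim p)"
  using valid by (auto simp: valid_bandit_def)

lemma feature_carrier: "a \<in> A \<Longrightarrow> feature B a \<in> carrier_vec (dim p)"
  using feature_ball by (auto simp: unit_ball_def)

sublocale measurable_bandit p B "env B" A
  using valid by unfold_locales (auto simp: valid_bandit_def arms_at_def)

sublocale env: prob_space "env B"
  using valid by (auto simp: valid_bandit_def)

abbreviation "seed_space \<equiv> \<Pi>\<^sub>M (s, i) \<in> (SIGMA s : levels p. {..<copies p s}). seed_dist (level_solver p S s)"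
abbreviation "coin_space \<equiv> \<Pi>\<^sub>M t \<in> {1..horizon p}. uniform_measure lborel {0..<1::real}"

lemma seed_prob: "c \<in> (SIGMA s : levels p. {..<copies p s}) \<Longrightarrow>
    prob_space ((\<lambda>(s, i). seed_dist (level_solver p S s)) c)"
  using solver by (auto simp: solves_mips_def)

lemma prob_space_uniform: "prob_space (uniform_measure lborel {0..<1::real})"
  by (intro prob_space_uniform_measure) auto

sublocale seeds: prob_space seed_space
  by (intro prob_space_PiM seed_prob)

sublocale coins: prob_space coin_space
  by (intro prob_space_PiM prob_space_uniform)

sublocale prob_space M
proof -
  interpret ce: pair_prob_space coin_space "env B" by unfold_locales
  interpret pair_prob_space seed_space "coin_space \<Otimes>\<^sub>M env B" by unfold_locales
  show "prob_space M" unfolding outcome_space_def by unfold_locales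
qed

lemma measurable_environment: "(\<lambda>\<omega>. snd (snd \<omega>)) \<in> measurable M (env B)"
  unfolding outcome_space_def by measurable

lemma measurable_coin: "t \<in> {1..horizon p} \<Longrightarrow> (\<lambda>\<omega>. fst (snd \<omega>) t) \<in> borel_measurable M"
proof -
  assume t: "t \<in> {1..horizon p}"
  have "(\<lambda>\<omega>. fst (snd \<omega>)) \<in> measurable M coin_space" unfolding outcome_space_def by measurable
  then have "(\<lambda>\<omega>. fst (snd \<omega>) t) \<in> measurable M (uniform_measure lborel {0..<1::real})"
    by (rule measurable_compose[OF _ measurable_component_singleton[OF t]])
  then show ?thesis by (simp add: measurable_cong_sets[of M M "uniform_measure lborel {0..<1::real}" borel])
qed

lemma measurable_answer: "(\<lambda>\<omega>. answer (level_solver p S s) (fst \<omega> (s, i)) us q) \<in> measurable M (count_space UNIV)"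
proof (cases "(s, i) \<in> (SIGMA s : levels p. {..<copies p s})")
  case True
  have "fst \<in> measurable M seed_space" unfolding outcome_space_def by measurable
  then have "(\<lambda>\<omega>. fst \<omega> (s, i)) \<in> measurable M (seed_dist (level_solver p S s))"
    using measurable_compose[OF _ measurable_component_singleton[OF True, of "\<lambda>(s, i). seed_dist (level_solver p S s)"]] by simp
  then show ?thesis
    by (rule measurable_compose) (use True solver in \<open>auto simp: solves_mips_def\<close>)
next
  case False
  \<comment> \<open>Functions in a product space are \<open>undefined\<close> off the index set, so
    here the answer does not vary.\<close>
  have "fst \<omega> (s, i) = undefined" if "\<omega> \<in> space M" for \<omega>
    using that False by (auto simp: outcome_space_def space_pair_measure space_PiM PiE_def extensional_def)
  then have "(\<lambda>\<omega>. answer (level_solver p S s) (fst \<omega> (s, i)) us q) \<in> measurable M (count_space UNIV)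
      \<longleftrightarrow> (\<lambda>\<omega>. answer (level_solver p S s) undefined us q) \<in> measurable M (count_space UNIV)"
    by (intro measurable_cong) simp
  then show ?thesis by simp
qed

lemma measurable_solver_oracle: "(\<lambda>\<omega>. solver_oracle p S (fst \<omega>) s us q) \<in> measurable M (count_space UNIV)"
  unfolding solver_oracle_def by (intro measurable_adaptive_answer measurable_answer)

lemma measurable_trace: "(\<lambda>\<omega>. run_trace.trace p S B \<omega> j) \<in> measurable M (count_space UNIV)"
  unfolding run_trace.trace_def
  by (rule measurable_answers[OF T measurable_environment measurable_coin measurable_solver_oracle])

lemma measurable_arms: "(\<lambda>\<omega>. run_trace.arms p S B \<omega> j) \<in> measurable M (count_space UNIV)"
  unfolding run_trace.arms_def by (rule measurable_compose[OF measurable_trace]) simp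

lemma measurable_played:
  assumes t: "t \<in> {1..horizon p}"
  shows "played p S B t \<in> measurable M (count_space UNIV)"
proof -
  have some: "played p S B t -` {Some a} \<inter> space M \<in> sets M" for a
  proof -
    have "played p S B t -` {Some a} \<inter> space M
        = (\<Union>j. (\<lambda>\<omega>. run_trace.arms p S B \<omega> j) -` {as. t \<le> length as \<and> as ! (t - 1) = a} \<inter> space M)"
      by (auto simp: run_trace.played_eq[OF T t])
    also have "\<dots> \<in> sets M"
      by (intro sets.countable_UN image_subsetI measurable_sets[OF measurable_arms]) auto
    finally show ?thesis .
  qed
  have "played p S B t -` {None} \<inter> space M = space M - (\<Union>a. played p S B t -` {Some a} \<inter> space M)" by auto
  also have "\<dots> \<in> sets M" using some by (intro sets.Diff sets.countable_UN image_subsetI) auto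
  finally have "played p S B t -` {x} \<inter> space M \<in> sets M" for x using some by (cases x) auto
  then show ?thesis by (subst measurable_count_space_eq2_countable) (auto simp: Pi_iff)
qed

lemma measurable_played_list:
  assumes "set ts \<subseteq> {1..horizon p}"
  shows "(\<lambda>\<omega>. map (\<lambda>t. played p S B t \<omega>) ts) \<in> measurable M (count_space UNIV)"
  using assms measurable_played by (intro measurable_map_discrete) auto

lemma measurable_reward:
  assumes t: "t \<in> {1..horizon p}"
  shows "reward_at p S B t \<in> borel_measurable M"
proof -
  define g where "g v \<omega> = (if None \<in> set v then 0 else scalar_prod (theta B) (feature B (the (last v)))
      + noise B (map the v) (snd (snd \<omega>)))" for v :: "nat option list" and \<omega> :: "('s, 'e) outcome"
  have ts: "set [1..<Suc t] \<subseteq> {1..horizon p}" using t by auto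
  show ?thesis
  proof (rule measurable_split_discrete[OF measurable_played_list[OF ts], of g])
    fix v
    have "(\<lambda>\<omega>. noise B (map the v) (snd (snd \<omega>))) \<in> borel_measurable M"
      by (rule measurable_compose[OF measurable_environment noise_measurable])
    then show "g v \<in> borel_measurable M" unfolding g_def[abs_def] by (cases "None \<in> set v") simp_all
  next
    fix \<omega>
    have l: "last (map (\<lambda>t. played p S B t \<omega>) [1..<Suc t]) = played p S B t \<omega>"
      using t by (simp add: last_map)
    have n: "None \<in> set (map (\<lambda>t. played p S B t \<omega>) [1..<Suc t]) \<longleftrightarrow> (\<exists>i\<in>{1..t}. played p S B i \<omega> = None)"
    proof -
      have "set (map (\<lambda>t. played p S B t \<omega>) [1..<Suc t]) = (\<lambda>t. played p S B t \<omega>) ` {1..t}"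
        unfolding set_map set_upt atLeastLessThanSuc_atLeastAtMost ..
      then show ?thesis by (metis (mono_tags, lifting) image_iff)
    qed
    show "reward_at p S B t \<omega> = g (map (\<lambda>t. played p S B t \<omega>) [1..<Suc t]) \<omega>"
      unfolding g_def l n run_trace.reward_noise_at(1)[OF T t] map_map comp_def ..
  qed
qed

lemma history_subalgebra: "t \<le> horizon p \<Longrightarrow> subalgebra M (history_algebra p S B t)"
  and history_played: "i \<in> {1..t} \<Longrightarrow> t \<le> horizon p \<Longrightarrow> played p S B i \<in> measurable (history_algebra p S B t) (count_space UNIV)"
  and history_reward: "i \<in> {1..<t} \<Longrightarrow> t \<le> horizon p \<Longrightarrow> reward_at p S B i \<in> borel_measurable (history_algebra p S B t)"
proof -
  let ?G = "{played p S B i -` X \<inter> space M | i X. i \<in> {1..t}} \<union> {reward_at p S B i -` X \<inter> space M | i X. i \<in> {1..<t} \<and> X \<in> sets borel}"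
  have G: "?G \<subseteq> Pow (space M)" by auto
  have H: "history_algebra p S B t = sigma (space M) ?G" unfolding history_algebra_def Let_def ..
  have sp: "space (history_algebra p S B t) = space M" unfolding H using G by (simp add: space_measure_of_conv)
  have se: "sets (history_algebra p S B t) = sigma_sets (space M) ?G" unfolding H using G by (rule sets_measure_of)
  show "subalgebra M (history_algebra p S B t)" if "t \<le> horizon p"
  proof -
    have GM: "?G \<subseteq> sets M"
      using that measurable_sets[OF measurable_played] measurable_sets[OF measurable_reward] by auto
    show ?thesis unfolding subalgebra_def sp se by (intro conjI refl sets.sigma_sets_subset GM)
  qed
  show "played p S B i \<in> measurable (history_algebra p S B t) (count_space UNIV)" if "i \<in> {1..t}"
    using that by (auto simp: measurable_def sp se intro!: sigma_sets.Basic)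
  show "reward_at p S B i \<in> borel_measurable (history_algebra p S B t)" if "i \<in> {1..<t}"
    using that by (auto simp: measurable_def sp se intro!: sigma_sets.Basic)
qed

end

section \<open>The self-normalised bound for the noise sum\<close>

section \<open>The confidence set\<close>

context bandit_setup
begin

text \<open>Uncompleted rounds and arms outside the pool count as the zero vector. The vectors thus
  lie in the unit ball for every outcome, before the run is known to behave well.\<close>

definition xvec :: "nat \<Rightarrow> ('s, 'e) outcome \<Rightarrow> real vec" where
  "xvec i \<omega> = (case played p S B (Suc i) \<omega> of None \<Rightarrow> 0\<^sub>v (dim p)
     | Some a \<Rightarrow> if a \<in> A then feature B a else 0\<^sub>v (dim p))"

text \<open>The noise as read off from the reward: \<open>history_algebra\<close> is generated by
  arms and rewards, so this form is measurable for it. It can differ from the noise only where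
  \<open>xvec\<close> is zero.\<close>

definition resid :: "nat \<Rightarrow> ('s, 'e) outcome \<Rightarrow> real" where
  "resid i \<omega> = reward_at p S B (Suc i) \<omega> - scalar_prod (theta B) (xvec i \<omega>)"

abbreviation "xs n \<omega> \<equiv> map (\<lambda>i. xvec i \<omega>) [0..<n]"
abbreviation "es n \<omega> \<equiv> map (\<lambda>i. resid i \<omega>) [0..<n]"
abbreviation "V n \<omega> \<equiv> design (dim p) (xs n \<omega>)"
abbreviation "noise_sum n \<omega> \<equiv> weighted_sum (dim p) (xs n \<omega>) (es n \<omega>)"

definition wealth :: "nat \<Rightarrow> ('s, 'e) outcome \<Rightarrow> real" where
  "wealth n \<omega> = exp (scalar_prod (noise_sum n \<omega>) (inv_mat (V n \<omega>) *\<^sub>v noise_sum n \<omega>) / 2) / sqrt (det (V n \<omega>))"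

lemma xvec_ball: "xvec i \<omega> \<in> unit_ball (dim p)"
  using feature_ball by (auto simp: xvec_def unit_ball_def norm2_def split: option.splits)

lemma xvec_carrier [simp]: "xvec i \<omega> \<in> carrier_vec (dim p)"
  using xvec_ball[of i \<omega>] by (simp add: unit_ball_def)

lemma set_xs: "set (xs n \<omega>) \<subseteq> carrier_vec (dim p)" "set (xs n \<omega>) \<subseteq> unit_ball (dim p)"
  by (auto intro!: xvec_ball)

lemma V_ge: "ge_one (dim p) (V n \<omega>)"
  by (rule ge_one_design[OF set_xs(1)])

text \<open>Under the Gaussian mixture after n rounds, alpha is normal with mean V^-1 S and
  covariance V^-1; \<open>drift\<close> and \<open>spread\<close> are the mean and the variance of
  its inner product with the next feature.\<close>

definition drift :: "nat \<Rightarrow> ('s, 'e) outcome \<Rightarrow> real" where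
  "drift n \<omega> = scalar_prod (xvec n \<omega>) (inv_mat (V n \<omega>) *\<^sub>v noise_sum n \<omega>)"

definition spread :: "nat \<Rightarrow> ('s, 'e) outcome \<Rightarrow> real" where
  "spread n \<omega> = scalar_prod (xvec n \<omega>) (inv_mat (V n \<omega>) *\<^sub>v xvec n \<omega>)"

lemma spread_nonneg: "spread n \<omega> \<ge> 0"
  unfolding spread_def by (rule inv_mat_form_bounds(3)[OF V_ge xvec_carrier])

text \<open>In a direction of zero variance the mean vanishes too, by Cauchy-Schwarz; this is the
  degenerate case of the mixture integral.\<close>

lemma spread_zeroD:
  assumes "spread n \<omega> = 0"
  shows "drift n \<omega> = 0"
proof -
  have "\<bar>scalar_prod (xvec n \<omega>) (inv_mat (V n \<omega>) *\<^sub>v noise_sum n \<omega>)\<bar>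
      \<le> mat_norm (inv_mat (V n \<omega>)) (xvec n \<omega>) * mat_norm (inv_mat (V n \<omega>)) (noise_sum n \<omega>)"
    by (rule inv_mat_cauchy_schwarz[OF V_ge xvec_carrier weighted_sum_carrier])
  moreover have "mat_norm (inv_mat (V n \<omega>)) (xvec n \<omega>) = 0"
    using assms by (simp add: spread_def mat_norm_def)
  ultimately show ?thesis unfolding drift_def by simp
qed

lemma wealth_0: "wealth 0 \<omega> = 1"
proof -
  have "inv_mat (1\<^sub>m (dim p)) *\<^sub>v 0\<^sub>v (dim p) \<in> carrier_vec (dim p)"
    by (rule inv_mat_mult_vec(1)[OF ge_one_one zero_carrier_vec])
  then show ?thesis by (simp add: wealth_def design_def)
qed

text \<open>The quadratic form grows by the Sherman-Morrison term and the determinant by the factor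
  1 + \<open>spread\<close>; together they make up exactly one factor
  \<open>mix_ratio\<close>.\<close>

lemma wealth_Suc:
  assumes n: "n < horizon p"
  shows "wealth (Suc n) \<omega> = wealth n \<omega> * mix_ratio (drift n \<omega>) (spread n \<omega>) (noise_at p S B (Suc n) \<omega>)"
proof -
  let ?x = "xvec n \<omega>" and ?e = "noise_at p S B (Suc n) \<omega>"
  have len: "length (es n \<omega>) = length (xs n \<omega>)" by simp
  have S: "noise_sum (Suc n) \<omega> = noise_sum n \<omega> + ?e \<cdot>\<^sub>v ?x"
  proof -
    have 1: "noise_sum (Suc n) \<omega> = noise_sum n \<omega> + resid n \<omega> \<cdot>\<^sub>v ?x"
      unfolding upt_Suc_append[OF le0] map_append list.map
      by (rule weighted_sum_snoc[OF len xvec_carrier])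
    have "resid n \<omega> \<cdot>\<^sub>v ?x = ?e \<cdot>\<^sub>v ?x"
    proof (cases "\<exists>a\<in>A. played p S B (Suc n) \<omega> = Some a")
      case False
      then have "?x = 0\<^sub>v (dim p)" by (auto simp: xvec_def split: option.splits)
      then show ?thesis by (auto intro!: eq_vecI)
    next
      case True
      then obtain a where a: "a \<in> A" "played p S B (Suc n) \<omega> = Some a" by auto
      have t: "Suc n \<in> {1..horizon p}" using n by simp
      obtain s h cs where r: "run p S B \<omega> (Suc n) = Some (s, h, cs)"
        using a(2) by (auto simp: played_def)
      obtain j where j: "h = run_trace.past p S B \<omega> j" "length (run_trace.arms p S B \<omega> j) = Suc n"
        using run_trace.run_SomeD[OF T _ r] n by auto
      have "\<not> (\<exists>i\<in>{1..Suc n}. played p S B i \<omega> = None)"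
      proof
        assume "\<exists>i\<in>{1..Suc n}. played p S B i \<omega> = None"
        then obtain i where i: "i \<in> {1..Suc n}" "played p S B i \<omega> = None" by auto
        have "played p S B (Suc (i - 1)) \<omega> = Some (run_trace.arms p S B \<omega> j ! (i - 1))"
          using i(1) j(2) by (intro run_trace.played_arms_nth[OF T]) auto
        then show False using i by simp
      qed
      then have np: "(\<exists>i\<in>{1..Suc n}. played p S B i \<omega> = None) = False" by blast
      have rn: "reward_at p S B (Suc n) \<omega> = scalar_prod (theta B) (feature B (the (played p S B (Suc n) \<omega>))) + ?e"
        unfolding run_trace.reward_noise_at[OF T t] np if_False ..
      have x: "?x = feature B a" "the (played p S B (Suc n) \<omega>) = a" using a by (simp_all add: xvec_def)
      have "resid n \<omega> = ?e" unfolding resid_def rn x by simp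
      then show ?thesis by simp
    qed
    then show ?thesis using 1 by simp
  qed
  have V: "V (Suc n) \<omega> = V n \<omega> + outer ?x"
    by (simp add: design_snoc)
  have q: "scalar_prod (noise_sum (Suc n) \<omega>) (inv_mat (V (Suc n) \<omega>) *\<^sub>v noise_sum (Suc n) \<omega>)
     = scalar_prod (noise_sum n \<omega>) (inv_mat (V n \<omega>) *\<^sub>v noise_sum n \<omega>)
       + (2 * drift n \<omega> * ?e + ?e\<^sup>2 * spread n \<omega> - (drift n \<omega>)\<^sup>2) / (1 + spread n \<omega>)"
    unfolding S V drift_def spread_def by (rule inv_mat_form_update[OF V_ge xvec_carrier weighted_sum_carrier])
  have dt: "det (V (Suc n) \<omega>) = det (V n \<omega>) * (1 + spread n \<omega>)"
    unfolding V spread_def by (rule det_add_outer[OF V_ge xvec_carrier])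
  show ?thesis unfolding wealth_def q dt mix_ratio_def
    by (simp add: add_divide_distrib exp_add real_sqrt_mult mult.commute)
qed

lemma wealth_nonneg: "wealth n \<omega> \<ge> 0"
  using det_design_le(1)[OF set_xs(2) d] by (simp add: wealth_def less_imp_le)

text \<open>For fixed arms, everything depends on the rewards through finite sums.\<close>

lemma history_list_function:
  assumes f: "\<And>v ys. length v = n \<Longrightarrow> length ys = m \<Longrightarrow> set (v @ ys) \<subseteq> carrier_vec (dim p) \<Longrightarrow>
      (\<lambda>\<omega>. f v ys (map (\<lambda>i. resid i \<omega>) [0..<n])) \<in> borel_measurable (history_algebra p S B t)"
    and nt: "n < t" "n + m \<le> t" "t \<le> horizon p"
  shows "(\<lambda>\<omega>. f (xs n \<omega>) (map (\<lambda>i. xvec i \<omega>) [n..<n + m]) (es n \<omega>)) \<in> borel_measurable (history_algebra p S B t)"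
proof -
  define F where "F = history_algebra p S B t"
  define x where "x v = (case v of None \<Rightarrow> 0\<^sub>v (dim p) | Some a \<Rightarrow> if a \<in> A then feature B a else 0\<^sub>v (dim p))" for v
  have xv: "xvec i \<omega> = x (played p S B (Suc i) \<omega>)" for i \<omega> by (simp add: xvec_def x_def)
  have xc: "x v \<in> carrier_vec (dim p)" for v using feature_carrier by (auto simp: x_def split: option.splits)
  have D: "(\<lambda>\<omega>. map (\<lambda>i. played p S B (Suc i) \<omega>) [0..<n + m]) \<in> measurable F (count_space UNIV)"
    unfolding F_def using nt by (intro measurable_map_discrete history_played) auto
  show ?thesis unfolding F_def[symmetric]
  proof (rule measurable_split_discrete[OF D, of "\<lambda>v \<omega>. f (map x (take n v)) (map x (drop n v)) (es n \<omega>)"])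
    fix v assume "v \<in> (\<lambda>\<omega>. map (\<lambda>i. played p S B (Suc i) \<omega>) [0..<n + m]) ` space F"
    then have "length v = n + m" by auto
    then show "(\<lambda>\<omega>. f (map x (take n v)) (map x (drop n v)) (es n \<omega>)) \<in> borel_measurable F"
      unfolding F_def using xc by (intro f) auto
  next
    fix \<omega>
    have "xs n \<omega> = map x (take n (map (\<lambda>i. played p S B (Suc i) \<omega>) [0..<n + m]))"
      by (auto simp: xv intro!: nth_equalityI)
    moreover have "map (\<lambda>i. xvec i \<omega>) [n..<n + m] = map x (drop n (map (\<lambda>i. played p S B (Suc i) \<omega>) [0..<n + m]))"
      by (auto simp: xv intro!: nth_equalityI)
    ultimately show "f (xs n \<omega>) (map (\<lambda>i. xvec i \<omega>) [n..<n + m]) (es n \<omega>)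
      = f (map x (take n (map (\<lambda>i. played p S B (Suc i) \<omega>) [0..<n + m])))
          (map x (drop n (map (\<lambda>i. played p S B (Suc i) \<omega>) [0..<n + m]))) (es n \<omega>)" by simp
  qed
qed

lemma history_resid:
  assumes "i < n" "n < t" "t \<le> horizon p"
  shows "resid i \<in> borel_measurable (history_algebra p S B t)"
proof -
  have "(\<lambda>\<omega>. scalar_prod (theta B) (xvec i \<omega>)) \<in> borel_measurable (history_algebra p S B t)"
  proof (rule measurable_split_discrete[of "played p S B (Suc i)" _
        "\<lambda>v \<omega>. scalar_prod (theta B) (case v of None \<Rightarrow> 0\<^sub>v (dim p) | Some a \<Rightarrow> if a \<in> A then feature B a else 0\<^sub>v (dim p))"])
    show "played p S B (Suc i) \<in> measurable (history_algebra p S B t) (count_space UNIV)"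
      using assms by (intro history_played) auto
  qed (simp_all add: xvec_def)
  moreover have "reward_at p S B (Suc i) \<in> borel_measurable (history_algebra p S B t)"
    using assms by (intro history_reward) auto
  ultimately show ?thesis unfolding resid_def[abs_def] by simp
qed

lemma measurable_weighted_sum:
  assumes e: "\<And>i. i < n \<Longrightarrow> e i \<in> borel_measurable F" and v: "length v = n"
  shows "i < k \<Longrightarrow> (\<lambda>\<omega>. weighted_sum k v (map (\<lambda>i. e i \<omega>) [0..<n]) $ i) \<in> borel_measurable F"
    and "W \<in> carrier_mat k k \<Longrightarrow> y \<in> carrier_vec k \<Longrightarrow>
      (\<lambda>\<omega>. scalar_prod y (W *\<^sub>v weighted_sum k v (map (\<lambda>i. e i \<omega>) [0..<n]))) \<in> borel_measurable F"
    and "W \<in> carrier_mat k k \<Longrightarrow>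
      (\<lambda>\<omega>. scalar_prod (weighted_sum k v (map (\<lambda>i. e i \<omega>) [0..<n])) (W *\<^sub>v weighted_sum k v (map (\<lambda>i. e i \<omega>) [0..<n])))
        \<in> borel_measurable F"
proof -
  let ?s = "\<lambda>\<omega>. weighted_sum k v (map (\<lambda>i. e i \<omega>) [0..<n])"
  have 1: "(\<lambda>\<omega>. ?s \<omega> $ i) \<in> borel_measurable F" if "i < k" for i
  proof -
    have "(\<lambda>\<omega>. ?s \<omega> $ i) = (\<lambda>\<omega>. \<Sum>l<n. e l \<omega> * v ! l $ i)"
      using that v by (auto simp: weighted_sum_def fun_eq_iff)
    then show ?thesis using e by simp
  qed
  then show "i < k \<Longrightarrow> (\<lambda>\<omega>. ?s \<omega> $ i) \<in> borel_measurable F" .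
  have W: "(\<lambda>\<omega>. (W *\<^sub>v ?s \<omega>) $ i) \<in> borel_measurable F" if "i < k" "W \<in> carrier_mat k k" for i
  proof -
    have "(\<lambda>\<omega>. (W *\<^sub>v ?s \<omega>) $ i) = (\<lambda>\<omega>. \<Sum>l<k. W $$ (i, l) * ?s \<omega> $ l)"
      using that by (auto simp: fun_eq_iff scalar_prod_def atLeast0LessThan weighted_sum_def)
    then show ?thesis using 1 by simp
  qed
  show "(\<lambda>\<omega>. scalar_prod y (W *\<^sub>v ?s \<omega>)) \<in> borel_measurable F" if "W \<in> carrier_mat k k" "y \<in> carrier_vec k"
  proof -
    have "(\<lambda>\<omega>. scalar_prod y (W *\<^sub>v ?s \<omega>)) = (\<lambda>\<omega>. \<Sum>l<k. y $ l * (W *\<^sub>v ?s \<omega>) $ l)"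
      using that by (auto simp: fun_eq_iff scalar_prod_def[of y] atLeast0LessThan)
    then show ?thesis using W that by simp
  qed
  show "(\<lambda>\<omega>. scalar_prod (?s \<omega>) (W *\<^sub>v ?s \<omega>)) \<in> borel_measurable F" if "W \<in> carrier_mat k k"
  proof -
    have "(\<lambda>\<omega>. scalar_prod (?s \<omega>) (W *\<^sub>v ?s \<omega>)) = (\<lambda>\<omega>. \<Sum>l<k. ?s \<omega> $ l * (W *\<^sub>v ?s \<omega>) $ l)"
      using that by (auto simp: fun_eq_iff scalar_prod_def[of "?s _"] atLeast0LessThan)
    then show ?thesis using W 1 that by simp
  qed
qed

lemma history_wealth:
  assumes "n < t" "t \<le> horizon p"
  shows "wealth n \<in> borel_measurable (history_algebra p S B t)"
proof -
  let ?f = "\<lambda>v (ys :: real vec list) e. exp (scalar_prod (weighted_sum (dim p) v e) (inv_mat (design (dim p) v) *\<^sub>v weighted_sum (dim p) v e) / 2)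
      / sqrt (det (design (dim p) v))"
  have "(\<lambda>\<omega>. ?f (xs n \<omega>) (map (\<lambda>i. xvec i \<omega>) [n..<n + 0]) (es n \<omega>)) \<in> borel_measurable (history_algebra p S B t)"
  proof (rule history_list_function[where f = ?f and n = n and m = 0])
    fix v ys :: "real vec list" assume v: "length v = n" "length ys = 0" "set (v @ ys) \<subseteq> carrier_vec (dim p)"
    then have W: "inv_mat (design (dim p) v) \<in> carrier_mat (dim p) (dim p)"
      by (intro ge_one_inverse(1) ge_one_design) auto
    from measurable_weighted_sum(3)[OF history_resid[OF _ assms] v(1) W]
    show "(\<lambda>\<omega>. ?f v ys (es n \<omega>)) \<in> borel_measurable (history_algebra p S B t)"
      by (intro borel_measurable_divide borel_measurable_const measurable_compose[OF _ borel_measurable_exp]) simp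
  qed (use assms in auto)
  then show ?thesis by (simp add: wealth_def[abs_def])
qed

lemma history_drift_spread:
  assumes "n < t" "t \<le> horizon p"
  shows "drift n \<in> borel_measurable (history_algebra p S B t)"
    "spread n \<in> borel_measurable (history_algebra p S B t)"
proof -
  let ?f = "\<lambda>v ys e. scalar_prod (hd ys) (inv_mat (design (dim p) v) *\<^sub>v weighted_sum (dim p) v e)"
  have "(\<lambda>\<omega>. ?f (xs n \<omega>) (map (\<lambda>i. xvec i \<omega>) [n..<n + 1]) (es n \<omega>)) \<in> borel_measurable (history_algebra p S B t)"
  \<comment> \<open>The one extra vector is the arm of round n + 1, which the history algebra knows
    before its reward.\<close>
  proof (rule history_list_function[where f = ?f and n = n and m = 1])
    fix v ys :: "real vec list" assume v: "length v = n" "length ys = 1" "set (v @ ys) \<subseteq> carrier_vec (dim p)"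
    then have W: "inv_mat (design (dim p) v) \<in> carrier_mat (dim p) (dim p)"
      by (intro ge_one_inverse(1) ge_one_design) auto
    have y: "hd ys \<in> carrier_vec (dim p)" using v by (cases ys) auto
    show "(\<lambda>\<omega>. ?f v ys (es n \<omega>)) \<in> borel_measurable (history_algebra p S B t)"
      by (rule measurable_weighted_sum(2)[OF history_resid[OF _ assms] v(1) W y])
  qed (use assms in auto)
  then show "drift n \<in> borel_measurable (history_algebra p S B t)" by (simp add: drift_def[abs_def])
  let ?g = "\<lambda>v ys (e :: real list). scalar_prod (hd ys) (inv_mat (design (dim p) v) *\<^sub>v hd ys)"
  have "(\<lambda>\<omega>. ?g (xs n \<omega>) (map (\<lambda>i. xvec i \<omega>) [n..<n + 1]) (es n \<omega>)) \<in> borel_measurable (history_algebra p S B t)"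
    by (rule history_list_function[where f = ?g and n = n and m = 1]) (use assms in auto)
  then show "spread n \<in> borel_measurable (history_algebra p S B t)" by (simp add: spread_def[abs_def])
qed

lemma prob_confidence:
  assumes sub: "subgaussian_noise p S B" and \<delta>: "\<delta> > 0"
  shows "prob {\<omega> \<in> space M. \<exists>n\<le>horizon p. wealth n \<omega> \<ge> 1 / \<delta>} \<le> \<delta>"
    "{\<omega> \<in> space M. \<exists>n\<le>horizon p. wealth n \<omega> \<ge> 1 / \<delta>} \<in> sets M"
proof -
  have noise: "integrable M (noise_at p S B (Suc t))"
    "integrable M (\<lambda>\<omega>. exp (\<alpha> * noise_at p S B (Suc t) \<omega>))"
    "AE \<omega> in M. real_cond_exp M (history_algebra p S B (Suc t)) (\<lambda>\<omega>. exp (\<alpha> * noise_at p S B (Suc t) \<omega>)) \<omega> \<le> exp (\<alpha>\<^sup>2 / 2)"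
    if "t < horizon p" for t \<alpha>
  proof -
    have "Suc t \<in> {1..horizon p}" using that by simp
    note h = bspec[OF sub[unfolded subgaussian_noise_def] this]
    show "integrable M (noise_at p S B (Suc t))" by (rule conjunct1[OF h])
    note h2 = spec[OF conjunct2[OF conjunct2[OF h]], of \<alpha>]
    show "integrable M (\<lambda>\<omega>. exp (\<alpha> * noise_at p S B (Suc t) \<omega>))" by (rule conjunct1[OF h2])
    show "AE \<omega> in M. real_cond_exp M (history_algebra p S B (Suc t)) (\<lambda>\<omega>. exp (\<alpha> * noise_at p S B (Suc t) \<omega>)) \<omega> \<le> exp (\<alpha>\<^sup>2 / 2)"
      by (rule conjunct2[OF h2])
  qed
  have wm: "wealth n \<in> borel_measurable M" if "n \<le> horizon p" for n
    using that
  proof (induction n)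
    case 0 then show ?case by (simp add: wealth_0[abs_def])
  next
    case (Suc n)
    have n: "n < horizon p" using Suc.prems by simp
    have sa: "subalgebra M (history_algebra p S B (Suc n))" using n by (intro history_subalgebra) simp
    have le: "n < Suc n" "Suc n \<le> horizon p" using n by auto
    note [measurable] = measurable_from_subalg[OF sa history_drift_spread(1)[OF le]]
      measurable_from_subalg[OF sa history_drift_spread(2)[OF le]]
    have [measurable]: "noise_at p S B (Suc n) \<in> borel_measurable M" "wealth n \<in> borel_measurable M"
      using n Suc.IH noise(1)[OF n] by auto
    have "wealth (Suc n) = (\<lambda>\<omega>. wealth n \<omega> * mix_ratio (drift n \<omega>) (spread n \<omega>) (noise_at p S B (Suc n) \<omega>))"
      by (rule ext) (rule wealth_Suc[OF n])
    also have "\<dots> \<in> borel_measurable M" unfolding mix_ratio_def by measurable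
    finally show ?case .
  qed
  have "prob {\<omega> \<in> space M. \<exists>n\<le>horizon p. wealth n \<omega> \<ge> 1 / \<delta>} \<le> 1 / (1 / \<delta>)"
  \<comment> \<open>The step from t to t + 1 is taken relative to the algebra of round t + 1, which
    already knows the arm of that round and hence \<open>drift\<close> and
    \<open>spread\<close>.\<close>
  proof (rule supermartingale_maximal[where F = "\<lambda>t. history_algebra p S B (Suc t)"])
    fix t X assume t: "t < horizon p" and X: "X \<in> sets (history_algebra p S B (Suc t))"
    have sa: "subalgebra M (history_algebra p S B (Suc t))" using t by (intro history_subalgebra) simp
    let ?W = "\<lambda>\<omega>. ennreal (wealth t \<omega>) * indicator X \<omega>"
    have "(\<integral>\<^sup>+\<omega>. ennreal (wealth (Suc t) \<omega>) * indicator X \<omega> \<partial>M)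
        = (\<integral>\<^sup>+\<omega>. ?W \<omega> * ennreal (mix_ratio (drift t \<omega>) (spread t \<omega>) (noise_at p S B (Suc t) \<omega>)) \<partial>M)"
    proof (rule nn_integral_cong)
      fix \<omega>
      have "ennreal (wealth (Suc t) \<omega>) = ennreal (wealth t \<omega>) * ennreal (mix_ratio (drift t \<omega>) (spread t \<omega>) (noise_at p S B (Suc t) \<omega>))"
        unfolding wealth_Suc[OF t] by (rule ennreal_mult[OF wealth_nonneg mix_ratio_nonneg[OF spread_nonneg]])
      then show "ennreal (wealth (Suc t) \<omega>) * indicator X \<omega>
          = ?W \<omega> * ennreal (mix_ratio (drift t \<omega>) (spread t \<omega>) (noise_at p S B (Suc t) \<omega>))"
        by (simp only: mult_ac)
    qed
    also have "\<dots> \<le> (\<integral>\<^sup>+\<omega>. ?W \<omega> \<partial>M)"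
    proof (rule nn_integral_mix_ratio_le[OF sa _ _ _ spread_nonneg spread_zeroD])
      show "?W \<in> borel_measurable (history_algebra p S B (Suc t))"
        by (rule borel_measurable_times_ennreal[OF measurable_compose[OF history_wealth measurable_ennreal]
              borel_measurable_indicator[OF X]]) (use t in auto)
      have le: "t < Suc t" "Suc t \<le> horizon p" using t by auto
      show "drift t \<in> borel_measurable (history_algebra p S B (Suc t))"
        "spread t \<in> borel_measurable (history_algebra p S B (Suc t))" by (rule history_drift_spread[OF le])+
      show "noise_at p S B (Suc t) \<in> borel_measurable M" by (rule borel_measurable_integrable[OF noise(1)[OF t]])
    qed (assumption, rule noise(2)[OF t], rule noise(3)[OF t])
    finally show "(\<integral>\<^sup>+\<omega>. ennreal (wealth (Suc t) \<omega>) * indicator X \<omega> \<partial>M) \<le> (\<integral>\<^sup>+\<omega>. ?W \<omega> \<partial>M)" .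
  next
    show "wealth 0 x = 1" for x by (rule wealth_0)
    show "wealth t \<in> borel_measurable M" if "t \<le> horizon p" for t by (rule wm[OF that])
    show "subalgebra M (history_algebra p S B (Suc t))" if "t < horizon p" for t
      using that by (intro history_subalgebra) simp
    show "wealth s \<in> borel_measurable (history_algebra p S B (Suc t))" if "s \<le> t" "t < horizon p" for s t
      using that by (intro history_wealth) auto
  qed (use \<delta> in simp)
  then show "prob {\<omega> \<in> space M. \<exists>n\<le>horizon p. wealth n \<omega> \<ge> 1 / \<delta>} \<le> \<delta>" by simp
  have "{\<omega> \<in> space M. \<exists>n\<le>horizon p. wealth n \<omega> \<ge> 1 / \<delta>}
      = space M - {\<omega> \<in> space M. \<forall>n<Suc (horizon p). wealth n \<omega> < 1 / \<delta>}" by (auto simp: not_less less_Suc_eq_le)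
  also have "\<dots> \<in> sets M"
    using wm by (intro sets.Diff sets.top sets_Collect_all_less borel_measurable_less) auto
  finally show "{\<omega> \<in> space M. \<exists>n\<le>horizon p. wealth n \<omega> \<ge> 1 / \<delta>} \<in> sets M" .
qed

text \<open>Taking logarithms in wealth < 2 / delta gives |S|^2 <= 2 ln (2 / delta) + ln det V in
  the V^-1 norm, and the determinant bound turns the right-hand side into the radicand of
  \<open>beta\<close>. The leading 1 of \<open>beta\<close> is the regularisation bias.\<close>

lemma noise_sum_norm_le:
  assumes w: "wealth n \<omega> < 2 / conf p" and n: "n \<le> horizon p" and c: "conf p > 0"
  shows "1 + mat_norm (inv_mat (V n \<omega>)) (noise_sum n \<omega>) \<le> beta p"
proof -
  let ?q = "scalar_prod (noise_sum n \<omega>) (inv_mat (V n \<omega>) *\<^sub>v noise_sum n \<omega>)"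
  note det = det_design_le[OF set_xs(2)[where n = n and \<omega> = \<omega>] d]
  have "ln (wealth n \<omega>) < ln (2 / conf p)"
    using w det(1) c by (intro iffD2[OF ln_less_cancel_iff]) (simp_all add: wealth_def)
  moreover have "ln (wealth n \<omega>) = ?q / 2 - ln (det (V n \<omega>)) / 2"
    using det(1) by (simp add: wealth_def ln_div ln_sqrt)
  ultimately have "?q \<le> 2 * ln (2 / conf p) + ln (det (V n \<omega>))" by linarith
  also have "\<dots> \<le> 2 * ln (2 / conf p) + real (dim p) * ln (1 + real n / real (dim p))"
    using det(2) by simp
  also have "\<dots> \<le> 2 * ln (2 / conf p) + real (dim p) * ln (1 + real (horizon p) / real (dim p))"
    using n d by (intro add_left_mono mult_left_mono iffD2[OF ln_le_cancel_iff])
      (auto simp: divide_right_mono intro!: add_pos_nonneg)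
  finally have "sqrt ?q \<le> sqrt (2 * ln (2 / conf p) + real (dim p) * ln (1 + real (horizon p) / real (dim p)))"
    by (rule real_sqrt_le_mono)
  then show ?thesis by (simp add: beta_def mat_norm_def)
qed

end

section \<open>Rounding errors of queries\<close>

section \<open>Rounding of queries\<close>

text \<open>On a finite grid the \<open>arg_min_on\<close> in \<open>round_query\<close> is a true
  minimum.\<close>

lemma finite_grid:
  assumes n: "n \<ge> 1" and e: "\<epsilon> > 0"
  shows "finite (grid n \<epsilon>)"
proof -
  define N where "N = \<lceil>real n / \<epsilon>\<rceil>"
  have "grid n \<epsilon> \<subseteq> (\<lambda>m. vec n (\<lambda>i. of_int (m i) * (\<epsilon> / real n))) ` ({..<n} \<rightarrow>\<^sub>E {-N..N})"
  proof
    fix v assume v: "v \<in> grid n \<epsilon>"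
    then have vc: "v \<in> carrier_vec n" and v1: "scalar_prod v v \<le> 1" by (auto simp: grid_def unit_ball_def norm2_def)
    have "\<forall>i. \<exists>m::int. i < n \<longrightarrow> v $ i = of_int m * (\<epsilon> / real n)" using v by (auto simp: grid_def)
    then obtain m where m: "\<And>i. i < n \<Longrightarrow> v $ i = of_int (m i) * (\<epsilon> / real n)" by metis
    have "m i \<in> {-N..N}" if i: "i < n" for i
    proof -
      have "(v $ i)\<^sup>2 \<le> (\<Sum>i<n. (v $ i)\<^sup>2)" using i by (intro member_le_sum) auto
      also have "\<dots> \<le> 1" using v1 vc by (simp add: scalar_prod_def atLeast0LessThan power2_eq_square)
      finally have "\<bar>v $ i\<bar> \<le> 1" by (simp add: abs_square_le_1)
      then have "\<bar>of_int (m i)\<bar> \<le> real n / \<epsilon>"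
        using m[OF i] n e by (simp add: abs_mult field_simps)
      then have "\<bar>real_of_int (m i)\<bar> \<le> of_int N" unfolding N_def by linarith
      then have "of_int \<bar>m i\<bar> \<le> (of_int N :: real)" by simp
      then have "\<bar>m i\<bar> \<le> N" by (simp only: of_int_le_iff)
      then show ?thesis by auto
    qed
    then have "restrict m {..<n} \<in> {..<n} \<rightarrow>\<^sub>E {-N..N}" by auto
    moreover have "v = vec n (\<lambda>i. of_int (restrict m {..<n} i) * (\<epsilon> / real n))"
      using m vc by (intro eq_vecI) auto
    ultimately show "v \<in> (\<lambda>m. vec n (\<lambda>i. of_int (m i) * (\<epsilon> / real n))) ` ({..<n} \<rightarrow>\<^sub>E {-N..N})" by blast
  qed
  then show ?thesis by (rule finite_subset) (auto intro!: finite_imageI finite_PiE)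
qed

text \<open>Rounding all coordinates towards zero stays in the unit ball.\<close>

lemma round_query_close:
  assumes n: "n \<ge> 1" and e: "\<epsilon> > 0" and q: "q \<in> unit_ball n"
  shows "round_query n \<epsilon> q \<in> unit_ball n" "norm2 (q - round_query n \<epsilon> q) \<le> \<epsilon>"
proof -
  have qc: "q \<in> carrier_vec n" and q1: "scalar_prod q q \<le> 1" using q by (auto simp: unit_ball_def norm2_def)
  define c where "c = \<epsilon> / real n"
  have c: "c > 0" using n e by (simp add: c_def)
  define m where "m i = (if q $ i \<ge> 0 then \<lfloor>q $ i / c\<rfloor> else \<lceil>q $ i / c\<rceil>)" for i
  define v where "v = vec n (\<lambda>i. of_int (m i) * c)"
  have bounds: "\<bar>of_int (m i) * c\<bar> \<le> \<bar>q $ i\<bar> \<and> \<bar>q $ i - of_int (m i) * c\<bar> \<le> c" for i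
  proof (cases "q $ i \<ge> 0")
    case True
    then have "0 \<le> of_int (m i) * c" "of_int (m i) * c \<le> q $ i" "q $ i \<le> (of_int (m i) + 1) * c"
      using c by (simp_all add: m_def pos_le_divide_eq[symmetric] pos_divide_le_eq[symmetric])
    then show ?thesis using True by (simp add: algebra_simps)
  next
    case False
    then have "of_int (m i) * c \<le> 0" "q $ i \<le> of_int (m i) * c" "(of_int (m i) - 1) * c \<le> q $ i"
      using c by (simp_all add: m_def pos_le_divide_eq[symmetric] pos_divide_le_eq[symmetric] mult_le_0_iff
          ceiling_le_zero divide_le_0_iff)
    then show ?thesis using False by (simp add: algebra_simps)
  qed
  have "scalar_prod v v \<le> scalar_prod q q"
  proof -
    have "scalar_prod v v = (\<Sum>i<n. (of_int (m i) * c)\<^sup>2)"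
      by (simp add: v_def scalar_prod_def atLeast0LessThan power2_eq_square)
    also have "\<dots> \<le> (\<Sum>i<n. (q $ i)\<^sup>2)"
      using bounds by (intro sum_mono) (simp add: abs_le_square_iff)
    also have "\<dots> = scalar_prod q q" using qc by (simp add: scalar_prod_def atLeast0LessThan power2_eq_square)
    finally show ?thesis .
  qed
  then have v: "v \<in> grid n \<epsilon>"
    using q1 by (auto simp: grid_def unit_ball_def norm2_def v_def c_def)
  have "norm2 (q - v) \<le> \<epsilon>"
  proof -
    have "scalar_prod (q - v) (q - v) = (\<Sum>i<n. (q $ i - of_int (m i) * c)\<^sup>2)"
      using qc by (simp add: v_def scalar_prod_def atLeast0LessThan power2_eq_square)
    also have "\<dots> \<le> (\<Sum>i<n. c\<^sup>2)"
      using bounds c by (intro sum_mono) (metis abs_le_square_iff abs_of_pos)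
    also have "\<dots> = \<epsilon>\<^sup>2 / real n" using n by (simp add: c_def power2_eq_square field_simps)
    also have "\<dots> \<le> \<epsilon>\<^sup>2 / 1" using n by (intro divide_left_mono) auto
    finally show ?thesis unfolding norm2_def using e by (intro real_le_lsqrt) auto
  qed
  moreover note fin = finite_grid[OF n e]
  have ne: "grid n \<epsilon> \<noteq> {}" using v by auto
  note am = arg_min_if_finite[OF fin ne, of "\<lambda>v. norm2 (q - v)"]
  have "round_query n \<epsilon> q \<in> grid n \<epsilon>" unfolding round_query_def by (rule am(1))
  then show "round_query n \<epsilon> q \<in> unit_ball n" by (simp add: grid_def)
  have "norm2 (q - round_query n \<epsilon> q) \<le> norm2 (q - v)"
    using am(2) v unfolding round_query_def by (auto simp: not_less)
  with \<open>norm2 (q - v) \<le> \<epsilon>\<close> show "norm2 (q - round_query n \<epsilon> q) \<le> \<epsilon>" by simp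
qed

text \<open>Cauchy-Schwarz. This shift is what separates the thresholds r + eps and c r - eps of the
  adaptive problem from r and c r of a single copy.\<close>

lemma round_query_inner:
  assumes n: "n \<ge> 1" and e: "\<epsilon> > 0" and q: "q \<in> unit_ball n" and x: "x \<in> unit_ball n"
  shows "\<bar>scalar_prod q x - scalar_prod (round_query n \<epsilon> q) x\<bar> \<le> \<epsilon>"
proof -
  let ?r = "round_query n \<epsilon> q"
  note r = round_query_close[OF n e q]
  have c: "q \<in> carrier_vec n" "?r \<in> carrier_vec n" "x \<in> carrier_vec n" using q r(1) x by (auto simp: unit_ball_def)
  have "(scalar_prod (q - ?r) x)\<^sup>2 \<le> scalar_prod (q - ?r) (q - ?r) * scalar_prod x x"
    using c by (intro scalar_prod_square_le) auto
  also have "\<dots> \<le> \<epsilon>\<^sup>2 * 1"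
  proof (intro mult_mono)
    show "scalar_prod (q - ?r) (q - ?r) \<le> \<epsilon>\<^sup>2"
      using r(2) e unfolding norm2_def by (simp add: sqrt_le_D)
    show "scalar_prod x x \<le> 1" using x by (simp add: unit_ball_def norm2_def)
  qed (auto intro: scalar_prod_self_nonneg)
  finally have "\<bar>scalar_prod (q - ?r) x\<bar> \<le> \<epsilon>" using e by (simp add: abs_le_square_iff[symmetric])
  then show ?thesis using c by (simp add: minus_scalar_prod_distrib[of _ n])
qed

lemma hist_nth:
  "i < length as \<Longrightarrow> hist B e as ! i
    = (as ! i, scalar_prod (theta B) (feature B (as ! i)) + noise B (take (Suc i) as) e)"
  by (simp add: hist_def)

section \<open>Deterministic analysis of a good outcome: levels, elimination, regret\<close>

section \<open>Levels and confidence widths\<close>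

text \<open>A single outcome on which the wealth stays small in every round and all coins lie in [0,
  1). Everything inside is deterministic.\<close>

locale elimination_run = bandit_setup p S B C for p :: params
    and S :: "nat \<Rightarrow> real \<Rightarrow> real \<Rightarrow> nat \<Rightarrow> 's solver" and B :: "'e bandit" and C +
  fixes \<omega> :: "('s, 'e) outcome"
  assumes T2: "horizon p \<ge> 2" and eta: "eta p = 1 / sqrt (real (horizon p))"
    and conf: "0 < conf p" "conf p < 1"
    and \<omega>: "\<omega> \<in> space (outcome_space p S B)"
    and coins: "\<And>t. t \<in> {1..horizon p} \<Longrightarrow> 0 \<le> fst (snd \<omega>) t \<and> fst (snd \<omega>) t < 1"
    and wealth: "\<And>n. n \<le> horizon p \<Longrightarrow> wealth n \<omega> < 2 / conf p"
begin

sublocale run_trace p S B \<omega> .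

definition val :: "nat \<Rightarrow> real" where
  "val a = scalar_prod (feature B a) (theta B)"

text \<open>By ln 2 >= 2/3 the radicand exceeds 1. The bound puts the lowest level at -2 or below,
  so that \<open>s_max\<close>, which can be as small as -2 for short horizons, belongs to
  \<open>levels\<close>.\<close>

lemma beta_gt: "beta p > 2"
proof -
  have "ln (2 / conf p) \<ge> ln 2" using conf by (simp add: field_simps)
  then have "2 * ln (2 / conf p) > 1" using ln2_ge_two_thirds by linarith
  moreover have "real (dim p) * ln (1 + real (horizon p) / real (dim p)) \<ge> 0" by simp
  ultimately have "sqrt (2 * ln (2 / conf p) + real (dim p) * ln (1 + real (horizon p) / real (dim p))) > sqrt 1"
    by (intro real_sqrt_less_mono) linarith
  then show ?thesis by (simp add: beta_def)
qed

lemma eta_pos: "eta p > 0" "(eta p)\<^sup>2 = 1 / real (horizon p)" "(eta p)\<^sup>2 \<le> 1 / 2"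
  using T2 by (auto simp: eta power_divide)

lemma s_max_ge: "s_max p \<ge> -2"
proof -
  have "1 / (8 * eta p) > 1 / 8"
  proof -
    have "eta p < 1" using T2 by (simp add: eta)
    then show ?thesis using eta_pos(1) by (simp add: field_simps)
  qed
  then have "log 2 (1 / (8 * eta p)) > log 2 (1 / 8)" using eta_pos(1) by (subst log_less_cancel_iff) auto
  also have "log 2 (1 / 8 :: real) = -3"
  proof -
    have "(1 / 8 :: real) = 2 powr (-3)" by (simp add: powr_minus powr_numeral)
    then show ?thesis by (simp only: log_powr_cancel)
  qed
  finally show ?thesis unfolding s_max_def by linarith
qed

lemma s_max_bounds: "2 powr (- of_int (s_max p)) \<le> 8 * eta p" "2 powr (of_int (s_max p) - 1) < 1 / (8 * eta p)"
proof -
  have pos: "1 / (8 * eta p) > 0" using eta_pos by simp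
  have pl: "2 powr (log 2 (1 / (8 * eta p))) = 1 / (8 * eta p)" using pos by (intro powr_log_cancel) auto
  have "2 powr (log 2 (1 / (8 * eta p))) \<le> 2 powr of_int (s_max p)"
    unfolding s_max_def by (intro powr_mono) auto
  then have "1 / (8 * eta p) \<le> 2 powr of_int (s_max p)" unfolding pl .
  then show "2 powr (- of_int (s_max p)) \<le> 8 * eta p"
    using eta_pos(1) by (simp add: powr_minus field_simps)
  have "of_int (s_max p) - 1 < log 2 (1 / (8 * eta p))" unfolding s_max_def by linarith
  then have "2 powr (of_int (s_max p) - 1) < 2 powr (log 2 (1 / (8 * eta p)))"
    by (intro powr_less_mono) auto
  then show "2 powr (of_int (s_max p) - 1) < 1 / (8 * eta p)" unfolding pl .
qed

lemma floor_log_beta: "\<lfloor>- log 2 (beta p)\<rfloor> \<le> -2"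
proof -
  have "log 2 (beta p) > log 2 2" using beta_gt by (subst log_less_cancel_iff) auto
  then show ?thesis by (simp add: floor_le_iff)
qed

lemma level_of_props:
  assumes w: "0 \<le> w" "w \<le> 1"
  shows "beta p * w \<le> 2 powr (- of_int (level_of p w))" "level_of p w \<in> levels p" "level_of p w \<le> s_max p"
proof -
  have smax: "s_max p \<in> levels p" using order_trans[OF floor_log_beta s_max_ge] by (simp add: levels_def)
  show "level_of p w \<le> s_max p" by (simp add: level_of_def)
  show "level_of p w \<in> levels p"
  proof (cases "w = 0")
    case False
    then have "log 2 (beta p * w) \<le> log 2 (beta p)"
      using w beta_gt by (subst log_le_cancel_iff) (auto simp: mult_left_le)
    then have "\<lfloor>- log 2 (beta p)\<rfloor> \<le> \<lfloor>- log 2 (beta p * w)\<rfloor>" by (intro floor_mono) simp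
    then show ?thesis using smax False by (auto simp: level_of_def levels_def)
  qed (use smax in \<open>simp add: level_of_def\<close>)
  show "beta p * w \<le> 2 powr (- of_int (level_of p w))"
  proof (cases "w = 0")
    case False
    then have pos: "beta p * w > 0" using w beta_gt by simp
    have "of_int (level_of p w) \<le> - log 2 (beta p * w)" using False by (simp add: level_of_def) linarith
    then have "2 powr (log 2 (beta p * w)) \<le> 2 powr (- of_int (level_of p w))" by (intro powr_mono) auto
    then show ?thesis using pos by simp
  qed simp
qed

lemma level_of_ge:
  assumes w: "0 \<le> w" and small: "beta p * w < 2 powr (- of_int s - 1)"
  shows "level_of p w \<ge> min (s + 1) (s_max p)"
proof (cases "w = 0")
  case False
  then have pos: "beta p * w > 0" using w beta_gt by simp
  have "log 2 (beta p * w) < log 2 (2 powr (- of_int s - 1))" using pos small by (subst log_less_cancel_iff) auto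
  then have "of_int (s + 1) \<le> - log 2 (beta p * w)" by simp
  then have "s + 1 \<le> \<lfloor>- log 2 (beta p * w)\<rfloor>" by (simp only: le_floor_iff)
  then show ?thesis using False by (simp add: level_of_def)
qed (simp add: level_of_def)

lemma gram_past: "gram p B (past j) = design (dim p) (map (feature B) (arms j))"
  by (simp add: gram_eq_fold_arms past_def design_def fold_map comp_def)

definition accurate :: "(nat \<times> real) list \<Rightarrow> bool" where
  "accurate h \<longleftrightarrow> ge_one (dim p) (gram p B h) \<and>
     (\<forall>a\<in>A. \<bar>scalar_prod (feature B a) (theta_hat p B h) - val a\<bar> \<le> beta p * width p B h a)"

lemma width_bounds:
  assumes "accurate h" "a \<in> A"
  shows "0 \<le> width p B h a" "width p B h a \<le> 1"
    "(width p B h a)\<^sup>2 = scalar_prod (feature B a) (inv_mat (gram p B h) *\<^sub>v feature B a)"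
proof -
  have V: "ge_one (dim p) (gram p B h)" using assms by (simp add: accurate_def)
  note f = inv_mat_form_bounds(2,3)[OF V feature_carrier[OF assms(2)]]
  have "scalar_prod (feature B a) (feature B a) \<le> 1" using feature_ball[OF assms(2)] by (simp add: unit_ball_def norm2_def)
  then show "0 \<le> width p B h a" "width p B h a \<le> 1"
    "(width p B h a)\<^sup>2 = scalar_prod (feature B a) (inv_mat (gram p B h) *\<^sub>v feature B a)"
    using f by (auto simp: width_def mat_norm_def)
qed

lemma xs_arms:
  assumes "set (arms j) \<subseteq> A"
  shows "map (\<lambda>i. xvec i \<omega>) [0..<length (arms j)] = map (feature B) (arms j)"
proof (rule nth_equalityI)
  fix i assume "i < length (map (\<lambda>i. xvec i \<omega>) [0..<length (arms j)])"
  then have i: "i < length (arms j)" by simp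
  then have "arms j ! i \<in> A" using assms by auto
  then show "map (\<lambda>i. xvec i \<omega>) [0..<length (arms j)] ! i = map (feature B) (arms j) ! i"
    using i played_arms_nth[OF T i] by (simp add: xvec_def)
qed simp

text \<open>For legal arms the vectors of the supermartingale are the features and the residuals are
  rewards minus means, so the estimate of the run falls under \<open>ridge_error\<close>.\<close>

lemma accurate_past:
  assumes A: "set (arms j) \<subseteq> A"
  shows "accurate (past j)"
proof -
  define xs where "xs = map (feature B) (arms j)"
  define es where "es = map (\<lambda>i. resid i \<omega>) [0..<length (arms j)]"
  have xs: "set xs \<subseteq> carrier_vec (dim p)" using A feature_carrier by (auto simp: xs_def)
  have xs': "xs = map (\<lambda>i. xvec i \<omega>) [0..<length (arms j)]" using xs_arms[OF A] by (simp add: xs_def)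
  have g: "gram p B (past j) = design (dim p) xs" by (simp add: gram_past xs_def)
  have len: "length es = length xs" by (simp add: es_def xs_def)
  have e: "es ! i = snd (past j ! i) - scalar_prod (theta B) (xs ! i)" if i: "i < length (arms j)" for i
  proof -
    obtain s cs where r: "run p S B \<omega> (Suc i) = Some (s, hist B (snd (snd \<omega>)) (take (Suc i) (arms j)), cs)"
      using run_Some_past[OF T, of "Suc i" j] i by auto
    have "reward_at p S B (Suc i) \<omega> = snd (past j ! i)"
      using i unfolding reward_at_def r by (simp add: past_def hist_nth)
    moreover have "xvec i \<omega> = xs ! i" using xs' i by simp
    ultimately show ?thesis using i by (simp add: es_def resid_def)
  qed
  have Y: "map snd (past j) = map2 (\<lambda>x e. scalar_prod (theta B) x + e) xs es"
    by (rule nth_equalityI) (use e len in \<open>auto simp: xs_def past_def\<close>)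
  have X: "map (\<lambda>(a, r). feature B a) (past j) = xs"
  proof -
    have "map (\<lambda>(a, r). feature B a) (past j) = map (feature B) (map fst (past j))"
      unfolding map_map by (rule map_cong) auto
    then show ?thesis by (simp add: xs_def past_def)
  qed
  have th: "theta_hat p B (past j) = inv_mat (transpose_mat (mat_of_rows (dim p) xs) * mat_of_rows (dim p) xs + 1\<^sub>m (dim p))
      *\<^sub>v (transpose_mat (mat_of_rows (dim p) xs) *\<^sub>v vec_of_list (map2 (\<lambda>x e. scalar_prod (theta B) x + e) xs es))"
    unfolding theta_hat_def Let_def X Y ..
  have b: "1 + mat_norm (inv_mat (design (dim p) xs)) (weighted_sum (dim p) xs es) \<le> beta p"
    using noise_sum_norm_le[OF wealth length_arms conf(1)] length_arms[of j] unfolding xs' es_def by blast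
  have "\<bar>scalar_prod (feature B a) (theta_hat p B (past j)) - val a\<bar> \<le> beta p * width p B (past j) a" if a: "a \<in> A" for a
  proof -
    have "\<bar>scalar_prod (feature B a) (theta_hat p B (past j)) - val a\<bar>
        \<le> width p B (past j) a * (1 + mat_norm (inv_mat (design (dim p) xs)) (weighted_sum (dim p) xs es))"
      unfolding th val_def width_def g
      by (rule ridge_error[OF xs theta_ball len feature_carrier[OF a]])
    also have "\<dots> \<le> width p B (past j) a * beta p"
      using b inv_mat_form_bounds(3)[OF ge_one_design[OF xs] feature_carrier[OF a]]
      by (intro mult_left_mono) (auto simp: width_def mat_norm_def g)
    finally show ?thesis by (simp add: mult.commute)
  qed
  then show ?thesis using ge_one_design[OF xs] by (simp add: accurate_def g)
qed

end

section \<open>Invariants of the elimination\<close>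

context elimination_run
begin

text \<open>Keys are upper confidence bounds, and the lower bound \<open>r\<close> has been raised
  close to the value of every stored arm, both up to 2 * 2^-l. At levels l <= 0 the last clause is
  dropped: initial arms enter without a lower bound, and gaps never exceed 2 anyway. Level 0 is
  allowed above \<open>s_max\<close> because initial arms start there even when \<open>s_max\<close>
  is negative.\<close>

definition placed :: "nat set \<Rightarrow> ereal \<Rightarrow> (int \<Rightarrow> arm_set) \<Rightarrow> bool" where
  "placed N r \<Psi> \<longleftrightarrow> (\<forall>l a k. heap (\<Psi> l) a = Some k \<longrightarrow> a \<in> N \<and> l \<in> levels p \<and> (l \<le> s_max p \<or> l = 0) \<and>
     val a \<le> k \<and> k \<le> val a + 2 * 2 powr (- of_int l) \<and> (l \<le> 0 \<or> ereal (val a - 2 * 2 powr (- of_int l)) \<le> r))"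

text \<open>An arm that is stored nowhere has been eliminated rightly.\<close>

definition covered :: "nat set \<Rightarrow> ereal \<Rightarrow> (int \<Rightarrow> arm_set) \<Rightarrow> bool" where
  "covered N r \<Psi> \<longleftrightarrow> (\<forall>a\<in>N. (\<exists>l. a \<in> arms_of (\<Psi> l)) \<or> ereal (val a) < r)"

text \<open>The last clause keeps the lower bound below some true value, so the best arm can never
  take the exit clause of \<open>covered\<close>.\<close>

definition state_ok :: "nat \<Rightarrow> state \<Rightarrow> bool" where
  "state_ok t s \<longleftrightarrow> placed (arms_at B t) (lower s) (psi s) \<and>
     (\<forall>l a k. heap (psi s l) a = Some k \<longrightarrow> lower s \<le> ereal k) \<and>
     covered (arms_at B t) (lower s) (psi s) \<and>
     (lower s = -\<infinity> \<or> (\<exists>a\<in>arms_at B t. lower s \<le> ereal (val a)))"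

lemma val_bounds: "a \<in> A \<Longrightarrow> \<bar>val a\<bar> \<le> 1"
proof -
  assume a: "a \<in> A"
  have "(val a)\<^sup>2 \<le> scalar_prod (feature B a) (feature B a) * scalar_prod (theta B) (theta B)"
    unfolding val_def using feature_carrier[OF a] theta_ball by (intro scalar_prod_square_le) (auto simp: unit_ball_def)
  also have "\<dots> \<le> 1 * 1"
    using feature_ball[OF a] theta_ball
    by (intro mult_mono) (auto simp: unit_ball_def norm2_def scalar_prod_self_nonneg)
  finally show ?thesis by (simp add: abs_square_le_1)
qed

lemma arms_at_mono: "t \<le> t' \<Longrightarrow> arms_at B t \<subseteq> arms_at B t'"
  by (force simp: arms_at_def)

lemma arms_at_Suc: "arms_at B (Suc t) = arms_at B t \<union> new_arms B (Suc t)"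
  by (auto simp: arms_at_def atLeastAtMostSuc_conv)

lemma finite_arms_at: "t \<le> horizon p \<Longrightarrow> finite (arms_at B t)"
  using arms_at_mono[of t "horizon p"] finite_A finite_subset by auto

lemma placed_mono: "placed N r \<Psi> \<Longrightarrow> N \<subseteq> N' \<Longrightarrow> r \<le> r' \<Longrightarrow> placed N' r' \<Psi>"
  unfolding placed_def by (meson order_trans subsetD)

definition lcb :: "(nat \<times> real) list \<Rightarrow> nat \<Rightarrow> real" where
  "lcb h a = scalar_prod (feature B a) (theta_hat p B h) - beta p * width p B h a"

lemma lcb_le: "accurate h \<Longrightarrow> a \<in> A \<Longrightarrow> lcb h a \<le> val a"
  unfolding accurate_def lcb_def by (auto dest!: bspec[of _ _ a])

text \<open>The estimate is within beta * width <= 2^-s of the value. The key adds 2^-s and so lies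
  between the value and the value plus 2 * 2^-s; the lower confidence bound lies at most 2 * 2^-s
  below the value.\<close>

lemma placed_put:
  assumes h: "accurate h" and a: "a \<in> N" "a \<in> A" and r: "ereal (lcb h a) \<le> r" and \<Psi>: "placed N r \<Psi>"
  shows "placed N r (put_arm p B h a \<Psi>)"
  unfolding placed_def
proof (intro allI impI)
  fix l b k
  assume k: "heap (put_arm p B h a \<Psi> l) b = Some k"
  let ?s = "level_of p (width p B h a)" and ?m = "scalar_prod (feature B a) (theta_hat p B h)"
  let ?goal = "\<lambda>b l k. b \<in> N \<and> l \<in> levels p \<and> (l \<le> s_max p \<or> l = 0) \<and>
     val b \<le> k \<and> k \<le> val b + 2 * 2 powr (- of_int l) \<and> (l \<le> 0 \<or> ereal (val b - 2 * 2 powr (- of_int l)) \<le> r)"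
  show "?goal b l k"
  proof (cases "l = ?s \<and> b = a")
    case False
    then have "heap (\<Psi> l) b = Some k" using k by (auto simp: put_arm_def Let_def psi_add_def split: if_splits)
    then show ?thesis using \<Psi> unfolding placed_def by blast
  next
    case True
    have kk: "k = ?m + 2 powr (- of_int ?s)" using k True by (simp add: put_arm_def Let_def psi_add_def)
    note w = width_bounds[OF h a(2)]
    note lev = level_of_props[OF w(1,2)]
    have acc: "\<bar>?m - val a\<bar> \<le> beta p * width p B h a" using h a(2) by (simp add: accurate_def)
    have "val a - 2 * 2 powr (- of_int ?s) \<le> lcb h a" using acc lev(1) unfolding lcb_def by linarith
    then have "ereal (val a - 2 * 2 powr (- of_int ?s)) \<le> r" using r by (meson ereal_less_eq(3) order_trans)
    moreover have "val a \<le> k" "k \<le> val a + 2 * 2 powr (- of_int ?s)" unfolding kk using acc lev(1) by linarith+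
    ultimately show ?thesis using True a lev by simp
  qed
qed

lemma placed_remove: "placed N r \<Psi> \<Longrightarrow> placed N r (\<Psi>(l := psi_remove a (\<Psi> l)))"
  unfolding placed_def by (auto simp: psi_remove_def split: if_splits)

lemma update_lower_props:
  fixes old :: ereal
  assumes h: "accurate h" and X: "X \<subseteq> A"
  defines "r \<equiv> update_lower p B h X old"
  shows "old \<le> r" "\<And>a. a \<in> X \<Longrightarrow> ereal (lcb h a) \<le> r" "r = old \<or> (\<exists>a\<in>X. r \<le> ereal (val a))"
proof -
  have fin: "finite X" using X finite_A finite_subset by auto
  have r: "r = Max (insert old ((\<lambda>a. ereal (lcb h a)) ` X))" by (simp add: r_def update_lower_def lcb_def)
  show "old \<le> r" "\<And>a. a \<in> X \<Longrightarrow> ereal (lcb h a) \<le> r" unfolding r using fin by (auto intro!: Max_ge)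
  have "r \<in> insert old ((\<lambda>a. ereal (lcb h a)) ` X)" unfolding r using fin by (intro Max_in) auto
  then show "r = old \<or> (\<exists>a\<in>X. r \<le> ereal (val a))"
  proof (elim insertE imageE)
    fix a assume a: "r = ereal (lcb h a)" "a \<in> X"
    then have "r \<le> ereal (val a)" using lcb_le[OF h] X by auto
    then show ?thesis using a(2) by blast
  qed simp
qed

lemma arms_of_placed: "placed N r \<Psi> \<Longrightarrow> arms_of (\<Psi> l) \<subseteq> N"
  by (auto simp: placed_def arms_of_def)

text \<open>An arm is popped when its key is below \<open>r\<close>; as keys bound values from
  above, its value is below \<open>r\<close> too, which is what \<open>covered\<close>
  demands.\<close>

lemma raise_ok:
  assumes h: "accurate h" and t: "t \<le> horizon p" and X: "X \<subseteq> arms_at B t"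
    and r: "r = update_lower p B h X (lower s)"
    and \<Psi>: "placed (arms_at B t) r \<Psi>" "covered (arms_at B t) r \<Psi>"
    and low: "lower s = -\<infinity> \<or> (\<exists>a\<in>arms_at B t. lower s \<le> ereal (val a))"
  shows "state_ok t (raise_and_eliminate p B h X (s\<lparr>psi := \<Psi>\<rparr>))"
proof -
  let ?N = "arms_at B t"
  have XA: "X \<subseteq> A" using X arms_at_mono[OF t] by blast
  have fin: "finite (arms_of (\<Psi> l))" for l
    using arms_of_placed[OF \<Psi>(1)] finite_arms_at[OF t] finite_subset by blast
  let ?s = "raise_and_eliminate p B h X (s\<lparr>psi := \<Psi>\<rparr>)"
  have psi: "psi ?s = (\<lambda>l. psi_eliminate r (\<Psi> l))" and lw: "lower ?s = r"
    unfolding raise_and_eliminate_def Let_def state_update_select r by simp_all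
  have heap: "heap (psi ?s l) a = Some k \<longleftrightarrow> heap (\<Psi> l) a = Some k \<and> r \<le> ereal k" for l a k
    unfolding psi psi_eliminate_heap[OF fin] by (auto split: option.splits simp: not_less)
  have "placed ?N r (psi ?s)" using \<Psi>(1) unfolding placed_def heap by blast
  moreover have "covered ?N r (psi ?s)"
    unfolding covered_def
  proof
    fix a assume a: "a \<in> ?N"
    show "(\<exists>l. a \<in> arms_of (psi ?s l)) \<or> ereal (val a) < r"
    proof (cases "ereal (val a) < r")
      case False
      then obtain l where "a \<in> arms_of (\<Psi> l)" using \<Psi>(2) a unfolding covered_def by blast
      then obtain k where k: "heap (\<Psi> l) a = Some k" by (auto simp: arms_of_def)
      have "val a \<le> k" using \<Psi>(1) k unfolding placed_def by blast
      then have "r \<le> ereal k" using False by (meson ereal_less_eq(3) not_less order_trans)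
      then have "heap (psi ?s l) a = Some k" using heap k by blast
      then show ?thesis by (auto simp: arms_of_def)
    qed simp
  qed
  moreover have "r = -\<infinity> \<or> (\<exists>a\<in>?N. r \<le> ereal (val a))"
    using update_lower_props(3)[OF h XA, where old = "lower s"] low X unfolding r[symmetric] by auto
  ultimately show ?thesis unfolding state_ok_def lw heap by blast
qed

lemma placed_fold_put:
  assumes h: "accurate h" and ys: "set ys \<subseteq> N" "set ys \<subseteq> A" "\<And>a. a \<in> set ys \<Longrightarrow> ereal (lcb h a) \<le> r"
    and \<Psi>: "placed N r \<Psi>"
  shows "placed N r (fold (put_arm p B h) ys \<Psi>)"
  using ys \<Psi>
proof (induction ys arbitrary: \<Psi>)
  case (Cons a ys)
  have "placed N r (put_arm p B h a \<Psi>)" using Cons.prems h by (intro placed_put) auto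
  then show ?case using Cons by simp
qed simp

lemma arms_of_fold_put:
  "(\<exists>l. a \<in> arms_of (\<Psi> l)) \<or> a \<in> set ys \<Longrightarrow> \<exists>l. a \<in> arms_of (fold (put_arm p B h) ys \<Psi> l)"
proof (induction ys arbitrary: \<Psi>)
  case (Cons b ys)
  have "a \<in> arms_of (put_arm p B h b \<Psi> l)" if "a \<in> arms_of (\<Psi> l)" for l
    using that by (cases "l = level_of p (width p B h b)") (simp_all add: arms_of_put_arm)
  moreover have "b \<in> arms_of (put_arm p B h b \<Psi> (level_of p (width p B h b)))" by (simp add: arms_of_put_arm)
  ultimately have "(\<exists>l. a \<in> arms_of (put_arm p B h b \<Psi> l)) \<or> a \<in> set ys"
    using Cons.prems by auto
  from Cons.IH[OF this] show ?case by simp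
qed simp

lemma add_new_ok:
  assumes s: "state_ok t s" and t: "Suc t \<le> horizon p" and h: "accurate h"
  shows "state_ok (Suc t) (add_new_arms p B h (new_arms B (Suc t)) s)"
  unfolding add_new_arms_def
proof (rule raise_ok[OF h t _ refl])
  let ?X = "new_arms B (Suc t)" and ?N = "arms_at B (Suc t)"
  let ?r = "update_lower p B h ?X (lower s)"
  show X: "?X \<subseteq> ?N" by (simp add: arms_at_Suc)
  then have XA: "?X \<subseteq> A" using arms_at_mono[OF t] by blast
  then have fin: "finite ?X" using finite_A finite_subset by blast
  note u = update_lower_props[OF h XA, where old = "lower s"]
  have pl: "placed ?N ?r (psi s)"
    using s u(1) unfolding state_ok_def by (auto intro: placed_mono simp: arms_at_Suc)
  show "placed ?N ?r (fold (put_arm p B h) (sorted_list_of_set ?X) (psi s))"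
    using X XA fin u(2) pl by (intro placed_fold_put[OF h]) auto
  show "covered ?N ?r (fold (put_arm p B h) (sorted_list_of_set ?X) (psi s))"
    unfolding covered_def
  proof
    fix a assume "a \<in> ?N"
    then have "(\<exists>l. a \<in> arms_of (psi s l)) \<or> a \<in> set (sorted_list_of_set ?X) \<or> ereal (val a) < lower s"
      using s fin unfolding state_ok_def covered_def arms_at_Suc by auto
    then show "(\<exists>l. a \<in> arms_of (fold (put_arm p B h) (sorted_list_of_set ?X) (psi s) l)) \<or> ereal (val a) < ?r"
      using arms_of_fold_put[of a "psi s"] u(1) less_le_trans by blast
  qed
  show "lower s = -\<infinity> \<or> (\<exists>a\<in>?N. lower s \<le> ereal (val a))"
    using s unfolding state_ok_def arms_at_Suc by blast
qed

text \<open>Initial keys are 0 + 2^0 = 1 and values lie in [-1, 1], so each key lies between the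
  value and the value plus 2.\<close>

lemma initial_ok: "state_ok 0 (initial_state p B)"
proof -
  let ?f = "\<lambda>a. psi_add (feature B a) a (0\<^sub>v (dim p)) 0"
  have IA: "init_arms B \<subseteq> A" by (auto simp: arms_at_def)
  then have fin: "finite (init_arms B)" using finite_A finite_subset by blast
  have h: "heap (fold ?f ys \<Psi>) = (\<lambda>a. if a \<in> set ys then Some 1 else heap \<Psi> a)" if "set ys \<subseteq> A" for ys \<Psi>
    using that
  proof (induction ys arbitrary: \<Psi>)
    case (Cons a ys)
    have "scalar_prod (feature B a) (0\<^sub>v (dim p)) = 0" using feature_carrier Cons.prems by auto
    then show ?case using Cons by (auto simp: psi_add_def fun_eq_iff)
  qed simp
  have heap: "heap (psi (initial_state p B) l) a = (if l = 0 \<and> a \<in> init_arms B then Some 1 else None)" for l a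
    using h[of "sorted_list_of_set (init_arms B)"] IA fin by (simp add: initial_state_def)
  have z: "0 \<in> levels p" using floor_log_beta by (simp add: levels_def)
  have a0: "arms_at B 0 = init_arms B" by (simp add: arms_at_def)
  have "placed (arms_at B 0) (-\<infinity>) (psi (initial_state p B))"
    unfolding placed_def heap a0 using z val_bounds IA by (auto split: if_splits simp: abs_le_iff) (force+)?
  moreover have "covered (arms_at B 0) (-\<infinity>) (psi (initial_state p B))"
    unfolding covered_def a0 arms_of_def by (auto simp: heap dom_def)
  ultimately show ?thesis unfolding state_ok_def by (simp add: initial_state_def)
qed

lemma fold_move_placed:
  assumes h: "accurate h" and ys: "set ys \<subseteq> N" "set ys \<subseteq> A" "\<And>a. a \<in> set ys \<Longrightarrow> ereal (lcb h a) \<le> r"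
    and \<Psi>: "placed N r \<Psi>"
  shows "placed N r (fold (\<lambda>a \<Psi>. put_arm p B h a (\<Psi>(l := psi_remove a (\<Psi> l)))) ys \<Psi>)"
  using ys \<Psi>
proof (induction ys arbitrary: \<Psi>)
  case (Cons a ys)
  have "placed N r (put_arm p B h a (\<Psi>(l := psi_remove a (\<Psi> l))))"
    using Cons.prems h by (intro placed_put placed_remove) auto
  then show ?case unfolding fold_Cons comp_apply
    by (rule Cons.IH[rotated -1]) (use Cons.prems in auto)
qed simp

lemma fold_move_covers:
  assumes "distinct ys" "(\<exists>l. a \<in> arms_of (\<Psi> l)) \<or> a \<in> set ys"
  shows "\<exists>l'. a \<in> arms_of (fold (\<lambda>a \<Psi>. put_arm p B h a (\<Psi>(l := psi_remove a (\<Psi> l)))) ys \<Psi> l')"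
  using assms
proof (induction ys arbitrary: \<Psi>)
  case (Cons b ys)
  have "(\<exists>l'. a \<in> arms_of (put_arm p B h b (\<Psi>(l := psi_remove b (\<Psi> l))) l')) \<or> a \<in> set ys"
  proof (cases "a = b")
    case True
    have "b \<in> arms_of (put_arm p B h b (\<Psi>(l := psi_remove b (\<Psi> l))) (level_of p (width p B h b)))"
      by (simp add: arms_of_put_arm)
    then show ?thesis using True by blast
  next
    case False
    have "a \<in> arms_of (put_arm p B h b (\<Psi>(l := psi_remove b (\<Psi> l))) l')" if "a \<in> arms_of (\<Psi> l')" for l'
      using that False by (cases "l' = level_of p (width p B h b)"; cases "l' = l")
        (simp_all add: arms_of_put_arm arms_of_psi_remove)
    then show ?thesis using Cons.prems(2) False by auto
  qed
  then show ?case unfolding fold_Cons comp_apply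
    by (rule Cons.IH[rotated]) (use Cons.prems(1) in simp)
qed simp

lemma fold_move_levels:
  assumes "distinct ys" "a \<in> arms_of (fold (\<lambda>a \<Psi>. put_arm p B h a (\<Psi>(l := psi_remove a (\<Psi> l)))) ys \<Psi> l')"
  shows "(a \<in> arms_of (\<Psi> l') \<and> (l' = l \<longrightarrow> a \<notin> set ys)) \<or> (a \<in> set ys \<and> l' = level_of p (width p B h a))"
  using assms
proof (induction ys arbitrary: \<Psi>)
  case (Cons b ys)
  have "a \<in> arms_of (fold (\<lambda>a \<Psi>. put_arm p B h a (\<Psi>(l := psi_remove a (\<Psi> l)))) ys (put_arm p B h b (\<Psi>(l := psi_remove b (\<Psi> l)))) l')"
    using Cons.prems(2) unfolding fold_Cons comp_apply .
  from Cons.IH[OF _ this] Cons.prems(1)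
  have "(a \<in> arms_of (put_arm p B h b (\<Psi>(l := psi_remove b (\<Psi> l))) l') \<and> (l' = l \<longrightarrow> a \<notin> set ys)) \<or>
      (a \<in> set ys \<and> l' = level_of p (width p B h a))" by auto
  then show ?case by (auto simp: arms_of_put_arm arms_of_psi_remove split: if_splits)
qed simp

lemma move_ok:
  assumes s: "state_ok t s" and t: "t \<le> horizon p" and h: "accurate h"
  shows "state_ok t (move_arms p B h s)"
proof -
  let ?l = "current_level s"
  let ?X = "arms_of (psi s ?l)" and ?N = "arms_at B t"
  let ?r = "update_lower p B h ?X (lower s)"
  let ?f = "\<lambda>a \<Psi>. put_arm p B h a (\<Psi>(?l := psi_remove a (\<Psi> ?l)))"
  have pl0: "placed ?N (lower s) (psi s)" using s by (simp add: state_ok_def)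
  have X: "?X \<subseteq> ?N" by (rule arms_of_placed[OF pl0])
  then have XA: "?X \<subseteq> A" using arms_at_mono[OF t] by blast
  then have fin: "finite ?X" using finite_A finite_subset by blast
  note u = update_lower_props[OF h XA, where old = "lower s"]
  have pl: "placed ?N ?r (psi s)" using placed_mono[OF pl0 order_refl u(1)] .
  show ?thesis unfolding move_arms_def Let_def
  proof (rule raise_ok[OF h t X refl])
    show "placed ?N ?r (fold ?f (sorted_list_of_set ?X) (psi s))"
      using X XA fin u(2) pl by (intro fold_move_placed[OF h]) auto
    show "covered ?N ?r (fold ?f (sorted_list_of_set ?X) (psi s))"
      unfolding covered_def
    proof
      fix a assume "a \<in> ?N"
      then have "((\<exists>l. a \<in> arms_of (psi s l)) \<or> a \<in> set (sorted_list_of_set ?X)) \<or> ereal (val a) < lower s"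
        using s unfolding state_ok_def covered_def by blast
      then show "(\<exists>l. a \<in> arms_of (fold ?f (sorted_list_of_set ?X) (psi s) l)) \<or> ereal (val a) < ?r"
        using fold_move_covers[of "sorted_list_of_set ?X" a "psi s"] u(1) less_le_trans by fastforce
    qed
    show "lower s = -\<infinity> \<or> (\<exists>a\<in>?N. lower s \<le> ereal (val a))" using s unfolding state_ok_def by blast
  qed
qed

lemma arms_of_move:
  assumes s: "state_ok t s" and t: "t \<le> horizon p" and h: "accurate h"
    and a: "a \<in> arms_of (psi (move_arms p B h s) l')"
  shows "(a \<in> arms_of (psi s l') \<and> l' \<noteq> current_level s) \<or>
    (a \<in> arms_of (psi s (current_level s)) \<and> l' = level_of p (width p B h a))"
proof -
  let ?X = "arms_of (psi s (current_level s))"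
  have "?X \<subseteq> arms_at B t" using s arms_of_placed unfolding state_ok_def by blast
  then have fin: "finite ?X" using finite_arms_at[OF t] finite_subset by blast
  have "a \<in> arms_of (fold (\<lambda>a \<Psi>. put_arm p B h a (\<Psi>(current_level s := psi_remove a (\<Psi> (current_level s)))))
      (sorted_list_of_set ?X) (psi s) l')"
    using a arms_of_psi_eliminate_subset unfolding move_arms_def Let_def raise_and_eliminate_def state_update_select
    by fastforce
  from fold_move_levels[OF _ this] fin show ?thesis by auto
qed

lemma best_arm_stored:
  assumes s: "state_ok t s" and t: "t \<le> horizon p" and b: "b \<in> arms_at B t"
    and best: "\<And>a. a \<in> arms_at B t \<Longrightarrow> val a \<le> val b"
  shows "\<exists>l. b \<in> arms_of (psi s l)"
proof (rule ccontr)
  assume "\<not> (\<exists>l. b \<in> arms_of (psi s l))"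
  then have lt: "ereal (val b) < lower s" using s b unfolding state_ok_def covered_def by blast
  then obtain a where "a \<in> arms_at B t" "lower s \<le> ereal (val a)" using s unfolding state_ok_def by auto
  then show False using best[of a] lt by (meson ereal_less_eq(3) leD order_trans)
qed

lemma levels_finite: "set (sorted_list_of_set (levels p)) = levels p"
  by (simp add: levels_def)

lemma state_ok_levels:
  assumes "state_ok t s" "l \<notin> levels p"
  shows "arms_of (psi s l) = {}"
proof -
  have "placed (arms_at B t) (lower s) (psi s)" using assms(1) by (simp add: state_ok_def)
  then have "heap (psi s l) a = None" for a
    using assms(2) unfolding placed_def by (cases "heap (psi s l) a") blast+
  then show ?thesis by (simp add: arms_of_def dom_def)
qed

text \<open>The best arm b is stored at a level l not below the current level c, so val b - 2 * 2^-l
  <= lower bound <= key of a <= val a + 2 * 2^-c. If l <= 0 then c <= 0 as well, and the trivial gap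
  2 suffices.\<close>

lemma gap_le:
  assumes s: "state_ok t s" and t: "t \<le> horizon p" and b: "b \<in> arms_at B t"
    and best: "\<And>a. a \<in> arms_at B t \<Longrightarrow> val a \<le> val b" and a: "a \<in> arms_of (psi s (current_level s))"
  shows "val b - val a \<le> 4 * 2 powr (- of_int (current_level s))"
proof -
  let ?c = "current_level s"
  obtain l where l: "b \<in> arms_of (psi s l)" using best_arm_stored[OF s t b best] by auto
  have cl: "?c \<le> l"
    using current_level_in(3)[of s l "sorted_list_of_set (levels p)"] l state_ok_levels[OF s]
    unfolding levels_finite by blast
  then have pw: "2 powr (- of_int l) \<le> 2 powr (- of_int ?c :: real)" by (intro powr_mono) auto
  obtain k where k: "heap (psi s ?c) a = Some k" using a by (auto simp: arms_of_def)
  have pk: "k \<le> val a + 2 * 2 powr (- of_int ?c)" "a \<in> arms_at B t" "lower s \<le> ereal k"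
    using s k unfolding state_ok_def placed_def by blast+
  obtain k' where k': "heap (psi s l) b = Some k'" using l by (auto simp: arms_of_def)
  have "l \<le> 0 \<or> ereal (val b - 2 * 2 powr (- of_int l)) \<le> lower s"
    using s k' unfolding state_ok_def placed_def by blast
  then show ?thesis
  proof
    assume "l \<le> 0"
    then have "2 powr 0 \<le> 2 powr (- of_int ?c :: real)" using cl by (intro powr_mono) auto
    moreover have "\<bar>val a\<bar> \<le> 1" "\<bar>val b\<bar> \<le> 1" using val_bounds pk(2) b arms_at_mono[OF t] by blast+
    ultimately show ?thesis by simp
  next
    assume "ereal (val b - 2 * 2 powr (- of_int l)) \<le> lower s"
    then have "val b - 2 * 2 powr (- of_int l) \<le> k" using pk(3) by (meson ereal_less_eq(3) order_trans)
    then show ?thesis using pk(1) pw by linarith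
  qed
qed

end

section \<open>Soundness of the selected arms and the regret\<close>

context elimination_run
begin

lemma good_st: "good_set (point_of B) A (psi (st j) l)"
proof -
  have "snd (snd \<omega>) \<in> space (env B)" using \<omega> by (auto simp: outcome_space_def space_pair_measure)
  then show ?thesis using mst_config[OF T, of "trace j"] unfolding mstate_def mset_fun_def st_def by blast
qed

lemma seed_in: "(s, i) \<in> (SIGMA s : levels p. {..<copies p s}) \<Longrightarrow> fst \<omega> (s, i) \<in> space (seed_dist (level_solver p S s))"
proof -
  assume c: "(s, i) \<in> (SIGMA s : levels p. {..<copies p s})"
  have "fst \<omega> \<in> space seed_space" using \<omega> by (auto simp: outcome_space_def space_pair_measure)
  then show ?thesis unfolding space_PiM using PiE_mem[OF _ c] by fastforce
qed

lemma point_of_ball: "a \<in> A \<Longrightarrow> point_of B a \<in> unit_ball (point_dim p)"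
  using vectorize_outer_unit_ball[OF feature_ball d] feature_carrier[of a] by (simp add: point_of_def point_dim_def)

lemma admissible_updates:
  assumes "good_set (point_of B) A \<Psi>"
  shows "admissible (point_dim p) (max_arms p) (updates \<Psi>)"
proof -
  have us: "\<And>u. u \<in> set (updates \<Psi>) \<Longrightarrow> \<exists>a\<in>A. u = Insert a (point_of B a) \<or> u = Delete a"
    using assms by (simp add: good_set_def)
  have dom: "dom (content us) \<subseteq> A" if "\<And>u. u \<in> set us \<Longrightarrow> \<exists>a\<in>A. u = Insert a (point_of B a) \<or> u = Delete a" for us
    using that
  proof (induction us rule: rev_induct)
    case Nil then show ?case by (simp add: content_def)
  next
    case (snoc u us)
    have IH: "dom (content us) \<subseteq> A" using snoc by auto
    obtain a where a: "a \<in> A" "u = Insert a (point_of B a) \<or> u = Delete a" using snoc.prems[of u] by auto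
    from a(2) show ?case
    proof
      assume "u = Insert a (point_of B a)"
      then have "dom (content (us @ [u])) = insert a (dom (content us))" by (auto simp: content_snoc dom_def)
      then show ?case using IH a(1) by (simp del: dom_fun_upd)
    next
      assume "u = Delete a"
      then have "dom (content (us @ [u])) = dom (content us) - {a}" by (simp add: content_snoc)
      then show ?case using IH by blast
    qed
  qed
  have card: "card A = max_arms p" using valid by (simp add: valid_bandit_def)
  show ?thesis unfolding admissible_def
  proof (intro conjI allI impI)
    fix a q assume "Insert a q \<in> set (updates \<Psi>)"
    then show "q \<in> unit_ball (point_dim p)" using us point_of_ball by fastforce
  next
    fix i
    have "dom (content (take i (updates \<Psi>))) \<subseteq> A" by (rule dom) (auto dest: in_set_takeD us)
    then show "card (dom (content (take i (updates \<Psi>)))) \<le> max_arms p"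
      unfolding card[symmetric] by (rule card_mono[OF finite_A])
  qed
qed

lemma mips_eps_pos: "mips_eps p s > 0"
  unfolding mips_eps_def using eta_pos(1) beta_gt d
  by (intro divide_pos_pos mult_pos_pos zero_less_power) auto

lemma point_dim_ge: "point_dim p \<ge> 1"
  using d by (simp add: point_dim_def)

definition query :: "(nat \<times> real) list \<Rightarrow> real vec" where
  "query h = vectorize ((1 / real (dim p)) \<cdot>\<^sub>m inv_mat (gram p B h))"

lemma query_ball: "accurate h \<Longrightarrow> query h \<in> unit_ball (point_dim p)"
  unfolding query_def point_dim_def by (intro vectorize_inv_mat_unit_ball d) (simp add: accurate_def)

lemma query_point:
  assumes h: "accurate h" and a: "a \<in> A"
  shows "scalar_prod (query h) (point_of B a) = (width p B h a)\<^sup>2 / (real (dim p))\<^sup>2"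
proof -
  have V: "ge_one (dim p) (gram p B h)" using h by (simp add: accurate_def)
  have dv: "dim_vec (feature B a) = dim p" using feature_carrier[OF a] by simp
  show ?thesis
    unfolding query_def point_of_def dv width_bounds(3)[OF h a]
    by (subst scalar_prod_vectorize_outer[OF ge_one_inverse(1)[OF V] feature_carrier[OF a]]) (simp add: power_divide)
qed

lemma content_good: "good_set pt A' \<Psi> \<Longrightarrow> content (updates \<Psi>) a = (if a \<in> arms_of \<Psi> then Some (pt a) else None)"
  by (simp add: good_set_def)

text \<open>Copies never return a point below their threshold, so whatever the seeds, a returned arm
  is good for the rounded query; rounding costs \<open>mips_eps\<close>. The regret is thus
  unaffected by the error probability of the solver.\<close>

lemma oracle_sound:
  assumes l: "l \<in> levels p" and \<Psi>: "good_set (point_of B) A \<Psi>" and q: "q \<in> unit_ball (point_dim p)"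
    and a: "solver_oracle p S (fst \<omega>) l (updates \<Psi>) q = Some a"
  shows "a \<in> arms_of \<Psi>" "scalar_prod q (point_of B a) \<ge> mips_r p l / 4 - mips_eps p l"
proof -
  let ?q = "round_query (point_dim p) (mips_eps p l) q"
  let ?out = "\<lambda>i. answer (level_solver p S l) (fst \<omega> (l, i)) (updates \<Psi>) ?q"
  note rq = round_query_close(1)[OF point_dim_ge mips_eps_pos[of l] q]
  have sol: "\<forall>z\<in>space (seed_dist (level_solver p S l)).
      mips_sound (1/4) (mips_r p l) 0 (content (updates \<Psi>)) ?q (answer (level_solver p S l) z (updates \<Psi>) ?q)"
    using solver[OF l] admissible_updates[OF \<Psi>] rq unfolding solves_mips_def by blast
  let ?P = "\<lambda>i. i < copies p l \<and> ?out i \<noteq> None"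
  have ex: "\<exists>i. ?P i" and out: "?out (LEAST i. ?P i) = Some a"
    using a unfolding solver_oracle_def adaptive_answer_def Let_def by (auto split: if_splits)
  have P: "?P (LEAST i. ?P i)" by (rule LeastI_ex[OF ex])
  then have "fst \<omega> (l, LEAST i. ?P i) \<in> space (seed_dist (level_solver p S l))" using l by (intro seed_in) auto
  from bspec[OF sol this] out obtain x where x: "content (updates \<Psi>) a = Some x" "scalar_prod ?q x \<ge> 1/4 * mips_r p l - 0"
    unfolding mips_sound_def by auto
  show arm: "a \<in> arms_of \<Psi>" using x(1) content_good[OF \<Psi>, of a] by (auto split: if_splits)
  then have aA: "a \<in> A" using \<Psi> by (auto simp: good_set_def)
  have "x = point_of B a" using x(1) content_good[OF \<Psi>, of a] arm by simp
  with x(2) have "scalar_prod ?q (point_of B a) \<ge> mips_r p l / 4" by simp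
  then show "scalar_prod q (point_of B a) \<ge> mips_r p l / 4 - mips_eps p l"
    using round_query_inner[OF point_dim_ge mips_eps_pos[of l] q point_of_ball[OF aA]] by linarith
qed

lemma state_ok_nonempty:
  assumes s: "state_ok t s" and ne: "arms_of (psi s l) \<noteq> {}"
  shows "arms_of (psi s (current_level s)) \<noteq> {}" "current_level s \<in> levels p" "current_level s \<le> l"
  using current_level_in[of s l "sorted_list_of_set (levels p)"] ne state_ok_levels[OF s]
  unfolding levels_finite by blast+

lemma pick_sound:
  assumes s: "state_ok t s" and t: "t \<le> horizon p" and good: "\<And>l. good_set (point_of B) A (psi s l)"
    and h: "accurate h" and u: "0 \<le> u" "u < 1"
    and a: "pick p B (solver_oracle p S (fst \<omega>)) u h s = Some a"
  shows "a \<in> arms_of (psi s (current_level s))"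
    "current_level s = s_max p \<or> mips_r p (current_level s) / 4 - mips_eps p (current_level s)
        \<le> (width p B h a)\<^sup>2 / (real (dim p))\<^sup>2"
proof -
  let ?l = "current_level s"
  let ?X = "arms_of (psi s ?l)"
  have ne: "\<not> (\<forall>l. arms_of (psi s l) = {})" using a by (auto simp: pick_def Let_def split: if_splits)
  then obtain l where "arms_of (psi s l) \<noteq> {}" by blast
  note cl = state_ok_nonempty[OF s this]
  have XA: "?X \<subseteq> A" using good[of ?l] by (simp add: good_set_def)
  then have fin: "finite ?X" using finite_A finite_subset by blast
  have "a \<in> ?X \<and> (?l = s_max p \<or> mips_r p ?l / 4 - mips_eps p ?l \<le> (width p B h a)\<^sup>2 / (real (dim p))\<^sup>2)"
  proof (cases "?l = s_max p")
    case True
    then have "a = sorted_list_of_set ?X ! nat \<lfloor>u * real (card ?X)\<rfloor>"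
      using a ne by (auto simp: pick_def Let_def)
    moreover have "nat \<lfloor>u * real (card ?X)\<rfloor> < card ?X"
    proof -
      have c: "card ?X > 0" using cl(1) fin by (simp add: card_gt_0_iff)
      then have "u * real (card ?X) < 1 * real (card ?X)" using u by (intro mult_strict_right_mono) auto
      then have "\<lfloor>u * real (card ?X)\<rfloor> < int (card ?X)" by (simp add: floor_less_iff)
      then show ?thesis using c by (simp add: nat_less_iff)
    qed
    ultimately have "a \<in> set (sorted_list_of_set ?X)" using fin by (metis length_sorted_list_of_set nth_mem)
    then show ?thesis using fin True by simp
  next
    case False
    then have o: "solver_oracle p S (fst \<omega>) ?l (updates (psi s ?l)) (query h) = Some a"
      using a ne by (auto simp: pick_def Let_def query_def split: if_splits)
    note os = oracle_sound[OF cl(2) good query_ball[OF h] o]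
    then have "a \<in> A" using XA by blast
    then show ?thesis using os query_point[OF h] by simp
  qed
  then show "a \<in> ?X" "?l = s_max p \<or> mips_r p ?l / 4 - mips_eps p ?l \<le> (width p B h a)\<^sup>2 / (real (dim p))\<^sup>2" by blast+
qed

lemma fst_att: "fst (att j) = pick p B (solver_oracle p S (fst \<omega>)) (fst (snd \<omega>) (Suc (length (arms j)))) (past j) (st j)"
  unfolding att_def by (rule fst_attempt)

text \<open>Both parts feed each other: legality of the played arms makes the estimates accurate,
  accuracy preserves \<open>state_ok\<close>, and this makes the next arm legal.\<close>

lemma run_invariant:
  "set (arms j) \<subseteq> A \<and> (length (arms j) < horizon p \<longrightarrow> state_ok (Suc (length (arms j))) (st j))"
proof (induction j)
  case 0
  have "accurate (past 0)" by (rule accurate_past) (simp add: arms_0)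
  moreover have "past 0 = []" by (simp add: past_def arms_0)
  ultimately have "state_ok (Suc 0) (add_new_arms p B [] (new_arms B (Suc 0)) (initial_state p B))"
    using T by (intro add_new_ok initial_ok) auto
  then show ?case by (simp add: arms_0 st_0)
next
  case (Suc j)
  show ?case
  proof (cases "length (arms j) < horizon p")
    case False
    then show ?thesis using done_Suc[of j] Suc by simp
  next
    case True
    have s: "state_ok (Suc (length (arms j))) (st j)" and sub: "set (arms j) \<subseteq> A" using Suc True by auto
    have t: "Suc (length (arms j)) \<le> horizon p" using True by simp
    have h: "accurate (past j)" by (rule accurate_past[OF sub])
    show ?thesis
    proof (cases "fst (att j)")
      case None
      then show ?thesis using None_Suc[OF True None] move_ok[OF s t h] sub by simp
    next
      case (Some a)
      note nx = Some_Suc[OF True Some]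
      have u: "0 \<le> fst (snd \<omega>) (Suc (length (arms j)))" "fst (snd \<omega>) (Suc (length (arms j))) < 1"
        using coins[of "Suc (length (arms j))"] t by auto
      have "a \<in> arms_of (psi (st j) (current_level (st j)))"
        using pick_sound(1)[OF s t good_st h u] Some fst_att by simp
      then have "a \<in> A" using good_st[of j "current_level (st j)"] by (auto simp: good_set_def)
      then have sub': "set (arms (Suc j)) \<subseteq> A" using nx sub by simp
      then have h': "accurate (past (Suc j))" by (rule accurate_past)
      show ?thesis
      proof (intro conjI impI sub')
        assume "length (arms (Suc j)) < horizon p"
        then have lt: "Suc (length (arms j)) < horizon p" using nx by simp
        then have "st (Suc j) = add_new_arms p B (past (Suc j)) (new_arms B (Suc (Suc (length (arms j))))) (st j)" using nx by simp
        moreover have "state_ok (Suc (Suc (length (arms j)))) (add_new_arms p B (past (Suc j)) (new_arms B (Suc (Suc (length (arms j))))) (st j))"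
          using lt by (intro add_new_ok[OF s _ h']) simp
        ultimately show "state_ok (Suc (length (arms (Suc j)))) (st (Suc j))" using nx by simp
      qed
    qed
  qed
qed

lemma optimal_arm_best:
  assumes t: "t \<le> horizon p" and ne: "arms_at B t \<noteq> {}"
  shows "optimal_arm B t \<in> arms_at B t" "\<And>a. a \<in> arms_at B t \<Longrightarrow> val a \<le> val (optimal_arm B t)"
proof -
  have fin: "finite (arms_at B t)" by (rule finite_arms_at[OF t])
  have "Max (val ` arms_at B t) \<in> val ` arms_at B t" using fin ne by (intro Max_in) auto
  then obtain b where b: "b \<in> arms_at B t" "val b = Max (val ` arms_at B t)" by auto
  have mx: "val a \<le> val b" if "a \<in> arms_at B t" for a using b(2) fin that by simp
  have "optimal_arm B t \<in> arms_at B t \<and> (\<forall>a\<in>arms_at B t. \<not> val a > val (optimal_arm B t))"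
    unfolding optimal_arm_def arg_max_on_def val_def[symmetric]
    by (rule arg_maxI[of _ b]) (use b mx in \<open>auto simp: not_less\<close>)
  then show "optimal_arm B t \<in> arms_at B t" "\<And>a. a \<in> arms_at B t \<Longrightarrow> val a \<le> val (optimal_arm B t)"
    by (auto simp: not_less)
qed

text \<open>At the top level the gap is at most 4 * 2^-s with 2^-s <= 8 eta. Below it the returned
  arm satisfies (beta w)^2 >= 4^-s / 64, so 2^-s <= 8 beta w and four times this bounds the
  gap.\<close>

lemma gap_bound:
  assumes T8: "horizon p \<ge> 8" and j: "length (arms j) < horizon p" and a: "fst (att j) = Some a"
  shows "val (optimal_arm B (Suc (length (arms j)))) - val a
    \<le> 32 / sqrt (real (horizon p)) + 32 * beta p * width p B (past j) a"
proof -
  let ?t = "Suc (length (arms j))" and ?s = "st j"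
  let ?l = "current_level ?s" and ?w = "width p B (past j) a"
  have t: "?t \<le> horizon p" using j by simp
  have sub: "set (arms j) \<subseteq> A" and s: "state_ok ?t ?s" using run_invariant[of j] j by auto
  have h: "accurate (past j)" by (rule accurate_past[OF sub])
  have u: "0 \<le> fst (snd \<omega>) ?t" "fst (snd \<omega>) ?t < 1" using coins[of ?t] t by auto
  note ps = pick_sound[OF s t good_st h u, of a, unfolded fst_att[symmetric], OF a]
  have "a \<in> arms_at B ?t" using s ps(1) arms_of_placed unfolding state_ok_def by blast
  then have ne: "arms_at B ?t \<noteq> {}" and aA: "a \<in> A" using arms_at_mono[OF t] by auto
  note w = width_bounds[OF h aA]
  have gap: "val (optimal_arm B ?t) - val a \<le> 4 * 2 powr (- of_int ?l)"
    using optimal_arm_best[OF t ne] by (intro gap_le[OF s t _ _ ps(1)])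
  have bw: "beta p * ?w \<ge> 0" using beta_gt w(1) by simp
  show ?thesis
  proof (cases "?l = s_max p")
    case True
    have "4 * 2 powr (- of_int (s_max p)) \<le> 32 / sqrt (real (horizon p))"
      using s_max_bounds(1) by (simp add: eta)
    then show ?thesis using gap bw True by simp
  next
    case False
    let ?b = "2 powr (- of_int ?l) :: real"
    have pw: "2 powr (- 2 * of_int ?l - 2) = ?b\<^sup>2 / 4"
      by (simp add: powr_diff powr_numeral power2_eq_square powr_add[symmetric])
    \<comment> \<open>T >= 8 keeps the approximate threshold positive: (1 - eta^2) / 4 - eta^2
      vanishes at eta^2 = 1/5 and equals 3/32 at eta^2 = 1/8.\<close>
    have "(eta p)\<^sup>2 \<le> 1 / 8" unfolding eta_pos(2) using T8 by (simp add: field_simps)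
    then have "(1 - (eta p)\<^sup>2) / 4 - (eta p)\<^sup>2 \<ge> 1 / 16" by (simp add: diff_divide_distrib)
    then have "?b\<^sup>2 / 4 * (1 / 16) \<le> ?b\<^sup>2 / 4 * ((1 - (eta p)\<^sup>2) / 4 - (eta p)\<^sup>2)" by (intro mult_left_mono) auto
    also have "\<dots> = (mips_r p ?l / 4 - mips_eps p ?l) * ((real (dim p))\<^sup>2 * (beta p)\<^sup>2)"
      using d beta_gt unfolding mips_r_def mips_eps_def pw by (simp add: field_simps)
    also have "\<dots> \<le> ?w\<^sup>2 / (real (dim p))\<^sup>2 * ((real (dim p))\<^sup>2 * (beta p)\<^sup>2)"
      using ps(2) False by (intro mult_right_mono) auto
    also have "\<dots> = (beta p * ?w)\<^sup>2" using d by (simp add: power_mult_distrib)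
    finally have "?b\<^sup>2 \<le> (8 * (beta p * ?w))\<^sup>2" by (simp add: power_mult_distrib)
    then have "?b \<le> 8 * (beta p * ?w)" using bw by (intro power2_le_imp_le[of ?b]) auto
    then show ?thesis using gap by (simp add: add_increasing)
  qed
qed

lemma played_attempt:
  assumes t: "t \<in> {1..horizon p}" and a: "played p S B t \<omega> = Some a"
  shows "\<exists>j. length (arms j) = t - 1 \<and> fst (att j) = Some a"
proof -
  obtain i where i: "t \<le> length (arms i)" "arms i ! (t - 1) = a" using a played_eq[OF T t] by auto
  \<comment> \<open>The arm of round t was chosen by the attempt just before the list of arms
    reaches length t.\<close>
  define k where "k = (LEAST k. t \<le> length (arms k))"
  have k: "t \<le> length (arms k)" unfolding k_def by (rule LeastI[of _ i]) (rule i(1))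
  have "length (arms 0) = 0" by (simp add: arms_0)
  then have "k \<noteq> 0" using k t by (cases k) auto
  then obtain j where j: "k = Suc j" by (cases k) auto
  then have "\<not> t \<le> length (arms j)" using not_less_Least[of j "\<lambda>k. t \<le> length (arms k)"] unfolding k_def[symmetric] by simp
  then have len: "length (arms j) = t - 1" and lt: "length (arms j) < horizon p"
    using arms_Suc[of j] k t unfolding j by auto
  have "fst (att j) \<noteq> None"
  proof
    assume "fst (att j) = None"
    then have "arms (Suc j) = arms j" using None_Suc[OF lt] by simp
    then show False using k len t unfolding j by auto
  qed
  then obtain b where b: "fst (att j) = Some b" by auto
  have "arms (Suc j) = arms j @ [b]" using Some_Suc[OF lt b] by simp
  moreover have "arms (Suc j) ! (t - 1) = arms i ! (t - 1)" using i k j t by (intro arms_nth_eq) auto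
  ultimately have "b = a" using i(2) len by (simp add: nth_append)
  then show ?thesis using b len by blast
qed

text \<open>Links two kinds of bookkeeping: widths come from the state of the run,
  \<open>spread\<close> from the supermartingale.\<close>

lemma width_spread:
  assumes j: "set (arms j) \<subseteq> A" "length (arms j) < horizon p" and a: "a \<in> A" "played p S B (Suc (length (arms j))) \<omega> = Some a"
  shows "(width p B (past j) a)\<^sup>2 = spread (length (arms j)) \<omega>"
proof -
  have "xvec (length (arms j)) \<omega> = feature B a" using a by (simp add: xvec_def)
  then show ?thesis
    unfolding spread_def xs_arms[OF j(1)] width_bounds(3)[OF accurate_past[OF j(1)] a(1)] gram_past by simp
qed

text \<open>Each round multiplies det V by 1 + \<open>spread\<close>, so the logarithms telescope to
  ln det V. As \<open>spread\<close> lies in [0, 1], it is at most 2 ln (1 +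
  \<open>spread\<close>).\<close>

lemma sum_spread_le: "(\<Sum>n<horizon p. spread n \<omega>) \<le> 2 * real (dim p) * ln (1 + real (horizon p) / real (dim p))"
proof -
  have le1: "spread n \<omega> \<le> 1" for n
  proof -
    have "spread n \<omega> \<le> scalar_prod (xvec n \<omega>) (xvec n \<omega>)"
      unfolding spread_def by (rule inv_mat_form_bounds(2)[OF V_ge xvec_carrier])
    also have "\<dots> \<le> 1" using xvec_ball[of n \<omega>] by (simp add: unit_ball_def norm2_def)
    finally show ?thesis .
  qed
  have ln: "spread n \<omega> \<le> 2 * ln (1 + spread n \<omega>)" for n
  proof -
    have v: "0 \<le> spread n \<omega>" "spread n \<omega> \<le> 1" using spread_nonneg le1 by auto
    have "spread n \<omega> - (spread n \<omega>)\<^sup>2 \<le> ln (1 + spread n \<omega>)" by (rule ln_one_plus_pos_lower_bound[OF v])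
    moreover have "ln (1 + spread n \<omega>) \<ge> spread n \<omega> / (1 + spread n \<omega>)"
    proof -
      have "ln (1 / (1 + spread n \<omega>)) \<le> 1 / (1 + spread n \<omega>) - 1" using v by (intro ln_le_minus_one) auto
      then show ?thesis using v by (simp add: ln_div field_simps)
    qed
    moreover have "spread n \<omega> / (1 + spread n \<omega>) \<ge> spread n \<omega> / 2" using v by (intro divide_left_mono) auto
    ultimately show ?thesis by linarith
  qed
  have det: "ln (det (design (dim p) (map (\<lambda>i. xvec i \<omega>) [0..<m]))) = (\<Sum>n<m. ln (1 + spread n \<omega>))" for m
  proof (induction m)
    case 0 then show ?case by (simp add: design_def)
  next
    case (Suc m)
    have dt: "det (design (dim p) (map (\<lambda>i. xvec i \<omega>) [0..<Suc m]))
        = det (design (dim p) (map (\<lambda>i. xvec i \<omega>) [0..<m])) * (1 + spread m \<omega>)"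
    proof -
      have "det (V m \<omega> + outer (xvec m \<omega>)) = det (V m \<omega>) * (1 + spread m \<omega>)"
        unfolding spread_def by (rule det_add_outer[OF V_ge xvec_carrier])
      then show ?thesis by (simp add: design_snoc)
    qed
    have "det (design (dim p) (map (\<lambda>i. xvec i \<omega>) [0..<m])) > 0" by (rule det_design_le(1)[OF set_xs(2) d])
    then show ?case unfolding dt using Suc spread_nonneg[of m \<omega>] by (subst ln_mult) auto
  qed
  have "(\<Sum>n<horizon p. spread n \<omega>) \<le> (\<Sum>n<horizon p. 2 * ln (1 + spread n \<omega>))" by (intro sum_mono ln)
  also have "\<dots> = 2 * ln (det (design (dim p) (map (\<lambda>i. xvec i \<omega>) [0..<horizon p])))"
    unfolding det by (simp add: sum_distrib_left)
  also have "\<dots> \<le> 2 * (real (dim p) * ln (1 + real (length (map (\<lambda>i. xvec i \<omega>) [0..<horizon p])) / real (dim p)))"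
    by (intro mult_left_mono det_design_le(2)[OF set_xs(2) d]) simp
  finally show ?thesis by simp
qed

text \<open>Sums \<open>gap_bound\<close> over the rounds and applies Cauchy-Schwarz to the widths,
  whose squares are the values of \<open>spread\<close>.\<close>

lemma regret_le:
  assumes T8: "horizon p \<ge> 8"
  shows "regret p S B \<omega> \<le> 32 * sqrt (real (horizon p))
    + 32 * beta p * sqrt (2 * real (dim p) * ln (1 + real (horizon p) / real (dim p)) * real (horizon p))"
proof -
  let ?T = "horizon p"
  have bound: "(case played p S B t \<omega> of None \<Rightarrow> 0
          | Some a \<Rightarrow> scalar_prod (feature B (optimal_arm B t)) (theta B) - scalar_prod (feature B a) (theta B))
      \<le> 32 / sqrt (real ?T) + 32 * beta p * sqrt (spread (t - 1) \<omega>)" if t: "t \<in> {1..?T}" for t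
  proof (cases "played p S B t \<omega>")
    case None
    then show ?thesis using beta_gt spread_nonneg by (simp add: add_nonneg_nonneg)
  next
    case (Some a)
    obtain j where j: "length (arms j) = t - 1" "fst (att j) = Some a" using played_attempt[OF t Some] by auto
    have lt: "length (arms j) < ?T" and St: "Suc (length (arms j)) = t" using j t by auto
    have sub: "set (arms j) \<subseteq> A" "set (arms (Suc j)) \<subseteq> A" using run_invariant by auto
    have aA: "a \<in> A" using Some_Suc[OF lt j(2)] sub(2) by simp
    have "sqrt (spread (t - 1) \<omega>) = width p B (past j) a"
      using width_spread[OF sub(1) lt aA] Some St j(1) width_bounds(1)[OF accurate_past[OF sub(1)] aA]
      by (metis abs_of_nonneg real_sqrt_abs)
    then show ?thesis using gap_bound[OF T8 lt j(2)] Some unfolding St by (simp add: val_def)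
  qed
  have "regret p S B \<omega> \<le> (\<Sum>t = 1..?T. 32 / sqrt (real ?T) + 32 * beta p * sqrt (spread (t - 1) \<omega>))"
    unfolding regret_def by (intro sum_mono bound)
  also have "\<dots> = (\<Sum>n<?T. 32 / sqrt (real ?T) + 32 * beta p * sqrt (spread n \<omega>))"
    by (rule sum.reindex_bij_witness[of _ Suc "\<lambda>t. t - 1"]) auto
  also have "\<dots> = real ?T * (32 / sqrt (real ?T)) + 32 * beta p * (\<Sum>n<?T. sqrt (spread n \<omega>))"
    by (simp add: sum.distrib sum_distrib_left)
  also have "real ?T * (32 / sqrt (real ?T)) = 32 * sqrt (real ?T)"
    using T2 by (simp add: field_simps)
  also have "(\<Sum>n<?T. sqrt (spread n \<omega>)) \<le> sqrt (2 * real (dim p) * ln (1 + real ?T / real (dim p)) * real ?T)"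
  proof (rule real_le_rsqrt)
    have "(\<Sum>n<?T. sqrt (spread n \<omega>))\<^sup>2 \<le> (\<Sum>n<?T. (sqrt (spread n \<omega>))\<^sup>2) * real (card {..<?T})"
      by (rule sum_squared_le_sum_of_squares)
    also have "\<dots> = (\<Sum>n<?T. spread n \<omega>) * real ?T" using spread_nonneg by simp
    also have "\<dots> \<le> 2 * real (dim p) * ln (1 + real ?T / real (dim p)) * real ?T"
      by (intro mult_right_mono sum_spread_le) simp
    finally show "(\<Sum>n<?T. sqrt (spread n \<omega>))\<^sup>2 \<le> 2 * real (dim p) * ln (1 + real ?T / real (dim p)) * real ?T" .
  qed
  finally show ?thesis using beta_gt by simp
qed

text \<open>Serves the horizons below 8, where the approximate threshold of the solver may be
  vacuous.\<close>

lemma regret_le_horizon: "regret p S B \<omega> \<le> 2 * real (horizon p)"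
proof -
  let ?T = "horizon p"
  have "(case played p S B t \<omega> of None \<Rightarrow> 0
          | Some a \<Rightarrow> scalar_prod (feature B (optimal_arm B t)) (theta B) - scalar_prod (feature B a) (theta B)) \<le> 2"
    if t: "t \<in> {1..?T}" for t
  proof (cases "played p S B t \<omega>")
    case (Some a)
    obtain j where j: "length (arms j) = t - 1" "fst (att j) = Some a" using played_attempt[OF t Some] by auto
    have lt: "length (arms j) < ?T" and St: "Suc (length (arms j)) = t" using j t by auto
    have "set (arms j) \<subseteq> A" "set (arms (Suc j)) \<subseteq> A" and s: "state_ok t (st j)" using run_invariant[of j] run_invariant[of "Suc j"] lt St by auto
    have aA: "a \<in> A" using Some_Suc[OF lt j(2)] run_invariant[of "Suc j"] by simp
    have u: "0 \<le> fst (snd \<omega>) t" "fst (snd \<omega>) t < 1" using coins[OF t] by auto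
    have tT: "t \<le> ?T" using t by simp
    have h: "accurate (past j)" using run_invariant accurate_past by blast
    have "a \<in> arms_of (psi (st j) (current_level (st j)))"
      using pick_sound(1)[OF s tT good_st h u] j(2) fst_att[of j] St by simp
    then have "a \<in> arms_at B t" using s arms_of_placed unfolding state_ok_def by blast
    then have "optimal_arm B t \<in> A" using optimal_arm_best(1)[OF tT] arms_at_mono[OF tT] by blast
    then show ?thesis using val_bounds[of a] val_bounds[of "optimal_arm B t"] aA Some by (simp add: val_def abs_le_iff)
  qed simp
  then have "regret p S B \<omega> \<le> (\<Sum>t = 1..?T. 2)" unfolding regret_def by (intro sum_mono) blast
  then show ?thesis by simp
qed

end

section \<open>Failures of the adaptive solver\<close>

text \<open>Every run of the algorithm coincides with a guided run, in which attempt \<open>i\<close> consults the single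
  copy \<open>\<iota> ! i\<close> only.  A guided run does not depend on the other copies, so these fail independently at
  its next query; a union bound over the finitely many \<open>\<iota>\<close> then covers the adaptive queries.\<close>

lemma answers_cong: "(\<And>i. i < j \<Longrightarrow> Q i = Q' i) \<Longrightarrow> answers p B Q u e j = answers p B Q' u e j"
  by (induction j) (simp_all add: Let_def split: prod.split)

context bandit_setup
begin

definition single_answer :: "(int \<times> nat \<Rightarrow> 's) \<Rightarrow> nat \<Rightarrow> int \<Rightarrow> update list \<Rightarrow> real vec \<Rightarrow> nat option" where
  "single_answer z i s us q = answer (level_solver p S s) (z (s, i)) us (round_query (point_dim p) (mips_eps p s) q)"

definition guided :: "nat list \<Rightarrow> ('s, 'e) outcome \<Rightarrow> nat \<Rightarrow> nat option list" where
  "guided \<iota> \<omega> j = answers p B (\<lambda>i. single_answer (fst \<omega>) (\<iota> ! i)) (fst (snd \<omega>)) (snd (snd \<omega>)) j"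

text \<open>The situations in which a copy has its guaranteed success probability at the rounded
  query.\<close>

definition legal :: "int \<Rightarrow> update list \<Rightarrow> real vec \<Rightarrow> bool" where
  "legal s us q \<longleftrightarrow> s \<in> levels p \<and> admissible (point_dim p) (max_arms p) us \<and>
     round_query (point_dim p) (mips_eps p s) q \<in> unit_ball (point_dim p)"

definition wrong :: "int \<Rightarrow> update list \<Rightarrow> real vec \<Rightarrow> nat option \<Rightarrow> bool" where
  "wrong s us q out \<longleftrightarrow>
     \<not> mips_solved (1/4) (mips_r p s) 0 (content us) (round_query (point_dim p) (mips_eps p s) q) out"

text \<open>An event in the guise of an oracle. Handing it to \<open>pick\<close> tests at the next
  query of the run whether all copies outside \<open>I\<close> err there, and
  \<open>measurable_pick\<close> makes this test measurable.\<close>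

definition flag :: "(int \<times> nat \<Rightarrow> 's) \<Rightarrow> nat set \<Rightarrow> nat \<Rightarrow> int \<Rightarrow> update list \<Rightarrow> real vec \<Rightarrow> nat option" where
  "flag z I f s us q =
     (if legal s us q \<and> (\<forall>i<copies p s. i \<notin> I \<longrightarrow> wrong s us q (single_answer z i s us q)) then Some f else None)"

text \<open>Two flags are needed to tell a flag from a randomly chosen arm.\<close>

definition fails :: "nat list \<Rightarrow> ('s, 'e) outcome \<Rightarrow> bool" where
  "fails \<iota> \<omega> \<longleftrightarrow> (let L = guided \<iota> \<omega> (length \<iota>); as = played_arms p L in length as < horizon p \<and>
     (\<forall>f\<in>{0, 1}. pick p B (flag (fst \<omega>) (set \<iota>) f) (fst (snd \<omega>) (Suc (length as))) (hist B (snd (snd \<omega>)) as)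
        (fst (config p B (snd (snd \<omega>)) L)) = Some f))"

lemma measurable_single_answer: "(\<lambda>\<omega>. single_answer (fst \<omega>) i s us q) \<in> measurable M (count_space UNIV)"
  unfolding single_answer_def by (rule measurable_answer)

lemma measurable_guided: "(\<lambda>\<omega>. guided \<iota> \<omega> j) \<in> measurable M (count_space UNIV)"
  unfolding guided_def
  by (rule measurable_answers[OF T measurable_environment measurable_coin measurable_single_answer])

lemma measurable_flag: "(\<lambda>\<omega>. flag (fst \<omega>) I f s us q) \<in> measurable M (count_space UNIV)"
proof (rule measurable_discrete_factor)
  show "(\<lambda>\<omega>. map (\<lambda>i. single_answer (fst \<omega>) i s us q) [0..<copies p s]) \<in> measurable M (count_space UNIV)"
    by (intro measurable_map_discrete measurable_single_answer)
  fix x y :: "('s, 'e) outcome"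
  assume "map (\<lambda>i. single_answer (fst x) i s us q) [0..<copies p s] = map (\<lambda>i. single_answer (fst y) i s us q) [0..<copies p s]"
  then have "single_answer (fst x) i s us q = single_answer (fst y) i s us q" if "i < copies p s" for i using that by simp
  then show "flag (fst x) I f s us q = flag (fst y) I f s us q" by (simp add: flag_def)
qed

lemma sets_fails: "{\<omega> \<in> space M. fails \<iota> \<omega>} \<in> sets M"
proof -
  define g where "g f L \<omega> = pick p B (flag (fst \<omega>) (set \<iota>) f) (fst (snd \<omega>) (Suc (length (played_arms p L))))
      (hist B (snd (snd \<omega>)) (played_arms p L)) (fst (config p B (snd (snd \<omega>)) L))" for f L and \<omega> :: "('s, 'e) outcome"
  define F where "F f L = {\<omega> \<in> space M. guided \<iota> \<omega> (length \<iota>) = L \<and> length (played_arms p L) < horizon p \<and> g f L \<omega> = Some f}" for f L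
  have F: "F f L \<in> sets M" for f L
  proof (cases "length (played_arms p L) < horizon p")
    case True
    have "g f L \<in> measurable M (count_space UNIV)"
      unfolding g_def[abs_def] using True
      by (intro measurable_pick[OF T measurable_environment measurable_coin measurable_flag]) simp
    then have "g f L -` {Some f} \<inter> space M \<in> sets M" by (rule measurable_sets) simp
    moreover have "(\<lambda>\<omega>. guided \<iota> \<omega> (length \<iota>)) -` {L} \<inter> space M \<in> sets M" by (rule measurable_sets[OF measurable_guided]) simp
    moreover have "F f L = (g f L -` {Some f} \<inter> space M) \<inter> ((\<lambda>\<omega>. guided \<iota> \<omega> (length \<iota>)) -` {L} \<inter> space M)"
      using True by (auto simp: F_def)
    ultimately show ?thesis by simp
  next
    case False
    then have "F f L = {}" by (auto simp: F_def)
    then show ?thesis by simp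
  qed
  have "{\<omega> \<in> space M. fails \<iota> \<omega>} = (\<Union>L. F 0 L \<inter> F 1 L)"
    by (auto simp: fails_def F_def g_def Let_def)
  also have "\<dots> \<in> sets M" using F by (intro sets.countable_UN image_subsetI sets.Int) auto
  finally show ?thesis .
qed

lemma guided_upd:
  assumes "snd c \<notin> set \<iota>"
  shows "guided \<iota> (z(c := x), y) (length \<iota>) = guided \<iota> (z, y) (length \<iota>)"
  unfolding guided_def fst_conv snd_conv
proof (rule answers_cong)
  fix i assume "i < length \<iota>"
  then have "(s, \<iota> ! i) \<noteq> c" for s using assms nth_mem by force
  then have "(z(c := x)) (s, \<iota> ! i) = z (s, \<iota> ! i)" for s by (metis fun_upd_other)
  then show "single_answer (z(c := x)) (\<iota> ! i) = single_answer z (\<iota> ! i)"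
    by (intro ext) (simp only: single_answer_def)
qed

lemma measurable_seed_answer: "(\<lambda>z. single_answer z i s us q) \<in> measurable seed_space (count_space UNIV)"
proof (cases "(s, i) \<in> (SIGMA s : levels p. {..<copies p s})")
  case True
  have "(\<lambda>z. z (s, i)) \<in> measurable seed_space (seed_dist (level_solver p S s))"
    using measurable_component_singleton[OF True, of "\<lambda>(s, i). seed_dist (level_solver p S s)"] by simp
  then show ?thesis unfolding single_answer_def
    by (rule measurable_compose) (use True solver in \<open>auto simp: solves_mips_def\<close>)
next
  case False
  have u: "z (s, i) = undefined" if "z \<in> space seed_space" for z
    using that False by (auto simp: space_PiM PiE_def extensional_def)
  have "(\<lambda>z. single_answer z i s us q) \<in> measurable seed_space (count_space UNIV)
      \<longleftrightarrow> (\<lambda>z. answer (level_solver p S s) undefined us (round_query (point_dim p) (mips_eps p s) q)) \<in> measurable seed_space (count_space UNIV)"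
    unfolding single_answer_def by (rule measurable_cong) (simp only: u)
  then show ?thesis by simp
qed

definition wrong_seeds :: "int \<Rightarrow> update list \<Rightarrow> real vec \<Rightarrow> 's set" where
  "wrong_seeds s us q = {x \<in> space (seed_dist (level_solver p S s)).
     wrong s us q (answer (level_solver p S s) x us (round_query (point_dim p) (mips_eps p s) q))}"

lemma emeasure_wrong:
  assumes "legal s us q"
  shows "wrong_seeds s us q \<in> sets (seed_dist (level_solver p S s))"
    and "emeasure (seed_dist (level_solver p S s)) (wrong_seeds s us q) \<le> ennreal (1 / 10)"
proof -
  let ?W = "wrong_seeds s us q"
  let ?N = "seed_dist (level_solver p S s)"
  let ?q = "round_query (point_dim p) (mips_eps p s) q"
  have sol: "solves_mips (point_dim p) (1/4) (mips_r p s) (max_arms p) (level_solver p S s)"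
    using assms solver by (simp add: legal_def)
  interpret N: prob_space ?N using sol by (simp add: solves_mips_def)
  let ?G = "{x \<in> space ?N. mips_solved (1/4) (mips_r p s) 0 (content us) ?q (answer (level_solver p S s) x us ?q)}"
  have m: "(\<lambda>x. answer (level_solver p S s) x us ?q) \<in> measurable ?N (count_space UNIV)"
    using sol by (simp add: solves_mips_def)
  have "?G = (\<lambda>x. answer (level_solver p S s) x us ?q) -` {out. mips_solved (1/4) (mips_r p s) 0 (content us) ?q out} \<inter> space ?N"
    by auto
  also have "\<dots> \<in> sets ?N" by (rule measurable_sets[OF m]) simp
  finally have G: "?G \<in> sets ?N" .
  have pG: "N.prob ?G \<ge> 0.9" using sol assms unfolding solves_mips_def legal_def by blast
  have W: "?W = space ?N - ?G" by (auto simp: wrong_seeds_def wrong_def)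
  show "?W \<in> sets ?N" unfolding W using G by simp
  have "N.prob ?W \<le> 1 / 10" unfolding W N.prob_compl[OF G] using pG by simp
  then show "emeasure ?N ?W \<le> ennreal (1 / 10)" by (simp add: N.emeasure_eq_measure ennreal_leI)
qed

text \<open>With coins and environment fixed, the next query of a guided run depends on the copies
  in \<open>\<iota>\<close> alone. At least m other copies of the queried level are fresh, and each
  errs with probability at most 1/10.\<close>

lemma emeasure_fails_section:
  assumes y: "y \<in> space (coin_space \<Otimes>\<^sub>M env B)" and lev: "s0 \<in> levels p"
    and m: "\<And>s. s \<in> levels p \<Longrightarrow> m + length \<iota> \<le> copies p s"
  shows "emeasure seed_space {z \<in> space seed_space. fails \<iota> (z, y)} \<le> ennreal (1 / 10) ^ m"
proof -
  let ?J = "SIGMA s : levels p. {..<copies p s}" and ?N = "\<lambda>(s, i). seed_dist (level_solver p S s)"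
  define next_query where "next_query L = (let as = played_arms p L; st = fst (config p B (snd y) L); s = current_level st;
      us = updates (psi st s); q = vectorize ((1 / real (dim p)) \<cdot>\<^sub>m inv_mat (gram p B (hist B (snd y) as))) in
      if length as < horizon p \<and> legal s us q \<and> \<not> (\<forall>s. arms_of (psi st s) = {}) \<and> s \<noteq> s_max p then Some (s, us, q) else None)" for L
  define D where "D z = next_query (guided \<iota> (z, y) (length \<iota>))" for z
  define fresh where "fresh s = (\<lambda>i. (s :: int, i)) ` {i. i < copies p s \<and> i \<notin> set \<iota>}" for s
  \<comment> \<open>Without a legal query the fresh copies of some level \<open>s0\<close> stand in,
    so that there are always at least m of them; \<open>Bad\<close> is then empty.\<close>
  define J' where "J' v = (case v of Some (s, us, q) \<Rightarrow> if legal s us q then fresh s else fresh s0 | None \<Rightarrow> fresh s0)"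
    for v :: "(int \<times> update list \<times> real vec) option"
  define Bad where "Bad v c = (case v of Some (s, us, q) \<Rightarrow>
       if legal s us q then wrong_seeds s us q else {}
     | None \<Rightarrow> {})" for v :: "(int \<times> update list \<times> real vec) option" and c :: "int \<times> nat"
  have fresh_sub: "fresh s \<subseteq> ?J" if "s \<in> levels p" for s using that by (auto simp: fresh_def)
  have fresh_card: "m \<le> card (fresh s)" if "s \<in> levels p" for s
  proof -
    have "{i. i < copies p s \<and> i \<notin> set \<iota>} = {..<copies p s} - set \<iota>" by auto
    then have "card (fresh s) = card ({..<copies p s} - set \<iota>)" unfolding fresh_def by (simp add: card_image inj_on_def)
    also have "\<dots> \<ge> card {..<copies p s} - card (set \<iota>)" by (rule diff_card_le_card_Diff) simp
    finally show ?thesis using m[OF that] card_length[of \<iota>] by simp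
  qed
  have J'_fresh: "\<exists>s\<in>levels p. J' v = fresh s" for v
    using lev by (auto simp: J'_def legal_def split: option.splits prod.splits if_splits)
  have gm: "(\<lambda>z. guided \<iota> (z, y) (length \<iota>)) \<in> measurable seed_space (count_space UNIV)"
  proof -
    have "snd y \<in> space (env B)" using y by (auto simp: space_pair_measure)
    then have "(\<lambda>_. snd y) \<in> measurable seed_space (env B)" by simp
    from measurable_answers[OF T this, of "\<lambda>_. fst y" "\<lambda>z i. single_answer z (\<iota> ! i)"]
    show ?thesis unfolding guided_def using measurable_seed_answer by simp
  qed
  have Dm: "D \<in> measurable seed_space (count_space UNIV)"
    unfolding D_def by (rule measurable_discrete_factor[OF gm]) simp
  \<comment> \<open>Queries contain real vectors, but they are computed from a list of answers, so
    only countably many occur.\<close>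
  have "D ` space seed_space \<subseteq> range next_query" by (auto simp: D_def)
  then have Dc: "countable (D ` space seed_space)" by (rule countable_subset) simp
  have Jsub: "J' v \<subseteq> ?J" for v using J'_fresh[of v] fresh_sub by auto
  have Jcard: "m \<le> card (J' (D z))" for z using J'_fresh[of "D z"] fresh_card by auto
  have inv: "(D (z(c := x)) = v) = (D z = v)" if "c \<in> J' v" for z x c v
  proof -
    obtain s where "J' v = fresh s" using J'_fresh[of v] by auto
    then have "c \<in> fresh s" using that by simp
    then have "snd c \<notin> set \<iota>" unfolding fresh_def by auto
    from guided_upd[OF this] show ?thesis unfolding D_def by simp
  qed
  have Badm: "Bad v c \<in> sets (?N c) \<and> emeasure (?N c) (Bad v c) \<le> ennreal (1 / 10)" if c: "c \<in> J' v" for c v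
  proof (cases "\<exists>s us q. v = Some (s, us, q) \<and> legal s us q")
    case True
    then obtain s us q where v: "v = Some (s, us, q)" "legal s us q" by auto
    have "fst c = s" using c v by (auto simp: J'_def fresh_def)
    then have "?N c = seed_dist (level_solver p S s)" by (cases c) simp
    then show ?thesis using emeasure_wrong[OF v(2)] v by (simp add: Bad_def)
  next
    case False
    then have "Bad v c = {}" by (auto simp: Bad_def split: option.splits)
    then show ?thesis by simp
  qed
  have fin: "finite ?J" by (auto simp: levels_def)
  have "prob_space (?N c)" if "c \<in> ?J" for c using that solver by (auto simp: solves_mips_def)
  note bad = emeasure_adaptive_failure_le[where J = ?J and M = ?N and D = D and J' = J' and B = Bad and \<epsilon> = "ennreal (1 / 10)" and m = m,
      OF fin this Dm Dc Jsub Jcard inv conjunct1[OF Badm] conjunct2[OF Badm]]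
  have "{z \<in> space seed_space. fails \<iota> (z, y)} \<subseteq> {z \<in> space seed_space. \<forall>c\<in>J' (D z). z c \<in> Bad (D z) c}"
  proof
    fix z assume "z \<in> {z \<in> space seed_space. fails \<iota> (z, y)}"
    then have z: "z \<in> space seed_space" and f: "fails \<iota> (z, y)" by auto
    define L where "L = guided \<iota> (z, y) (length \<iota>)"
    define as where "as = played_arms p L"
    define st where "st = fst (config p B (snd y) L)"
    define s where "s = current_level st"
    define us where "us = updates (psi st s)"
    define q where "q = vectorize ((1 / real (dim p)) \<cdot>\<^sub>m inv_mat (gram p B (hist B (snd y) as)))"
    have len: "length as < horizon p"
      and pk: "\<And>f. f \<in> {0, 1} \<Longrightarrow> pick p B (flag z (set \<iota>) f) (fst y (Suc (length as))) (hist B (snd y) as) st = Some f"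
      using f unfolding fails_def Let_def L_def[symmetric] as_def[symmetric] st_def[symmetric] fst_conv snd_conv by auto
    have ne: "\<not> (\<forall>s. arms_of (psi st s) = {})" using pk[of 0] by (auto simp: pick_def Let_def split: if_splits)
    have sm: "s \<noteq> s_max p"
    proof
      assume "s = s_max p"
      then have "pick p B (flag z (set \<iota>) 0) (fst y (Suc (length as))) (hist B (snd y) as) st
        = pick p B (flag z (set \<iota>) 1) (fst y (Suc (length as))) (hist B (snd y) as) st"
        unfolding pick_def Let_def s_def by simp
      then show False using pk[of 0] pk[of 1] by simp
    qed
    have "flag z (set \<iota>) 0 s us q = Some 0"
      using pk[of 0] ne sm unfolding pick_def Let_def s_def us_def q_def by simp
    then have fl: "legal s us q" "\<And>i. i < copies p s \<Longrightarrow> i \<notin> set \<iota> \<Longrightarrow> wrong s us q (single_answer z i s us q)"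
      unfolding flag_def by (auto split: if_splits)
    have D: "D z = Some (s, us, q)"
      using len ne sm fl(1)
      unfolding D_def next_query_def Let_def L_def[symmetric] as_def[symmetric] st_def[symmetric] s_def[symmetric]
        us_def[symmetric] q_def[symmetric] by auto
    have "z c \<in> Bad (D z) c" if c: "c \<in> J' (D z)" for c
    proof -
      obtain i where i: "c = (s, i)" "i < copies p s" "i \<notin> set \<iota>" using c fl(1) by (auto simp: D J'_def fresh_def)
      have "(s, i) \<in> ?J" using i fl(1) by (auto simp: legal_def)
      then have "z c \<in> space (?N (s, i))" using z i(1) unfolding space_PiM by (metis PiE_mem)
      then show ?thesis using fl(1) fl(2)[OF i(2,3)] i(1) by (simp add: D Bad_def wrong_seeds_def single_answer_def)
    qed
    then show "z \<in> {z \<in> space seed_space. \<forall>c\<in>J' (D z). z c \<in> Bad (D z) c}" using z by blast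
  qed
  then have "emeasure seed_space {z \<in> space seed_space. fails \<iota> (z, y)} \<le> emeasure seed_space {z \<in> space seed_space. \<forall>c\<in>J' (D z). z c \<in> Bad (D z) c}"
    using bad(1) by (intro emeasure_mono) auto
  then show ?thesis using bad(2) by auto
qed

text \<open>Seeds are independent of coins and environment, so the bound for sections
  integrates.\<close>

lemma emeasure_fails:
  assumes lev: "s0 \<in> levels p" and m: "\<And>s. s \<in> levels p \<Longrightarrow> m + length \<iota> \<le> copies p s"
  shows "emeasure M {\<omega> \<in> space M. fails \<iota> \<omega>} \<le> ennreal (1 / 10) ^ m"
proof -
  interpret ce: pair_prob_space coin_space "env B" by unfold_locales
  have Y: "prob_space (coin_space \<Otimes>\<^sub>M env B)" by unfold_locales
  interpret P: pair_prob_space seed_space "coin_space \<Otimes>\<^sub>M env B" by unfold_locales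
  let ?Y = "coin_space \<Otimes>\<^sub>M env B"
  have s: "{\<omega> \<in> space M. fails \<iota> \<omega>} \<in> sets (seed_space \<Otimes>\<^sub>M ?Y)" using sets_fails by (simp add: outcome_space_def)
  have "emeasure M {\<omega> \<in> space M. fails \<iota> \<omega>}
      = (\<integral>\<^sup>+y. emeasure seed_space ((\<lambda>z. (z, y)) -` {\<omega> \<in> space M. fails \<iota> \<omega>}) \<partial>?Y)"
    using P.emeasure_pair_measure_alt2[OF s] by (simp add: outcome_space_def)
  also have "\<dots> \<le> (\<integral>\<^sup>+y. ennreal (1 / 10) ^ m \<partial>?Y)"
  proof (rule nn_integral_mono)
    fix y assume y: "y \<in> space ?Y"
    have "(\<lambda>z. (z, y)) -` {\<omega> \<in> space M. fails \<iota> \<omega>} = {z \<in> space seed_space. fails \<iota> (z, y)}"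
      using y by (auto simp: outcome_space_def space_pair_measure)
    then show "emeasure seed_space ((\<lambda>z. (z, y)) -` {\<omega> \<in> space M. fails \<iota> \<omega>}) \<le> ennreal (1 / 10) ^ m"
      using emeasure_fails_section[OF y lev m] by simp
  qed
  also have "\<dots> = ennreal (1 / 10) ^ m" unfolding nn_integral_const prob_space.emeasure_space_1[OF Y] by simp
  finally show ?thesis .
qed

definition fails_within :: "nat \<Rightarrow> nat \<Rightarrow> ('s, 'e) outcome \<Rightarrow> bool" where
  "fails_within N \<kappa> \<omega> \<longleftrightarrow> (\<exists>j<N. \<exists>\<iota>. set \<iota> \<subseteq> {..<\<kappa>} \<and> length \<iota> = j \<and> fails \<iota> \<omega>)"

text \<open>A union bound over at most N * \<open>\<kappa>\<close> ^ N index sequences; each leaves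
  at least k - N copies of every level untouched.\<close>

lemma prob_fails_within:
  assumes lev: "s0 \<in> levels p" and k: "\<And>s. s \<in> levels p \<Longrightarrow> k \<le> copies p s" and N: "N \<le> k" and \<kappa>: "\<kappa> \<ge> 1"
  shows "{\<omega> \<in> space M. fails_within N \<kappa> \<omega>} \<in> sets M"
    "prob {\<omega> \<in> space M. fails_within N \<kappa> \<omega>} \<le> real N * real \<kappa> ^ N * (1 / 10) ^ (k - N)"
proof -
  let ?I = "\<lambda>j. {\<iota>. set \<iota> \<subseteq> {..<\<kappa>} \<and> length \<iota> = j}"
  have fin: "finite (?I j)" and card: "card (?I j) = \<kappa> ^ j" for j
    using finite_lists_length_eq[of "{..<\<kappa>}" j] card_lists_length_eq[of "{..<\<kappa>}" j] by auto
  have eq: "{\<omega> \<in> space M. fails_within N \<kappa> \<omega>} = (\<Union>j<N. \<Union>\<iota>\<in>?I j. {\<omega> \<in> space M. fails \<iota> \<omega>})"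
    by (auto simp: fails_within_def)
  have inner: "(\<Union>\<iota>\<in>?I j. {\<omega> \<in> space M. fails \<iota> \<omega>}) \<in> sets M" for j
    using fin sets_fails by (intro sets.finite_UN) auto
  show "{\<omega> \<in> space M. fails_within N \<kappa> \<omega>} \<in> sets M"
    unfolding eq by (intro sets.finite_UN inner) auto
  have one: "prob {\<omega> \<in> space M. fails \<iota> \<omega>} \<le> (1 / 10) ^ (k - N)" if "\<iota> \<in> ?I j" "j < N" for \<iota> j
  proof -
    have "emeasure M {\<omega> \<in> space M. fails \<iota> \<omega>} \<le> ennreal (1 / 10) ^ (k - N)"
    proof (rule emeasure_fails[OF lev])
      fix s assume "s \<in> levels p"
      then show "k - N + length \<iota> \<le> copies p s" using k[of s] N that by auto
    qed
    also have "\<dots> = ennreal ((1 / 10) ^ (k - N))" by (simp add: ennreal_power)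
    finally show ?thesis by (simp add: emeasure_eq_measure)
  qed
  have "prob {\<omega> \<in> space M. fails_within N \<kappa> \<omega>} \<le> (\<Sum>j<N. prob (\<Union>\<iota>\<in>?I j. {\<omega> \<in> space M. fails \<iota> \<omega>}))"
    unfolding eq using inner by (intro finite_measure_subadditive_finite) auto
  also have "\<dots> \<le> (\<Sum>j<N. real \<kappa> ^ N * (1 / 10) ^ (k - N))"
  proof (rule sum_mono)
    fix j assume j: "j \<in> {..<N}"
    have "prob (\<Union>\<iota>\<in>?I j. {\<omega> \<in> space M. fails \<iota> \<omega>}) \<le> (\<Sum>\<iota>\<in>?I j. prob {\<omega> \<in> space M. fails \<iota> \<omega>})"
      using fin sets_fails by (intro finite_measure_subadditive_finite) auto
    also have "\<dots> \<le> (\<Sum>\<iota>\<in>?I j. (1 / 10) ^ (k - N))" using one j by (intro sum_mono) auto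
    also have "\<dots> = real \<kappa> ^ j * (1 / 10) ^ (k - N)" using card by simp
    also have "\<dots> \<le> real \<kappa> ^ N * (1 / 10) ^ (k - N)"
      using j \<kappa> by (intro mult_right_mono power_increasing) auto
    finally show "prob (\<Union>\<iota>\<in>?I j. {\<omega> \<in> space M. fails \<iota> \<omega>}) \<le> real \<kappa> ^ N * (1 / 10) ^ (k - N)" .
  qed
  also have "\<dots> = real N * real \<kappa> ^ N * (1 / 10) ^ (k - N)" by simp
  finally show "prob {\<omega> \<in> space M. fails_within N \<kappa> \<omega>} \<le> real N * real \<kappa> ^ N * (1 / 10) ^ (k - N)" .
qed

end

section \<open>Counting attempts and bounding the selection time\<close>

section \<open>Termination and time\<close>

context elimination_run
begin

text \<open>The copy with the least index that answers at attempt \<open>i\<close>, as in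
  \<open>adaptive_answer\<close>. If no copy answers, copy 0 will do, because its answer is null
  like all others.\<close>

definition chosen_copy :: "nat \<Rightarrow> nat" where
  "chosen_copy i = (let s = current_level (st i); out = (\<lambda>c. single_answer (fst \<omega>) c s (updates (psi (st i) s)) (query (past i)))
     in if s \<in> levels p \<and> (\<exists>c. c < copies p s \<and> out c \<noteq> None) then LEAST c. c < copies p s \<and> out c \<noteq> None else 0)"

lemma chosen_copy_less:
  assumes "\<And>s. s \<in> levels p \<Longrightarrow> copies p s \<le> \<kappa>" "\<kappa> \<ge> 1"
  shows "chosen_copy i < \<kappa>"
proof -
  let ?P = "\<lambda>c. c < copies p (current_level (st i)) \<and> single_answer (fst \<omega>) c (current_level (st i))
      (updates (psi (st i) (current_level (st i)))) (query (past i)) \<noteq> None"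
  show ?thesis
  proof (cases "current_level (st i) \<in> levels p \<and> (\<exists>c. ?P c)")
    case True
    from LeastI_ex[where P = ?P, OF conjunct2[OF True]] have "?P (LEAST c. ?P c)" .
    then show ?thesis using assms(1)[of "current_level (st i)"] True by (simp add: chosen_copy_def Let_def)
  next
    case False
    then show ?thesis using assms(2) unfolding chosen_copy_def Let_def by (subst if_not_P) auto
  qed
qed

lemma solver_oracle_single:
  "solver_oracle p S (fst \<omega>) s us q = (let out = (\<lambda>c. single_answer (fst \<omega>) c s us q) in
     if \<exists>c. c < copies p s \<and> out c \<noteq> None then out (LEAST c. c < copies p s \<and> out c \<noteq> None) else None)"
  unfolding solver_oracle_def adaptive_answer_def single_answer_def Let_def ..

lemma undone_state_ok: "length (arms j) < horizon p \<Longrightarrow> state_ok (Suc (length (arms j))) (st j)"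
  using run_invariant by blast

lemma accurate_run: "accurate (past j)"
  using run_invariant accurate_past by blast

text \<open>The actual run is the guided run of the copies that it happens to use, so an event about
  all guided runs covers it.\<close>

lemma guided_trace:
  assumes pos: "\<And>s. s \<in> levels p \<Longrightarrow> copies p s \<ge> 1"
    and \<iota>: "\<And>i. i < j \<Longrightarrow> \<iota> ! i = chosen_copy i"
  shows "guided \<iota> \<omega> j = trace j"
  using \<iota>
proof (induction j)
  case 0 then show ?case by (simp add: guided_def trace_def)
next
  case (Suc j)
  have IH: "guided \<iota> \<omega> j = trace j" using Suc by simp
  have G: "guided \<iota> \<omega> (Suc j) = trace j @ [if length (arms j) \<ge> horizon p then None
      else pick p B (single_answer (fst \<omega>) (\<iota> ! j)) (fst (snd \<omega>) (Suc (length (arms j)))) (past j) (st j)]"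
    using IH unfolding guided_def answers_Suc Let_def arms_def past_def st_def by simp
  show ?case
  proof (cases "length (arms j) \<ge> horizon p")
    case True
    then show ?thesis unfolding G trace_Suc by simp
  next
    case False
    then have ok: "state_ok (Suc (length (arms j))) (st j)" by (intro undone_state_ok) simp
    let ?s = "current_level (st j)"
    have eq: "single_answer (fst \<omega>) (\<iota> ! j) ?s (updates (psi (st j) ?s)) (query (past j))
        = solver_oracle p S (fst \<omega>) ?s (updates (psi (st j) ?s)) (query (past j))"
      if ne: "\<not> (\<forall>s. arms_of (psi (st j) s) = {})"
    proof -
      have lev: "?s \<in> levels p" using ne state_ok_nonempty(2)[OF ok] by blast
      let ?out = "\<lambda>c. single_answer (fst \<omega>) c ?s (updates (psi (st j) ?s)) (query (past j))"
      have c: "\<iota> ! j = chosen_copy j" using Suc.prems by simp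
      show ?thesis
      proof (cases "\<exists>c. c < copies p ?s \<and> ?out c \<noteq> None")
        case True
        then show ?thesis unfolding c chosen_copy_def solver_oracle_single Let_def using lev by simp
      next
        case False
        then have "\<iota> ! j = 0" unfolding c chosen_copy_def Let_def by (subst if_not_P) auto
        moreover have "?out 0 = None" using False pos[OF lev] by auto
        ultimately show ?thesis using False unfolding solver_oracle_single Let_def by auto
      qed
    qed
    have "pick p B (single_answer (fst \<omega>) (\<iota> ! j)) u (past j) (st j) = pick p B (solver_oracle p S (fst \<omega>)) u (past j) (st j)" for u
      using eq unfolding pick_def Let_def query_def by auto
    then show ?thesis unfolding G trace_Suc fst_att by simp
  qed
qed

text \<open>An arm of width at least 2^(-s-1) / beta has inner product at least r + eps with the
  query, hence at least r after rounding, so null is a wrong answer for every copy. The guided run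
  of the copies used so far would then fail, against the assumption.\<close>

lemma null_answer_widths:
  assumes ok: "\<not> fails_within N \<kappa> \<omega>" and j: "j < N" "length (arms j) < horizon p"
    and pos: "\<And>s. s \<in> levels p \<Longrightarrow> copies p s \<ge> 1" and \<kappa>: "\<And>s. s \<in> levels p \<Longrightarrow> copies p s \<le> \<kappa>" "\<kappa> \<ge> 1"
    and ne: "\<not> (\<forall>s. arms_of (psi (st j) s) = {})" and none: "fst (att j) = None"
  shows "current_level (st j) \<noteq> s_max p"
    "a \<in> arms_of (psi (st j) (current_level (st j))) \<Longrightarrow>
      beta p * width p B (past j) a < 2 powr (- of_int (current_level (st j)) - 1)"
proof -
  let ?s = "current_level (st j)"
  let ?us = "updates (psi (st j) ?s)" and ?q = "query (past j)"
  note sok = undone_state_ok[OF j(2)]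
  have lev: "?s \<in> levels p" using ne state_ok_nonempty(2)[OF sok] by blast
  have pk: "pick p B (solver_oracle p S (fst \<omega>)) (fst (snd \<omega>) (Suc (length (arms j)))) (past j) (st j) = None"
    using none unfolding fst_att .
  show sm: "?s \<noteq> s_max p"
    using pk ne unfolding pick_def Let_def by (auto split: if_splits)
  then have so: "solver_oracle p S (fst \<omega>) ?s ?us ?q = None"
    using pk ne unfolding pick_def Let_def query_def by auto
  have out: "single_answer (fst \<omega>) c ?s ?us ?q = None" if c: "c < copies p ?s" for c
  proof (rule ccontr)
    let ?P = "\<lambda>c. c < copies p ?s \<and> single_answer (fst \<omega>) c ?s ?us ?q \<noteq> None"
    assume "single_answer (fst \<omega>) c ?s ?us ?q \<noteq> None"
    then have ex: "\<exists>c. ?P c" using c by blast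
    then have "?P (LEAST c. ?P c)" by (rule LeastI_ex)
    then show False using so ex unfolding solver_oracle_single Let_def by auto
  qed
  show "beta p * width p B (past j) a < 2 powr (- of_int ?s - 1)" if a: "a \<in> arms_of (psi (st j) ?s)"
  proof (rule ccontr)
    assume "\<not> beta p * width p B (past j) a < 2 powr (- of_int ?s - 1)"
    then have big: "2 powr (- of_int ?s - 1) \<le> beta p * width p B (past j) a" by simp
    have aA: "a \<in> A" using a good_st[of j ?s] by (auto simp: good_set_def)
    define \<iota> where "\<iota> = map chosen_copy [0..<j]"
    have len: "length \<iota> = j" by (simp add: \<iota>_def)
    have tr: "guided \<iota> \<omega> j = trace j" by (rule guided_trace[OF pos]) (simp_all add: \<iota>_def)
    have leg: "legal ?s ?us ?q"
      unfolding legal_def using lev admissible_updates[OF good_st] round_query_close(1)[OF point_dim_ge mips_eps_pos query_ball[OF accurate_run]]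
      by blast
    have "2 powr (- 2 * of_int ?s - 2) = 2 powr ((- of_int ?s - 1) + (- of_int ?s - 1) :: real)" by simp
    also have "\<dots> = (2 powr (- of_int ?s - 1))\<^sup>2" unfolding power2_eq_square by (rule powr_add)
    finally have "2 powr (- 2 * of_int ?s - 2) = (2 powr (- of_int ?s - 1 :: real))\<^sup>2" .
    also have "\<dots> \<le> (beta p * width p B (past j) a)\<^sup>2" using big by (intro power_mono) auto
    finally have "2 powr (- 2 * of_int ?s - 2) / ((real (dim p))\<^sup>2 * (beta p)\<^sup>2)
        \<le> (beta p * width p B (past j) a)\<^sup>2 / ((real (dim p))\<^sup>2 * (beta p)\<^sup>2)" by (intro divide_right_mono) auto
    also have "\<dots> = scalar_prod ?q (point_of B a)"
      using beta_gt unfolding query_point[OF accurate_run aA] by (simp add: power_mult_distrib)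
    \<comment> \<open>As (1 - eta^2) + eta^2 = 1, the threshold r + eps is exactly the square of
      2^(-s-1) / (d beta).\<close>
    also have "2 powr (- 2 * of_int ?s - 2) / ((real (dim p))\<^sup>2 * (beta p)\<^sup>2) = mips_r p ?s + mips_eps p ?s"
      by (simp add: mips_r_def mips_eps_def add_divide_distrib[symmetric] algebra_simps)
    finally have ge: "mips_r p ?s + mips_eps p ?s \<le> scalar_prod ?q (point_of B a)" .
    have "mips_r p ?s \<le> scalar_prod (round_query (point_dim p) (mips_eps p ?s) ?q) (point_of B a)"
      using round_query_inner[OF point_dim_ge mips_eps_pos[of ?s] query_ball[OF accurate_run] point_of_ball[OF aA], of j] ge by linarith
    moreover have "content ?us a = Some (point_of B a)" using content_good[OF good_st, of j ?s a] a by simp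
    then have "point_of B a \<in> ran (content ?us)" by (rule ranI)
    ultimately have wrong: "wrong ?s ?us ?q None" unfolding wrong_def mips_solved_def by auto
    have fl: "flag (fst \<omega>) (set \<iota>) f ?s ?us ?q = Some f" for f using leg out wrong by (simp add: flag_def)
    have "pick p B (flag (fst \<omega>) (set \<iota>) f) u (past j) (st j) = Some f" for f u
      using ne sm fl[unfolded query_def] unfolding pick_def Let_def by (subst if_not_P) simp_all
    then have "fails \<iota> \<omega>"
      unfolding fails_def Let_def len tr arms_def[symmetric] past_def[symmetric] st_def[symmetric] using j(2) by simp
    moreover have "set \<iota> \<subseteq> {..<\<kappa>}" using chosen_copy_less[OF \<kappa>] by (auto simp: \<iota>_def)
    ultimately show False using ok j(1) len unfolding fails_within_def by blast
  qed
qed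

text \<open>Counts the levels that null answers can still climb. For short horizons level 0 can lie
  above \<open>s_max\<close>, and from there arms go to \<open>s_max\<close>; the extra 1 below
  \<open>s_max\<close> makes even a change to that exceptional level a decrease.\<close>

definition potential :: "int \<Rightarrow> nat" where
  "potential c = (if c = s_max p then 0 else if c < s_max p then nat (s_max p - c) + 1 else 1)"

definition attempts_per_round :: nat where
  "attempts_per_round = nat (s_max p - \<lfloor>- log 2 (beta p)\<rfloor>) + 3"

lemma potential_less: "c \<in> levels p \<Longrightarrow> Suc (potential c) \<le> attempts_per_round"
  by (auto simp: potential_def attempts_per_round_def levels_def)

lemma stored_nonempty:
  assumes init: "init_arms B \<noteq> {}" and s: "state_ok t s" and t: "t \<le> horizon p"
  shows "\<exists>l. arms_of (psi s l) \<noteq> {}"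
proof -
  have "arms_at B t \<noteq> {}" using init by (auto simp: arms_at_def)
  from best_arm_stored[OF s t optimal_arm_best[OF t this]] show ?thesis by blast
qed

text \<open>The new lowest level holds an arm that either was stored elsewhere, hence above the old
  lowest level, or has just moved; after a null answer moved arms are narrow, so they rise by a
  level or land in \<open>s_max\<close>.\<close>

lemma potential_decreases:
  assumes ok: "\<not> fails_within N \<kappa> \<omega>" and j: "j < N" "length (arms j) < horizon p"
    and pos: "\<And>s. s \<in> levels p \<Longrightarrow> copies p s \<ge> 1" and \<kappa>: "\<And>s. s \<in> levels p \<Longrightarrow> copies p s \<le> \<kappa>" "\<kappa> \<ge> 1"
    and init: "init_arms B \<noteq> {}" and none: "fst (att j) = None"
  shows "potential (current_level (st (Suc j))) < potential (current_level (st j))"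
proof -
  let ?c = "current_level (st j)" and ?c' = "current_level (st (Suc j))" and ?t = "Suc (length (arms j))"
  have t: "?t \<le> horizon p" using j by simp
  note s = undone_state_ok[OF j(2)]
  have nx: "st (Suc j) = move_arms p B (past j) (st j)" using None_Suc[OF j(2) none] by simp
  have s': "state_ok ?t (st (Suc j))" unfolding nx by (rule move_ok[OF s t accurate_run])
  obtain l0 where l0: "arms_of (psi (st j) l0) \<noteq> {}" using stored_nonempty[OF init s t] by auto
  then have ne: "\<not> (\<forall>l. arms_of (psi (st j) l) = {})" by blast
  have w: "?c \<noteq> s_max p" "\<And>a. a \<in> arms_of (psi (st j) ?c) \<Longrightarrow> beta p * width p B (past j) a < 2 powr (- of_int ?c - 1)"
    using null_answer_widths[OF ok j pos \<kappa> ne none] by auto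
  note c = state_ok_nonempty[OF s]
  have c_or: "l \<le> s_max p \<or> l = 0" if "arms_of (psi x l) \<noteq> {}" "state_ok ?t x" for l x
    using that unfolding state_ok_def placed_def arms_of_def by blast
  obtain l1 where "arms_of (psi (st (Suc j)) l1) \<noteq> {}" using stored_nonempty[OF init s' t] by auto
  then have ne': "arms_of (psi (st (Suc j)) ?c') \<noteq> {}" by (rule state_ok_nonempty(1)[OF s'])
  then obtain a where a: "a \<in> arms_of (psi (st (Suc j)) ?c')" by auto
  have cc: "?c \<le> s_max p \<or> ?c = 0" by (rule c_or[OF c(1)[OF l0] s])
  have cc': "?c' \<le> s_max p \<or> ?c' = 0" by (rule c_or[OF ne' s'])
  from arms_of_move[OF s t accurate_run a[unfolded nx]]
  consider "a \<in> arms_of (psi (st j) ?c')" "?c' \<noteq> ?c"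
    | "a \<in> arms_of (psi (st j) ?c)" "?c' = level_of p (width p B (past j) a)"
    unfolding nx[symmetric] by blast
  then show ?thesis
  proof cases
    case 1
    then have "?c \<le> ?c'" using c(3)[of ?c'] by blast
    then have lt: "?c < ?c'" using 1(2) by simp
    then show ?thesis using cc cc' w(1) unfolding potential_def by (auto split: if_splits)
  next
    case 2
    have aA: "a \<in> A" using 2(1) good_st[of j ?c] by (auto simp: good_set_def)
    note wb = width_bounds(1,2)[OF accurate_run[of j] aA]
    have "?c' \<ge> min (?c + 1) (s_max p)" unfolding 2(2) by (rule level_of_ge[OF wb(1) w(2)[OF 2(1)]])
    moreover have "?c' \<le> s_max p" unfolding 2(2) by (rule level_of_props(3)[OF wb])
    ultimately show ?thesis using w(1) unfolding potential_def by (auto simp: min_def split: if_splits)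
  qed
qed

text \<open>An amortised count: a null answer lowers the potential by at least 1, and a played arm
  brings a new allowance of \<open>attempts_per_round\<close>.\<close>

lemma attempts_le:
  assumes ok: "\<not> fails_within (horizon p * attempts_per_round) \<kappa> \<omega>"
    and pos: "\<And>s. s \<in> levels p \<Longrightarrow> copies p s \<ge> 1" and \<kappa>: "\<And>s. s \<in> levels p \<Longrightarrow> copies p s \<le> \<kappa>" "\<kappa> \<ge> 1"
    and init: "init_arms B \<noteq> {}" and j: "length (arms j) < horizon p"
  shows "j + potential (current_level (st j)) \<le> Suc (length (arms j)) * attempts_per_round"
  using j
proof (induction j)
  have pot: "Suc (potential (current_level (st j))) \<le> attempts_per_round" if j: "length (arms j) < horizon p" for j
  proof -
    have t: "Suc (length (arms j)) \<le> horizon p" using j by simp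
    note s = undone_state_ok[OF j]
    obtain l where "arms_of (psi (st j) l) \<noteq> {}" using stored_nonempty[OF init s t] by auto
    then show ?thesis by (intro potential_less state_ok_nonempty(2)[OF s])
  qed
  {
    case 0
    then show ?case using pot[of 0] by (simp add: arms_0)
  next
    case (Suc j)
    have j: "length (arms j) < horizon p"
      using Suc.prems arms_mono[of j "Suc j"] by auto
    have IH: "j + potential (current_level (st j)) \<le> Suc (length (arms j)) * attempts_per_round" by (rule Suc.IH[OF j])
    show ?case
    proof (cases "fst (att j)")
      case None
      have len: "length (arms (Suc j)) = length (arms j)" using None_Suc[OF j None] by simp
      have t: "Suc (length (arms j)) \<le> horizon p" using j by simp
      note s = undone_state_ok[OF j]
      obtain l where l: "arms_of (psi (st j) l) \<noteq> {}" using stored_nonempty[OF init s t] by auto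
      have "current_level (st j) \<noteq> s_max p"
      proof
        assume "current_level (st j) = s_max p"
        then have "fst (att j) \<noteq> None" using l unfolding fst_att pick_def Let_def by auto
        then show False using None by simp
      qed
      then have "potential (current_level (st j)) \<ge> 1" by (simp add: potential_def)
      moreover have "Suc (length (arms j)) * attempts_per_round \<le> horizon p * attempts_per_round"
        using t by (intro mult_right_mono) auto
      \<comment> \<open>The bound under proof itself keeps \<open>j\<close> in the range of attempts
        for which failures are excluded.\<close>
      ultimately have "j < horizon p * attempts_per_round" using IH by linarith
      from potential_decreases[OF ok this j pos \<kappa> init None] IH len show ?thesis by simp
    next
      case (Some a)
      have len: "length (arms (Suc j)) = Suc (length (arms j))" using Some_Suc[OF j Some] by simp
      show ?thesis using IH pot[OF Suc.prems] unfolding len by simp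
    qed
  }
qed

lemma step_time_le:
  assumes ok: "\<not> fails_within (horizon p * attempts_per_round) \<kappa> \<omega>"
    and pos: "\<And>s. s \<in> levels p \<Longrightarrow> copies p s \<ge> 1" and \<kappa>: "\<And>s. s \<in> levels p \<Longrightarrow> copies p s \<le> \<kappa>" "\<kappa> \<ge> 1"
    and init: "init_arms B \<noteq> {}" and t: "t \<in> {1..horizon p}"
    and cost: "\<And>j. length (arms j) < horizon p \<Longrightarrow> real (snd (att j)) \<le> cm"
  shows "\<exists>c. step_time p S B t \<omega> = Some c \<and> real c \<le> real (horizon p * attempts_per_round + 1) * cm"
proof -
  let ?N = "horizon p * attempts_per_round"
  have bound: "j \<le> ?N" if j: "length (arms j) < horizon p" for j
  proof -
    have "j + potential (current_level (st j)) \<le> Suc (length (arms j)) * attempts_per_round"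
      by (rule attempts_le[OF ok pos \<kappa> init j])
    also have "\<dots> \<le> ?N" using j by (intro mult_right_mono) auto
    finally show ?thesis by simp
  qed
  \<comment> \<open>Attempt Suc N exceeds the bound on attempts before the horizon, so all rounds
    have ended by then.\<close>
  have "length (arms (Suc ?N)) \<ge> horizon p" using bound[of "Suc ?N"] by (meson Suc_n_not_le_n not_less)
  then have "t \<le> length (arms (Suc ?N))" using t by simp
  from run_Some_past[OF T this] obtain s cs where r: "run p S B \<omega> t = Some (s, hist B (snd (snd \<omega>)) (take t (arms (Suc ?N))), cs)" by auto
  have tT: "t \<le> horizon p" using t by simp
  obtain j where j: "length (arms j) = t" "length cs = t" "\<forall>c\<in>set cs. c \<le> (\<Sum>i<j. snd (att i))" "\<forall>i<j. length (arms i) < t"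
    using run_SomeD[OF T tT r] by blast
  have "j \<noteq> 0" using j(1) t arms_0 by (cases j) auto
  then have "length (arms (j - 1)) < t" using j(4) by simp
  then have last: "length (arms (j - 1)) < horizon p" using tT by (rule less_le_trans)
  have jN: "j \<le> ?N + 1" using bound[OF last] unfolding le_diff_conv .
  have cm: "cm \<ge> 0" by (rule order_trans[OF of_nat_0_le_iff cost[OF last]])
  have "cs ! (t - 1) \<in> set cs" using j(2) t by (intro nth_mem) auto
  then have "real (cs ! (t - 1)) \<le> (\<Sum>i<j. real (snd (att i)))" 
    using j(3) unfolding of_nat_sum[symmetric] of_nat_le_iff by blast
  also have "\<dots> \<le> (\<Sum>i<j. cm)"
  proof (rule sum_mono)
    fix i assume "i \<in> {..<j}"
    then have "length (arms i) < horizon p" using j(4) tT by auto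
    then show "real (snd (att i)) \<le> cm" by (rule cost)
  qed
  also have "\<dots> = real j * cm" by simp
  also have "\<dots> \<le> real (?N + 1) * cm" using jN cm by (intro mult_right_mono) linarith+
  finally show ?thesis unfolding step_time_def r by simp
qed

lemma attempt_cost:
  assumes j: "length (arms j) < horizon p" and \<kappa>: "\<And>s. s \<in> levels p \<Longrightarrow> copies p s \<le> \<kappa>" and Q: "Q \<ge> 0"
    and qt: "\<And>s z us q. s \<in> levels p \<Longrightarrow> s \<noteq> s_max p \<Longrightarrow> z \<in> space (seed_dist (level_solver p S s)) \<Longrightarrow>
      admissible (point_dim p) (max_arms p) us \<Longrightarrow> q \<in> unit_ball (point_dim p) \<Longrightarrow>
      real (query_time (level_solver p S s) z us q) \<le> Q"
  shows "real (snd (att j)) \<le> real (card (levels p)) + 1 + 2 * real (point_dim p) + real \<kappa> * (Q + 1)"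
proof -
  let ?s = "current_level (st j)"
  have \<kappa>Q: "0 \<le> real \<kappa> * (Q + 1)" using Q by simp
  show ?thesis
  proof (cases "(\<forall>s. arms_of (psi (st j) s) = {}) \<or> ?s = s_max p")
    case any: True
    have "snd (att j) \<le> card (levels p) + 1"
    proof (cases "\<forall>s. arms_of (psi (st j) s) = {}")
      case True
      show ?thesis unfolding att_def attempt_def Let_def if_P[OF True] snd_conv by simp
    next
      case False
      then have s: "?s = s_max p" using any False by metis
      show ?thesis unfolding att_def attempt_def Let_def if_not_P[OF False] if_P[OF s] snd_conv by simp
    qed
    then have "real (snd (att j)) \<le> real (card (levels p)) + 1" by linarith
    then show ?thesis using \<kappa>Q by linarith
  next
    case False
    then have ne: "\<not> (\<forall>s. arms_of (psi (st j) s) = {})" and sm: "?s \<noteq> s_max p" by simp_all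
    from ne obtain l where l: "arms_of (psi (st j) l) \<noteq> {}" by auto
    have lev: "?s \<in> levels p" by (rule state_ok_nonempty(2)[OF undone_state_ok[OF j] l])
    let ?q = "round_query (point_dim p) (mips_eps p ?s) (query (past j))"
    define f where "f i = query_time (level_solver p S ?s) (fst \<omega> (?s, i)) (updates (psi (st j) ?s)) ?q" for i
    have "snd (att j) = card (levels p) + point_dim p + (point_dim p + (\<Sum>i<copies p ?s. f i + 1))"
      unfolding att_def attempt_def Let_def if_not_P[OF ne] if_not_P[OF sm] snd_conv adaptive_query_time_def query_def f_def
      by (rule refl)
    then have "real (snd (att j)) = real (card (levels p)) + 2 * real (point_dim p) + (\<Sum>i<copies p ?s. real (f i) + 1)"
      by (simp add: sum.distrib sum_Suc)
    also have "(\<Sum>i<copies p ?s. real (f i) + 1) \<le> (\<Sum>i<copies p ?s. Q + 1)"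
    proof (rule sum_mono)
      fix i assume "i \<in> {..<copies p ?s}"
      then have "fst \<omega> (?s, i) \<in> space (seed_dist (level_solver p S ?s))" using lev by (intro seed_in) auto
      from qt[OF lev sm this admissible_updates[OF good_st]
          round_query_close(1)[OF point_dim_ge mips_eps_pos query_ball[OF accurate_run]]]
      show "real (f i) + 1 \<le> Q + 1" by (simp add: f_def)
    qed
    also have "\<dots> \<le> real \<kappa> * (Q + 1)" using \<kappa>[OF lev] Q by (simp add: mult_right_mono)
    finally show ?thesis by simp
  qed
qed

end

section \<open>Exponents and thresholds as the number of arms grows\<close>

section \<open>Asymptotics in the number of arms\<close>

lemma ln_nat_at_top: "filterlim (\<lambda>K::nat. ln (real K)) at_top sequentially"
  by (rule filterlim_compose[OF ln_at_top filterlim_real_sequentially])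

text \<open>K^b = exp (b ln K) >= (b ln K)^2 / 2, which beats c ln K once ln K >= 2 c / b^2.\<close>

lemma eventually_ln_le_powr:
  fixes b c :: real
  assumes "b > 0"
  shows "\<forall>\<^sub>F K in sequentially. c * ln (real K) \<le> real K powr b"
proof -
  have "\<forall>\<^sub>F K in sequentially. max 0 (2 * c / b\<^sup>2) \<le> ln (real K)"
    using ln_nat_at_top unfolding filterlim_at_top by blast
  moreover have "\<forall>\<^sub>F K in sequentially. (1::nat) \<le> K" by (rule eventually_ge_at_top)
  ultimately show ?thesis
  proof eventually_elim
    case (elim K)
    let ?y = "ln (real K)"
    have y: "0 \<le> ?y" "2 * c / b\<^sup>2 \<le> ?y" using elim(1) by auto
    have "2 * c \<le> ?y * b\<^sup>2" using y(2) assms by (simp add: pos_divide_le_eq)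
    then have "2 * c * ?y \<le> ?y * b\<^sup>2 * ?y" using y(1) by (rule mult_right_mono)
    then have le: "c * ?y \<le> (b * ?y)\<^sup>2 / 2" by (simp add: power2_eq_square algebra_simps)
    have nn: "0 \<le> b * ?y" using y(1) assms by simp
    have "c * ?y \<le> exp (b * ?y)" using exp_lower_Taylor_quadratic[OF nn] nn le by linarith
    also have "exp (b * ?y) = real K powr b" using elim(2) by (simp add: powr_def)
    finally show ?case .
  qed
qed

lemma eventually_ln_power_le:
  fixes a q :: real
  assumes "q > 0"
  shows "\<forall>\<^sub>F K in sequentially. a * ln (real K) ^ N \<le> q * real K"
proof -
  have "((\<lambda>K::nat. ln (real K) ^ N / exp (ln (real K))) \<longlongrightarrow> 0) sequentially"
    by (rule filterlim_compose[OF tendsto_power_div_exp_0 ln_nat_at_top])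
  then have "\<forall>\<^sub>F K in sequentially. ln (real K) ^ N / exp (ln (real K)) < q / (\<bar>a\<bar> + 1)"
    by (rule order_tendstoD(2)) (use assms in simp)
  moreover have "\<forall>\<^sub>F K in sequentially. (1::nat) \<le> K" by (rule eventually_ge_at_top)
  ultimately show ?thesis
  proof eventually_elim
    case (elim K)
    let ?y = "ln (real K) ^ N"
    have K: "real K > 0" and y: "0 \<le> ?y" using elim(2) by auto
    have a: "\<bar>a\<bar> + 1 > 0" by simp
    have "?y / real K < q / (\<bar>a\<bar> + 1)" using elim(1) K by simp
    then have "?y < q / (\<bar>a\<bar> + 1) * real K" using K by (simp only: pos_divide_less_eq)
    then have "?y * (\<bar>a\<bar> + 1) < q / (\<bar>a\<bar> + 1) * real K * (\<bar>a\<bar> + 1)" using a by (rule mult_strict_right_mono)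
    also have "\<dots> = q * real K" using a by simp
    finally have "?y * (\<bar>a\<bar> + 1) < q * real K" .
    moreover have "a * ?y \<le> (\<bar>a\<bar> + 1) * ?y" using y by (intro mult_right_mono) auto
    ultimately show ?case by (simp add: mult.commute)
  qed
qed

text \<open>With a = 3 - r/4 and b = 3 - r the exponent is 4 a b / (a + b)^2 = 1 - ((a - b) / (a +
  b))^2, and (a - b) / (a + b) >= (3 r / 4) / 6 = r / 8.\<close>

lemma rho_query_le:
  assumes r: "0 < r" "r \<le> 1"
  shows "rho_query (1/4) r \<le> 1 - r\<^sup>2 / 64"
proof -
  define a where "a = 3 - 1/4 * r"
  define b where "b = 3 - r"
  have ab: "a > 0" "b > 0" using r by (auto simp: a_def b_def)
  have sq: "(sqrt (a / b))\<^sup>2 = a / b" using ab by simp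
  have "rho_query (1/4) r = 4 * (a / b) / (1 + a / b)\<^sup>2"
    unfolding rho_query_def Let_def a_def[symmetric] b_def[symmetric] sq ..
  also have "1 + a / b = (a + b) / b" using ab by (simp add: field_simps)
  also have "4 * (a / b) / ((a + b) / b)\<^sup>2 = 4 * a * b / (a + b)\<^sup>2"
    using ab by (simp add: power_divide power2_eq_square)
  also have "4 * a * b = (a + b)\<^sup>2 - (a - b)\<^sup>2" by (simp add: power2_eq_square algebra_simps)
  also have "\<dots> / (a + b)\<^sup>2 = 1 - ((a - b) / (a + b))\<^sup>2"
    using ab unfolding power_divide by (simp add: diff_divide_distrib)
  finally have eq: "rho_query (1/4) r = 1 - ((a - b) / (a + b))\<^sup>2" .
  have "a + b \<le> 6" "a - b = 3 * r / 4" using r by (simp_all add: a_def b_def)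
  then have "r / 8 * (a + b) \<le> r / 8 * 6" using r by (intro mult_left_mono) auto
  then have "r / 8 \<le> (a - b) / (a + b)" using ab \<open>a - b = _\<close> by (simp add: pos_le_divide_eq)
  then have "(r / 8)\<^sup>2 \<le> ((a - b) / (a + b))\<^sup>2" using r by (intro power_mono) auto
  then show ?thesis unfolding eq by (simp add: power_divide)
qed

text \<open>Of the gain 2 g, a portion g/4 absorbs the error term of the exponent. The surplus 3/4 g
  over the final exponent 1 - g will pay for logarithmic factors.\<close>

lemma eventually_query_time_le:
  assumes fam: "solver_family S" and n: "n \<ge> 1" and r: "0 < r" "r \<le> 1" and g: "g > 0"
    and rho: "rho_query (1/4) r \<le> 1 - 2 * g"
  shows "\<forall>\<^sub>F K in sequentially. \<forall>z\<in>space (seed_dist (S n (1/4) r K)). \<forall>us q. admissible n K us \<longrightarrow> q \<in> unit_ball n \<longrightarrow>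
    real (query_time (S n (1/4) r K) z us q) \<le> real K powr (1 - 7/4 * g)"
proof -
  have c: "(1/4::real) \<in> {0<..<1}" and r': "r \<in> {0<..1}" using r by auto
  note f = fam[unfolded solver_family_def, rule_format, OF n c r']
  show ?thesis using conjunct2[OF f]
  proof (elim bexE exE, goal_cases)
    case (1 h1 h2 h3 K1)
    have "\<forall>\<^sub>F K in sequentially. norm (h3 K) \<le> g / 4 * norm (ln (real K) powr - 0.45)"
      using landau_o.smallD[OF 1(3), of "g / 4"] g by simp
    moreover have "\<forall>\<^sub>F K in sequentially. max K1 3 \<le> K" by (rule eventually_ge_at_top)
    ultimately show ?case
    proof eventually_elim
      case (elim K)
      have K: "K1 \<le> K" "3 \<le> real K" using elim(2) by auto
      have "exp 1 \<le> real K" using exp_le K(2) by linarith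
      then have "1 \<le> ln (real K)" using K(2) by (subst ln_ge_iff) auto
      then have "ln (real K) powr - 0.45 \<le> ln (real K) powr 0" by (intro powr_mono) auto
      then have "norm (ln (real K) powr - 0.45) \<le> 1" using \<open>1 \<le> ln (real K)\<close> by simp
      then have "g / 4 * norm (ln (real K) powr - 0.45) \<le> g / 4 * 1" using g by (intro mult_left_mono) auto
      then have h: "h3 K \<le> g / 4" using elim(1) by simp
      show ?case
      proof (intro ballI allI impI)
        fix z us q assume z: "z \<in> space (seed_dist (S n (1/4) r K))" "admissible n K us" "q \<in> unit_ball n"
        have "real (query_time (S n (1/4) r K) z us q) \<le> real K powr (rho_query (1/4) r + h3 K)"
          using 1(4) K(1) z by blast
        also have "\<dots> \<le> real K powr (1 - 7/4 * g)" using K(2) rho h by (intro powr_mono) auto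
        finally show "real (query_time (S n (1/4) r K) z us q) \<le> real K powr (1 - 7/4 * g)" .
      qed
    qed
  qed
qed

section \<open>Empty arm sets\<close>

lemma raise_and_eliminate_empty:
  assumes "\<forall>s. arms_of (psi st s) = {}"
  shows "\<forall>s. arms_of (psi (raise_and_eliminate p B h X st) s) = {}"
  using assms by (simp add: raise_and_eliminate_def Let_def psi_eliminate_def)

text \<open>With nothing stored every attempt is null, and moving arms stores nothing, so the loop
  diverges.\<close>

lemma select_arm_empty:
  assumes "\<forall>s. arms_of (psi st s) = {}"
  shows "select_arm p S B z u h st = None"
proof (rule ccontr)
  assume "select_arm p S B z u h st \<noteq> None"
  then obtain t where t: "select_arm p S B z u h st = Some t" by auto
  have att: "fst (attempt p S B z u h st) = None" if "\<forall>s. arms_of (psi st s) = {}" for st :: state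
    using that by (simp add: attempt_def Let_def)
  have move: "\<forall>s. arms_of (psi (move_arms p B h st) s) = {}" if "\<forall>s. arms_of (psi st s) = {}" for st :: state
    unfolding move_arms_def Let_def by (rule raise_and_eliminate_empty) (use that in simp)
  let ?Q = "\<lambda>(st :: state, a, c :: nat). (\<forall>s. arms_of (psi st s) = {}) \<and> a = (None :: nat option)"
  have "?Q t"
  proof (rule while_option_rule[OF _ t[unfolded select_arm_def]])
    show "?Q (st, attempt p S B z u h st)" using att[OF assms] assms by (cases "attempt p S B z u h st") auto
    fix x :: "state \<times> nat option \<times> nat" assume x: "?Q x"
    obtain s a c where xe: "x = (s, a, c)" by (cases x)
    then have e: "\<forall>l. arms_of (psi s l) = {}" using x by simp
    obtain a' c' where a': "attempt p S B z u h (move_arms p B h s) = (a', c')" by fastforce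
    then have "a' = None" using att[OF move[OF e]] by simp
    then show "?Q (case x of (st, a, c) \<Rightarrow> let st' = move_arms p B h st; (a', c') = attempt p S B z u h st' in (st', a', c + c'))"
      using move[OF e] by (simp add: xe Let_def a')
  qed
  moreover have "\<not> (\<lambda>(st, a, c). a = None) t" by (rule while_option_stop[OF t[unfolded select_arm_def]])
  ultimately show False by (auto split: prod.splits)
qed

lemma run_no_arms:
  assumes "arms_at B (horizon p) = {}" "t < horizon p"
  shows "run p S B \<omega> (Suc t) = None"
  using assms(2)
proof (induction t)
  case 0
  obtain z u e where \<omega>: "\<omega> = (z, u, e)" by (cases \<omega>)
  have A: "init_arms B = {}" "new_arms B 1 = {}" using assms(1) 0 by (auto simp: arms_at_def)
  have "\<forall>s. arms_of (psi (initial_state p B) s) = {}" using A(1) by (simp add: initial_state_def arms_of_def)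
  then have "\<forall>s. arms_of (psi (add_new_arms p B [] (new_arms B 1) (initial_state p B)) s) = {}"
    unfolding add_new_arms_def A(2) by (intro raise_and_eliminate_empty) simp
  note e = this[unfolded One_nat_def]
  show ?case by (simp add: \<omega> select_arm_empty[OF e])
next
  case (Suc t)
  then have "run p S B \<omega> (Suc t) = None" by simp
  then show ?case unfolding run.simps(2)[of p S B \<omega> "Suc t"] by (simp only: option.case)
qed

text \<open>Covers K = 0, where \<open>solver_family\<close> promises no solver: no round is
  completed, and uncompleted rounds contribute nothing.\<close>

lemma regret_no_arms:
  assumes "arms_at B (horizon p) = {}"
  shows "regret p S B \<omega> = 0"
  unfolding regret_def
proof (rule sum.neutral, rule ballI)
  fix t assume "t \<in> {1..horizon p}"
  then have "t - 1 < horizon p" "Suc (t - 1) = t" by auto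
  with run_no_arms[OF assms, of "t - 1" S \<omega>] have "played p S B t \<omega> = None" by (simp add: played_def)
  then show "(case played p S B t \<omega> of None \<Rightarrow> 0
     | Some a \<Rightarrow> scalar_prod (feature B (optimal_arm B t)) (theta B) - scalar_prod (feature B a) (theta B)) = 0" by simp
qed

section \<open>The good event\<close>

context bandit_setup
begin

text \<open>The coins are drawn from a measure on all reals, so they lie in [0, 1) only almost
  surely; on this set all of them do.\<close>

definition coin_event :: "('s, 'e) outcome set" where
  "coin_event = space seed_space \<times> (Pi\<^sub>E {1..horizon p} (\<lambda>_. {0..<1})) \<times> space (env B)"

lemma coin_event:
  shows "coin_event \<in> sets M" and "prob coin_event = 1"
    and "\<omega> \<in> coin_event \<Longrightarrow> t \<in> {1..horizon p} \<Longrightarrow> 0 \<le> fst (snd \<omega>) t \<and> fst (snd \<omega>) t < 1"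
proof -
  let ?G = "Pi\<^sub>E {1..horizon p} (\<lambda>_. {0..<1::real})"
  interpret ce: pair_prob_space coin_space "env B" by unfold_locales
  interpret se: pair_prob_space seed_space "coin_space \<Otimes>\<^sub>M env B" by unfold_locales
  interpret u: product_sigma_finite "\<lambda>_::nat. uniform_measure lborel {0..<1::real}"
    unfolding product_sigma_finite_def using prob_space_imp_sigma_finite[OF prob_space_uniform] by blast
  have G: "?G \<in> sets coin_space" by (rule sets_PiM_I_finite) auto
  have "emeasure (uniform_measure lborel {0..<1::real}) {0..<1} = 1" by (subst emeasure_uniform_measure) auto
  then have eG: "emeasure coin_space ?G = 1" by (subst u.emeasure_PiM) auto
  have Y: "?G \<times> space (env B) \<in> sets (coin_space \<Otimes>\<^sub>M env B)" using G by (intro pair_measureI) auto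
  have "emeasure (coin_space \<Otimes>\<^sub>M env B) (?G \<times> space (env B)) = emeasure coin_space ?G * emeasure (env B) (space (env B))"
    by (rule env.emeasure_pair_measure_Times[OF G sets.top])
  then have eY: "emeasure (coin_space \<Otimes>\<^sub>M env B) (?G \<times> space (env B)) = 1"
    unfolding eG env.emeasure_space_1 by simp
  have sY: "sigma_finite_measure (coin_space \<Otimes>\<^sub>M env B)" by unfold_locales
  have "emeasure (seed_space \<Otimes>\<^sub>M (coin_space \<Otimes>\<^sub>M env B)) (space seed_space \<times> (?G \<times> space (env B)))
      = emeasure seed_space (space seed_space) * emeasure (coin_space \<Otimes>\<^sub>M env B) (?G \<times> space (env B))"
    by (rule sigma_finite_measure.emeasure_pair_measure_Times[OF sY sets.top Y])
  then have "emeasure M coin_event = 1"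
    unfolding eY seeds.emeasure_space_1 coin_event_def outcome_space_def by simp
  then show "prob coin_event = 1" by (simp add: measure_def)
  show "coin_event \<in> sets M" unfolding coin_event_def outcome_space_def by (rule pair_measureI[OF sets.top Y])
  show "0 \<le> fst (snd \<omega>) t \<and> fst (snd \<omega>) t < 1" if "\<omega> \<in> coin_event" "t \<in> {1..horizon p}"
  proof -
    have "fst (snd \<omega>) \<in> ?G" using that(1) unfolding coin_event_def by auto
    then have "fst (snd \<omega>) t \<in> {0..<1}" using that(2) by (rule PiE_mem)
    then show ?thesis by simp
  qed
qed

lemma prob_Diff_ge:
  assumes "X \<in> sets M" "W \<in> sets M"
  shows "prob (X - W) \<ge> prob X - prob W"
  using finite_measure_Diff'[OF assms] finite_measure_mono[OF Int_lower2[of X W] assms(2)] by simp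

text \<open>Half of delta is spent on the confidence bound; the other half is kept for failures of
  the solver.\<close>

lemma good_event:
  assumes "subgaussian_noise p S B" and conf: "0 < conf p" "conf p < 1"
    and T2: "horizon p \<ge> 2" and eta: "eta p = 1 / sqrt (real (horizon p))"
  obtains G where "G \<in> sets M" "prob G \<ge> 1 - conf p / 2" "\<And>\<omega>. \<omega> \<in> G \<Longrightarrow> elimination_run p S B C \<omega>"
proof (rule that)
  let ?W = "{\<omega> \<in> space M. \<exists>n\<le>horizon p. wealth n \<omega> \<ge> 1 / (conf p / 2)}"
  have pos: "conf p / 2 > 0" using conf by simp
  note W = prob_confidence[OF assms(1) pos]
  show "coin_event - ?W \<in> sets M" using coin_event(1) W(2) by (rule sets.Diff)
  show "prob (coin_event - ?W) \<ge> 1 - conf p / 2"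
    using prob_Diff_ge[OF coin_event(1) W(2)] coin_event(2) W(1) by linarith
  fix \<omega> assume w: "\<omega> \<in> coin_event - ?W"
  then have sp: "\<omega> \<in> space M" using sets.sets_into_space[OF coin_event(1)] by blast
  show "elimination_run p S B C \<omega>"
  proof (unfold_locales)
    show "0 \<le> fst (snd \<omega>) t \<and> fst (snd \<omega>) t < 1" if "t \<in> {1..horizon p}" for t
      using coin_event(3) w that by blast
    show "wealth n \<omega> < 2 / conf p" if "n \<le> horizon p" for n
    proof (rule ccontr)
      assume "\<not> wealth n \<omega> < 2 / conf p"
      then have "wealth n \<omega> \<ge> 1 / (conf p / 2)" by simp
      then have "\<omega> \<in> ?W" using sp that by blast
      then show False using w by blast
    qed
  qed (use sp conf T2 eta in auto)
qed

end

section \<open>Constants for a fixed horizon, and the final bounds\<close>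

section \<open>Parameters with a fixed horizon\<close>

text \<open>Chosen so that beta^2 <= \<open>level_const\<close> * ln T for T >= 2; as ln T >= 1/2,
  the terms of beta^2 without ln T are doubled.\<close>

definition level_const :: "nat \<Rightarrow> real \<Rightarrow> real" where
  "level_const d \<delta> = 4 + 8 * ln (2 / \<delta>) + 4 * real d"

text \<open>Half of m^2 / 64, where m = 1 / (4 d^2 \<open>level_const\<close> T ln T) bounds
  \<open>mips_r\<close> from below at every queried level and r^2 / 64 is the gain in
  \<open>rho_query_le\<close>; this gives 2 * 64 * 16 = 2048.\<close>

definition rate :: "nat \<Rightarrow> real \<Rightarrow> nat \<Rightarrow> real" where
  "rate d \<delta> T = 1 / (2048 * real d ^ 4 * (level_const d \<delta>)\<^sup>2) / ((real T)\<^sup>2 * (ln (real T))\<^sup>2)"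

locale horizon_params =
  fixes d T :: nat and \<delta> :: real
  assumes d1: "1 \<le> d" and T2: "2 \<le> T" and \<delta>: "0 < \<delta>" "\<delta> < 1"
begin

definition P :: "nat \<Rightarrow> params" where
  "P K = \<lparr>dim = d, horizon = T, conf = \<delta>, eta = 1 / sqrt (real T), max_arms = K\<rparr>"

text \<open>These quantities do not involve the number of arms, so they are read off at
  \<open>P 0\<close> and are constants as K grows.\<close>

definition bet :: real where "bet = beta (P 0)"
definition lev :: "int set" where "lev = levels (P 0)"
definition smax :: int where "smax = s_max (P 0)"
definition eps :: "int \<Rightarrow> real" where "eps = mips_eps (P 0)"
definition dpsi :: real where "dpsi = delta_psi (P 0)"
definition mr :: "int \<Rightarrow> real" where "mr = mips_r (P 0)"

lemma P_simps: "params.dim (P K) = d" "horizon (P K) = T" "conf (P K) = \<delta>" "eta (P K) = 1 / sqrt (real T)"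
    "max_arms (P K) = K" "point_dim (P K) = d * d"
  by (simp_all add: P_def point_dim_def)

lemma beta_P: "beta (P K) = bet" by (simp add: bet_def beta_def P_simps)
lemma s_max_P: "s_max (P K) = smax" by (simp add: smax_def s_max_def P_simps)
lemma levels_P: "levels (P K) = lev" unfolding lev_def levels_def beta_P s_max_P ..
lemma delta_psi_P: "delta_psi (P K) = dpsi" unfolding dpsi_def delta_psi_def s_max_P P_simps ..
lemma mips_eps_P: "mips_eps (P K) = eps" unfolding eps_def mips_eps_def beta_P P_simps by (rule ext) (rule refl)
lemma mips_r_P: "mips_r (P K) = mr" unfolding mr_def mips_r_def beta_P P_simps by (rule ext) (rule refl)

lemma ln_T: "1 / 2 \<le> ln (real T)"
proof -
  have "ln 2 \<le> ln (real T)" using T2 by (subst ln_le_cancel_iff) auto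
  then show ?thesis using ln2_ge_two_thirds by linarith
qed

lemma ln_delta: "0 \<le> ln (2 / \<delta>)"
  by (rule ln_ge_zero) (use \<delta> in \<open>simp add: field_simps\<close>)

lemma ln_ratio: "0 \<le> ln (1 + real T / real d)" "ln (1 + real T / real d) \<le> 2 * ln (real T)"
proof -
  show "0 \<le> ln (1 + real T / real d)" by (rule ln_ge_zero) simp
  have "real T / real d \<le> real T / 1" using d1 by (intro divide_left_mono) auto
  moreover have "2 * real T \<le> real T * real T" using T2 by (intro mult_right_mono) auto
  ultimately have le: "1 + real T / real d \<le> real T ^ 2" using T2 unfolding power2_eq_square by linarith
  have "1 + real T / real d > 0" by (rule add_pos_nonneg) auto
  then have "ln (1 + real T / real d) \<le> ln (real T ^ 2)" using le T2 by (subst ln_le_cancel_iff) auto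
  also have "\<dots> = 2 * ln (real T)" using T2 by (simp add: ln_realpow)
  finally show "ln (1 + real T / real d) \<le> 2 * ln (real T)" .
qed

lemma bet_ge: "1 \<le> bet"
  using ln_delta ln_ratio(1) by (simp add: bet_def beta_def P_simps)

text \<open>(1 + sqrt y)^2 <= 2 + 2 y with y the radicand of \<open>beta\<close>.\<close>

lemma bet_sq_le: "bet\<^sup>2 \<le> 2 + 4 * ln (2 / \<delta>) + 4 * real d * ln (real T)"
proof -
  define u where "u = real d * ln (1 + real T / real d)"
  define v where "v = real d * ln (real T)"
  define l where "l = ln (2 / \<delta>)"
  define y where "y = 2 * l + u"
  have "0 \<le> y" using ln_delta ln_ratio(1) by (simp add: y_def u_def l_def)
  then have sq: "(sqrt y)\<^sup>2 = y" by simp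
  have "0 \<le> (1 - sqrt y)\<^sup>2" by simp
  then have "2 * sqrt y \<le> 1 + y" using sq by (simp add: power2_diff)
  moreover have "bet = 1 + sqrt y" by (simp add: bet_def beta_def P_simps y_def u_def l_def)
  then have "bet\<^sup>2 = 1 + 2 * sqrt y + y" using sq by (simp add: power2_sum)
  ultimately have b2: "bet\<^sup>2 \<le> 2 + 2 * y" by linarith
  have "real d * ln (1 + real T / real d) \<le> real d * (2 * ln (real T))"
    using ln_ratio(2) by (rule mult_left_mono) simp
  then have "u \<le> 2 * v" unfolding u_def v_def by simp
  then have "2 + 2 * y \<le> 2 + 2 * (2 * l + 2 * v)" by (simp add: y_def)
  also have "\<dots> = 2 + 4 * l + 4 * v" by simp
  finally have "bet\<^sup>2 \<le> 2 + 4 * l + 4 * v" by (rule order_trans[OF b2])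
  then show ?thesis by (simp add: v_def l_def)
qed

lemma bet_sq_le_const: "bet\<^sup>2 \<le> level_const d \<delta> * ln (real T)"
proof -
  have "4 * ln (2 / \<delta>) = 8 * ln (2 / \<delta>) * (1 / 2)" by simp
  also have "\<dots> \<le> 8 * ln (2 / \<delta>) * ln (real T)" using ln_T ln_delta by (intro mult_left_mono) auto
  finally have "4 * ln (2 / \<delta>) \<le> 8 * ln (2 / \<delta>) * ln (real T)" .
  then show ?thesis using bet_sq_le ln_T unfolding level_const_def distrib_right by linarith
qed

lemma level_const_pos: "level_const d \<delta> > 0"
  using ln_delta by (simp add: level_const_def add_pos_nonneg)

lemma rate_bounds: "0 < rate d \<delta> T" "rate d \<delta> T \<le> 1 / 2"
proof -
  have d: "1 \<le> real d ^ 4" using d1 by (intro one_le_power) auto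
  have c: "1 \<le> (level_const d \<delta>)\<^sup>2" using ln_delta by (intro one_le_power) (simp add: level_const_def)
  have "1 \<le> real d ^ 4 * (level_const d \<delta>)\<^sup>2" using mult_mono[OF d c] by simp
  then have dc: "2048 \<le> 2048 * real d ^ 4 * (level_const d \<delta>)\<^sup>2" by simp
  have "1 \<le> real T * ln (real T)" using mult_mono[of 2 "real T" "1/2" "ln (real T)"] T2 ln_T by simp
  then have "1 \<le> (real T * ln (real T))\<^sup>2" by (rule one_le_power)
  then have t: "1 \<le> (real T)\<^sup>2 * (ln (real T))\<^sup>2" by (simp only: power_mult_distrib)
  show "0 < rate d \<delta> T" unfolding rate_def using dc t by (intro divide_pos_pos) linarith+
  have "1 / (2048 * real d ^ 4 * (level_const d \<delta>)\<^sup>2) \<le> 1 / 2048" using dc by (intro divide_left_mono) auto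
  then have "rate d \<delta> T \<le> (1 / 2048) / 1" unfolding rate_def using t dc by (intro frac_le) auto
  then show "rate d \<delta> T \<le> 1 / 2" by simp
qed

lemma inv_T_le: "1 / real T \<le> 1 / 2" using T2 by (simp add: field_simps)

lemma mr_eq: "mr s = 2 powr (- 2 * of_int s - 2) * (1 - 1 / real T) / ((real d)\<^sup>2 * bet\<^sup>2)"
  unfolding mr_def mips_r_def beta_P P_simps by (simp add: power_divide)

lemma mr_pos: "mr s > 0"
  unfolding mr_eq using inv_T_le d1 bet_ge by (intro divide_pos_pos mult_pos_pos) auto

text \<open>The guarantees of the solver family are for r <= 1. Every level satisfies s > -log beta
  - 1, hence 4^(-s-1) <= beta^2.\<close>

lemma mr_le: "s \<in> lev \<Longrightarrow> mr s \<le> 1"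
proof -
  assume s: "s \<in> lev"
  have "\<lfloor>- log 2 bet\<rfloor> \<le> s" using s by (simp add: lev_def levels_def beta_P)
  then have "- log 2 bet < of_int s + 1" by (simp only: floor_le_iff)
  then have "2 powr (- 2 * of_int s - 2) \<le> 2 powr (log 2 bet + log 2 bet)" by (intro powr_mono) auto
  also have "\<dots> = bet\<^sup>2" unfolding powr_add power2_eq_square using bet_ge by simp
  finally have "2 powr (- 2 * of_int s - 2) * (1 - 1 / real T) \<le> bet\<^sup>2 * 1" using inv_T_le by (intro mult_mono) auto
  also have "\<dots> \<le> (real d)\<^sup>2 * bet\<^sup>2" using d1 mult_right_mono[of 1 "(real d)\<^sup>2" "bet\<^sup>2"] by simp
  finally show "mr s \<le> 1" unfolding mr_eq using d1 bet_ge by (subst divide_le_eq_1_pos) auto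
qed

text \<open>A queried level has s <= 0 or s <= log (sqrt T / 8), so 4^(-s-1) is at least 1/4 or
  16/T. At \<open>smax\<close> arms are drawn at random and no solver is asked.\<close>

lemma level_scale_ge:
  assumes s: "s \<in> lev" "s \<noteq> smax"
  shows "1 / (2 * real T) \<le> 2 powr (- 2 * of_int s - 2)"
proof (cases "s \<le> 0")
  case True
  have "1 / (2 * real T) \<le> 1 / 4" using inv_T_le by simp
  also have "\<dots> = 2 powr (- 2 :: real)" by (simp add: powr_minus)
  also have "\<dots> \<le> 2 powr (- 2 * of_int s - 2)" using True by (intro powr_mono) auto
  finally show ?thesis .
next
  case False
  let ?x = "sqrt (real T) / 8"
  have x: "?x > 0" "?x * ?x = real T / 64" using T2 by auto
  have "s \<le> max 0 smax" using s(1) by (simp add: lev_def levels_def s_max_P)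
  then have "s \<le> smax - 1" using s(2) False by linarith
  also have "smax = \<lceil>log 2 ?x\<rceil>" by (simp add: smax_def s_max_def P_simps)
  finally have "of_int s \<le> log 2 ?x" using ceiling_correct[of "log 2 ?x"] by linarith
  then have "2 powr (- (log 2 ?x + log 2 ?x) + - 2) \<le> 2 powr (- 2 * of_int s - 2)" by (intro powr_mono) auto
  moreover have "2 powr (- (log 2 ?x + log 2 ?x) + - 2) = inverse (?x * ?x) * (1 / 4)"
    unfolding powr_add powr_minus using x(1) by simp
  moreover have "inverse (?x * ?x) * (1 / 4) = 16 / real T" unfolding x(2) by simp
  moreover have "1 / (2 * real T) \<le> 16 / real T" using T2 by (simp add: field_simps)
  ultimately show ?thesis by linarith
qed

lemma rho_query_mr_le:
  assumes s: "s \<in> lev" "s \<noteq> smax"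
  shows "rho_query (1/4) (mr s) \<le> 1 - 2 * rate d \<delta> T"
proof -
  define m where "m = 1 / (2 * real T) * (1 / 2) / ((real d)\<^sup>2 * (level_const d \<delta> * ln (real T)))"
  have pos: "real d > 0" "real T > 0" "ln (real T) > 0" "level_const d \<delta> > 0"
    using d1 T2 ln_T level_const_pos by auto
  have num: "1 / (2 * real T) * (1 / 2) \<le> 2 powr (- 2 * of_int s - 2) * (1 - 1 / real T)"
    using level_scale_ge[OF s] inv_T_le by (intro mult_mono) auto
  have den: "(real d)\<^sup>2 * bet\<^sup>2 \<le> (real d)\<^sup>2 * (level_const d \<delta> * ln (real T))"
    using bet_sq_le_const by (intro mult_left_mono) auto
  have "0 < (real d)\<^sup>2 * bet\<^sup>2" using d1 bet_ge by (intro mult_pos_pos zero_less_power) auto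
  moreover have "0 \<le> 2 powr (- 2 * of_int s - 2) * (1 - 1 / real T)" using inv_T_le by (intro mult_nonneg_nonneg) auto
  ultimately have "m \<le> mr s" unfolding m_def mr_eq using num den by (intro frac_le)
  moreover have m0: "0 < m" unfolding m_def using pos by (intro divide_pos_pos mult_pos_pos zero_less_power) auto
  ultimately have "m\<^sup>2 \<le> (mr s)\<^sup>2" by (intro power_mono) auto
  moreover have "m\<^sup>2 / 64 = 2 * rate d \<delta> T"
    using pos unfolding m_def rate_def by (simp add: power_mult_distrib power_divide power2_eq_square power4_eq_xxxx field_simps)
  ultimately show ?thesis using rho_query_le[OF mr_pos mr_le[OF s(1)]] by linarith
qed

lemma finite_lev: "finite lev" by (simp add: lev_def levels_def)

lemma zero_in_lev: "0 \<in> lev"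
proof -
  have "log 2 bet \<ge> 0" using bet_ge by simp
  then have "\<lfloor>- log 2 bet\<rfloor> \<le> 0" by (simp add: floor_le_iff)
  then show ?thesis by (simp add: lev_def levels_def beta_P)
qed

text \<open>Level, eps and error probability enter only as an additive constant beside the multiple
  of ln K; the lower bound uses d^2 >= 1.\<close>

lemma copies_bounds:
  "\<exists>A\<ge>0. \<forall>K\<ge>1. \<forall>s\<in>lev. nat \<lceil>ln (real K) - A\<rceil> \<le> copies (P K) s \<and>
     copies (P K) s \<le> nat \<lceil>real (d * d) * ln (real K) + A\<rceil>"
proof -
  let ?n = "real (d * d)"
  define w where "w s = ?n / (eps s * dpsi)" for s
  define A where "A = (\<Sum>s\<in>lev. \<bar>?n * ln (w s)\<bar>)"
  have n: "1 \<le> ?n" using d1 mult_mono[of 1 "real d" 1 "real d"] by simp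
  have eps_pos: "eps s > 0" for s
    unfolding eps_def mips_eps_def beta_P P_simps using d1 T2 bet_ge
    by (intro divide_pos_pos mult_pos_pos zero_less_power) auto
  have "dpsi > 0" unfolding dpsi_def delta_psi_def P_simps using \<delta> by (intro divide_pos_pos) auto
  then have w: "w s > 0" for s unfolding w_def using n eps_pos by (intro divide_pos_pos mult_pos_pos) auto
  have A: "\<bar>?n * ln (w s)\<bar> \<le> A" if "s \<in> lev" for s
    unfolding A_def by (rule member_le_sum[OF that]) (use finite_lev in auto)
  have "nat \<lceil>ln (real K) - A\<rceil> \<le> copies (P K) s \<and> copies (P K) s \<le> nat \<lceil>?n * ln (real K) + A\<rceil>"
    if K: "1 \<le> K" and s: "s \<in> lev" for K s
  proof -
    have "real K * ?n / (eps s * dpsi) = real K * w s" by (simp add: w_def)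
    then have "copies (P K) s = nat \<lceil>?n * ln (real K * w s)\<rceil>"
      unfolding copies_def num_copies_def P_simps mips_eps_P delta_psi_P by simp
    also have "ln (real K * w s) = ln (real K) + ln (w s)" using K w by (intro ln_mult_pos) auto
    finally have c: "copies (P K) s = nat \<lceil>?n * ln (real K) + ?n * ln (w s)\<rceil>" by (simp only: distrib_left)
    have "1 * ln (real K) \<le> ?n * ln (real K)" using n K by (intro mult_right_mono) auto
    then show ?thesis unfolding c using A[OF s] by (intro conjI nat_mono ceiling_mono) linarith+
  qed
  moreover have "A \<ge> 0" unfolding A_def by (intro sum_nonneg) auto
  ultimately show ?thesis by blast
qed

text \<open>With z = d ln (T / delta) one has beta^2 <= 12 z, and the radicand of the width sum is
  at most 4 z T, so beta times its root is at most 7 z sqrt T. As sqrt T <= 2 z sqrt T, the constant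
  is 32 * 2 + 32 * 7 = 288.\<close>

lemma regret_bound:
  assumes "elimination_run (P K) S B C \<omega>"
  shows "regret (P K) S B \<omega> \<le> 288 * real d * sqrt (real T) * ln (real T / \<delta>)"
proof -
  interpret E: elimination_run "P K" S B C \<omega> by fact
  let ?L = "ln (real T / \<delta>)" and ?q = "sqrt (real T)"
  have "real T / 1 \<le> real T / \<delta>" using \<delta> by (intro divide_left_mono) auto
  then have L1: "ln (real T) \<le> ?L" using T2 by (subst ln_le_cancel_iff) auto
  have "2 / \<delta> \<le> real T / \<delta>" using \<delta> T2 by (intro divide_right_mono) auto
  then have L2: "ln (2 / \<delta>) \<le> ?L" using \<delta> T2 by (subst ln_le_cancel_iff) auto
  have L: "1 / 2 \<le> ?L" using L1 ln_T by linarith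
  define z where "z = real d * ?L"
  have Lz: "?L \<le> z" unfolding z_def using mult_right_mono[of 1 "real d" ?L] d1 L by simp
  have z: "1 / 2 \<le> z" using L Lz by linarith
  have q: "0 \<le> ?q" "?q * ?q = real T" by simp_all
  have lnT_z: "real d * ln (real T) \<le> z" unfolding z_def using L1 by (rule mult_left_mono) simp
  have "?q * 1 \<le> ?q * (2 * z)" using z q(1) by (intro mult_left_mono) auto
  then have qz: "?q \<le> 2 * (?q * z)" by simp
  show ?thesis
  proof (cases "T < 8")
    \<comment> \<open>Here sqrt T <= 3, so the trivial bound 2 T is at most 6 sqrt T.\<close>
    case True
    then have "sqrt (real T) \<le> sqrt (3\<^sup>2)" by (intro real_sqrt_le_mono) auto
    then have "?q \<le> 3" by simp
    then have "?q * ?q \<le> 3 * ?q" using q(1) by (rule mult_right_mono)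
    then have "real T \<le> 3 * ?q" using q(2) by simp
    then have "regret (P K) S B \<omega> \<le> 6 * ?q" using E.regret_le_horizon unfolding P_simps by linarith
    moreover have "0 \<le> ?q * z" using q(1) z by (intro mult_nonneg_nonneg) auto
    ultimately have "regret (P K) S B \<omega> \<le> 288 * (?q * z)" using qz by linarith
    then show ?thesis by (simp add: z_def mult_ac)
  next
    case False
    let ?X = "2 * real d * ln (1 + real T / real d) * real T"
    have X0: "0 \<le> ?X" using ln_ratio(1) by (intro mult_nonneg_nonneg) auto
    have "bet\<^sup>2 \<le> 12 * z" using bet_sq_le L2 L Lz lnT_z by linarith
    moreover have "real d * ln (1 + real T / real d) \<le> real d * (2 * ln (real T))"
      using ln_ratio(2) by (rule mult_left_mono) simp
    then have "2 * real d * ln (1 + real T / real d) \<le> 4 * z" using lnT_z by linarith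
    then have "?X \<le> 4 * z * real T" by (rule mult_right_mono) simp
    ultimately have "bet\<^sup>2 * ?X \<le> 12 * z * (4 * z * real T)" by (rule mult_mono) (use X0 z in simp_all)
    also have "\<dots> = 48 * (z\<^sup>2 * real T)" by (simp add: power2_eq_square)
    also have "\<dots> \<le> 49 * (z\<^sup>2 * real T)" by (intro mult_right_mono) auto
    also have "\<dots> = (7 * (?q * z))\<^sup>2" by (simp add: power_mult_distrib)
    finally have "(bet * sqrt ?X)\<^sup>2 \<le> (7 * (?q * z))\<^sup>2" using X0 by (simp add: power_mult_distrib)
    then have "bet * sqrt ?X \<le> 7 * (?q * z)" by (rule power2_le_imp_le) (use q(1) z in simp)
    moreover have "regret (P K) S B \<omega> \<le> 32 * ?q + 32 * bet * sqrt ?X"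
      using E.regret_le False unfolding P_simps beta_P by simp
    ultimately have "regret (P K) S B \<omega> \<le> 288 * (?q * z)" using qz by linarith
    then show ?thesis by (simp add: z_def mult_ac)
  qed
qed

text \<open>At most T * C arms are added later. An initial arm guarantees that something is stored
  in every round.\<close>

lemma init_nonempty:
  assumes v: "valid_bandit d T C K B" and K: "T * C < K"
  shows "init_arms B \<noteq> {}"
proof
  assume "init_arms B = {}"
  then have "arms_at B T = (\<Union>i\<in>{1..T}. new_arms B i)" by (simp add: arms_at_def)
  then have "K \<le> (\<Sum>i\<in>{1..T}. card (new_arms B i))"
    using v card_UN_le[of "{1..T}" "new_arms B"] by (simp add: valid_bandit_def)
  also have "\<dots> \<le> of_nat (card {1..T}) * C" using v by (intro sum_bounded_above) (auto simp: valid_bandit_def)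
  finally show False using K by simp
qed

lemma bandit_setup_P:
  fixes B :: "'e bandit"
  assumes fam: "solver_family S" and v: "valid_bandit d T C K B" and K: "1 \<le> K"
  shows "bandit_setup (P K) S B C"
proof
  fix s assume "s \<in> levels (P K)"
  then have "mr s \<in> {0<..1}" using mr_pos mr_le by (auto simp: levels_P)
  moreover have "(1/4::real) \<in> {0<..<1}" "1 \<le> d * d" using d1 by auto
  ultimately show "solves_mips (point_dim (P K)) (1/4) (mips_r (P K) s) (max_arms (P K)) (level_solver (P K) S s)"
    using fam K unfolding solver_family_def level_solver_def P_simps mips_r_P by blast
qed (use d1 T2 v in \<open>auto simp: P_simps\<close>)

end

lemma prob_space_pair_measure:
  assumes "prob_space M" "prob_space N"
  shows "prob_space (M \<Otimes>\<^sub>M N)"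
proof -
  interpret M: prob_space M by fact
  interpret N: prob_space N by fact
  interpret pair_prob_space M N by unfold_locales
  show ?thesis by unfold_locales
qed

context horizon_params
begin

text \<open>A bound for the number of attempts in T rounds; since it does not depend on K, its use
  as an exponent leaves powers of ln K polylogarithmic.\<close>

definition rounds :: nat where
  "rounds = T * (nat (smax - \<lfloor>- log 2 bet\<rfloor>) + 3)"

lemma step_time_bound:
  assumes run: "elimination_run (P K) S B C \<omega>"
    and ok: "\<not> bandit_setup.fails_within (P K) S B rounds \<kappa> \<omega>"
    and cop: "\<And>s. s \<in> lev \<Longrightarrow> 1 \<le> copies (P K) s \<and> copies (P K) s \<le> \<kappa>" "1 \<le> \<kappa>"
    and init: "init_arms B \<noteq> {}" and t: "t \<in> {1..T}" and Q: "0 \<le> Q"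
    and qt: "\<And>s z us q. s \<in> lev \<Longrightarrow> s \<noteq> smax \<Longrightarrow> z \<in> space (seed_dist (level_solver (P K) S s)) \<Longrightarrow>
      admissible (d * d) K us \<Longrightarrow> q \<in> unit_ball (d * d) \<Longrightarrow> real (query_time (level_solver (P K) S s) z us q) \<le> Q"
  shows "\<exists>c. step_time (P K) S B t \<omega> = Some c \<and>
    real c \<le> real (rounds + 1) * (real (card lev) + 1 + 2 * real (d * d) + real \<kappa> * (Q + 1))"
proof -
  interpret E: elimination_run "P K" S B C \<omega> by fact
  have r: "T * E.attempts_per_round = rounds"
    unfolding E.attempts_per_round_def rounds_def s_max_P beta_P ..
  show ?thesis
  proof (rule E.step_time_le[unfolded P_simps r levels_P])
    show "\<not> E.fails_within rounds \<kappa> \<omega>" by (rule ok)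
    show "1 \<le> copies (P K) s" if "s \<in> lev" for s using cop(1)[OF that] by blast
    show "copies (P K) s \<le> \<kappa>" if "s \<in> lev" for s using cop(1)[OF that] by blast
    show "1 \<le> \<kappa>" "init_arms B \<noteq> {}" "t \<in> {1..T}" by fact+
    fix j assume j: "length (E.arms j) < T"
    show "real (snd (E.att j)) \<le> real (card lev) + 1 + 2 * real (d * d) + real \<kappa> * (Q + 1)"
    proof (rule E.attempt_cost[unfolded P_simps levels_P s_max_P])
      show "length (E.arms j) < T" "0 \<le> Q" by fact+
      show "copies (P K) s \<le> \<kappa>" if "s \<in> lev" for s using cop(1)[OF that] by blast
      fix s z us q
      assume "s \<in> lev" "s \<noteq> smax" "z \<in> space (seed_dist (level_solver (P K) S s))"
        "admissible (d * d) K us" "q \<in> unit_ball (d * d)"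
      then show "real (query_time (level_solver (P K) S s) z us q) \<le> Q" by (rule qt)
    qed
  qed
qed

text \<open>For K = 0 the logarithm in \<open>num_copies\<close> is \<open>ln 0 = 0\<close>, so
  there are no copies and the seed space is a product over the empty set.\<close>

lemma prob_space_no_arms:
  assumes "prob_space (env B)"
  shows "prob_space (outcome_space (P 0) S B)"
proof -
  have e: "(SIGMA s : levels (P 0). {..<copies (P 0) s}) = {}"
    by (auto simp: copies_def num_copies_def P_simps)
  show ?thesis unfolding outcome_space_def e
    by (intro prob_space_pair_measure prob_space_PiM prob_space_uniform_measure assms) auto
qed

text \<open>From k >= ln K - A and 1/10 <= 1/e follows 10^-k <= e^A / K; all other factors are
  constants and powers of ln K, which K outgrows.\<close>

lemma fails_prob_le:
  fixes y A a K :: real and k N \<kappa> :: nat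
  assumes y: "1 \<le> y" "K = exp y" and k: "y - A \<le> real k" "N \<le> k" and \<kappa>: "real \<kappa> \<le> a * y"
    and small: "real N * a ^ N * 10 ^ N * exp A * y ^ N \<le> q * K"
  shows "real N * real \<kappa> ^ N * (1 / 10) ^ (k - N) \<le> q"
proof -
  have K: "K > 0" using y(2) by simp
  have "inverse 3 \<le> inverse (exp (1::real))" by (rule le_imp_inverse_le[OF exp_le exp_gt_zero])
  moreover have "1 / 10 \<le> inverse (3 :: real)" by (simp add: inverse_eq_divide)
  ultimately have "1 / 10 \<le> exp (- 1 :: real)" unfolding exp_minus by (rule order_trans[rotated])
  then have "(1 / 10 :: real) ^ k \<le> exp (- 1) ^ k" by (rule power_mono) simp
  also have "\<dots> = exp (real k * - 1)" by (rule exp_of_nat_mult[symmetric])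
  also have "\<dots> \<le> exp (A - y)" using k(1) by simp
  also have "\<dots> = exp A / K" using y(2) by (simp add: exp_diff)
  finally have e: "(1 / 10 :: real) ^ k \<le> exp A / K" .
  have "(1 / 10 :: real) ^ (k - N) = (1 / 10) ^ k / (1 / 10) ^ N" by (rule power_diff[OF _ k(2)]) simp
  also have "\<dots> = 10 ^ N * (1 / 10) ^ k" by (simp add: power_divide)
  also have "\<dots> \<le> 10 ^ N * (exp A / K)" using e by (rule mult_left_mono) simp
  finally have p: "(1 / 10 :: real) ^ (k - N) \<le> 10 ^ N * (exp A / K)" .
  have "real \<kappa> ^ N \<le> (a * y) ^ N" using \<kappa> by (rule power_mono) simp
  then have "real N * real \<kappa> ^ N \<le> real N * (a * y) ^ N" by (rule mult_left_mono) simp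
  then have "real N * real \<kappa> ^ N * (1 / 10) ^ (k - N) \<le> real N * (a * y) ^ N * (10 ^ N * (exp A / K))"
    by (rule mult_mono[OF _ p]) (use \<kappa> order_trans[OF of_nat_0_le_iff \<kappa>] in simp_all)
  also have "\<dots> = real N * a ^ N * 10 ^ N * exp A * y ^ N / K" by (simp add: power_mult_distrib)
  also have "\<dots> \<le> q" using small K by (simp add: pos_divide_le_eq)
  finally show ?thesis .
qed

lemma high_probability_bound:
  fixes S :: "nat \<Rightarrow> real \<Rightarrow> real \<Rightarrow> nat \<Rightarrow> 's solver"
  assumes fam: "solver_family S"
  shows "\<exists>K0. \<forall>K. \<forall>B :: 'e bandit. valid_bandit d T C K B \<longrightarrow> subgaussian_noise (P K) S B \<longrightarrow>
    (\<exists>E\<in>sets (outcome_space (P K) S B). measure (outcome_space (P K) S B) E \<ge> 1 - \<delta> \<and>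
      (\<forall>\<omega>\<in>E. regret (P K) S B \<omega> \<le> 288 * real d * sqrt (real T) * ln (real T / \<delta>) ^ 1 \<and>
        (K \<ge> K0 \<longrightarrow> (\<forall>t\<in>{1..T}. \<exists>c. step_time (P K) S B t \<omega> = Some c \<and>
           real c \<le> real K powr (1 - rate d \<delta> T)))))"
proof -
  let ?n = "real (d * d)" and ?g = "rate d \<delta> T"
  obtain A where A0: "0 \<le> A" and A: "\<And>K s. 1 \<le> K \<Longrightarrow> s \<in> lev \<Longrightarrow> nat \<lceil>ln (real K) - A\<rceil> \<le> copies (P K) s \<and>
     copies (P K) s \<le> nat \<lceil>?n * ln (real K) + A\<rceil>" using copies_bounds by blast
  \<comment> \<open>Makes \<open>\<kappa> K\<close> at most a * ln K as soon as ln K >= 1.\<close>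
  define a where "a = ?n + A + 1"
  define kk where "kk K = nat \<lceil>ln (real K) - A\<rceil>" for K :: nat
  define \<kappa> where "\<kappa> K = nat \<lceil>?n * ln (real K) + A\<rceil>" for K :: nat
  define D where "D = real (card lev) + 1 + 2 * ?n"
  \<comment> \<open>The selection time will be at most c2 * ln K * Q, where Q >= 1 bounds one query
    to one copy.\<close>
  define c2 where "c2 = real (rounds + 1) * (D + 2 * a)"
  have n1: "1 \<le> ?n" using d1 mult_mono[of 1 "real d" 1 "real d"] by simp
  have a0: "0 \<le> a" using n1 A0 by (simp add: a_def)
  have "\<forall>\<^sub>F K in sequentially. \<forall>s\<in>lev - {smax}. \<forall>z\<in>space (seed_dist (S (d * d) (1/4) (mr s) K)). \<forall>us q.
      admissible (d * d) K us \<longrightarrow> q \<in> unit_ball (d * d) \<longrightarrow>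
      real (query_time (S (d * d) (1/4) (mr s) K) z us q) \<le> real K powr (1 - 7/4 * ?g)"
  proof (rule eventually_ball_finite)
    show "finite (lev - {smax})" using finite_lev by simp
    show "\<forall>s\<in>lev - {smax}. \<forall>\<^sub>F K in sequentially. \<forall>z\<in>space (seed_dist (S (d * d) (1/4) (mr s) K)). \<forall>us q.
      admissible (d * d) K us \<longrightarrow> q \<in> unit_ball (d * d) \<longrightarrow>
      real (query_time (S (d * d) (1/4) (mr s) K) z us q) \<le> real K powr (1 - 7/4 * ?g)"
    proof
      fix s assume "s \<in> lev - {smax}"
      then have s: "s \<in> lev" "s \<noteq> smax" by auto
      have "1 \<le> d * d" using d1 by simp
      then show "\<forall>\<^sub>F K in sequentially. \<forall>z\<in>space (seed_dist (S (d * d) (1/4) (mr s) K)). \<forall>us q.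
        admissible (d * d) K us \<longrightarrow> q \<in> unit_ball (d * d) \<longrightarrow>
        real (query_time (S (d * d) (1/4) (mr s) K) z us q) \<le> real K powr (1 - 7/4 * ?g)"
        by (rule eventually_query_time_le[OF fam _ mr_pos mr_le[OF s(1)] rate_bounds(1) rho_query_mr_le[OF s]])
    qed
  qed
  then obtain K1 where K1: "\<And>K s z us q. K1 \<le> K \<Longrightarrow> s \<in> lev \<Longrightarrow> s \<noteq> smax \<Longrightarrow>
      z \<in> space (seed_dist (S (d * d) (1/4) (mr s) K)) \<Longrightarrow> admissible (d * d) K us \<Longrightarrow> q \<in> unit_ball (d * d) \<Longrightarrow>
      real (query_time (S (d * d) (1/4) (mr s) K) z us q) \<le> real K powr (1 - 7/4 * ?g)"
    unfolding eventually_sequentially by blast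
  \<comment> \<open>The surplus between the exponent of a query and the final exponent absorbs the
    factor c2 * ln K.\<close>
  have "3/4 * ?g > 0" using rate_bounds(1) by simp
  from eventually_ln_le_powr[OF this, of c2] obtain K2 where
    K2: "\<And>K. K2 \<le> K \<Longrightarrow> c2 * ln (real K) \<le> real K powr (3/4 * ?g)" unfolding eventually_sequentially by blast
  have "\<delta> / 2 > 0" using \<delta> by simp
  from eventually_ln_power_le[OF this, of "real rounds * a ^ rounds * 10 ^ rounds * exp A" rounds] obtain K3 where
    K3: "\<And>K. K3 \<le> K \<Longrightarrow> real rounds * a ^ rounds * 10 ^ rounds * exp A * ln (real K) ^ rounds \<le> \<delta> / 2 * real K"
    unfolding eventually_sequentially by blast
  have "\<forall>\<^sub>F K in sequentially. A + real rounds + 1 \<le> ln (real K)"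
    using ln_nat_at_top unfolding filterlim_at_top by blast
  then obtain K4 where K4: "\<And>K. K4 \<le> K \<Longrightarrow> A + real rounds + 1 \<le> ln (real K)" unfolding eventually_sequentially by blast
  \<comment> \<open>The summands T * C + 1 force an initial arm; they also make \<open>K0\<close>
    positive, so that K = 0 is exempt from the time bound.\<close>
  define K0 where "K0 = K1 + K2 + K3 + K4 + T * C + 1"
  show ?thesis
  proof (rule exI[of _ K0], intro allI impI)
    fix K and B :: "'e bandit"
    assume v: "valid_bandit d T C K B" and sub: "subgaussian_noise (P K) S B"
    let ?M = "outcome_space (P K) S B"
    show "\<exists>E\<in>sets ?M. measure ?M E \<ge> 1 - \<delta> \<and>
      (\<forall>\<omega>\<in>E. regret (P K) S B \<omega> \<le> 288 * real d * sqrt (real T) * ln (real T / \<delta>) ^ 1 \<and>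
        (K \<ge> K0 \<longrightarrow> (\<forall>t\<in>{1..T}. \<exists>c. step_time (P K) S B t \<omega> = Some c \<and> real c \<le> real K powr (1 - ?g))))"
    proof (cases "K = 0")
      case True
      have ps: "prob_space ?M" unfolding True by (rule prob_space_no_arms) (use v in \<open>simp add: valid_bandit_def\<close>)
      have "finite (arms_at B T)" "card (arms_at B T) = 0" using v True by (auto simp: valid_bandit_def arms_at_def)
      then have "arms_at B (horizon (P K)) = {}" by (simp add: P_simps)
      then have reg: "regret (P K) S B \<omega> = 0" for \<omega> by (rule regret_no_arms)
      have "1 \<le> real T / \<delta>" using \<delta> T2 by (simp add: pos_le_divide_eq)
      then have "0 \<le> ln (real T / \<delta>)" by (rule ln_ge_zero)
      then have "0 \<le> 288 * real d * sqrt (real T) * ln (real T / \<delta>) ^ 1" by simp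
      moreover have "\<not> K \<ge> K0" using True by (simp add: K0_def)
      ultimately show ?thesis using prob_space.prob_space[OF ps] \<delta> reg
        by (intro bexI[of _ "space ?M"] conjI ballI impI) auto
    next
      case False
      then have Kp: "1 \<le> K" by simp
      interpret Bd: bandit_setup "P K" S B C by (rule bandit_setup_P[OF fam v Kp])
      have cf: "0 < conf (P K)" "conf (P K) < 1" "2 \<le> horizon (P K)"
          "eta (P K) = 1 / sqrt (real (horizon (P K)))" using \<delta> T2 unfolding P_simps by auto
      obtain G where G: "G \<in> sets ?M" "measure ?M G \<ge> 1 - conf (P K) / 2"
          "\<And>\<omega>. \<omega> \<in> G \<Longrightarrow> elimination_run (P K) S B C \<omega>"
        by (rule Bd.good_event[OF sub cf]) (rule that)
      have pG: "measure ?M G \<ge> 1 - \<delta> / 2" using G(2) unfolding P_simps .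
      have reg: "regret (P K) S B \<omega> \<le> 288 * real d * sqrt (real T) * ln (real T / \<delta>) ^ 1" if "\<omega> \<in> G" for \<omega>
        using regret_bound[OF G(3)[OF that]] unfolding power_one_right .
      show ?thesis
      proof (cases "K0 \<le> K")
        \<comment> \<open>Below \<open>K0\<close> only the regret is claimed, and the confidence
          event alone suffices for it.\<close>
        case False
        have "measure ?M G \<ge> 1 - \<delta>" using pG \<delta> by linarith
        then show ?thesis using G(1) reg False by blast
      next
        case large: True
        then have Ks: "K1 \<le> K" "K2 \<le> K" "K3 \<le> K" "K4 \<le> K" "T * C < K" by (auto simp: K0_def)
        define y where "y = ln (real K)"
        define Q where "Q = real K powr (1 - 7/4 * ?g)"
        have Ky: "real K = exp y" using Kp by (simp add: y_def)
        have y: "A + real rounds + 1 \<le> y" using K4[OF Ks(4)] by (simp add: y_def)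
        then have y1: "1 \<le> y" using A0 by linarith
        have kr: "y - A \<le> real (kk K)" unfolding kk_def y_def by (rule real_nat_ceiling_ge)
        then have "real rounds + 1 \<le> real (kk K)" using y by linarith
        then have kN: "rounds + 1 \<le> kk K" by linarith
        have ny: "1 * y \<le> ?n * y" using n1 y1 by (intro mult_right_mono) auto
        have "?n * y + A \<le> real (\<kappa> K)" unfolding \<kappa>_def y_def by (rule real_nat_ceiling_ge)
        then have \<kappa>1: "1 \<le> \<kappa> K" using ny y1 A0 by linarith
        have "0 \<le> \<lceil>?n * y + A\<rceil>" using ny y1 A0 by linarith
        then have "real (\<kappa> K) = of_int \<lceil>?n * y + A\<rceil>" unfolding \<kappa>_def y_def by simp
        then have "real (\<kappa> K) \<le> ?n * y + A + 1" by linarith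
        also have "\<dots> \<le> ?n * y + A * y + 1 * y"
          using mult_left_mono[OF y1 A0] y1 by linarith
        also have "\<dots> = a * y" unfolding a_def distrib_right ..
        finally have \<kappa>a: "real (\<kappa> K) \<le> a * y" .
        have cop: "kk K \<le> copies (P K) s \<and> copies (P K) s \<le> \<kappa> K" if "s \<in> lev" for s
          unfolding kk_def \<kappa>_def by (rule A[OF Kp that])
        let ?F = "{\<omega> \<in> space ?M. Bd.fails_within rounds (\<kappa> K) \<omega>}"
        have z: "0 \<in> levels (P K)" unfolding levels_P by (rule zero_in_lev)
        have kc: "kk K \<le> copies (P K) s" if "s \<in> levels (P K)" for s using cop[OF that[unfolded levels_P]] by blast
        have Nk: "rounds \<le> kk K" using kN by simp
        have F: "?F \<in> sets ?M" by (rule Bd.prob_fails_within(1)[OF z _ Nk \<kappa>1]) (rule kc)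
        have "measure ?M ?F \<le> real rounds * real (\<kappa> K) ^ rounds * (1 / 10) ^ (kk K - rounds)"
          by (rule Bd.prob_fails_within(2)[OF z _ Nk \<kappa>1]) (rule kc)
        also have "\<dots> \<le> \<delta> / 2"
          by (rule fails_prob_le[OF y1 Ky kr Nk \<kappa>a]) (use K3[OF Ks(3)] in \<open>simp only: y_def\<close>)
        finally have pF: "measure ?M ?F \<le> \<delta> / 2" .
        have E: "G - ?F \<in> sets ?M" using G(1) F by (rule sets.Diff)
        have pE: "measure ?M (G - ?F) \<ge> 1 - \<delta>" using Bd.prob_Diff_ge[OF G(1) F] pG pF by linarith
        have Q1: "1 \<le> Q" unfolding Q_def using Kp rate_bounds(2) by (intro ge_one_powr_ge_zero) auto
        have yQ: "1 \<le> y * Q" using mult_mono[OF y1 Q1] y1 by simp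
        have D0: "0 \<le> D" by (simp add: D_def)
        have "D * 1 \<le> D * (y * Q)" using yQ D0 by (rule mult_left_mono)
        moreover have "real (\<kappa> K) * (Q + 1) \<le> (a * y) * (2 * Q)"
          using \<kappa>a Q1 by (intro mult_mono) auto
        ultimately have "D + real (\<kappa> K) * (Q + 1) \<le> D * (y * Q) + (a * y) * (2 * Q)" by linarith
        also have "\<dots> = (D + 2 * a) * (y * Q)" by (simp add: algebra_simps)
        finally have "real (rounds + 1) * (D + real (\<kappa> K) * (Q + 1)) \<le> real (rounds + 1) * ((D + 2 * a) * (y * Q))"
          by (rule mult_left_mono) simp
        also have "\<dots> = c2 * y * Q" by (simp only: c2_def mult.assoc)
        also have "\<dots> \<le> real K powr (3/4 * ?g) * Q"
          using K2[OF Ks(2)] Q1 unfolding y_def by (intro mult_right_mono) auto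
        also have "\<dots> = real K powr (3/4 * ?g + (1 - 7/4 * ?g))" unfolding Q_def powr_add ..
        also have "3/4 * ?g + (1 - 7/4 * ?g) = 1 - ?g" by simp
        finally have cost: "real (rounds + 1) * (D + real (\<kappa> K) * (Q + 1)) \<le> real K powr (1 - ?g)" .
        have ls: "level_solver (P K) S s = S (d * d) (1/4) (mr s) K" for s
          unfolding level_solver_def P_simps mips_r_P ..
        have time: "\<exists>c. step_time (P K) S B t \<omega> = Some c \<and> real c \<le> real K powr (1 - ?g)"
          if w: "\<omega> \<in> G - ?F" and t: "t \<in> {1..T}" for \<omega> t
        proof -
          have wG: "\<omega> \<in> G" using w by blast
          then have "\<omega> \<in> space ?M" using sets.sets_into_space[OF G(1)] by blast
          then have ok: "\<not> Bd.fails_within rounds (\<kappa> K) \<omega>" using w by blast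
          have c1: "1 \<le> copies (P K) s \<and> copies (P K) s \<le> \<kappa> K" if "s \<in> lev" for s
            using cop[OF that] kN by linarith
          have Q0: "0 \<le> Q" using Q1 by simp
          have "\<exists>c. step_time (P K) S B t \<omega> = Some c \<and>
             real c \<le> real (rounds + 1) * (real (card lev) + 1 + 2 * real (d * d) + real (\<kappa> K) * (Q + 1))"
            by (rule step_time_bound[OF G(3)[OF wG] ok _ \<kappa>1 init_nonempty[OF v Ks(5)] t Q0])
              (use c1 K1[OF Ks(1)] in \<open>unfold ls Q_def, blast+\<close>)
          then show ?thesis using cost unfolding D_def by (meson order_trans)
        qed
        show ?thesis
        proof (intro bexI[OF _ E] conjI ballI impI)
          show "measure ?M (G - ?F) \<ge> 1 - \<delta>" by (rule pE)
          fix \<omega> assume w: "\<omega> \<in> G - ?F"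
          then show "regret (P K) S B \<omega> \<le> 288 * real d * sqrt (real T) * ln (real T / \<delta>) ^ 1" using reg by blast
          show "\<exists>c. step_time (P K) S B t \<omega> = Some c \<and> real c \<le> real K powr (1 - ?g)" if "t \<in> {1..T}" for t
            by (rule time[OF w that])
        qed
      qed
    qed
  qed
qed

end

theorem corollary5p3:
  shows "\<exists>C>0. \<exists>k::nat. \<forall>d\<ge>1. \<forall>\<delta>\<in>{0<..<1}.
    \<exists>g :: nat \<Rightarrow> real.
      (\<exists>c\<^sub>1>0. \<exists>c\<^sub>2>0. \<forall>T\<ge>2. c\<^sub>1 / ((real T)\<^sup>2 * (ln (real T))\<^sup>2) \<le> g T \<and>
                              g T \<le> c\<^sub>2 / ((real T)\<^sup>2 * (ln (real T))\<^sup>2)) \<and>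
      (\<forall>T\<ge>2. \<forall>C\<^sub>c\<^sub>h\<^sub>a\<^sub>n\<^sub>g\<^sub>e. \<forall>S :: nat \<Rightarrow> real \<Rightarrow> real \<Rightarrow> nat \<Rightarrow> 's solver. solver_family S \<longrightarrow>
        (\<exists>K\<^sub>0. \<forall>K. \<forall>B :: 'e bandit.
          let p = \<lparr>dim = d, horizon = T, conf = \<delta>, eta = 1 / sqrt (real T), max_arms = K\<rparr>
          in valid_bandit d T C\<^sub>c\<^sub>h\<^sub>a\<^sub>n\<^sub>g\<^sub>e K B \<longrightarrow> subgaussian_noise p S B \<longrightarrow>
             (\<exists>E\<in>sets (outcome_space p S B).
                measure (outcome_space p S B) E \<ge> 1 - \<delta> \<and>
                (\<forall>\<omega>\<in>E.
                   regret p S B \<omega> \<le> C * real d * sqrt (real T) * ln (real T / \<delta>) ^ k \<and>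
                   (K \<ge> K\<^sub>0 \<longrightarrow>
                     (\<forall>t\<in>{1..T}. \<exists>c. step_time p S B t \<omega> = Some c \<and>
                                     real c \<le> real K powr (1 - g T)))))))"
proof (rule exI[of _ "288::real"], rule conjI, simp, rule exI[of _ "1::nat"], intro allI impI ballI, goal_cases)
  case (1 d \<delta>)
  then have \<delta>: "0 < \<delta>" "\<delta> < 1" by auto
  \<comment> \<open>Serves as both constants, since \<open>rate\<close> is an exact multiple of 1 /
    (T^2 ln^2 T).\<close>
  define c where "c = 1 / (2048 * real d ^ 4 * (level_const d \<delta>)\<^sup>2)"
  \<comment> \<open>Positivity of \<open>level_const\<close>, which does not involve the horizon, is
    taken from the smallest admissible horizon.\<close>
  interpret two: horizon_params d 2 \<delta> by unfold_locales (use 1 \<delta> in auto)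
  have c: "c > 0" unfolding c_def using 1 two.level_const_pos
    by (intro divide_pos_pos mult_pos_pos zero_less_power) auto
  show ?case
  proof (rule exI[of _ "rate d \<delta>"], rule conjI)
    have "\<forall>T\<ge>2. c / ((real T)\<^sup>2 * (ln (real T))\<^sup>2) \<le> rate d \<delta> T \<and> rate d \<delta> T \<le> c / ((real T)\<^sup>2 * (ln (real T))\<^sup>2)"
      by (simp add: rate_def c_def)
    then show "\<exists>c\<^sub>1>0. \<exists>c\<^sub>2>0. \<forall>T\<ge>2. c\<^sub>1 / ((real T)\<^sup>2 * (ln (real T))\<^sup>2) \<le> rate d \<delta> T \<and>
        rate d \<delta> T \<le> c\<^sub>2 / ((real T)\<^sup>2 * (ln (real T))\<^sup>2)" using c by blast
  next
    show "\<forall>T\<ge>2. \<forall>C. \<forall>S :: nat \<Rightarrow> real \<Rightarrow> real \<Rightarrow> nat \<Rightarrow> 's solver. solver_family S \<longrightarrow>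
        (\<exists>K\<^sub>0. \<forall>K. \<forall>B :: 'e bandit.
          let p = \<lparr>dim = d, horizon = T, conf = \<delta>, eta = 1 / sqrt (real T), max_arms = K\<rparr>
          in valid_bandit d T C K B \<longrightarrow> subgaussian_noise p S B \<longrightarrow>
             (\<exists>E\<in>sets (outcome_space p S B).
                measure (outcome_space p S B) E \<ge> 1 - \<delta> \<and>
                (\<forall>\<omega>\<in>E.
                   regret p S B \<omega> \<le> 288 * real d * sqrt (real T) * ln (real T / \<delta>) ^ 1 \<and>
                   (K \<ge> K\<^sub>0 \<longrightarrow>
                     (\<forall>t\<in>{1..T}. \<exists>c. step_time p S B t \<omega> = Some c \<and>
                                     real c \<le> real K powr (1 - rate d \<delta> T))))))"
    proof (intro allI impI)
      fix T C :: nat and S :: "nat \<Rightarrow> real \<Rightarrow> real \<Rightarrow> nat \<Rightarrow> 's solver"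
      assume T: "2 \<le> T" and fam: "solver_family S"
      interpret horizon_params d T \<delta> by unfold_locales (use 1 T \<delta> in auto)
      show "\<exists>K\<^sub>0. \<forall>K. \<forall>B :: 'e bandit.
          let p = \<lparr>dim = d, horizon = T, conf = \<delta>, eta = 1 / sqrt (real T), max_arms = K\<rparr>
          in valid_bandit d T C K B \<longrightarrow> subgaussian_noise p S B \<longrightarrow>
             (\<exists>E\<in>sets (outcome_space p S B).
                measure (outcome_space p S B) E \<ge> 1 - \<delta> \<and>
                (\<forall>\<omega>\<in>E.
                   regret p S B \<omega> \<le> 288 * real d * sqrt (real T) * ln (real T / \<delta>) ^ 1 \<and>
                   (K \<ge> K\<^sub>0 \<longrightarrow>
                     (\<forall>t\<in>{1..T}. \<exists>c. step_time p S B t \<omega> = Some c \<and>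
                                     real c \<le> real K powr (1 - rate d \<delta> T)))))"
        unfolding Let_def by (rule high_probability_bound[OF fam, unfolded P_def])
    qed
  qed
qed

end
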